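(* Let $(X_i)_{i\ge1}$ and $(Y_i)_{i\ge1}$ be independent sequences of i.i.d. random variables with $\mathbb{P}[X_i=\pm1]=\frac12$ and $Y_i$ standard Gaussian $\mathcal{N}(0,1)$; put $S_0=0$, $S_n=\sum_{i=1}^nX_i$. Fix $t>0$ and, for $n\in2\mathbb{N}$, $n\ge2$, set $\varepsilon_n=(\frac tn)^{1/2}$, $a_n^{\varepsilon_n}=e^{\varepsilon_nS_n}$ and $b_n^{\varepsilon_n}=\varepsilon_n\sum_{j=1}^nY_j\exp(\varepsilon_nS_{j-1})$. Then, as $n\to\infty$ along even integers, $$\mathbb{P}\big[a_n^{\varepsilon_n}=1,\ b_n^{\varepsilon_n}\in[0,dx)\big]=\mathbb{P}\Big[S_n=0,\ \varepsilon_n\sum_{j=1}^nY_j\exp(\varepsilon_nS_{j-1})\in[0,dx)\Big]\sim_n2\varepsilon_n\,p_{\mathrm{Aff}(\mathbb{R})}(t,e,e)\,dx ,$$ that is, denoting by $q_n$ the continuous density with respect to Lebesgue measure of the measure $\Gamma\mapsto\mathbb{P}[S_n=0,\ b_n^{\varepsilon_n}\in\Gamma]$ on $\mathbb{R}$, one has $q_n(0)\sim_n2\varepsilon_n\,p_{\mathrm{Aff}(\mathbb{R})}(t,e,e)$.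
   Context: $\mathrm{Aff}(\mathbb{R})=\{(a,b):a>0,\ b\in\mathbb{R}\}$ is identified with the group of matrices $\begin{pmatrix} a& b\\ 0&1\end{pmatrix}$, and $e=(1,0)$. The function $p_{\mathrm{Aff}(\mathbb{R})}(t,e,\cdot)$ is the density, with respect to the Riemannian volume $\frac{da\,db}{a^2}$, of the Brownian motion on $\mathrm{Aff}(\mathbb{R})$ at time $t$ started at $e$, i.e. of $(a_t,b_t)=\big(\exp(B^1_t),\int_0^t\exp(B^1_s)\,dB^2_s\big)$ with $B^1,B^2$ independent standard scalar Brownian motions. The symbol $\sim_n$ means that the ratio tends to $1$ as $n\to\infty$. *)

theory Defs
  imports "HOL-Probability.Probability"
begin

section \<open>The random walk and its discrete affine group companions\<close>

definition rademacher_sequence :: "'a measure \<Rightarrow> (nat \<Rightarrow> 'a \<Rightarrow> real) \<Rightarrow> bool" where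
  "rademacher_sequence M X \<longleftrightarrow>
     prob_space M \<and>
     prob_space.indep_vars M (\<lambda>_. borel) X {1..} \<and>
     (\<forall>i\<ge>1. measure M {\<omega> \<in> space M. X i \<omega> = 1} = 1 / 2 \<and>
             measure M {\<omega> \<in> space M. X i \<omega> = - 1} = 1 / 2)"

definition std_gaussian_sequence :: "'a measure \<Rightarrow> (nat \<Rightarrow> 'a \<Rightarrow> real) \<Rightarrow> bool" where
  "std_gaussian_sequence M Y \<longleftrightarrow>
     prob_space M \<and>
     prob_space.indep_vars M (\<lambda>_. borel) Y {1..} \<and>
     (\<forall>i\<ge>1. distributed M lborel (Y i) std_normal_density)"

text \<open>Independence of two real valued processes indexed by \<open>I\<close>, regarded as random elements of
  the product space over \<open>I\<close>.\<close>

definition indep_processes ::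
  "'a measure \<Rightarrow> 'i set \<Rightarrow> ('i \<Rightarrow> 'a \<Rightarrow> real) \<Rightarrow> ('i \<Rightarrow> 'a \<Rightarrow> real) \<Rightarrow> bool" where
  "indep_processes M I U V \<longleftrightarrow>
     prob_space.indep_var M
       (PiM I (\<lambda>_. borel)) (\<lambda>\<omega>. \<lambda>i\<in>I. U i \<omega>)
       (PiM I (\<lambda>_. borel)) (\<lambda>\<omega>. \<lambda>i\<in>I. V i \<omega>)"

definition walk :: "(nat \<Rightarrow> 'a \<Rightarrow> real) \<Rightarrow> nat \<Rightarrow> 'a \<Rightarrow> real" where
  "walk X n \<omega> = (\<Sum>i=1..n. X i \<omega>)"

definition step_size :: "real \<Rightarrow> nat \<Rightarrow> real" where
  "step_size t n = sqrt (t / real n)"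

definition walk_a :: "real \<Rightarrow> (nat \<Rightarrow> 'a \<Rightarrow> real) \<Rightarrow> nat \<Rightarrow> 'a \<Rightarrow> real" where
  "walk_a \<epsilon> X n \<omega> = exp (\<epsilon> * walk X n \<omega>)"

definition walk_b ::
  "real \<Rightarrow> (nat \<Rightarrow> 'a \<Rightarrow> real) \<Rightarrow> (nat \<Rightarrow> 'a \<Rightarrow> real) \<Rightarrow> nat \<Rightarrow> 'a \<Rightarrow> real" where
  "walk_b \<epsilon> X Y n \<omega> = \<epsilon> * (\<Sum>j=1..n. Y j \<omega> * exp (\<epsilon> * walk X (j - 1) \<omega>))"

text \<open>\<open>q\<close> is the continuous Lebesgue density of the (sub-probability) law of \<open>Z\<close> on the event \<open>P\<close>,
  i.e. of the measure mapping \<open>\<Gamma>\<close> to the probability of \<open>P\<close> and \<open>Z \<in> \<Gamma>\<close>.\<close>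

definition continuous_density_on_event ::
  "'a measure \<Rightarrow> ('a \<Rightarrow> bool) \<Rightarrow> ('a \<Rightarrow> real) \<Rightarrow> (real \<Rightarrow> real) \<Rightarrow> bool" where
  "continuous_density_on_event M P Z q \<longleftrightarrow>
     continuous_on UNIV q \<and> (\<forall>x. 0 \<le> q x) \<and>
     (\<forall>\<Gamma>\<in>sets borel. emeasure M {\<omega> \<in> space M. P \<omega> \<and> Z \<omega> \<in> \<Gamma>}
                      = (\<integral>\<^sup>+x. ennreal (q x) * indicator \<Gamma> x \<partial>lborel))"


section \<open>Brownian motion and the Ito integral\<close>

definition brownian_motion :: "'b measure \<Rightarrow> (real \<Rightarrow> 'b \<Rightarrow> real) \<Rightarrow> bool" where
  "brownian_motion N B \<longleftrightarrow>
     prob_space N \<and>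
     (\<forall>s\<ge>0. B s \<in> borel_measurable N) \<and>
     (\<forall>\<omega>\<in>space N. B 0 \<omega> = 0) \<and>
     (\<forall>\<omega>\<in>space N. continuous_on {0..} (\<lambda>s. B s \<omega>)) \<and>
     (\<forall>r s. 0 \<le> r \<and> r < s \<longrightarrow>
        distributed N lborel (\<lambda>\<omega>. B s \<omega> - B r \<omega>) (normal_density 0 (sqrt (s - r)))) \<and>
     (\<forall>(m::nat) \<tau>. 0 \<le> \<tau> 0 \<and> mono \<tau> \<longrightarrow>
        prob_space.indep_vars N (\<lambda>_. borel) (\<lambda>i \<omega>. B (\<tau> (Suc i)) \<omega> - B (\<tau> i) \<omega>) {..<m})"

text \<open>The \<open>\<sigma>\<close>-algebra generated by \<open>B1 u\<close> and \<open>B2 u\<close> for \<open>0 \<le> u \<le> s\<close>.\<close>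

definition natural_filtration ::
  "'b measure \<Rightarrow> (real \<Rightarrow> 'b \<Rightarrow> real) \<Rightarrow> (real \<Rightarrow> 'b \<Rightarrow> real) \<Rightarrow> real \<Rightarrow> 'b measure" where
  "natural_filtration N B1 B2 s =
     vimage_algebra (space N) (\<lambda>\<omega>. \<lambda>u\<in>{0..s}. (B1 u \<omega>, B2 u \<omega>)) (PiM {0..s} (\<lambda>_. borel))"

text \<open>A simple integrand on \<open>[0, t]\<close> has nodes \<open>0 = \<tau> 0 < \<dots> < \<tau> m = t\<close> and takes
  on \<open>(\<tau> i, \<tau> (i + 1)]\<close> the value \<open>\<xi> i\<close>, which is known at time \<open>\<tau> i\<close>.\<close>

definition simple_integrand ::
  "'b measure \<Rightarrow> (real \<Rightarrow> 'b measure) \<Rightarrow> real \<Rightarrow> nat \<Rightarrow> (nat \<Rightarrow> real) \<Rightarrow> (nat \<Rightarrow> 'b \<Rightarrow> real) \<Rightarrow> bool" where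
  "simple_integrand N F t m \<tau> \<xi> \<longleftrightarrow>
     \<tau> 0 = 0 \<and> \<tau> m = t \<and> (\<forall>i<m. \<tau> i < \<tau> (Suc i)) \<and>
     (\<forall>i<m. \<xi> i \<in> borel_measurable (F (\<tau> i)) \<and> integrable N (\<lambda>\<omega>. (\<xi> i \<omega>)\<^sup>2))"

definition simple_process :: "nat \<Rightarrow> (nat \<Rightarrow> real) \<Rightarrow> (nat \<Rightarrow> 'b \<Rightarrow> real) \<Rightarrow> real \<Rightarrow> 'b \<Rightarrow> real" where
  "simple_process m \<tau> \<xi> s \<omega> = (\<Sum>i<m. \<xi> i \<omega> * indicator {\<tau> i<..\<tau> (Suc i)} s)"

definition simple_integral ::
  "(real \<Rightarrow> 'b \<Rightarrow> real) \<Rightarrow> nat \<Rightarrow> (nat \<Rightarrow> real) \<Rightarrow> (nat \<Rightarrow> 'b \<Rightarrow> real) \<Rightarrow> 'b \<Rightarrow> real" where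
  "simple_integral W m \<tau> \<xi> \<omega> = (\<Sum>i<m. \<xi> i \<omega> * (W (\<tau> (Suc i)) \<omega> - W (\<tau> i) \<omega>))"

text \<open>\<open>J\<close> is (a version of) the Ito integral of \<open>H\<close> over \<open>[0, t]\<close> against the Brownian
  motion \<open>W\<close>: \<open>H\<close> is measurable and adapted to \<open>F\<close>, and \<open>J\<close> is the limit in mean square of integrals
  of simple integrands that converge to \<open>H\<close> in mean square on \<open>[0, t] \<times> \<Omega>\<close>. (By the Ito isometry
  \<open>J\<close> is almost surely unique when \<open>W\<close> is a Brownian motion for the filtration \<open>F\<close>.)\<close>

definition has_ito_integral ::
  "'b measure \<Rightarrow> (real \<Rightarrow> 'b measure) \<Rightarrow> (real \<Rightarrow> 'b \<Rightarrow> real) \<Rightarrow> (real \<Rightarrow> 'b \<Rightarrow> real) \<Rightarrow> real \<Rightarrow>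
   ('b \<Rightarrow> real) \<Rightarrow> bool" where
  "has_ito_integral N F W H t J \<longleftrightarrow>
     (\<lambda>(\<omega>, s). H s \<omega>) \<in> borel_measurable (N \<Otimes>\<^sub>M restrict_space lborel {0..t}) \<and>
     (\<forall>s\<in>{0..t}. H s \<in> borel_measurable (F s)) \<and>
     J \<in> borel_measurable N \<and>
     (\<exists>m \<tau> \<xi>.
        (\<forall>k::nat. simple_integrand N F t (m k) (\<tau> k) (\<xi> k)) \<and>
        (\<lambda>k. \<integral>\<^sup>+\<omega>. (\<integral>\<^sup>+s\<in>{0..t}. ennreal ((H s \<omega> - simple_process (m k) (\<tau> k) (\<xi> k) s \<omega>)\<^sup>2) \<partial>lborel) \<partial>N)
          \<longlonglongrightarrow> 0 \<and>
        (\<lambda>k. \<integral>\<^sup>+\<omega>. ennreal ((J \<omega> - simple_integral W (m k) (\<tau> k) (\<xi> k) \<omega>)\<^sup>2) \<partial>N) \<longlonglongrightarrow> 0)"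


section \<open>Densities on the affine group\<close>

text \<open>The affine group is the half-plane of pairs \<open>(a, b)\<close> with \<open>a > 0\<close>, carrying the Riemannian
  volume \<open>da db / a\<^sup>2\<close>; outside the half-plane the measure is zero.\<close>

definition aff_group :: "(real \<times> real) set" where
  "aff_group = {0<..} \<times> UNIV"

definition aff_unit :: "real \<times> real" where
  "aff_unit = (1, 0)"

definition aff_volume :: "(real \<times> real) measure" where
  "aff_volume = density lborel (\<lambda>x. ennreal (indicator aff_group x / (fst x)\<^sup>2))"

text \<open>Continuity on the group makes the point values \<open>p g\<close>, \<open>g \<in> aff_group\<close>, unique.\<close>

definition aff_continuous_density :: "'b measure \<Rightarrow> ('b \<Rightarrow> real \<times> real) \<Rightarrow> (real \<times> real \<Rightarrow> real) \<Rightarrow> bool" where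
  "aff_continuous_density N G p \<longleftrightarrow>
     continuous_on aff_group p \<and> (\<forall>g\<in>aff_group. 0 \<le> p g) \<and>
     distributed N aff_volume G (\<lambda>g. ennreal (p g))"

text \<open>\<open>p\<close> is the function \<open>p(t, e, \<cdot>)\<close>, where \<open>b\<close> is the value at time \<open>t\<close> of the Ito integral of
  \<open>exp (B1 s)\<close> against \<open>B2\<close>.\<close>

definition aff_heat_kernel ::
  "'b measure \<Rightarrow> (real \<Rightarrow> 'b \<Rightarrow> real) \<Rightarrow> ('b \<Rightarrow> real) \<Rightarrow> real \<Rightarrow> (real \<times> real \<Rightarrow> real) \<Rightarrow> bool" where
  "aff_heat_kernel N B1 b t p \<longleftrightarrow> aff_continuous_density N (\<lambda>\<omega>. (exp (B1 t \<omega>), b \<omega>)) p"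

end

theory Submission
  imports Defs
begin

text \<open>Given \<open>X\<close>, the variable \<open>walk_b\<close> is a centred Gaussian whose variance \<open>A n\<close> is
  \<open>\<epsilon>\<^sup>2 * (\<Sum>j<n. exp (2 * \<epsilon> * S j))\<close>, so the density at \<open>0\<close> on the event \<open>S n = 0\<close> is the expectation of
  \<open>1 / sqrt (2 * pi * A n)\<close> on that event. In the same way, given \<open>B1\<close>, the Ito integral is a centred Gaussian whose
  variance is the integral of \<open>exp (2 * B1 s)\<close> over \<open>[0, t]\<close>. Disintegrating with respect to \<open>B1 t\<close> replaces \<open>B1\<close> by a
  Brownian bridge, and the heat kernel at the unit becomes \<open>1 / (2 * pi * sqrt t)\<close> times the expectation of
  \<open>1 / sqrt A\<close>, where \<open>A\<close> is the exponential functional of the bridge from \<open>0\<close> to \<open>0\<close>.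

  It remains to see that \<open>sqrt n\<close> times the expectation of \<open>1 / sqrt (A n)\<close> on \<open>S n = 0\<close> tends to \<open>sqrt (2 / pi)\<close> times
  the expectation of \<open>1 / sqrt A\<close>. The inverse square root is replaced by a bounded Lipschitz function, which
  costs little because \<open>1 / A n\<close> is at most the average of \<open>exp (- 2 * \<epsilon> * S j) / t\<close> by Cauchy--Schwarz, and
  \<open>A n\<close> by its Riemann sum over \<open>k + 1\<close> long blocks. For fixed \<open>k\<close>, the central limit theorem for the first \<open>k\<close> block
  increments and the local limit theorem for the last one give a limit in terms of a Gaussian vector
  weighted by a Gaussian density, which is the law of the increments of the Brownian bridge. Finally \<open>k\<close>
  tends to infinity and the regularisation is removed.\<close>

section \<open>Gaussian vectors\<close>

text \<open>The event \<open>S n = 0\<close> has probability of order \<open>1 / sqrt n\<close>, so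
  every error bound on it must keep that factor. This works because the return to 0 costs only the
  factor \<open>sqrt (2 / n)\<close> for quantities that depend on at most half of the steps: the
  other half has uniformly small point probabilities. No weak convergence on path space is involved.
  For a fixed number of blocks everything is a finite-dimensional integral, and pointwise convergent
  copies of the block sums, supplied by Skorohod's theorem, are inserted into the local limit
  theorem. The bridge is not obtained by conditioning: a linear correction that forces the endpoint
  turns a free Gaussian vector into the conditioned one. The factor 2 of the claim is parity: at
  even times the walk lives on the even integers, so its point probabilities are twice the Gaussian
  density. The integral \<open>b\<close> is known only as a mean square limit along unspecified
  simple integrands, and the kernel only as a continuous density; the isometry and the uniqueness of
  continuous densities pin both down.\<close>

definition gauss :: "real \<Rightarrow> real measure" where
  "gauss s = density lborel (\<lambda>x. ennreal (normal_density 0 s x))"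

lemma sets_gauss [simp, measurable_cong]: "sets (gauss s) = sets borel"
  by (simp add: gauss_def)

lemma space_gauss [simp]: "space (gauss s) = UNIV"
  by (simp add: gauss_def)

lemma prob_space_gauss: "s > 0 \<Longrightarrow> prob_space (gauss s)"
  unfolding gauss_def by (rule prob_space_normal_density)

lemma nn_integral_gauss:
  "f \<in> borel_measurable borel \<Longrightarrow>
   (\<integral>\<^sup>+x. f x \<partial>gauss s) = (\<integral>\<^sup>+x. ennreal (normal_density 0 s x) * f x \<partial>lborel)"
  unfolding gauss_def by (subst nn_integral_density) auto

lemma distributed_gauss_iff:
  "distributed N lborel X (normal_density 0 s) \<longleftrightarrow> X \<in> borel_measurable N \<and> distr N borel X = gauss s"
proof -
  have "distr N lborel X = distr N borel X"
    by (rule distr_cong) auto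
  then show ?thesis
    unfolding distributed_def gauss_def by auto
qed

lemma measurable_normal_density [measurable (raw)]:
  assumes [measurable]: "f \<in> borel_measurable A" "g \<in> borel_measurable A"
  shows "(\<lambda>x. normal_density 0 (f x) (g x)) \<in> borel_measurable A"
  unfolding normal_density_def by measurable

text \<open>The density of the law of \<open>x + c\<close> with respect to the law of \<open>x\<close>, for \<open>x\<close> centred Gaussian with
  standard deviation \<open>s\<close>.\<close>

definition gauss_tilt :: "real \<Rightarrow> real \<Rightarrow> real \<Rightarrow> real" where
  "gauss_tilt s c x = exp ((2 * c * x - c\<^sup>2) / (2 * s\<^sup>2))"

lemma normal_density_shift: "s > 0 \<Longrightarrow> normal_density 0 s (x - c) = normal_density 0 s x * gauss_tilt s c x"
  unfolding normal_density_def gauss_tilt_def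
  by (simp add: mult_exp_exp power2_eq_square field_simps)

lemma gauss_tilt_measurable [measurable]: "gauss_tilt s c \<in> borel_measurable borel"
  unfolding gauss_tilt_def[abs_def] by measurable

lemma gauss_tilt_nonneg [simp]: "0 \<le> gauss_tilt s c x"
  by (simp add: gauss_tilt_def)

lemma nn_integral_gauss_shift:
  assumes [measurable]: "f \<in> borel_measurable borel" and s: "s > 0"
  shows "(\<integral>\<^sup>+x. f (x + c) \<partial>gauss s) = (\<integral>\<^sup>+x. ennreal (gauss_tilt s c x) * f x \<partial>gauss s)"
proof -
  have "(\<integral>\<^sup>+x. f (x + c) \<partial>gauss s) = (\<integral>\<^sup>+x. ennreal (normal_density 0 s x) * f (x + c) \<partial>lborel)"
    by (rule nn_integral_gauss) auto
  also have "\<dots> = (\<integral>\<^sup>+x. ennreal (normal_density 0 s (x - c)) * f x \<partial>lborel)"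
    by (subst nn_integral_real_affine[where c=1 and t="-c"]) (auto simp: add.commute)
  also have "\<dots> = (\<integral>\<^sup>+x. ennreal (normal_density 0 s x) * (ennreal (gauss_tilt s c x) * f x) \<partial>lborel)"
    by (simp add: normal_density_shift[OF s] ennreal_mult mult.assoc)
  also have "\<dots> = (\<integral>\<^sup>+x. ennreal (gauss_tilt s c x) * f x \<partial>gauss s)"
    by (rule nn_integral_gauss[symmetric]) auto
  finally show ?thesis .
qed

text \<open>The steps of a Gaussian random walk of length \<open>k\<close>, that is, the law of
  \<open>k\<close> Brownian increments over consecutive cells of length
  \<open>s\<^sup>2\<close>.\<close>

definition gauss_vec :: "nat \<Rightarrow> real \<Rightarrow> (nat \<Rightarrow> real) measure" where
  "gauss_vec k s = PiM {..<k} (\<lambda>_. gauss s)"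

lemma sets_gauss_vec [simp, measurable_cong]: "sets (gauss_vec k s) = sets (PiM {..<k} (\<lambda>_. borel))"
  unfolding gauss_vec_def by (intro sets_PiM_cong) auto

lemma prob_space_gauss_vec: "s > 0 \<Longrightarrow> prob_space (gauss_vec k s)"
  unfolding gauss_vec_def by (intro prob_space_PiM prob_space_gauss)

text \<open>Both sides are products: a common shift acts on each factor separately, and so does a
  product density. Each side is therefore compared on rectangles with the product of the shifted
  one-dimensional laws.\<close>

lemma distr_gauss_vec_shift:
  assumes s: "s > 0"
  shows "distr (gauss_vec k s) (PiM {..<k} (\<lambda>_. borel)) (\<lambda>d. \<lambda>i\<in>{..<k}. d i + c)
       = density (gauss_vec k s) (\<lambda>d. ennreal (\<Prod>i<k. gauss_tilt s c (d i)))"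
    (is "?L = ?R")
proof -
  interpret g: prob_space "gauss s" by (rule prob_space_gauss[OF s])
  interpret product_sigma_finite "\<lambda>_::nat. gauss s" ..
  have sh: "prob_space (distr (gauss s) borel (\<lambda>x. x + c))"
    by (rule g.prob_space_distr) auto
  interpret h: prob_space "distr (gauss s) borel (\<lambda>x. x + c)" by (rule sh)
  interpret q: product_sigma_finite "\<lambda>_::nat. distr (gauss s) borel (\<lambda>x. x + c)" ..
  have em: "emeasure (distr (gauss s) borel (\<lambda>x. x + c)) A
      = (\<integral>\<^sup>+x. ennreal (gauss_tilt s c x) * indicator A x \<partial>gauss s)" if [measurable]: "A \<in> sets borel" for A
  proof -
    have "emeasure (distr (gauss s) borel (\<lambda>x. x + c)) A = (\<integral>\<^sup>+x. indicator A (x + c) \<partial>gauss s)"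
    proof -
      have [measurable]: "(\<lambda>x. x + c) -` A \<in> sets borel"
        by (rule measurable_sets_borel[OF _ that]) simp
      have "emeasure (distr (gauss s) borel (\<lambda>x. x + c)) A = emeasure (gauss s) ((\<lambda>x. x + c) -` A)"
        by (simp add: emeasure_distr)
      also have "\<dots> = (\<integral>\<^sup>+x. indicator ((\<lambda>x. x + c) -` A) x \<partial>gauss s)"
        by (subst nn_integral_indicator) auto
      finally show ?thesis by (simp add: indicator_def)
    qed
    then show ?thesis by (simp add: nn_integral_gauss_shift[OF _ s])
  qed
  have "?L = PiM {..<k} (\<lambda>_. distr (gauss s) borel (\<lambda>x. x + c))"
  proof (rule q.PiM_eqI)
    fix A :: "nat \<Rightarrow> real set" assume "\<And>i. i \<in> {..<k} \<Longrightarrow> A i \<in> sets (distr (gauss s) borel (\<lambda>x. x + c))"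
    then have A[measurable]: "\<And>i. i \<in> {..<k} \<Longrightarrow> A i \<in> sets borel" by simp
    have "emeasure ?L (Pi\<^sub>E {..<k} A) = emeasure (gauss_vec k s) (Pi\<^sub>E {..<k} (\<lambda>i. (\<lambda>x. x + c) -` A i))"
    proof -
      have "(\<lambda>d. \<lambda>i\<in>{..<k}. d i + c) -` Pi\<^sub>E {..<k} A \<inter> space (gauss_vec k s)
          = Pi\<^sub>E {..<k} (\<lambda>i. (\<lambda>x. x + c) -` A i)"
        by (auto simp: gauss_vec_def space_PiM PiE_def Pi_iff)
      then show ?thesis
        by (subst emeasure_distr) (auto intro!: sets_PiM_I_finite A)
    qed
    also have "\<dots> = (\<Prod>i<k. emeasure (gauss s) ((\<lambda>x. x + c) -` A i))"
      unfolding gauss_vec_def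
      by (subst emeasure_PiM) (auto intro!: measurable_sets_borel[OF _ A])
    also have "\<dots> = (\<Prod>i<k. emeasure (distr (gauss s) borel (\<lambda>x. x + c)) (A i))"
      by (intro prod.cong refl) (auto simp: emeasure_distr A)
    finally show "emeasure ?L (Pi\<^sub>E {..<k} A) = (\<Prod>i<k. emeasure (distr (gauss s) borel (\<lambda>x. x + c)) (A i))" .
  qed (auto intro!: sets_PiM_cong)
  also have "\<dots> = ?R"
  proof (rule q.PiM_eqI[symmetric])
    fix A :: "nat \<Rightarrow> real set" assume "\<And>i. i \<in> {..<k} \<Longrightarrow> A i \<in> sets (distr (gauss s) borel (\<lambda>x. x + c))"
    then have A[measurable]: "\<And>i. i \<in> {..<k} \<Longrightarrow> A i \<in> sets borel" by simp
    have "emeasure ?R (Pi\<^sub>E {..<k} A)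
        = (\<integral>\<^sup>+d. ennreal (\<Prod>i<k. gauss_tilt s c (d i)) * indicator (Pi\<^sub>E {..<k} A) d \<partial>gauss_vec k s)"
      by (rule emeasure_density) (auto intro!: sets_PiM_I_finite A)
    also have "\<dots> = (\<integral>\<^sup>+d. (\<Prod>i<k. ennreal (gauss_tilt s c (d i)) * indicator (A i) (d i)) \<partial>gauss_vec k s)"
    proof (rule nn_integral_cong)
      fix d assume "d \<in> space (gauss_vec k s)"
      then have "d \<in> extensional {..<k}" by (simp add: gauss_vec_def space_PiM PiE_def)
      then have "indicator (Pi\<^sub>E {..<k} A) d = (\<Prod>i<k. indicator (A i) (d i) :: ennreal)"
        by (auto simp: indicator_def PiE_def Pi_iff prod_zero_iff)
      then show "ennreal (\<Prod>i<k. gauss_tilt s c (d i)) * indicator (Pi\<^sub>E {..<k} A) d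
          = (\<Prod>i<k. ennreal (gauss_tilt s c (d i)) * indicator (A i) (d i))"
        by (simp add: prod.distrib prod_ennreal[symmetric])
    qed
    also have "\<dots> = (\<Prod>i<k. \<integral>\<^sup>+x. ennreal (gauss_tilt s c x) * indicator (A i) x \<partial>gauss s)"
      unfolding gauss_vec_def by (rule product_nn_integral_prod) auto
    also have "\<dots> = (\<Prod>i<k. emeasure (distr (gauss s) borel (\<lambda>x. x + c)) (A i))"
      by (intro prod.cong refl em[symmetric]) (auto simp: A)
    finally show "emeasure ?R (Pi\<^sub>E {..<k} A) = (\<Prod>i<k. emeasure (distr (gauss s) borel (\<lambda>x. x + c)) (A i))" .
  qed (auto intro!: sets_PiM_cong)
  finally show ?thesis .
qed

text \<open>The finite-dimensional Cameron--Martin formula for a constant drift. The tilt of all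
  coordinates together depends on \<open>d\<close> only through the sum, that is, through the
  endpoint of the Gaussian walk.\<close>

lemma nn_integral_gauss_vec_shift:
  assumes s: "s > 0" and [measurable]: "F \<in> borel_measurable (PiM {..<k} (\<lambda>_. borel))"
  shows "(\<integral>\<^sup>+d. F (\<lambda>i\<in>{..<k}. d i + c) \<partial>gauss_vec k s)
       = (\<integral>\<^sup>+d. ennreal (exp ((2 * c * (\<Sum>i<k. d i) - k * c\<^sup>2) / (2 * s\<^sup>2))) * F d \<partial>gauss_vec k s)"
proof -
  have "(\<integral>\<^sup>+d. F (\<lambda>i\<in>{..<k}. d i + c) \<partial>gauss_vec k s)
      = (\<integral>\<^sup>+d. F d \<partial>distr (gauss_vec k s) (PiM {..<k} (\<lambda>_. borel)) (\<lambda>d. \<lambda>i\<in>{..<k}. d i + c))"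
    by (subst nn_integral_distr) auto
  also have "\<dots> = (\<integral>\<^sup>+d. ennreal (\<Prod>i<k. gauss_tilt s c (d i)) * F d \<partial>gauss_vec k s)"
    unfolding distr_gauss_vec_shift[OF s] by (subst nn_integral_density) auto
  also have "(\<lambda>d. \<Prod>i<k. gauss_tilt s c (d i)) = (\<lambda>d. exp ((2 * c * (\<Sum>i<k. d i) - k * c\<^sup>2) / (2 * s\<^sup>2)))"
    by (simp add: gauss_tilt_def exp_sum[symmetric] sum_divide_distrib[symmetric] sum_subtractf sum_distrib_left)
  finally show ?thesis .
qed

text \<open>Completing the square in \<open>c\<close>: with \<open>m = Suc k\<close>, the integrand
  is a constant times the normal density in \<open>c\<close> with mean \<open>x / m\<close> and
  variance \<open>s\<^sup>2 / m\<close>. Apart from \<open>normal_density 0 s (x - S)\<close>, that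
  constant is the reciprocal of the product of \<open>m\<close> and the density at \<open>x\<close>
  of a sum of \<open>m\<close> steps, which explains the second factor on the left-hand
  side.\<close>

lemma nn_integral_bridge_kernel:
  fixes x S s :: real
  assumes s: "s > 0"
  shows "(\<integral>\<^sup>+c. ennreal (normal_density 0 s (x - S - c) * exp ((2 * c * S - real k * c\<^sup>2) / (2 * s\<^sup>2))) \<partial>lborel)
       * ennreal (real (Suc k) * normal_density 0 (s * sqrt (Suc k)) x)
       = ennreal (normal_density 0 s (x - S))"
proof -
  define m where "m = real (Suc k)"
  have m: "m > 0" "real k = m - 1" by (auto simp: m_def)
  have e: "normal_density 0 s (x - S - c) * exp ((2 * c * S - real k * c\<^sup>2) / (2 * s\<^sup>2))
      = normal_density 0 s (x - S) * (exp (x\<^sup>2 / (2 * m * s\<^sup>2)) * sqrt (2 * pi * s\<^sup>2 / m)) * normal_density (x / m) (s / sqrt m) c" for c :: real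
  proof -
    have 1: "sqrt (2 * pi * s\<^sup>2 / m) * (1 / sqrt (2 * pi * (s / sqrt m)\<^sup>2)) = 1"
      using s m by (simp add: power_divide)
    \<comment> \<open>The cross terms in \<open>c * S\<close> cancel and the coefficient of
      \<open>c\<^sup>2\<close> is \<open>- m\<close>, so the centre \<open>x / m\<close> does not
      depend on \<open>S\<close>.\<close>
    have 2: "-(x - S - c)\<^sup>2 / (2 * s\<^sup>2) + (2 * c * S - real k * c\<^sup>2) / (2 * s\<^sup>2)
       = -(x - S)\<^sup>2 / (2 * s\<^sup>2) + (x\<^sup>2 / (2 * m * s\<^sup>2) + - (c - x / m)\<^sup>2 / (2 * (s / sqrt m)\<^sup>2))"
    proof -
      have h: "(s / sqrt m)\<^sup>2 = s\<^sup>2 / m" using m by (simp add: power_divide)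
      show ?thesis unfolding h m(2) using s m(1)
        by (simp add: field_simps power2_eq_square)
    qed
    have "normal_density 0 s (x - S - c) * exp ((2 * c * S - real k * c\<^sup>2) / (2 * s\<^sup>2))
      = 1 / sqrt (2 * pi * s\<^sup>2) * exp (-(x - S - c)\<^sup>2 / (2 * s\<^sup>2) + (2 * c * S - real k * c\<^sup>2) / (2 * s\<^sup>2))"
      by (simp add: normal_density_def mult_exp_exp)
    also have "\<dots> = (1 / sqrt (2 * pi * s\<^sup>2) * exp (-(x - S)\<^sup>2 / (2 * s\<^sup>2)))
        * (exp (x\<^sup>2 / (2 * m * s\<^sup>2)) * exp (- (c - x / m)\<^sup>2 / (2 * (s / sqrt m)\<^sup>2)))"
      unfolding 2 exp_add by (simp only: mult.assoc)
    also have "\<dots> = (1 / sqrt (2 * pi * s\<^sup>2) * exp (-(x - S)\<^sup>2 / (2 * s\<^sup>2)))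
        * (exp (x\<^sup>2 / (2 * m * s\<^sup>2)) * exp (- (c - x / m)\<^sup>2 / (2 * (s / sqrt m)\<^sup>2)))
        * (sqrt (2 * pi * s\<^sup>2 / m) * (1 / sqrt (2 * pi * (s / sqrt m)\<^sup>2)))"
      unfolding 1 by (rule mult_1_right[symmetric])
    finally show ?thesis unfolding normal_density_def by (simp only: mult_ac diff_0_right)
  qed
  have "(\<integral>\<^sup>+c. ennreal (normal_density 0 s (x - S - c) * exp ((2 * c * S - real k * c\<^sup>2) / (2 * s\<^sup>2))) \<partial>lborel)
     = ennreal (normal_density 0 s (x - S) * (exp (x\<^sup>2 / (2 * m * s\<^sup>2)) * sqrt (2 * pi * s\<^sup>2 / m)))
       * (\<integral>\<^sup>+c. ennreal (normal_density (x / m) (s / sqrt m) c) \<partial>lborel)"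
    unfolding e using m by (subst nn_integral_cmult[symmetric]) (auto simp: ennreal_mult)
  also have "(\<integral>\<^sup>+c. ennreal (normal_density (x / m) (s / sqrt m) c) \<partial>lborel) = 1"
    using s m by (subst nn_integral_eq_integral) auto
  finally have "(\<integral>\<^sup>+c. ennreal (normal_density 0 s (x - S - c) * exp ((2 * c * S - real k * c\<^sup>2) / (2 * s\<^sup>2))) \<partial>lborel)
       * ennreal (real (Suc k) * normal_density 0 (s * sqrt (Suc k)) x)
     = ennreal (normal_density 0 s (x - S) * (exp (x\<^sup>2 / (2 * m * s\<^sup>2)) * sqrt (2 * pi * s\<^sup>2 / m))
         * (m * normal_density 0 (s * sqrt m) x))"
    unfolding m_def[symmetric] using m(1) by (simp add: ennreal_mult'' del: of_nat_Suc)
  also have "(exp (x\<^sup>2 / (2 * m * s\<^sup>2)) * sqrt (2 * pi * s\<^sup>2 / m)) * (m * normal_density 0 (s * sqrt m) x) = 1"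
  proof -
    have "sqrt (2 * pi * s\<^sup>2 / m) * m = sqrt (2 * pi * s\<^sup>2 * m)"
      using m by (simp add: real_sqrt_divide real_sqrt_mult real_div_sqrt field_simps)
    moreover have "exp (x\<^sup>2 / (2 * m * s\<^sup>2)) * exp (- (x\<^sup>2 / (2 * s\<^sup>2 * m))) = 1"
      by (simp add: exp_add[symmetric] mult.commute mult.left_commute)
    moreover have "2 * pi * s\<^sup>2 * m > 0" using s m by simp
    ultimately show ?thesis using m s
      by (simp add: normal_density_def power_mult_distrib algebra_simps)
  qed
  then have "normal_density 0 s (x - S) * (exp (x\<^sup>2 / (2 * m * s\<^sup>2)) * sqrt (2 * pi * s\<^sup>2 / m))
         * (m * normal_density 0 (s * sqrt m) x) = normal_density 0 s (x - S)"
    by (metis mult.assoc mult.right_neutral)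
  finally show ?thesis .
qed

text \<open>Weighting the first \<open>k\<close> of \<open>k + 1\<close> Gaussian steps by the
  density of the last one at \<open>x\<close> minus their sum describes the walk that ends at
  \<open>x\<close>. On the right that law is realised without conditioning: with \<open>u\<close>
  the last step, the discrepancy between \<open>x\<close> and the actual endpoint is spread evenly
  over all steps. The proof takes this common correction \<open>c\<close> as a new variable in place
  of \<open>u\<close>, removes it from \<open>F\<close> by the drift formula, and integrates it
  out.\<close>

lemma nn_integral_bridge:
  assumes s: "s > 0" and [measurable]: "F \<in> borel_measurable (PiM {..<k} (\<lambda>_. borel))"
  shows "(\<integral>\<^sup>+d. F d * ennreal (normal_density 0 s (x - (\<Sum>i<k. d i))) \<partial>gauss_vec k s)
    = ennreal (normal_density 0 (s * sqrt (Suc k)) x) *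
      (\<integral>\<^sup>+d. (\<integral>\<^sup>+u. F (\<lambda>i\<in>{..<k}. d i + (x - (\<Sum>i<k. d i) - u) / real (Suc k)) \<partial>gauss s) \<partial>gauss_vec k s)"
proof -
  define m where "m = real (Suc k)"
  have m: "m > 0" "real k = m - 1" by (auto simp: m_def)
  interpret P: prob_space "gauss_vec k s" by (rule prob_space_gauss_vec[OF s])
  interpret PL: pair_sigma_finite "gauss_vec k s" lborel ..
  have mF[measurable]: "(\<lambda>d. F (\<lambda>i\<in>{..<k}. d i + c)) \<in> borel_measurable (PiM {..<k} (\<lambda>_. borel))" for c
    by measurable
  have "(\<integral>\<^sup>+u. F (\<lambda>i\<in>{..<k}. d i + (x - (\<Sum>i<k. d i) - u) / m) \<partial>gauss s)
      = (\<integral>\<^sup>+c. ennreal (m * normal_density 0 s (x - (\<Sum>i<k. d i) - m * c)) * F (\<lambda>i\<in>{..<k}. d i + c) \<partial>lborel)"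
    if d: "d \<in> space (gauss_vec k s)" for d
  proof -
    have [measurable]: "(\<lambda>c. F (\<lambda>i\<in>{..<k}. d i + c)) \<in> borel_measurable borel" by measurable
    have [measurable]: "(\<lambda>u. F (\<lambda>i\<in>{..<k}. d i + (x - (\<Sum>i<k. d i) - u) / m)) \<in> borel_measurable borel" by measurable
    have "(\<integral>\<^sup>+u. F (\<lambda>i\<in>{..<k}. d i + (x - (\<Sum>i<k. d i) - u) / m) \<partial>gauss s)
        = (\<integral>\<^sup>+u. ennreal (normal_density 0 s u) * F (\<lambda>i\<in>{..<k}. d i + (x - (\<Sum>i<k. d i) - u) / m) \<partial>lborel)"
      by (rule nn_integral_gauss) measurable
    \<comment> \<open>Substitution \<open>u = x - S - m * c\<close> with \<open>S\<close> the sum of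
      the \<open>d i\<close>; the Jacobian is \<open>m\<close>.\<close>
    also have "\<dots> = ennreal \<bar>- m\<bar> * (\<integral>\<^sup>+c. ennreal (normal_density 0 s ((x - (\<Sum>i<k. d i)) + - m * c))
          * F (\<lambda>i\<in>{..<k}. d i + (x - (\<Sum>i<k. d i) - ((x - (\<Sum>i<k. d i)) + - m * c)) / m) \<partial>lborel)"
      using m by (intro nn_integral_real_affine) auto
    also have "\<dots> = ennreal m * (\<integral>\<^sup>+c. ennreal (normal_density 0 s (x - (\<Sum>i<k. d i) - m * c))
          * F (\<lambda>i\<in>{..<k}. d i + c) \<partial>lborel)"
      using m by simp
    also have "\<dots> = (\<integral>\<^sup>+c. ennreal (m * normal_density 0 s (x - (\<Sum>i<k. d i) - m * c)) * F (\<lambda>i\<in>{..<k}. d i + c) \<partial>lborel)"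
      using m by (subst nn_integral_cmult[symmetric]) (auto simp: ennreal_mult mult.assoc)
    finally show ?thesis .
  qed
  then have "(\<integral>\<^sup>+d. (\<integral>\<^sup>+u. F (\<lambda>i\<in>{..<k}. d i + (x - (\<Sum>i<k. d i) - u) / m) \<partial>gauss s) \<partial>gauss_vec k s)
     = (\<integral>\<^sup>+d. (\<integral>\<^sup>+c. ennreal (m * normal_density 0 s (x - (\<Sum>i<k. d i) - m * c)) * F (\<lambda>i\<in>{..<k}. d i + c) \<partial>lborel) \<partial>gauss_vec k s)"
    by (intro nn_integral_cong) auto
  also have "\<dots> = (\<integral>\<^sup>+c. (\<integral>\<^sup>+d. ennreal (m * normal_density 0 s (x - (\<Sum>i<k. d i) - m * c)) * F (\<lambda>i\<in>{..<k}. d i + c) \<partial>gauss_vec k s) \<partial>lborel)"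
    by (rule PL.Fubini'[symmetric]) measurable
  also have "\<dots> = (\<integral>\<^sup>+c. (\<integral>\<^sup>+d. ennreal (exp ((2 * c * (\<Sum>i<k. d i) - k * c\<^sup>2) / (2 * s\<^sup>2)))
        * (ennreal (m * normal_density 0 s (x - (\<Sum>i<k. d i) - c)) * F d) \<partial>gauss_vec k s) \<partial>lborel)"
  proof (rule nn_integral_cong)
    fix c :: real
    \<comment> \<open>The shifted vector has sum \<open>S + k * c\<close>. Expressed through it, the
      correction \<open>m * c\<close> becomes a single \<open>c\<close>.\<close>
    have "(\<integral>\<^sup>+d. ennreal (m * normal_density 0 s (x - (\<Sum>i<k. d i) - m * c)) * F (\<lambda>i\<in>{..<k}. d i + c) \<partial>gauss_vec k s)
       = (\<integral>\<^sup>+d. (\<lambda>d. ennreal (m * normal_density 0 s (x - (\<Sum>i<k. d i) - c)) * F d) (\<lambda>i\<in>{..<k}. d i + c) \<partial>gauss_vec k s)"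
      by (intro nn_integral_cong) (simp add: sum.distrib m(2) algebra_simps)
    also have "\<dots> = (\<integral>\<^sup>+d. ennreal (exp ((2 * c * (\<Sum>i<k. d i) - k * c\<^sup>2) / (2 * s\<^sup>2)))
        * (ennreal (m * normal_density 0 s (x - (\<Sum>i<k. d i) - c)) * F d) \<partial>gauss_vec k s)"
      by (rule nn_integral_gauss_vec_shift[OF s]) measurable
    finally show "(\<integral>\<^sup>+d. ennreal (m * normal_density 0 s (x - (\<Sum>i<k. d i) - m * c)) * F (\<lambda>i\<in>{..<k}. d i + c) \<partial>gauss_vec k s)
      = (\<integral>\<^sup>+d. ennreal (exp ((2 * c * (\<Sum>i<k. d i) - k * c\<^sup>2) / (2 * s\<^sup>2)))
        * (ennreal (m * normal_density 0 s (x - (\<Sum>i<k. d i) - c)) * F d) \<partial>gauss_vec k s)" .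
  qed
  also have "\<dots> = (\<integral>\<^sup>+d. (\<integral>\<^sup>+c. ennreal (exp ((2 * c * (\<Sum>i<k. d i) - k * c\<^sup>2) / (2 * s\<^sup>2)))
        * (ennreal (m * normal_density 0 s (x - (\<Sum>i<k. d i) - c)) * F d) \<partial>lborel) \<partial>gauss_vec k s)"
    by (rule PL.Fubini') measurable
  also have "\<dots> = (\<integral>\<^sup>+d. F d * ennreal m * (\<integral>\<^sup>+c. ennreal (normal_density 0 s (x - (\<Sum>i<k. d i) - c)
        * exp ((2 * c * (\<Sum>i<k. d i) - k * c\<^sup>2) / (2 * s\<^sup>2))) \<partial>lborel) \<partial>gauss_vec k s)"
    using m(1) by (intro nn_integral_cong, subst nn_integral_cmult[symmetric]) (auto simp: ennreal_mult mult_ac)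
  finally have "ennreal (normal_density 0 (s * sqrt (Suc k)) x) *
      (\<integral>\<^sup>+d. (\<integral>\<^sup>+u. F (\<lambda>i\<in>{..<k}. d i + (x - (\<Sum>i<k. d i) - u) / m) \<partial>gauss s) \<partial>gauss_vec k s)
    = ennreal (normal_density 0 (s * sqrt (Suc k)) x) * (\<integral>\<^sup>+d. F d * ennreal m * (\<integral>\<^sup>+c. ennreal (normal_density 0 s (x - (\<Sum>i<k. d i) - c)
        * exp ((2 * c * (\<Sum>i<k. d i) - k * c\<^sup>2) / (2 * s\<^sup>2))) \<partial>lborel) \<partial>gauss_vec k s)"
    by simp
  also have "\<dots> = (\<integral>\<^sup>+d. ennreal (normal_density 0 (s * sqrt (Suc k)) x) * (F d * ennreal m * (\<integral>\<^sup>+c. ennreal (normal_density 0 s (x - (\<Sum>i<k. d i) - c)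
        * exp ((2 * c * (\<Sum>i<k. d i) - k * c\<^sup>2) / (2 * s\<^sup>2))) \<partial>lborel)) \<partial>gauss_vec k s)"
    by (rule nn_integral_cmult[symmetric]) measurable
  also have "\<dots> = (\<integral>\<^sup>+d. F d * ennreal (normal_density 0 s (x - (\<Sum>i<k. d i))) \<partial>gauss_vec k s)"
    unfolding nn_integral_bridge_kernel[OF s, where k=k, symmetric] m_def[symmetric]
    unfolding ennreal_mult'[OF less_imp_le[OF m(1)], of "normal_density 0 (s * sqrt m) x"]
    by (simp only: mult_ac)
  finally show ?thesis unfolding m_def by (rule sym)
qed

text \<open>Freezing the independent variable \<open>U\<close> leaves a sum of independent normal
  variables with constant coefficients, which is normal with the variances added. Positive
  coefficients keep each summand nondegenerate. It is applied to the walk, with \<open>U\<close> the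
  signs, and to the Riemann sums of the Ito integral, with \<open>U\<close> the values of
  \<open>B\<close> on the grid.\<close>

lemma nn_integral_gaussian_mixture:
  fixes V :: "nat \<Rightarrow> 'b \<Rightarrow> real"
  assumes N: "prob_space N"
    and UV: "prob_space.indep_var N S U (PiM J (\<lambda>_. borel)) (\<lambda>\<omega>. \<lambda>j\<in>J. V j \<omega>)"
    and V: "prob_space.indep_vars N (\<lambda>_. borel) V J"
    and J: "finite J" "J \<noteq> {}" and s: "s > 0"
    and nV: "\<And>j. j \<in> J \<Longrightarrow> distributed N lborel (V j) (normal_density 0 s)"
    and c[measurable]: "\<And>j. j \<in> J \<Longrightarrow> c j \<in> borel_measurable S"
    and c_pos: "\<And>j u. j \<in> J \<Longrightarrow> u \<in> space S \<Longrightarrow> c j u > 0"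
    and F[measurable]: "F \<in> borel_measurable (S \<Otimes>\<^sub>M borel)"
  shows "(\<integral>\<^sup>+\<omega>. F (U \<omega>, \<Sum>j\<in>J. c j (U \<omega>) * V j \<omega>) \<partial>N)
    = (\<integral>\<^sup>+\<omega>. (\<integral>\<^sup>+y. F (U \<omega>, y) * ennreal (normal_density 0 (s * sqrt (\<Sum>j\<in>J. (c j (U \<omega>))\<^sup>2)) y) \<partial>lborel) \<partial>N)"
proof -
  interpret N: prob_space N by fact
  let ?V = "\<lambda>\<omega>. \<lambda>j\<in>J. V j \<omega>" and ?P = "PiM J (\<lambda>_. borel :: real measure)"
  have [measurable]: "U \<in> measurable N S" "?V \<in> measurable N ?P"
    using UV N.indep_var_rv1 N.indep_var_rv2 by blast+
  interpret DU: prob_space "distr N S U" by (rule N.prob_space_distr) measurable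
  interpret DV: prob_space "distr N ?P ?V" by (rule N.prob_space_distr) measurable
  have [measurable]: "(\<lambda>(u, v). F (u, \<Sum>j\<in>J. c j u * v j)) \<in> borel_measurable (S \<Otimes>\<^sub>M ?P)"
    by measurable
  have "(\<integral>\<^sup>+\<omega>. F (U \<omega>, \<Sum>j\<in>J. c j (U \<omega>) * V j \<omega>) \<partial>N)
      = (\<integral>\<^sup>+\<omega>. (\<lambda>(u, v). F (u, \<Sum>j\<in>J. c j u * v j)) (U \<omega>, ?V \<omega>) \<partial>N)"
    by (simp cong: sum.cong)
  also have "\<dots> = (\<integral>\<^sup>+z. (\<lambda>(u, v). F (u, \<Sum>j\<in>J. c j u * v j)) z \<partial>(distr N (S \<Otimes>\<^sub>M ?P) (\<lambda>\<omega>. (U \<omega>, ?V \<omega>))))"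
    by (subst nn_integral_distr) auto
  also have "distr N (S \<Otimes>\<^sub>M ?P) (\<lambda>\<omega>. (U \<omega>, ?V \<omega>)) = distr N S U \<Otimes>\<^sub>M distr N ?P ?V"
    using UV unfolding N.indep_var_distribution_eq by simp
  also have "(\<integral>\<^sup>+z. (\<lambda>(u, v). F (u, \<Sum>j\<in>J. c j u * v j)) z \<partial>(distr N S U \<Otimes>\<^sub>M distr N ?P ?V))
      = (\<integral>\<^sup>+u. (\<integral>\<^sup>+v. F (u, \<Sum>j\<in>J. c j u * v j) \<partial>distr N ?P ?V) \<partial>distr N S U)"
    by (subst DV.nn_integral_fst[symmetric]) auto
  also have "\<dots> = (\<integral>\<^sup>+u. (\<integral>\<^sup>+y. F (u, y) * ennreal (normal_density 0 (s * sqrt (\<Sum>j\<in>J. (c j u)\<^sup>2)) y) \<partial>lborel) \<partial>distr N S U)"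
  proof (rule nn_integral_cong)
    fix u assume "u \<in> space (distr N S U)"
    then have u: "u \<in> space S" by simp
    have F'[measurable]: "(\<lambda>y. F (u, y)) \<in> borel_measurable borel"
      using u by measurable
    have iv: "N.indep_vars (\<lambda>_. borel) (\<lambda>j \<omega>. c j u * V j \<omega>) J"
      by (rule N.indep_vars_compose2[OF V, where Y="\<lambda>j x. c j u * x"]) simp
    have dj: "distributed N lborel (\<lambda>\<omega>. c j u * V j \<omega>) (normal_density 0 (c j u * s))" if "j \<in> J" for j
      using N.normal_density_affine[OF nV[OF that] s, where \<beta>=0 and \<alpha>="c j u"] c_pos[OF that u] by simp
    have "distributed N lborel (\<lambda>\<omega>. \<Sum>j\<in>J. c j u * V j \<omega>) (normal_density (\<Sum>j\<in>J. 0) (sqrt (\<Sum>j\<in>J. (c j u * s)\<^sup>2)))"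
      by (rule N.sum_indep_normal[OF J iv _ dj]) (use c_pos u s in auto)
    also have "sqrt (\<Sum>j\<in>J. (c j u * s)\<^sup>2) = s * sqrt (\<Sum>j\<in>J. (c j u)\<^sup>2)"
      using s by (simp add: power_mult_distrib sum_distrib_right[symmetric] real_sqrt_mult)
    finally have d: "distributed N lborel (\<lambda>\<omega>. \<Sum>j\<in>J. c j u * V j \<omega>) (normal_density 0 (s * sqrt (\<Sum>j\<in>J. (c j u)\<^sup>2)))"
      by simp
    have "(\<integral>\<^sup>+v. F (u, \<Sum>j\<in>J. c j u * v j) \<partial>distr N ?P ?V) = (\<integral>\<^sup>+\<omega>. F (u, \<Sum>j\<in>J. c j u * V j \<omega>) \<partial>N)"
      by (subst nn_integral_distr) (auto cong: sum.cong)
    also have "\<dots> = (\<integral>\<^sup>+y. ennreal (normal_density 0 (s * sqrt (\<Sum>j\<in>J. (c j u)\<^sup>2)) y) * F (u, y) \<partial>lborel)"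
      by (rule distributed_nn_integral[OF d, symmetric]) simp
    finally show "(\<integral>\<^sup>+v. F (u, \<Sum>j\<in>J. c j u * v j) \<partial>distr N ?P ?V)
       = (\<integral>\<^sup>+y. F (u, y) * ennreal (normal_density 0 (s * sqrt (\<Sum>j\<in>J. (c j u)\<^sup>2)) y) \<partial>lborel)"
      by (simp add: mult.commute)
  qed
  also have "\<dots> = (\<integral>\<^sup>+\<omega>. (\<integral>\<^sup>+y. F (U \<omega>, y) * ennreal (normal_density 0 (s * sqrt (\<Sum>j\<in>J. (c j (U \<omega>))\<^sup>2)) y) \<partial>lborel) \<partial>N)"
    by (rule nn_integral_distr) measurable
  finally show ?thesis .
qed

section \<open>Independence of Brownian increments from the past\<close>

text \<open>The library's \<open>indep_var\<close> forces both variables to take values in the same type.\<close>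

definition (in prob_space) indep2 where
  "indep2 S U T V \<longleftrightarrow> U \<in> measurable M S \<and> V \<in> measurable M T \<and>
    (\<forall>A\<in>sets S. \<forall>C\<in>sets T.
      prob ((U -` A \<inter> space M) \<inter> (V -` C \<inter> space M)) = prob (U -` A \<inter> space M) * prob (V -` C \<inter> space M))"

lemma (in prob_space) indep2_iff_indep_var: "indep2 S U T V \<longleftrightarrow> indep_var S U T V"
proof
  assume *: "indep_var S U T V"
  have "prob ((U -` A \<inter> space M) \<inter> (V -` C \<inter> space M)) = prob (U -` A \<inter> space M) * prob (V -` C \<inter> space M)"
    if "A \<in> sets S" "C \<in> sets T" for A C
  proof -
    have "(\<lambda>x. (U x, V x)) -` (A \<times> C) \<inter> space M = (U -` A \<inter> space M) \<inter> (V -` C \<inter> space M)" by auto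
    with indep_varD[OF * that] show ?thesis by simp
  qed
  then show "indep2 S U T V"
    using indep_var_rv1[OF *] indep_var_rv2[OF *] by (simp add: indep2_def)
next
  assume *: "indep2 S U T V"
  have stable: "Int_stable {X -` A \<inter> space M |A. A \<in> sets R}" for X :: "'a \<Rightarrow> 'b" and R
  proof (rule Int_stableI)
    fix a b assume "a \<in> {X -` A \<inter> space M |A. A \<in> sets R}" "b \<in> {X -` A \<inter> space M |A. A \<in> sets R}"
    then obtain A B where "A \<in> sets R" "B \<in> sets R" "a = X -` A \<inter> space M" "b = X -` B \<inter> space M" by auto
    then have "a \<inter> b = X -` (A \<inter> B) \<inter> space M" "A \<inter> B \<in> sets R" by auto
    then show "a \<inter> b \<in> {X -` A \<inter> space M |A. A \<in> sets R}" by blast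
  qed
  have "indep_set {U -` A \<inter> space M |A. A \<in> sets S} {V -` C \<inter> space M |C. C \<in> sets T}"
    unfolding indep_sets2_eq using * measurable_sets[of U M S] measurable_sets[of V M T]
    by (auto simp: indep2_def)
  from indep_set_sigma_sets[OF this stable stable] * show "indep_var S U T V"
    by (simp add: indep_var_eq indep2_def)
qed

text \<open>For fixed \<open>C\<close> the sets \<open>A\<close> that obey the product rule form a
  Dynkin system, so the rule passes from an intersection-stable generator to the whole
  \<sigma>-algebra.\<close>

lemma (in prob_space) indep2_generator:
  assumes S: "sets S = sigma_sets (space S) G" and G: "Int_stable G"
    and U: "U \<in> measurable M S" and V: "V \<in> measurable M T"
    and eq: "\<And>A C. A \<in> G \<Longrightarrow> C \<in> sets T \<Longrightarrow>
      prob ((U -` A \<inter> space M) \<inter> (V -` C \<inter> space M)) = prob (U -` A \<inter> space M) * prob (V -` C \<inter> space M)"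
  shows "indep2 S U T V"
  unfolding indep2_def
proof (intro conjI ballI U V)
  fix A C assume A: "A \<in> sets S" and C: "C \<in> sets T"
  have VC: "V -` C \<inter> space M \<in> events" by (rule measurable_sets[OF V C])
  have G_sub: "G \<subseteq> Pow (space S)"
    by (metis S sets.space_closed sigma_sets_superset_generator subset_trans)
  have GS: "sigma_sets (space S) G = sets S" by (simp add: S)
  have U_sets: "U -` B \<inter> space M \<in> events" if "B \<in> sigma_sets (space S) G" for B
    using measurable_sets[OF U] that unfolding GS .
  from A have "A \<in> sigma_sets (space S) G" by (simp add: S)
  then show "prob ((U -` A \<inter> space M) \<inter> (V -` C \<inter> space M)) = prob (U -` A \<inter> space M) * prob (V -` C \<inter> space M)"
  proof (induct A rule: sigma_sets_induct_disjoint[OF G G_sub, consumes 1, case_names basic empty compl union])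
    case (basic B)
    then show ?case by (rule eq[OF _ C])
  next
    case empty
    show ?case by simp
  next
    case (compl B)
    have e: "U -` (space S - B) \<inter> space M = space M - (U -` B \<inter> space M)"
      using measurable_space[OF U] by auto
    have "prob ((U -` (space S - B) \<inter> space M) \<inter> (V -` C \<inter> space M))
        = prob ((V -` C \<inter> space M) - ((U -` B \<inter> space M) \<inter> (V -` C \<inter> space M)))"
      unfolding e by (rule arg_cong[where f=prob]) auto
    also have "\<dots> = prob (V -` C \<inter> space M) - prob ((U -` B \<inter> space M) \<inter> (V -` C \<inter> space M))"
      using VC U_sets[OF compl(1)] by (intro finite_measure_Diff) auto
    finally show ?case
      unfolding compl(2) e prob_compl[OF U_sets[OF compl(1)]] by (simp add: algebra_simps)
  next
    case (union B)
    have "(\<lambda>i. prob ((U -` B i \<inter> space M) \<inter> (V -` C \<inter> space M))) sums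
        prob (\<Union>i. (U -` B i \<inter> space M) \<inter> (V -` C \<inter> space M))"
      using union(1,2) VC U_sets by (intro finite_measure_UNION) (auto simp: disjoint_family_on_def)
    moreover have "(\<Union>i. (U -` B i \<inter> space M) \<inter> (V -` C \<inter> space M)) = (U -` (\<Union>i. B i) \<inter> space M) \<inter> (V -` C \<inter> space M)"
      by auto
    moreover have "(\<lambda>i. prob (U -` B i \<inter> space M)) sums prob (\<Union>i. U -` B i \<inter> space M)"
      using union(1,2) U_sets by (intro finite_measure_UNION) (auto simp: disjoint_family_on_def)
    then have "(\<lambda>i. prob (U -` B i \<inter> space M) * prob (V -` C \<inter> space M)) sums
       (prob (U -` (\<Union>i. B i) \<inter> space M) * prob (V -` C \<inter> space M))"
      by (intro sums_mult2) (simp add: vimage_UN)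
    ultimately show ?case
      unfolding union(3) by (auto dest: sums_unique2)
  qed
qed

lemma (in prob_space) indep2_compose:
  assumes "indep2 S U T V" and f: "f \<in> measurable S S'" and g: "g \<in> measurable T T'"
  shows "indep2 S' (\<lambda>\<omega>. f (U \<omega>)) T' (\<lambda>\<omega>. g (V \<omega>))"
  unfolding indep2_def
proof (intro conjI ballI)
  have U: "U \<in> measurable M S" and V: "V \<in> measurable M T" using assms by (auto simp: indep2_def)
  show "(\<lambda>\<omega>. f (U \<omega>)) \<in> measurable M S'" "(\<lambda>\<omega>. g (V \<omega>)) \<in> measurable M T'"
    using measurable_compose[OF U f] measurable_compose[OF V g] .
  fix A C assume A: "A \<in> sets S'" and C: "C \<in> sets T'"
  have e: "(\<lambda>\<omega>. f (U \<omega>)) -` A \<inter> space M = U -` (f -` A \<inter> space S) \<inter> space M"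
       "(\<lambda>\<omega>. g (V \<omega>)) -` C \<inter> space M = V -` (g -` C \<inter> space T) \<inter> space M"
    using measurable_space[OF U] measurable_space[OF V] by auto
  show "prob (((\<lambda>\<omega>. f (U \<omega>)) -` A \<inter> space M) \<inter> ((\<lambda>\<omega>. g (V \<omega>)) -` C \<inter> space M))
      = prob ((\<lambda>\<omega>. f (U \<omega>)) -` A \<inter> space M) * prob ((\<lambda>\<omega>. g (V \<omega>)) -` C \<inter> space M)"
    unfolding e using assms(1) measurable_sets[OF f A] measurable_sets[OF g C] unfolding indep2_def by blast
qed

text \<open>Regrouping of three variables, checked on rectangles: \<open>U\<close> splits off from
  the pair, \<open>V\<close> splits off from \<open>V'\<close>, and the first two factors are joined
  again. In the application \<open>U\<close> is the path of \<open>B\<close>, \<open>V\<close> the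
  past of \<open>W\<close>, and \<open>V'\<close> a later increment of \<open>W\<close>.\<close>

lemma (in prob_space) indep2_pair:
  assumes UV: "indep2 S U (T1 \<Otimes>\<^sub>M T2) (\<lambda>\<omega>. (V \<omega>, V' \<omega>))" and VV: "indep2 T1 V T2 V'"
  shows "indep2 (S \<Otimes>\<^sub>M T1) (\<lambda>\<omega>. (U \<omega>, V \<omega>)) T2 V'"
proof -
  have [measurable]: "U \<in> measurable M S" "V \<in> measurable M T1" "V' \<in> measurable M T2"
    using UV VV by (auto simp: indep2_def)
  have UV1: "indep2 S U T1 V"
    using indep2_compose[OF UV, of "\<lambda>x. x" S fst T1] by simp
  show ?thesis
  proof (rule indep2_generator)
    show "sets (S \<Otimes>\<^sub>M T1) = sigma_sets (space (S \<Otimes>\<^sub>M T1)) {a \<times> b | a b. a \<in> sets S \<and> b \<in> sets T1}"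
      by (simp add: sets_pair_measure space_pair_measure)
    fix A C assume "A \<in> {a \<times> b | a b. a \<in> sets S \<and> b \<in> sets T1}" and C: "C \<in> sets T2"
    then obtain a b where A: "A = a \<times> b" and a: "a \<in> sets S" and b: "b \<in> sets T1" by auto
    have bC: "b \<times> C \<in> sets (T1 \<Otimes>\<^sub>M T2)" using b C by simp
    have "prob (((\<lambda>\<omega>. (U \<omega>, V \<omega>)) -` A \<inter> space M) \<inter> (V' -` C \<inter> space M))
       = prob ((U -` a \<inter> space M) \<inter> ((\<lambda>\<omega>. (V \<omega>, V' \<omega>)) -` (b \<times> C) \<inter> space M))"
      unfolding A by (rule arg_cong[where f=prob]) auto
    also have "\<dots> = prob (U -` a \<inter> space M) * prob ((\<lambda>\<omega>. (V \<omega>, V' \<omega>)) -` (b \<times> C) \<inter> space M)"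
      using UV a bC by (simp add: indep2_def)
    also have "(\<lambda>\<omega>. (V \<omega>, V' \<omega>)) -` (b \<times> C) \<inter> space M = (V -` b \<inter> space M) \<inter> (V' -` C \<inter> space M)" by auto
    also have "prob \<dots> = prob (V -` b \<inter> space M) * prob (V' -` C \<inter> space M)"
      using VV b C by (simp add: indep2_def)
    also have "prob (U -` a \<inter> space M) * \<dots> = prob ((U -` a \<inter> space M) \<inter> (V -` b \<inter> space M)) * prob (V' -` C \<inter> space M)"
      using UV1 a b by (simp add: indep2_def)
    also have "(U -` a \<inter> space M) \<inter> (V -` b \<inter> space M) = (\<lambda>\<omega>. (U \<omega>, V \<omega>)) -` A \<inter> space M"
      unfolding A by auto
    finally show "prob (((\<lambda>\<omega>. (U \<omega>, V \<omega>)) -` A \<inter> space M) \<inter> (V' -` C \<inter> space M))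
       = prob ((\<lambda>\<omega>. (U \<omega>, V \<omega>)) -` A \<inter> space M) * prob (V' -` C \<inter> space M)" .
  qed (auto intro: Int_stable_pair_measure_generator)
qed

section \<open>From independent increments to independence of the joint filtration\<close>

lemma brownian_motion_measurable: "brownian_motion N B \<Longrightarrow> 0 \<le> s \<Longrightarrow> B s \<in> borel_measurable N"
  by (simp add: brownian_motion_def)

text \<open>The definition of Brownian motion speaks only of increments along a monotone sequence of
  times. The sequence used here runs through \<open>0\<close>, the points of \<open>J\<close> and
  \<open>u\<close>, and then stays at \<open>v\<close>: the values of \<open>W\<close> on
  \<open>J\<close> are partial sums of the increments up to \<open>u\<close>, and the increment from
  \<open>u\<close> to \<open>v\<close> is the next one.\<close>

lemma brownian_motion_finite_dim_indep:
  assumes W: "brownian_motion N W" and J: "finite J" "J \<subseteq> {0..u}" and uv: "0 \<le> u" "u \<le> v"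
  shows "prob_space.indep2 N (PiM J (\<lambda>_. borel)) (\<lambda>\<omega>. \<lambda>j\<in>J. W j \<omega>) borel (\<lambda>\<omega>. W v \<omega> - W u \<omega>)"
proof -
  interpret prob_space N using W by (simp add: brownian_motion_def)
  define xs where "xs = sorted_list_of_set (insert 0 (insert u J))"
  define n where "n = length xs"
  have set_xs: "set xs = insert 0 (insert u J)" and s_xs: "sorted xs" "distinct xs"
    using J by (auto simp: xs_def simp del: sorted_list_of_set.sorted_key_list_of_set_insert_remove sorted_list_of_set_insert_remove)
  have n0: "n > 0" using set_xs by (cases xs) (auto simp: n_def)
  \<comment> \<open>Past the end of the list the sequence is constantly \<open>v\<close>, so the
    increment with index \<open>n - 1\<close> is the one from \<open>u\<close> to
    \<open>v\<close>.\<close>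
  define \<tau> where "\<tau> i = (if i < n then xs ! i else v)" for i
  have le_u: "x \<in> set xs \<Longrightarrow> 0 \<le> x \<and> x \<le> u" for x using J uv unfolding set_xs by auto
  have mono: "mono \<tau>"
  proof (rule monoI)
    fix i j :: nat assume "i \<le> j"
    then show "\<tau> i \<le> \<tau> j"
      using le_u[of "xs ! i"] uv s_xs(1) by (auto simp: \<tau>_def n_def sorted_nth_mono)
  qed
  have first: "\<tau> 0 = 0"
  proof -
    obtain k where "k < n" "xs ! k = 0" using set_xs unfolding n_def by (metis in_set_conv_nth insertI1)
    then have "xs ! 0 \<le> 0" using s_xs(1) by (metis le0 n_def sorted_nth_mono)
    then show ?thesis using n0 le_u[of "xs ! 0"] by (simp add: \<tau>_def n_def)
  qed
  have last: "\<tau> (n - 1) = u" "\<tau> n = v"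
  proof -
    obtain k where k: "k < n" "xs ! k = u" using set_xs unfolding n_def by (metis in_set_conv_nth insertI1 insertI2)
    then have "u \<le> xs ! (n - 1)" using sorted_nth_mono[OF s_xs(1), of k "n - 1"] by (simp add: n_def)
    then show "\<tau> (n - 1) = u" using n0 le_u[of "xs ! (n - 1)"] by (simp add: \<tau>_def n_def)
  qed (simp add: \<tau>_def)
  define D where "D i \<omega> = W (\<tau> (Suc i)) \<omega> - W (\<tau> i) \<omega>" for i \<omega>
  have iv: "indep_vars (\<lambda>_. borel) D {..<n}"
    using W mono first unfolding brownian_motion_def D_def[abs_def] by simp
  \<comment> \<open>The position of \<open>j\<close> in the list, hence the number of increments
    whose sum is \<open>W j\<close>.\<close>
  define idx where "idx j = (SOME i. i < n \<and> xs ! i = j)" for j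
  have idx: "idx j < n \<and> xs ! idx j = j" if "j \<in> J" for j
    unfolding idx_def by (rule someI_ex) (use that set_xs in \<open>auto simp: n_def in_set_conv_nth dest: sym\<close>)
  have Wsum: "W j \<omega> = (\<Sum>i<idx j. D i \<omega>)" if j: "j \<in> J" and \<omega>: "\<omega> \<in> space N" for j \<omega>
  proof -
    have "(\<Sum>i<idx j. D i \<omega>) = W (\<tau> (idx j)) \<omega> - W (\<tau> 0) \<omega>"
      unfolding D_def by (rule sum_lessThan_telescope)
    moreover have "W 0 \<omega> = 0" using W \<omega> by (simp add: brownian_motion_def)
    moreover have "\<tau> (idx j) = j" using idx[OF j] by (simp add: \<tau>_def)
    ultimately show ?thesis by (simp add: first)
  qed
  have "indep_var (PiM {..<n-1} (\<lambda>_. borel)) (\<lambda>\<omega>. \<lambda>i\<in>{..<n-1}. D i \<omega>) (PiM {n-1} (\<lambda>_. borel)) (\<lambda>\<omega>. \<lambda>i\<in>{n-1}. D i \<omega>)"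
    by (rule indep_var_restrict[OF iv]) (use n0 in auto)
  then have iv2: "indep2 (PiM J (\<lambda>_. borel)) (\<lambda>\<omega>. (\<lambda>d. \<lambda>j\<in>J. \<Sum>i<idx j. d i) (\<lambda>i\<in>{..<n-1}. D i \<omega>))
       borel (\<lambda>\<omega>. (\<lambda>d. d (n-1)) (\<lambda>i\<in>{n-1}. D i \<omega>))"
    unfolding indep2_iff_indep_var[symmetric]
  proof (rule indep2_compose)
    show "(\<lambda>d. \<lambda>j\<in>J. \<Sum>i<idx j. d i) \<in> measurable (PiM {..<n-1} (\<lambda>_. borel)) (PiM J (\<lambda>_. borel :: real measure))"
    proof (intro measurable_restrict borel_measurable_sum measurable_component_singleton)
      fix j i assume "j \<in> J" "i \<in> {..<idx j}"
      then show "i \<in> {..<n-1}" using idx[of j] by auto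
    qed
  qed simp
  have rv: "W j \<in> borel_measurable N" if "j \<in> J" for j
    using W that J(2) by (auto simp: brownian_motion_def)
  show ?thesis
    unfolding indep2_def
  proof (intro conjI ballI)
    show "(\<lambda>\<omega>. \<lambda>j\<in>J. W j \<omega>) \<in> measurable N (PiM J (\<lambda>_. borel))"
      by (intro measurable_restrict rv)
    show "(\<lambda>\<omega>. W v \<omega> - W u \<omega>) \<in> borel_measurable N"
      using uv by (intro borel_measurable_diff brownian_motion_measurable[OF W]) auto
    fix A C assume A: "A \<in> sets (PiM J (\<lambda>_. borel :: real measure))" and C: "C \<in> sets (borel :: real measure)"
    have 1: "(\<lambda>\<omega>. \<lambda>j\<in>J. W j \<omega>) -` A \<inter> space N
       = (\<lambda>\<omega>. (\<lambda>d. \<lambda>j\<in>J. \<Sum>i<idx j. d i) (\<lambda>i\<in>{..<n-1}. D i \<omega>)) -` A \<inter> space N"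
    proof -
      have "(\<lambda>j\<in>J. W j \<omega>) = (\<lambda>j\<in>J. \<Sum>i<idx j. (\<lambda>i\<in>{..<n-1}. D i \<omega>) i)" if "\<omega> \<in> space N" for \<omega>
      proof (rule restrict_ext)
        fix j assume j: "j \<in> J"
        have "i < n - 1" if "i < idx j" for i using idx[OF j] that by linarith
        then show "W j \<omega> = (\<Sum>i<idx j. (\<lambda>i\<in>{..<n-1}. D i \<omega>) i)"
          unfolding Wsum[OF j \<open>\<omega> \<in> space N\<close>] by (intro sum.cong) auto
      qed
      then show ?thesis by (auto simp: comp_def)
    qed
    have 2: "(\<lambda>\<omega>. W v \<omega> - W u \<omega>) -` C \<inter> space N = (\<lambda>\<omega>. (\<lambda>d. d (n-1)) (\<lambda>i\<in>{n-1}. D i \<omega>)) -` C \<inter> space N"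
      using n0 last by (auto simp: comp_def D_def)
    show "prob (((\<lambda>\<omega>. \<lambda>j\<in>J. W j \<omega>) -` A \<inter> space N) \<inter> ((\<lambda>\<omega>. W v \<omega> - W u \<omega>) -` C \<inter> space N))
       = prob ((\<lambda>\<omega>. \<lambda>j\<in>J. W j \<omega>) -` A \<inter> space N) * prob ((\<lambda>\<omega>. W v \<omega> - W u \<omega>) -` C \<inter> space N)"
      unfolding 1 2 using iv2 A C unfolding indep2_def by blast
  qed
qed

text \<open>Cylinders over finitely many times generate the product \<sigma>-algebra and are stable
  under intersection, so the finite-dimensional case is enough.\<close>

lemma brownian_motion_past_indep:
  assumes W: "brownian_motion N W" and uv: "0 \<le> u" "u \<le> v"
  shows "prob_space.indep2 N (PiM {0..u} (\<lambda>_. borel)) (\<lambda>\<omega>. \<lambda>j\<in>{0..u}. W j \<omega>) borel (\<lambda>\<omega>. W v \<omega> - W u \<omega>)"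
proof -
  interpret prob_space N using W by (simp add: brownian_motion_def)
  have rv: "W j \<in> borel_measurable N" if "0 \<le> j" for j
    using W that by (auto simp: brownian_motion_def)
  show ?thesis
  proof (rule indep2_generator)
    show "sets (PiM {0..u} (\<lambda>_. borel :: real measure)) = sigma_sets (space (PiM {0..u} (\<lambda>_. borel))) (prod_algebra {0..u} (\<lambda>_. borel))"
      by (simp add: sets_PiM space_PiM)
    show "(\<lambda>\<omega>. \<lambda>j\<in>{0..u}. W j \<omega>) \<in> measurable N (PiM {0..u} (\<lambda>_. borel))"
      by (intro measurable_restrict rv) auto
    show "(\<lambda>\<omega>. W v \<omega> - W u \<omega>) \<in> borel_measurable N"
      using rv uv by auto
    fix A C assume "A \<in> prod_algebra {0..u} (\<lambda>_. borel :: real measure)" and C: "C \<in> sets (borel :: real measure)"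
    then obtain J E where A: "A = prod_emb {0..u} (\<lambda>_. borel) J (Pi\<^sub>E J E)" and J: "finite J" "J \<subseteq> {0..u}"
        and E: "\<And>i. i \<in> J \<Longrightarrow> E i \<in> sets (borel :: real measure)"
      by (elim prod_algebraE) auto
    have 1: "(\<lambda>\<omega>. \<lambda>j\<in>{0..u}. W j \<omega>) -` A \<inter> space N = (\<lambda>\<omega>. \<lambda>j\<in>J. W j \<omega>) -` Pi\<^sub>E J E \<inter> space N"
      using J(2) by (auto simp: A prod_emb_def PiE_iff restrict_restrict Int_absorb1)
    show "prob (((\<lambda>\<omega>. \<lambda>j\<in>{0..u}. W j \<omega>) -` A \<inter> space N) \<inter> ((\<lambda>\<omega>. W v \<omega> - W u \<omega>) -` C \<inter> space N))
       = prob ((\<lambda>\<omega>. \<lambda>j\<in>{0..u}. W j \<omega>) -` A \<inter> space N) * prob ((\<lambda>\<omega>. W v \<omega> - W u \<omega>) -` C \<inter> space N)"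
    proof -
      have "Pi\<^sub>E J E \<in> sets (PiM J (\<lambda>_. borel))" by (intro sets_PiM_I_finite J(1) E)
      with brownian_motion_finite_dim_indep[OF W J uv] C show ?thesis
        unfolding 1 indep2_def by (simp only:)
    qed
  qed (rule Int_stable_prod_algebra)
qed

lemma
  fixes B W :: "real \<Rightarrow> 'b \<Rightarrow> real"
  shows natural_filtration_generator: "(\<lambda>\<omega>. \<lambda>r\<in>{0..u}. (B r \<omega>, W r \<omega>)) \<in> space N \<rightarrow> space (PiM {0..u} (\<lambda>_. borel :: (real \<times> real) measure))"
    and space_natural_filtration [simp]: "space (natural_filtration N B W u) = space N"
  by (auto simp: space_PiM natural_filtration_def)

text \<open>The path of \<open>B\<close> is independent of the past of \<open>W\<close> taken
  together with its next increment, and that past is independent of the increment; regrouping makes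
  the two pasts jointly independent of the increment. Hence \<open>W\<close> keeps its role as an
  integrator for a filtration that also contains \<open>B\<close>.\<close>

lemma natural_filtration_increment_indep:
  assumes B: "brownian_motion N B" and W: "brownian_motion N W" and BW: "indep_processes N {0..} B W"
    and uv: "0 \<le> u" "u \<le> v" and \<xi>: "\<xi> \<in> borel_measurable (natural_filtration N B W u)"
  shows "prob_space.indep_var N borel \<xi> borel (\<lambda>\<omega>. W v \<omega> - W u \<omega>)" and "\<xi> \<in> borel_measurable N"
proof -
  interpret prob_space N using W by (simp add: brownian_motion_def)
  let ?P = "PiM {0..u} (\<lambda>_. borel :: real measure)" and ?Q = "PiM {0..u} (\<lambda>_. borel :: (real \<times> real) measure)"
  have rv: "W j \<in> borel_measurable N" "B j \<in> borel_measurable N" if "0 \<le> j" for j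
    using B W that by (auto simp: brownian_motion_def)
  have "indep2 ?P (\<lambda>\<omega>. restrict (\<lambda>i\<in>{0..}. B i \<omega>) {0..u})
     (?P \<Otimes>\<^sub>M borel) (\<lambda>\<omega>. (\<lambda>f. (restrict f {0..u}, f v - f u)) (\<lambda>i\<in>{0..}. W i \<omega>))"
  proof (rule indep2_compose[OF BW[unfolded indep_processes_def, folded indep2_iff_indep_var]])
    show res[measurable]: "(\<lambda>f. restrict f {0..u}) \<in> measurable (PiM {0..} (\<lambda>_. borel)) ?P"
      by (rule measurable_restrict_subset) auto
    have "0 \<le> v" using uv by simp
    then show "(\<lambda>f. (restrict f {0..u}, f v - f u)) \<in> measurable (PiM {0..} (\<lambda>_. borel)) (?P \<Otimes>\<^sub>M borel)"
      using uv(1) by (intro measurable_Pair borel_measurable_diff measurable_component_singleton res) auto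
  qed
  moreover have "restrict (\<lambda>i\<in>{0..}. B i \<omega>) {0..u} = (\<lambda>i\<in>{0..u}. B i \<omega>)"
     "(\<lambda>f. (restrict f {0..u}, f v - f u)) (\<lambda>i\<in>{0..}. W i \<omega>) = (\<lambda>i\<in>{0..u}. W i \<omega>, W v \<omega> - W u \<omega>)" for \<omega>
    using uv by (auto simp: fun_eq_iff)
  ultimately have "indep2 ?P (\<lambda>\<omega>. \<lambda>i\<in>{0..u}. B i \<omega>) (?P \<Otimes>\<^sub>M borel) (\<lambda>\<omega>. (\<lambda>i\<in>{0..u}. W i \<omega>, W v \<omega> - W u \<omega>))"
    by simp
  from indep2_pair[OF this brownian_motion_past_indep[OF W uv]]
  have "indep2 ?Q (\<lambda>\<omega>. (\<lambda>(f, g). \<lambda>r\<in>{0..u}. (f r, g r)) (\<lambda>i\<in>{0..u}. B i \<omega>, \<lambda>i\<in>{0..u}. W i \<omega>))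
     borel (\<lambda>\<omega>. (\<lambda>x. x) (W v \<omega> - W u \<omega>))"
  proof (rule indep2_compose)
    show "(\<lambda>(f, g). \<lambda>r\<in>{0..u}. (f r, g r)) \<in> measurable (?P \<Otimes>\<^sub>M ?P) ?Q"
      unfolding case_prod_beta borel_prod[symmetric]
      by (intro measurable_restrict) measurable
  qed simp
  moreover have "(\<lambda>(f, g). \<lambda>r\<in>{0..u}. (f r, g r)) (\<lambda>i\<in>{0..u}. B i \<omega>, \<lambda>i\<in>{0..u}. W i \<omega>)
     = (\<lambda>r\<in>{0..u}. (B r \<omega>, W r \<omega>))" for \<omega>
    by (auto simp: fun_eq_iff)
  ultimately have iQ: "indep2 ?Q (\<lambda>\<omega>. \<lambda>r\<in>{0..u}. (B r \<omega>, W r \<omega>)) borel (\<lambda>\<omega>. W v \<omega> - W u \<omega>)"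
    by simp
  \<comment> \<open>Events of the filtration are preimages of product-measurable sets under the path
    map, so independence of that map carries over to \<open>\<xi>\<close> without factorising
    \<open>\<xi>\<close> through it.\<close>
  have ex: "\<exists>A\<in>sets ?Q. \<xi> -` X \<inter> space N = (\<lambda>\<omega>. \<lambda>r\<in>{0..u}. (B r \<omega>, W r \<omega>)) -` A \<inter> space N" if "X \<in> sets borel" for X
  proof -
    have "\<xi> -` X \<inter> space (natural_filtration N B W u) \<in> sets (natural_filtration N B W u)"
      by (rule measurable_sets[OF \<xi> that])
    then show ?thesis
      using sets_vimage_algebra2[OF natural_filtration_generator[of B W u N]]
      by (auto simp: natural_filtration_def)
  qed
  show \<xi>N: "\<xi> \<in> borel_measurable N"
  proof (rule measurableI)
    fix X :: "real set" assume "X \<in> sets borel"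
    from ex[OF this] show "\<xi> -` X \<inter> space N \<in> sets N"
      using measurable_sets[of _ N ?Q] iQ by (auto simp: indep2_def)
  qed simp
  show "indep_var borel \<xi> borel (\<lambda>\<omega>. W v \<omega> - W u \<omega>)"
    unfolding indep2_iff_indep_var[symmetric] indep2_def
  proof (intro conjI ballI \<xi>N)
    show "(\<lambda>\<omega>. W v \<omega> - W u \<omega>) \<in> borel_measurable N" using rv uv by auto
    fix X C assume X: "X \<in> sets (borel :: real measure)" and C: "C \<in> sets (borel :: real measure)"
    from ex[OF X] iQ C
    show "prob ((\<xi> -` X \<inter> space N) \<inter> ((\<lambda>\<omega>. W v \<omega> - W u \<omega>) -` C \<inter> space N))
      = prob (\<xi> -` X \<inter> space N) * prob ((\<lambda>\<omega>. W v \<omega> - W u \<omega>) -` C \<inter> space N)"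
      unfolding indep2_def by (metis (no_types, lifting))
  qed
qed

lemma measurable_natural_filtration:
  assumes "0 \<le> r" "r \<le> u"
  shows "B r \<in> borel_measurable (natural_filtration N B W u)"
    and "W r \<in> borel_measurable (natural_filtration N B W u)"
proof -
  have "(\<lambda>\<omega>. \<lambda>r\<in>{0..u}. (B r \<omega>, W r \<omega>)) \<in> measurable (natural_filtration N B W u) (PiM {0..u} (\<lambda>_. borel))"
    unfolding natural_filtration_def by (rule measurable_vimage_algebra1[OF natural_filtration_generator])
  from measurable_compose[OF this measurable_component_singleton[of r]]
  have m: "(\<lambda>\<omega>. (B r \<omega>, W r \<omega>)) \<in> borel_measurable (natural_filtration N B W u)" using assms by simp
  show "B r \<in> borel_measurable (natural_filtration N B W u)"
    using measurable_compose[OF m[unfolded borel_prod[symmetric]] measurable_fst] by simp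
  show "W r \<in> borel_measurable (natural_filtration N B W u)"
    using measurable_compose[OF m[unfolded borel_prod[symmetric]] measurable_snd] by simp
qed

lemma natural_filtration_mono:
  assumes "u \<le> v" and \<xi>: "\<xi> \<in> borel_measurable (natural_filtration N B W u)"
  shows "\<xi> \<in> borel_measurable (natural_filtration N B W v)"
proof -
  have id: "(\<lambda>x. x) \<in> measurable (natural_filtration N B W v) (natural_filtration N B W u)"
    unfolding natural_filtration_def[of N B W u]
  proof (rule measurable_vimage_algebra2)
    show "(\<lambda>\<omega>. \<lambda>r\<in>{0..u}. (B r \<omega>, W r \<omega>)) \<in> measurable (natural_filtration N B W v) (PiM {0..u} (\<lambda>_. borel))"
      unfolding borel_prod[symmetric]
      by (intro measurable_restrict measurable_Pair measurable_natural_filtration) (use assms in auto)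
  qed simp
  show ?thesis using measurable_compose[OF id \<xi>] .
qed

section \<open>The isometry for simple integrals\<close>

lemma normal_moments:
  assumes N: "prob_space N" and X: "distributed N lborel X (normal_density 0 s)" and s: "s > 0"
  shows "integrable N X" "(\<integral>\<omega>. X \<omega> \<partial>N) = 0"
    "integrable N (\<lambda>\<omega>. (X \<omega>)\<^sup>2)" "(\<integral>\<omega>. (X \<omega>)\<^sup>2 \<partial>N) = s\<^sup>2"
proof -
  have 1: "integrable lborel (\<lambda>x. normal_density 0 s x * x)"
    using integrable_normal_moment[OF s, of 0 1] by simp
  have 2: "integrable lborel (\<lambda>x. normal_density 0 s x * x\<^sup>2)"
    using integrable_normal_moment[OF s, of 0 2] by simp
  show "integrable N X" using distributed_integrable[OF X, of "\<lambda>x. x"] 1 by simp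
  show "integrable N (\<lambda>\<omega>. (X \<omega>)\<^sup>2)" using distributed_integrable[OF X, of "\<lambda>x. x\<^sup>2"] 2 by simp
  have "(\<integral>x. normal_density 0 s x * x \<partial>lborel) = 0"
    using integral_normal_moment_odd[OF s, of 0 0] by simp
  then show "(\<integral>\<omega>. X \<omega> \<partial>N) = 0"
    using distributed_integral[OF X, of "\<lambda>x. x"] by simp
  have "(\<integral>x. normal_density 0 s x * x\<^sup>2 \<partial>lborel) = s\<^sup>2"
    using integral_normal_moment_even[OF s, of 0 1] by (simp add: numeral_2_eq_2)
  then show "(\<integral>\<omega>. (X \<omega>)\<^sup>2 \<partial>N) = s\<^sup>2"
    using distributed_integral[OF X, of "\<lambda>x. x\<^sup>2"] by simp
qed

lemma integrable_mult_of_squares: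
  fixes f g :: "'b \<Rightarrow> real"
  assumes [measurable]: "f \<in> borel_measurable N" "g \<in> borel_measurable N"
    and "integrable N (\<lambda>x. (f x)\<^sup>2)" "integrable N (\<lambda>x. (g x)\<^sup>2)"
  shows "integrable N (\<lambda>x. f x * g x)"
proof (rule Bochner_Integration.integrable_bound)
  show "integrable N (\<lambda>x. (f x)\<^sup>2 + (g x)\<^sup>2)" using assms by simp
  have "\<bar>a * b\<bar> \<le> a\<^sup>2 + b\<^sup>2" for a b :: real
  proof -
    have "0 \<le> \<bar>a\<bar> * \<bar>b\<bar>" by simp
    moreover have "2 * (\<bar>a\<bar> * \<bar>b\<bar>) \<le> a\<^sup>2 + b\<^sup>2"
      using sum_squares_bound[of "\<bar>a\<bar>" "\<bar>b\<bar>"] by (simp add: mult.assoc)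
    ultimately show ?thesis unfolding abs_mult by linarith
  qed
  then show "AE x in N. norm (f x * g x) \<le> norm ((f x)\<^sup>2 + (g x)\<^sup>2)" by simp
qed simp

text \<open>The integrated square of a step function is the Gram form of the overlap lengths of its
  intervals. It is used for each \<omega> separately on the right-hand side of the isometry;
  nonnegativity of the form is what permits passing between \<open>ennreal\<close> and real
  integrals.\<close>

lemma nn_integral_step_function_square:
  fixes c u v :: "'i \<Rightarrow> real"
  assumes uv: "\<And>i. i \<in> I \<Longrightarrow> 0 \<le> u i \<and> u i \<le> v i \<and> v i \<le> t"
  shows "0 \<le> (\<Sum>i\<in>I. \<Sum>j\<in>I. c i * c j * measure lborel ({u i<..v i} \<inter> {u j<..v j}))" (is "0 \<le> ?S")
    "(\<integral>\<^sup>+s\<in>{0..t}. ennreal ((\<Sum>i\<in>I. c i * indicator {u i<..v i} s)\<^sup>2) \<partial>lborel)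
      = ennreal (\<Sum>i\<in>I. \<Sum>j\<in>I. c i * c j * measure lborel ({u i<..v i} \<inter> {u j<..v j}))" (is "?L2 = ennreal ?S2")
proof -
  note Int_greaterThanAtMost [simp del]
  let ?f = "\<lambda>s. (\<Sum>i\<in>I. c i * indicator {u i<..v i} s)\<^sup>2"
  have f: "?f s = (\<Sum>i\<in>I. \<Sum>j\<in>I. c i * c j * indicator ({u i<..v i} \<inter> {u j<..v j}) s)" for s
    unfolding power2_eq_square sum_product indicator_inter_arith
    by (intro sum.cong refl) (simp only: mult_ac)
  have int: "integrable lborel (indicator ({u i<..v i} \<inter> {u j<..v j}) :: real \<Rightarrow> real)" for i j
  proof (rule integrable_real_indicator)
    have "emeasure lborel ({u i<..v i} \<inter> {u j<..v j}) \<le> emeasure lborel {u i..v i}"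
      by (rule emeasure_mono) auto
    also have "\<dots> < \<infinity>" by (cases "u i \<le> v i") auto
    finally show "emeasure lborel ({u i<..v i} \<inter> {u j<..v j}) < \<infinity>" .
  qed simp
  have intf: "integrable lborel ?f"
    unfolding f by (intro Bochner_Integration.integrable_sum integrable_mult_right int)
  have S: "integral\<^sup>L lborel ?f = ?S"
    unfolding f by (simp add: Bochner_Integration.integral_sum Bochner_Integration.integrable_sum int)
  show "0 \<le> ?S" unfolding S[symmetric] by simp
  have "?f s = 0" if "s \<notin> {0..t}" for s
  proof -
    have "indicator {u i<..v i} s = (0 :: real)" if "i \<in> I" for i
      using uv[OF that] \<open>s \<notin> {0..t}\<close> by auto
    then show ?thesis by simp
  qed
  then have "(\<integral>\<^sup>+s\<in>{0..t}. ennreal (?f s) \<partial>lborel) = (\<integral>\<^sup>+s. ennreal (?f s) \<partial>lborel)"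
    by (intro nn_integral_cong) (auto simp: indicator_def)
  also have "\<dots> = ennreal ?S"
    unfolding S[symmetric] by (intro nn_integral_eq_integral intf) simp
  finally show "(\<integral>\<^sup>+s\<in>{0..t}. ennreal (?f s) \<partial>lborel) = ennreal ?S" .
qed

locale two_brownian =
  fixes N :: "'b measure" and B W :: "real \<Rightarrow> 'b \<Rightarrow> real"
  assumes B: "brownian_motion N B" and W: "brownian_motion N W"
    and BW: "indep_processes N {0..} B W"

sublocale two_brownian \<subseteq> prob_space N
  using B by (simp add: brownian_motion_def)

context two_brownian
begin

abbreviation F :: "real \<Rightarrow> 'b measure" where "F \<equiv> natural_filtration N B W"

lemma increment_moments:
  assumes "0 \<le> u" "u \<le> v"
  shows "integrable N (\<lambda>\<omega>. W v \<omega> - W u \<omega>)" "(\<integral>\<omega>. W v \<omega> - W u \<omega> \<partial>N) = 0"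
    "integrable N (\<lambda>\<omega>. (W v \<omega> - W u \<omega>)\<^sup>2)" "(\<integral>\<omega>. (W v \<omega> - W u \<omega>)\<^sup>2 \<partial>N) = v - u"
proof -
  have d: "distributed N lborel (\<lambda>\<omega>. W v \<omega> - W u \<omega>) (normal_density 0 (sqrt (v - u)))" if "u < v"
    using W assms that by (simp add: brownian_motion_def)
  show "integrable N (\<lambda>\<omega>. W v \<omega> - W u \<omega>)" "(\<integral>\<omega>. W v \<omega> - W u \<omega> \<partial>N) = 0"
    "integrable N (\<lambda>\<omega>. (W v \<omega> - W u \<omega>)\<^sup>2)" "(\<integral>\<omega>. (W v \<omega> - W u \<omega>)\<^sup>2 \<partial>N) = v - u"
    using assms normal_moments[OF prob_space_axioms d] by (cases "u = v"; simp)+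
qed

lemma adapted_measurable:
  fixes \<xi> :: "'b \<Rightarrow> real"
  assumes "0 \<le> u" "\<xi> \<in> borel_measurable (F u)"
  shows "\<xi> \<in> borel_measurable N"
  by (rule natural_filtration_increment_indep(2)[OF B W BW assms(1) order_refl assms(2)])

lemma adapted_times_increment:
  assumes uv: "0 \<le> u" "u \<le> v" and \<zeta>: "\<zeta> \<in> borel_measurable (F u)" "integrable N \<zeta>"
  shows "integrable N (\<lambda>\<omega>. \<zeta> \<omega> * (W v \<omega> - W u \<omega>))"
    "(\<integral>\<omega>. \<zeta> \<omega> * (W v \<omega> - W u \<omega>) \<partial>N) = 0"
    "integrable N (\<lambda>\<omega>. \<zeta> \<omega> * (W v \<omega> - W u \<omega>)\<^sup>2)"
    "(\<integral>\<omega>. \<zeta> \<omega> * (W v \<omega> - W u \<omega>)\<^sup>2 \<partial>N) = (\<integral>\<omega>. \<zeta> \<omega> \<partial>N) * (v - u)"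
proof -
  note m = increment_moments[OF uv]
  have i: "indep_var borel \<zeta> borel (\<lambda>\<omega>. W v \<omega> - W u \<omega>)"
    by (rule natural_filtration_increment_indep[OF B W BW uv \<zeta>(1)])
  have i2: "indep_var borel \<zeta> borel (\<lambda>\<omega>. (W v \<omega> - W u \<omega>)\<^sup>2)"
    using indep_var_compose[OF i, of "\<lambda>x. x" borel "\<lambda>x. x\<^sup>2" borel] by (simp add: comp_def)
  show "integrable N (\<lambda>\<omega>. \<zeta> \<omega> * (W v \<omega> - W u \<omega>))"
    by (rule indep_var_integrable[OF i \<zeta>(2) m(1)])
  show "(\<integral>\<omega>. \<zeta> \<omega> * (W v \<omega> - W u \<omega>) \<partial>N) = 0"
    using indep_var_lebesgue_integral[OF i \<zeta>(2) m(1)] m(2) by simp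
  show "integrable N (\<lambda>\<omega>. \<zeta> \<omega> * (W v \<omega> - W u \<omega>)\<^sup>2)"
    by (rule indep_var_integrable[OF i2 \<zeta>(2) m(3)])
  show "(\<integral>\<omega>. \<zeta> \<omega> * (W v \<omega> - W u \<omega>)\<^sup>2 \<partial>N) = (\<integral>\<omega>. \<zeta> \<omega> \<partial>N) * (v - u)"
    using indep_var_lebesgue_integral[OF i2 \<zeta>(2) m(3)] m(4) by simp
qed

lemma adapted_square_times_increment:
  assumes uv: "0 \<le> u" "u \<le> v" and \<xi>: "\<xi> \<in> borel_measurable (F u)" "integrable N (\<lambda>\<omega>. (\<xi> \<omega>)\<^sup>2)"
  shows "integrable N (\<lambda>\<omega>. (\<xi> \<omega> * (W v \<omega> - W u \<omega>))\<^sup>2)"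
proof -
  have "(\<lambda>\<omega>. (\<xi> \<omega>)\<^sup>2) \<in> borel_measurable (F u)" using \<xi>(1) by measurable
  from adapted_times_increment(3)[OF uv this \<xi>(2)] show ?thesis by (simp add: power_mult_distrib)
qed

lemma increment_adapted:
  assumes "0 \<le> u" "u \<le> v"
  shows "(\<lambda>\<omega>. W v \<omega> - W u \<omega>) \<in> borel_measurable (F v)"
  using assms by (intro borel_measurable_diff measurable_natural_filtration) auto

text \<open>The longer increment is split at \<open>v\<close>: the part after \<open>v\<close> is
  centred and independent of all that is known at time \<open>v\<close>, and the common part
  contributes its variance.\<close>

lemma increments_product_same_start:
  assumes u: "0 \<le> u" and v: "u \<le> v" "v \<le> v'" and \<zeta>: "\<zeta> \<in> borel_measurable (F u)" "integrable N \<zeta>"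
  shows "integrable N (\<lambda>\<omega>. \<zeta> \<omega> * ((W v \<omega> - W u \<omega>) * (W v' \<omega> - W u \<omega>)))"
    "(\<integral>\<omega>. \<zeta> \<omega> * ((W v \<omega> - W u \<omega>) * (W v' \<omega> - W u \<omega>)) \<partial>N) = (\<integral>\<omega>. \<zeta> \<omega> \<partial>N) * (v - u)"
proof -
  note a = adapted_times_increment[OF u v(1) \<zeta>]
  have "0 \<le> v" using u v by simp
  have \<zeta>2: "(\<lambda>\<omega>. \<zeta> \<omega> * (W v \<omega> - W u \<omega>)) \<in> borel_measurable (F v)"
    by (intro borel_measurable_times increment_adapted u v natural_filtration_mono[OF v(1) \<zeta>(1)])
  note b = adapted_times_increment[OF \<open>0 \<le> v\<close> v(2) \<zeta>2 a(1)]
  have e: "(\<lambda>\<omega>. \<zeta> \<omega> * ((W v \<omega> - W u \<omega>) * (W v' \<omega> - W u \<omega>)))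
    = (\<lambda>\<omega>. \<zeta> \<omega> * (W v \<omega> - W u \<omega>)\<^sup>2 + \<zeta> \<omega> * (W v \<omega> - W u \<omega>) * (W v' \<omega> - W v \<omega>))"
    by (auto simp: fun_eq_iff algebra_simps power2_eq_square)
  show "integrable N (\<lambda>\<omega>. \<zeta> \<omega> * ((W v \<omega> - W u \<omega>) * (W v' \<omega> - W u \<omega>)))"
    unfolding e by (intro Bochner_Integration.integrable_add a(3) b(1))
  show "(\<integral>\<omega>. \<zeta> \<omega> * ((W v \<omega> - W u \<omega>) * (W v' \<omega> - W u \<omega>)) \<partial>N) = (\<integral>\<omega>. \<zeta> \<omega> \<partial>N) * (v - u)"
    unfolding e by (subst Bochner_Integration.integral_add[OF a(3) b(1)]) (simp only: a(4) b(2) add_0_right)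
qed

text \<open>The increment that starts first is split at \<open>u'\<close>. Its part before
  \<open>u'\<close> is known when the other increment starts and contributes nothing; the part after
  \<open>u'\<close> falls under the case of a common start. If the first interval ends before
  \<open>u'\<close>, only the vanishing contribution is present.\<close>

lemma increments_product_ordered:
  assumes u: "0 \<le> u" "u \<le> u'" and v: "u \<le> v" "u' \<le> v'"
    and \<xi>: "\<xi> \<in> borel_measurable (F u)" "integrable N (\<lambda>\<omega>. (\<xi> \<omega>)\<^sup>2)"
    and \<eta>: "\<eta> \<in> borel_measurable (F u')" "integrable N (\<lambda>\<omega>. (\<eta> \<omega>)\<^sup>2)"
  shows "integrable N (\<lambda>\<omega>. (\<xi> \<omega> * (W v \<omega> - W u \<omega>)) * (\<eta> \<omega> * (W v' \<omega> - W u' \<omega>)))" (is ?I)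
    "(\<integral>\<omega>. (\<xi> \<omega> * (W v \<omega> - W u \<omega>)) * (\<eta> \<omega> * (W v' \<omega> - W u' \<omega>)) \<partial>N)
     = (\<integral>\<omega>. \<xi> \<omega> * \<eta> \<omega> \<partial>N) * measure lborel ({u<..v} \<inter> {u'<..v'})" (is ?E)
proof -
  have u': "0 \<le> u'" using u by simp
  have \<xi>': "\<xi> \<in> borel_measurable (F u')" by (rule natural_filtration_mono[OF u(2) \<xi>(1)])
  have m[measurable]: "\<xi> \<in> borel_measurable N" "\<eta> \<in> borel_measurable N"
    using adapted_measurable[OF u(1) \<xi>(1)] adapted_measurable[OF u' \<eta>(1)] .
  have mW[measurable]: "W r \<in> borel_measurable N" if "0 \<le> r" for r
    using brownian_motion_measurable[OF W that] .
  \<comment> \<open>Up to a time \<open>w \<le> u'\<close> the first increment is just another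
    coefficient known at time \<open>u'\<close>.\<close>
  have early: "integrable N (\<lambda>\<omega>. \<xi> \<omega> * (W w \<omega> - W u \<omega>) * \<eta> \<omega> * (W v' \<omega> - W u' \<omega>))"
    "(\<integral>\<omega>. \<xi> \<omega> * (W w \<omega> - W u \<omega>) * \<eta> \<omega> * (W v' \<omega> - W u' \<omega>) \<partial>N) = 0"
    if w: "u \<le> w" "w \<le> u'" for w
  proof -
    have 1: "(\<lambda>\<omega>. \<xi> \<omega> * (W w \<omega> - W u \<omega>)) \<in> borel_measurable (F u')"
      using w u by (intro borel_measurable_times \<xi>' borel_measurable_diff measurable_natural_filtration) auto
    then have 2: "(\<lambda>\<omega>. \<xi> \<omega> * (W w \<omega> - W u \<omega>) * \<eta> \<omega>) \<in> borel_measurable (F u')"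
      by (rule borel_measurable_times[OF _ \<eta>(1)])
    have 3: "integrable N (\<lambda>\<omega>. \<xi> \<omega> * (W w \<omega> - W u \<omega>) * \<eta> \<omega>)"
      by (intro integrable_mult_of_squares adapted_square_times_increment u w \<xi> \<eta> m adapted_measurable[OF u' 1])
    from adapted_times_increment(1,2)[OF u' v(2) 2 3]
    show "integrable N (\<lambda>\<omega>. \<xi> \<omega> * (W w \<omega> - W u \<omega>) * \<eta> \<omega> * (W v' \<omega> - W u' \<omega>))"
      "(\<integral>\<omega>. \<xi> \<omega> * (W w \<omega> - W u \<omega>) * \<eta> \<omega> * (W v' \<omega> - W u' \<omega>) \<partial>N) = 0" .
  qed
  show ?I ?E
  proof (atomize (full), cases "v \<le> u'")
    case True
    then have "{u<..v} \<inter> {u'<..v'} = {}" by auto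
    with early[OF v(1) True] show "?I \<and> ?E" by (simp add: mult.assoc del: Int_greaterThanAtMost)
  next
    case False
    have prod: "(\<lambda>\<omega>. \<xi> \<omega> * \<eta> \<omega>) \<in> borel_measurable (F u')" by (intro borel_measurable_times \<xi>' \<eta>(1))
    have int: "integrable N (\<lambda>\<omega>. \<xi> \<omega> * \<eta> \<omega>)" by (intro integrable_mult_of_squares m \<xi> \<eta>)
    have len: "measure lborel ({u<..v} \<inter> {u'<..v'}) = min v v' - u'"
    proof -
      have "{u<..v} \<inter> {u'<..v'} = {u'<..min v v'}" using u False v by auto
      then show ?thesis using False v by simp
    qed
    have late: "integrable N (\<lambda>\<omega>. \<xi> \<omega> * \<eta> \<omega> * ((W v \<omega> - W u' \<omega>) * (W v' \<omega> - W u' \<omega>))) \<and>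
      (\<integral>\<omega>. \<xi> \<omega> * \<eta> \<omega> * ((W v \<omega> - W u' \<omega>) * (W v' \<omega> - W u' \<omega>)) \<partial>N) = (\<integral>\<omega>. \<xi> \<omega> * \<eta> \<omega> \<partial>N) * (min v v' - u')"
    proof (cases "v \<le> v'")
      case True
      then show ?thesis using increments_product_same_start[OF u' _ True prod int] False by simp
    next
      case False
      then show ?thesis using increments_product_same_start[OF u' v(2) _ prod int, of v] by (simp add: mult_ac)
    qed
    have e: "(\<lambda>\<omega>. (\<xi> \<omega> * (W v \<omega> - W u \<omega>)) * (\<eta> \<omega> * (W v' \<omega> - W u' \<omega>)))
      = (\<lambda>\<omega>. \<xi> \<omega> * (W u' \<omega> - W u \<omega>) * \<eta> \<omega> * (W v' \<omega> - W u' \<omega>)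
         + \<xi> \<omega> * \<eta> \<omega> * ((W v \<omega> - W u' \<omega>) * (W v' \<omega> - W u' \<omega>)))"
      by (auto simp: fun_eq_iff algebra_simps)
    show "?I \<and> ?E"
      unfolding e len using late early[OF u(2) order_refl]
      by (auto simp: Bochner_Integration.integral_add)
  qed
qed

lemma increments_product:
  assumes u: "0 \<le> u" "0 \<le> u'" and v: "u \<le> v" "u' \<le> v'"
    and \<xi>: "\<xi> \<in> borel_measurable (F u)" "integrable N (\<lambda>\<omega>. (\<xi> \<omega>)\<^sup>2)"
    and \<eta>: "\<eta> \<in> borel_measurable (F u')" "integrable N (\<lambda>\<omega>. (\<eta> \<omega>)\<^sup>2)"
  shows "integrable N (\<lambda>\<omega>. (\<xi> \<omega> * (W v \<omega> - W u \<omega>)) * (\<eta> \<omega> * (W v' \<omega> - W u' \<omega>)))"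
    "(\<integral>\<omega>. (\<xi> \<omega> * (W v \<omega> - W u \<omega>)) * (\<eta> \<omega> * (W v' \<omega> - W u' \<omega>)) \<partial>N)
     = (\<integral>\<omega>. \<xi> \<omega> * \<eta> \<omega> \<partial>N) * measure lborel ({u<..v} \<inter> {u'<..v'})"
proof (atomize (full), cases "u \<le> u'")
  case True
  from increments_product_ordered[OF u(1) True v \<xi> \<eta>]
  show "integrable N (\<lambda>\<omega>. (\<xi> \<omega> * (W v \<omega> - W u \<omega>)) * (\<eta> \<omega> * (W v' \<omega> - W u' \<omega>))) \<and>
    (\<integral>\<omega>. (\<xi> \<omega> * (W v \<omega> - W u \<omega>)) * (\<eta> \<omega> * (W v' \<omega> - W u' \<omega>)) \<partial>N)
     = (\<integral>\<omega>. \<xi> \<omega> * \<eta> \<omega> \<partial>N) * measure lborel ({u<..v} \<inter> {u'<..v'})" by (rule conjI)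
next
  case False
  then have "u' \<le> u" by simp
  have e: "(\<lambda>\<omega>. (\<xi> \<omega> * (W v \<omega> - W u \<omega>)) * (\<eta> \<omega> * (W v' \<omega> - W u' \<omega>)))
      = (\<lambda>\<omega>. (\<eta> \<omega> * (W v' \<omega> - W u' \<omega>)) * (\<xi> \<omega> * (W v \<omega> - W u \<omega>)))"
    "(\<lambda>\<omega>. \<xi> \<omega> * \<eta> \<omega>) = (\<lambda>\<omega>. \<eta> \<omega> * \<xi> \<omega>)"
    "{u<..v} \<inter> {u'<..v'} = {u'<..v'} \<inter> {u<..v}"
    by (rule ext, rule mult.commute)+ (rule Int_commute)
  note o = increments_product_ordered[OF u(2) \<open>u' \<le> u\<close> v(2,1) \<eta> \<xi>]
  show "integrable N (\<lambda>\<omega>. (\<xi> \<omega> * (W v \<omega> - W u \<omega>)) * (\<eta> \<omega> * (W v' \<omega> - W u' \<omega>))) \<and>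
    (\<integral>\<omega>. (\<xi> \<omega> * (W v \<omega> - W u \<omega>)) * (\<eta> \<omega> * (W v' \<omega> - W u' \<omega>)) \<partial>N)
     = (\<integral>\<omega>. \<xi> \<omega> * \<eta> \<omega> \<partial>N) * measure lborel ({u<..v} \<inter> {u'<..v'})"
    by (rule conjI, subst e(1), rule o(1), subst e(1), subst e(2), subst e(3), rule o(2))
qed

text \<open>The intervals may overlap and the index set is arbitrary. The difference of two simple
  integrals over unrelated grids is thus an instance, without passing to a common refinement; only
  pairwise covariances, proportional to the overlap lengths, enter.\<close>

lemma ito_isometry:
  assumes I: "finite I"
    and uv: "\<And>i. i \<in> I \<Longrightarrow> 0 \<le> u i \<and> u i \<le> v i \<and> v i \<le> t"
    and \<xi>: "\<And>i. i \<in> I \<Longrightarrow> \<xi> i \<in> borel_measurable (F (u i))"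
    and \<xi>2: "\<And>i. i \<in> I \<Longrightarrow> integrable N (\<lambda>\<omega>. (\<xi> i \<omega>)\<^sup>2)"
  shows "(\<integral>\<^sup>+\<omega>. ennreal ((\<Sum>i\<in>I. \<xi> i \<omega> * (W (v i) \<omega> - W (u i) \<omega>))\<^sup>2) \<partial>N)
    = (\<integral>\<^sup>+\<omega>. (\<integral>\<^sup>+s\<in>{0..t}. ennreal ((\<Sum>i\<in>I. \<xi> i \<omega> * indicator {u i<..v i} s)\<^sup>2) \<partial>lborel) \<partial>N)"
proof -
  note Int_greaterThanAtMost [simp del]
  let ?L = "\<lambda>i j. measure lborel ({u i<..v i} \<inter> {u j<..v j})"
  have m: "\<xi> i \<in> borel_measurable N" if "i \<in> I" for i
    using adapted_measurable \<xi> uv that by blast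
  have i2: "integrable N (\<lambda>\<omega>. \<xi> i \<omega> * \<xi> j \<omega>)" if "i \<in> I" "j \<in> I" for i j
    using that by (intro integrable_mult_of_squares m \<xi>2)
  have sq: "(\<Sum>i\<in>I. f i)\<^sup>2 = (\<Sum>i\<in>I. \<Sum>j\<in>I. f i * f j)" for f :: "_ \<Rightarrow> real"
    by (simp add: power2_eq_square sum_product)
  have ip: "integrable N (\<lambda>\<omega>. (\<xi> i \<omega> * (W (v i) \<omega> - W (u i) \<omega>)) * (\<xi> j \<omega> * (W (v j) \<omega> - W (u j) \<omega>)))"
    "(\<integral>\<omega>. (\<xi> i \<omega> * (W (v i) \<omega> - W (u i) \<omega>)) * (\<xi> j \<omega> * (W (v j) \<omega> - W (u j) \<omega>)) \<partial>N)
     = (\<integral>\<omega>. \<xi> i \<omega> * \<xi> j \<omega> \<partial>N) * ?L i j"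
    if "i \<in> I" "j \<in> I" for i j
    using increments_product[OF _ _ _ _ \<xi>[OF that(1)] \<xi>2[OF that(1)] \<xi>[OF that(2)] \<xi>2[OF that(2)]] uv that by auto
  have "(\<integral>\<^sup>+\<omega>. ennreal ((\<Sum>i\<in>I. \<xi> i \<omega> * (W (v i) \<omega> - W (u i) \<omega>))\<^sup>2) \<partial>N)
      = ennreal (\<integral>\<omega>. (\<Sum>i\<in>I. \<xi> i \<omega> * (W (v i) \<omega> - W (u i) \<omega>))\<^sup>2 \<partial>N)"
  proof (rule nn_integral_eq_integral)
    show "integrable N (\<lambda>\<omega>. (\<Sum>i\<in>I. \<xi> i \<omega> * (W (v i) \<omega> - W (u i) \<omega>))\<^sup>2)"
      unfolding sq by (intro Bochner_Integration.integrable_sum ip)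
  qed simp
  also have "(\<integral>\<omega>. (\<Sum>i\<in>I. \<xi> i \<omega> * (W (v i) \<omega> - W (u i) \<omega>))\<^sup>2 \<partial>N)
      = (\<Sum>i\<in>I. \<Sum>j\<in>I. (\<integral>\<omega>. \<xi> i \<omega> * \<xi> j \<omega> \<partial>N) * ?L i j)"
    unfolding sq by (subst Bochner_Integration.integral_sum, auto intro!: Bochner_Integration.integrable_sum ip sum.cong)
       (subst Bochner_Integration.integral_sum, auto intro!: ip sum.cong)
  also have "\<dots> = (\<integral>\<omega>. (\<Sum>i\<in>I. \<Sum>j\<in>I. \<xi> i \<omega> * \<xi> j \<omega> * ?L i j) \<partial>N)"
    by (simp add: Bochner_Integration.integral_sum Bochner_Integration.integrable_sum i2)
  also have "ennreal \<dots> = (\<integral>\<^sup>+\<omega>. ennreal (\<Sum>i\<in>I. \<Sum>j\<in>I. \<xi> i \<omega> * \<xi> j \<omega> * ?L i j) \<partial>N)"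
  proof (rule nn_integral_eq_integral[symmetric])
    show "integrable N (\<lambda>\<omega>. \<Sum>i\<in>I. \<Sum>j\<in>I. \<xi> i \<omega> * \<xi> j \<omega> * ?L i j)"
      by (intro Bochner_Integration.integrable_sum integrable_mult_left i2)
    show "AE \<omega> in N. 0 \<le> (\<Sum>i\<in>I. \<Sum>j\<in>I. \<xi> i \<omega> * \<xi> j \<omega> * ?L i j)"
      by (intro AE_I2 nn_integral_step_function_square(1)[OF uv])
  qed
  also have "\<dots> = (\<integral>\<^sup>+\<omega>. (\<integral>\<^sup>+s\<in>{0..t}. ennreal ((\<Sum>i\<in>I. \<xi> i \<omega> * indicator {u i<..v i} s)\<^sup>2) \<partial>lborel) \<partial>N)"
    by (subst nn_integral_step_function_square(2)[OF uv]) simp_all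
  finally show ?thesis .
qed

end

section \<open>Riemann sums approximating the Ito integral\<close>

lemma nn_integral_exp_gauss:
  assumes s: "s > 0"
  shows "(\<integral>\<^sup>+x. ennreal (exp (a * x)) \<partial>gauss s) = ennreal (exp (a\<^sup>2 * s\<^sup>2 / 2))"
proof -
  interpret g: prob_space "gauss s" by (rule prob_space_gauss[OF s])
  \<comment> \<open>The tilt with shift \<open>a * s\<^sup>2\<close> is a probability density, and
    \<open>exp (a * x)\<close> is a constant multiple of it.\<close>
  have "1 = (\<integral>\<^sup>+x. ennreal (gauss_tilt s (a * s\<^sup>2) x) * 1 \<partial>gauss s)"
    using nn_integral_gauss_shift[OF _ s, of "\<lambda>_. 1" "a * s\<^sup>2"] g.emeasure_space_1 by simp
  then have 1: "1 = (\<integral>\<^sup>+x. ennreal (gauss_tilt s (a * s\<^sup>2) x) \<partial>gauss s)" by simp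
  have "(\<integral>\<^sup>+x. ennreal (exp (a * x)) \<partial>gauss s)
      = (\<integral>\<^sup>+x. ennreal (exp (a\<^sup>2 * s\<^sup>2 / 2)) * ennreal (gauss_tilt s (a * s\<^sup>2) x) \<partial>gauss s)"
  proof (intro nn_integral_cong)
    fix x
    have "exp (a * x) = exp (a\<^sup>2 * s\<^sup>2 / 2 + (2 * (a * s\<^sup>2) * x - (a * s\<^sup>2)\<^sup>2) / (2 * s\<^sup>2))"
      using s by (simp add: field_simps power2_eq_square)
    then show "ennreal (exp (a * x)) = ennreal (exp (a\<^sup>2 * s\<^sup>2 / 2)) * ennreal (gauss_tilt s (a * s\<^sup>2) x)"
      unfolding gauss_tilt_def by (simp add: exp_add ennreal_mult)
  qed
  also have "\<dots> = ennreal (exp (a\<^sup>2 * s\<^sup>2 / 2)) * (\<integral>\<^sup>+x. ennreal (gauss_tilt s (a * s\<^sup>2) x) \<partial>gauss s)"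
    by (rule nn_integral_cmult) simp
  finally show ?thesis using 1 by simp
qed

lemma brownian_exp_moment:
  assumes B: "brownian_motion N B" and rs: "0 \<le> r" "r \<le> s"
  shows "(\<integral>\<^sup>+\<omega>. ennreal (exp (a * (B s \<omega> - B r \<omega>))) \<partial>N) = ennreal (exp (a\<^sup>2 * (s - r) / 2))"
proof (cases "r = s")
  case True
  interpret prob_space N using B by (simp add: brownian_motion_def)
  show ?thesis using True by (simp add: emeasure_space_1)
next
  case False
  then have d: "distributed N lborel (\<lambda>\<omega>. B s \<omega> - B r \<omega>) (normal_density 0 (sqrt (s - r)))" and "sqrt (s - r) > 0"
    using B rs by (auto simp: brownian_motion_def)
  then have m: "(\<lambda>\<omega>. B s \<omega> - B r \<omega>) \<in> borel_measurable N"
    and e: "distr N borel (\<lambda>\<omega>. B s \<omega> - B r \<omega>) = gauss (sqrt (s - r))" by (simp_all add: distributed_gauss_iff)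
  have "(\<integral>\<^sup>+\<omega>. ennreal (exp (a * (B s \<omega> - B r \<omega>))) \<partial>N)
      = (\<integral>\<^sup>+x. ennreal (exp (a * x)) \<partial>distr N borel (\<lambda>\<omega>. B s \<omega> - B r \<omega>))"
    using m by (subst nn_integral_distr) auto
  also have "\<dots> = ennreal (exp (a\<^sup>2 * (sqrt (s - r))\<^sup>2 / 2))"
    unfolding e by (rule nn_integral_exp_gauss) fact
  finally show ?thesis using rs by simp
qed

lemma brownian_exp_moment_0:
  assumes B: "brownian_motion N B" and s: "0 \<le> s"
  shows "(\<integral>\<^sup>+\<omega>. ennreal (exp (a * B s \<omega>)) \<partial>N) = ennreal (exp (a\<^sup>2 * s / 2))"
proof -
  have "(\<integral>\<^sup>+\<omega>. ennreal (exp (a * B s \<omega>)) \<partial>N) = (\<integral>\<^sup>+\<omega>. ennreal (exp (a * (B s \<omega> - B 0 \<omega>))) \<partial>N)"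
    using B by (intro nn_integral_cong) (simp add: brownian_motion_def)
  then show ?thesis using brownian_exp_moment[OF B order_refl s, of a] by simp
qed

lemma integrable_of_nn_integral_eq:
  fixes f :: "'b \<Rightarrow> real"
  assumes "f \<in> borel_measurable N" "\<And>x. 0 \<le> f x" "(\<integral>\<^sup>+x. ennreal (f x) \<partial>N) = ennreal c" "0 \<le> c"
  shows "integrable N f" "integral\<^sup>L N f = c"
proof -
  show *: "integrable N f" using assms by (intro integrableI_nonneg) auto
  have "ennreal (integral\<^sup>L N f) = ennreal c"
    using nn_integral_eq_integral[OF *] assms by simp
  then show "integral\<^sup>L N f = c"
    using assms by (simp add: ennreal_inj integral_nonneg_AE)
qed

lemma (in prob_space) nn_integral_indep_mult:
  fixes X Y :: "'a \<Rightarrow> real"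
  assumes XY: "indep_var borel X borel Y" and [measurable]: "f \<in> borel_measurable borel" "g \<in> borel_measurable borel"
  shows "(\<integral>\<^sup>+\<omega>. f (X \<omega>) * g (Y \<omega>) \<partial>M) = (\<integral>\<^sup>+\<omega>. f (X \<omega>) \<partial>M) * (\<integral>\<^sup>+\<omega>. g (Y \<omega>) \<partial>M)"
proof -
  have [measurable]: "X \<in> borel_measurable M" "Y \<in> borel_measurable M"
    using indep_var_rv1[OF XY] indep_var_rv2[OF XY] .
  interpret Y: prob_space "distr M borel Y" by (rule prob_space_distr) simp
  have "(\<integral>\<^sup>+\<omega>. f (X \<omega>) * g (Y \<omega>) \<partial>M) = (\<integral>\<^sup>+z. f (fst z) * g (snd z) \<partial>distr M (borel \<Otimes>\<^sub>M borel) (\<lambda>\<omega>. (X \<omega>, Y \<omega>)))"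
    by (subst nn_integral_distr) auto
  also have "distr M (borel \<Otimes>\<^sub>M borel) (\<lambda>\<omega>. (X \<omega>, Y \<omega>)) = distr M borel X \<Otimes>\<^sub>M distr M borel Y"
    using XY by (simp add: indep_var_distribution_eq)
  also have "(\<integral>\<^sup>+z. f (fst z) * g (snd z) \<partial>(distr M borel X \<Otimes>\<^sub>M distr M borel Y))
      = (\<integral>\<^sup>+x. (\<integral>\<^sup>+y. f x * g y \<partial>distr M borel Y) \<partial>distr M borel X)"
    by (subst Y.nn_integral_fst[symmetric]) auto
  also have "\<dots> = (\<integral>\<^sup>+x. f x \<partial>distr M borel X) * (\<integral>\<^sup>+y. g y \<partial>distr M borel Y)"
    by (simp add: nn_integral_cmult nn_integral_multc)
  finally show ?thesis by (simp add: nn_integral_distr)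
qed

lemma brownian_increment_indep:
  assumes B: "brownian_motion N B" and rs: "0 \<le> r" "r \<le> s"
  shows "prob_space.indep_var N borel (B r) borel (\<lambda>\<omega>. B s \<omega> - B r \<omega>)"
proof -
  interpret prob_space N using B by (simp add: brownian_motion_def)
  have "indep2 (PiM {r} (\<lambda>_. borel)) (\<lambda>\<omega>. \<lambda>j\<in>{r}. B j \<omega>) borel (\<lambda>\<omega>. B s \<omega> - B r \<omega>)"
    by (rule brownian_motion_finite_dim_indep[OF B _ _ rs]) (use rs in auto)
  then have "indep2 borel (\<lambda>\<omega>. (\<lambda>f. f r) (\<lambda>j\<in>{r}. B j \<omega>)) borel (\<lambda>\<omega>. (\<lambda>x. x) (B s \<omega> - B r \<omega>))"
    by (rule indep2_compose) auto
  then show ?thesis by (simp add: indep2_iff_indep_var)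
qed

text \<open>The factor \<open>exp (B r)\<close> is independent of the increment \<open>Z\<close>
  from \<open>r\<close> to \<open>s\<close>. The mean of \<open>(exp Z - 1)\<^sup>2\<close> is
  \<open>exp (2 * (s - r)) - 2 * exp ((s - r) / 2) + 1\<close>, and its middle term is at most
  \<open>- 2\<close>.\<close>

lemma brownian_exp_increment:
  assumes B: "brownian_motion N B" and rs: "0 \<le> r" "r \<le> s"
  shows "(\<integral>\<^sup>+\<omega>. ennreal ((exp (B s \<omega>) - exp (B r \<omega>))\<^sup>2) \<partial>N) \<le> ennreal (exp (2 * r) * (exp (2 * (s - r)) - 1))"
proof -
  interpret prob_space N using B by (simp add: brownian_motion_def)
  have [measurable]: "B r \<in> borel_measurable N" "B s \<in> borel_measurable N"
    using brownian_motion_measurable[OF B] rs by auto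
  let ?Z = "\<lambda>\<omega>. B s \<omega> - B r \<omega>"
  have 1: "integrable N (\<lambda>\<omega>. exp (a * ?Z \<omega>))" "(\<integral>\<omega>. exp (a * ?Z \<omega>) \<partial>N) = exp (a\<^sup>2 * (s - r) / 2)" for a
    by (rule integrable_of_nn_integral_eq[OF _ _ brownian_exp_moment[OF B rs]]; simp)+
  have e: "(exp z - 1)\<^sup>2 = exp (2 * z) - 2 * exp (1 * z) + 1" for z :: real
    by (simp add: power2_eq_square algebra_simps mult_exp_exp)
  have "(\<integral>\<^sup>+\<omega>. ennreal ((exp (?Z \<omega>) - 1)\<^sup>2) \<partial>N) = ennreal (\<integral>\<omega>. (exp (?Z \<omega>) - 1)\<^sup>2 \<partial>N)"
  proof (rule nn_integral_eq_integral)
    show "integrable N (\<lambda>\<omega>. (exp (?Z \<omega>) - 1)\<^sup>2)"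
      unfolding e by (intro Bochner_Integration.integrable_add Bochner_Integration.integrable_diff integrable_mult_right 1(1)) simp
  qed simp
  also have "(\<integral>\<omega>. (exp (?Z \<omega>) - 1)\<^sup>2 \<partial>N) = exp (2 * (s - r)) - 2 * exp ((s - r) / 2) + 1"
    unfolding e using 1[of 2] 1[of 1] by (simp add: prob_space)
  also have "\<dots> \<le> exp (2 * (s - r)) - 1"
    using rs by simp
  finally have Z: "(\<integral>\<^sup>+\<omega>. ennreal ((exp (?Z \<omega>) - 1)\<^sup>2) \<partial>N) \<le> ennreal (exp (2 * (s - r)) - 1)"
    by (simp add: ennreal_leI)
  have "(\<integral>\<^sup>+\<omega>. ennreal ((exp (B s \<omega>) - exp (B r \<omega>))\<^sup>2) \<partial>N)
      = (\<integral>\<^sup>+\<omega>. ennreal (exp (2 * B r \<omega>)) * ennreal ((exp (?Z \<omega>) - 1)\<^sup>2) \<partial>N)"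
  proof (intro nn_integral_cong)
    fix \<omega>
    have "exp (B s \<omega>) - exp (B r \<omega>) = exp (B r \<omega>) * (exp (?Z \<omega>) - 1)"
      by (simp add: algebra_simps mult_exp_exp)
    then have "(exp (B s \<omega>) - exp (B r \<omega>))\<^sup>2 = exp (2 * B r \<omega>) * (exp (?Z \<omega>) - 1)\<^sup>2"
      by (simp only: power_mult_distrib exp_double)
    then show "ennreal ((exp (B s \<omega>) - exp (B r \<omega>))\<^sup>2) = ennreal (exp (2 * B r \<omega>)) * ennreal ((exp (?Z \<omega>) - 1)\<^sup>2)"
      by (simp add: ennreal_mult)
  qed
  also have "\<dots> = (\<integral>\<^sup>+\<omega>. ennreal (exp (2 * B r \<omega>)) \<partial>N) * (\<integral>\<^sup>+\<omega>. ennreal ((exp (?Z \<omega>) - 1)\<^sup>2) \<partial>N)"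
    by (rule nn_integral_indep_mult[OF brownian_increment_indep[OF B rs]]) auto
  also have "\<dots> \<le> ennreal (exp (2 * r)) * ennreal (exp (2 * (s - r)) - 1)"
    using brownian_exp_moment_0[OF B rs(1), of 2] by (intro mult_mono Z) auto
  finally show ?thesis using rs by (simp add: ennreal_mult)
qed

lemma nn_integral_iterated_linear:
  assumes L: "sigma_finite_measure L"
    and f[measurable]: "(\<lambda>(\<omega>, s). f \<omega> s) \<in> borel_measurable (N \<Otimes>\<^sub>M L)"
    and g[measurable]: "(\<lambda>(\<omega>, s). g \<omega> s) \<in> borel_measurable (N \<Otimes>\<^sub>M L)"
  shows "(\<integral>\<^sup>+\<omega>. (\<integral>\<^sup>+s. c * f \<omega> s + d * g \<omega> s \<partial>L) \<partial>N)
    = c * (\<integral>\<^sup>+\<omega>. (\<integral>\<^sup>+s. f \<omega> s \<partial>L) \<partial>N) + d * (\<integral>\<^sup>+\<omega>. (\<integral>\<^sup>+s. g \<omega> s \<partial>L) \<partial>N)"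
proof -
  interpret L: sigma_finite_measure L by fact
  have "f \<omega> \<in> borel_measurable L" "g \<omega> \<in> borel_measurable L" if "\<omega> \<in> space N" for \<omega>
    using measurable_Pair2[OF f that] measurable_Pair2[OF g that] by simp_all
  then have "(\<integral>\<^sup>+\<omega>. (\<integral>\<^sup>+s. c * f \<omega> s + d * g \<omega> s \<partial>L) \<partial>N)
      = (\<integral>\<^sup>+\<omega>. c * (\<integral>\<^sup>+s. f \<omega> s \<partial>L) + d * (\<integral>\<^sup>+s. g \<omega> s \<partial>L) \<partial>N)"
    by (intro nn_integral_cong) (simp add: nn_integral_add nn_integral_cmult)
  also have "\<dots> = c * (\<integral>\<^sup>+\<omega>. (\<integral>\<^sup>+s. f \<omega> s \<partial>L) \<partial>N) + d * (\<integral>\<^sup>+\<omega>. (\<integral>\<^sup>+s. g \<omega> s \<partial>L) \<partial>N)"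
    by (simp add: nn_integral_add nn_integral_cmult)
  finally show ?thesis .
qed

section \<open>Uniform grids and left-endpoint sums for the Ito integral\<close>

definition grid :: "real \<Rightarrow> nat \<Rightarrow> nat \<Rightarrow> real" where
  "grid t m k = real k * t / real m"

lemma grid_0 [simp]: "grid t m 0 = 0"
  by (simp add: grid_def)

lemma grid_end [simp]: "m > 0 \<Longrightarrow> grid t m m = t"
  by (simp add: grid_def)

lemma grid_mono: "t \<ge> 0 \<Longrightarrow> i \<le> j \<Longrightarrow> grid t m i \<le> grid t m j"
  by (simp add: grid_def divide_right_mono mult_right_mono)

lemma grid_step: "grid t m (Suc k) - grid t m k = t / real m"
  by (simp add: grid_def diff_divide_distrib[symmetric] algebra_simps)

lemma grid_nonneg [simp]: "t \<ge> 0 \<Longrightarrow> 0 \<le> grid t m k"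
  by (simp add: grid_def)

text \<open>The cells are open on the left and closed on the right, as in
  \<open>simple_process\<close>; this is why \<open>s = 0\<close> is excluded and the index is a
  ceiling minus one.\<close>

lemma grid_cell:
  assumes "0 < t" "m > 0" "0 < s" "s \<le> t"
  obtains k where "k < m" "grid t m k < s" "s \<le> grid t m (Suc k)"
    "\<And>j. s \<in> {grid t m j<..grid t m (Suc j)} \<longleftrightarrow> j = k"
proof -
  define k where "k = nat (\<lceil>s * m / t\<rceil> - 1)"
  have p: "s * m / t > 0" using assms by simp
  then have ge: "\<lceil>s * m / t\<rceil> \<ge> 1" by linarith
  have k: "real k = of_int \<lceil>s * m / t\<rceil> - 1" using ge by (simp add: k_def)
  have lo: "real k < s * m / t" and hi: "s * m / t \<le> real k + 1" unfolding k by linarith+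
  have "s * m / t \<le> real m" using assms by (simp add: field_simps)
  then have "real k < real m" using lo by linarith
  moreover have gk: "grid t m k < s" using lo assms by (simp add: grid_def field_simps)
  moreover have gk': "s \<le> grid t m (Suc k)" using hi assms by (simp add: grid_def field_simps)
  moreover have "s \<in> {grid t m j<..grid t m (Suc j)} \<longleftrightarrow> j = k" for j
  proof
    assume j: "s \<in> {grid t m j<..grid t m (Suc j)}"
    have "\<not> j < k"
      using grid_mono[of t "Suc j" k m] assms gk j by auto
    moreover have "\<not> k < j"
      using grid_mono[of t "Suc k" j m] assms gk' j by auto
    ultimately show "j = k" by simp
  qed (use gk gk' in auto)
  ultimately show ?thesis using that by auto
qed

context two_brownian
begin

definition riemann_integral :: "real \<Rightarrow> nat \<Rightarrow> 'b \<Rightarrow> real" where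
  "riemann_integral t m \<omega> = (\<Sum>k<m. exp (B (grid t m k) \<omega>) * (W (grid t m (Suc k)) \<omega> - W (grid t m k) \<omega>))"

text \<open>The definition of the Ito integral provides only some sequence of simple integrands. By
  the isometry their integrals differ from the left-endpoint sum by as much as the integrands differ
  in mean square, and both integrands are compared with \<open>exp (B s)\<close>. Two uses of
  \<open>(x - z)\<^sup>2 \<le> 2 * (x - y)\<^sup>2 + 2 * (y - z)\<^sup>2\<close> produce the factor
  4; the errors of the unknown sequence vanish in the limit.\<close>

lemma riemann_integral_approximation:
  assumes t: "t > 0" and m: "m > 0"
    and b: "has_ito_integral N F W (\<lambda>s \<omega>. exp (B s \<omega>)) t b"
  shows "(\<integral>\<^sup>+\<omega>. ennreal ((b \<omega> - riemann_integral t m \<omega>)\<^sup>2) \<partial>N) \<le> ennreal (4 * t * (exp (2 * t) * (exp (2 * (t / m)) - 1)))"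
proof -
  define Lt where "Lt = restrict_space lborel {0..t}"
  have Lt: "(\<integral>\<^sup>+s\<in>{0..t}. f s \<partial>lborel) = (\<integral>\<^sup>+s. f s \<partial>Lt)" for f
    unfolding Lt_def by (subst nn_integral_restrict_space) auto
  have Lt_space: "space Lt = {0..t}" by (simp add: Lt_def space_restrict_space)
  interpret Lt: finite_measure Lt
    using t by (intro finite_measureI) (simp add: Lt_def emeasure_restrict_space space_restrict_space)
  interpret NL: pair_sigma_finite N Lt ..
  have B_m[measurable]: "(\<lambda>(\<omega>, s). exp (B s \<omega>)) \<in> borel_measurable (N \<Otimes>\<^sub>M Lt)"
    using b by (simp add: has_ito_integral_def Lt_def)
  have b_m[measurable]: "b \<in> borel_measurable N" using b by (simp add: has_ito_integral_def)
  have ind[measurable]: "(indicator {x<..y} :: real \<Rightarrow> real) \<in> borel_measurable Lt" for x y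
    unfolding Lt_def by (intro measurable_restrict_space1) simp
  have BW_m[measurable]: "B r \<in> borel_measurable N" "W r \<in> borel_measurable N" if "0 \<le> r" for r
    using brownian_motion_measurable B W that by auto
  have [measurable]: "B (grid t m k) \<in> borel_measurable N" "W (grid t m k) \<in> borel_measurable N" for k
    using BW_m t by auto
  define r where "r \<omega> s = (\<Sum>k<m. exp (B (grid t m k) \<omega>) * indicator {grid t m k<..grid t m (Suc k)} s)" for \<omega> s
  have r_m[measurable]: "(\<lambda>(\<omega>, s). r \<omega> s) \<in> borel_measurable (N \<Otimes>\<^sub>M Lt)"
    unfolding r_def case_prod_beta by measurable
  \<comment> \<open>A bound, uniform over the cells, for the mean square difference of
    \<open>exp (B s)\<close> between a point of a cell and the left end of that cell.\<close>
  define C where "C = exp (2 * t) * (exp (2 * (t / m)) - 1)"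
  have C: "0 \<le> C" using t by (simp add: C_def)
  have Hr: "(\<integral>\<^sup>+\<omega>. (\<integral>\<^sup>+s. ennreal ((exp (B s \<omega>) - r \<omega> s)\<^sup>2) \<partial>Lt) \<partial>N) \<le> ennreal (t * C)"
  proof -
    have "(\<integral>\<^sup>+\<omega>. (\<integral>\<^sup>+s. ennreal ((exp (B s \<omega>) - r \<omega> s)\<^sup>2) \<partial>Lt) \<partial>N)
        = (\<integral>\<^sup>+s. (\<integral>\<^sup>+\<omega>. ennreal ((exp (B s \<omega>) - r \<omega> s)\<^sup>2) \<partial>N) \<partial>Lt)"
      by (rule NL.Fubini'[symmetric]) measurable
    also have "\<dots> \<le> (\<integral>\<^sup>+s. ennreal C \<partial>Lt)"
    proof (rule nn_integral_mono_AE)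
      \<comment> \<open>The point 0 lies in no cell and is discarded as a null set.\<close>
      have ae: "AE s in Lt. s \<noteq> 0"
        unfolding Lt_def by (subst AE_restrict_space_iff) (auto intro: AE_mp[OF AE_lborel_singleton[of 0]])
      have key: "(\<integral>\<^sup>+\<omega>. ennreal ((exp (B s \<omega>) - r \<omega> s)\<^sup>2) \<partial>N) \<le> ennreal C" if "s \<in> space Lt" "s \<noteq> 0" for s
      proof -
        have s: "0 < s" "s \<le> t" using that by (auto simp: Lt_space)
        from grid_cell[OF t m s] obtain k where k: "k < m" "grid t m k < s" "s \<le> grid t m (Suc k)"
          "\<And>j. s \<in> {grid t m j<..grid t m (Suc j)} \<longleftrightarrow> j = k" by blast
        have ind_eq: "indicator {grid t m j<..grid t m (Suc j)} s = (if j = k then 1 else 0 :: real)" for j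
          by (simp only: indicator_def k(4)) simp
        have "r \<omega> s = exp (B (grid t m k) \<omega>)" for \<omega>
        proof -
          have "r \<omega> s = (\<Sum>j<m. if j = k then exp (B (grid t m k) \<omega>) else 0)"
            unfolding r_def ind_eq by (rule sum.cong) auto
          then show ?thesis using k(1) by simp
        qed
        then have "(\<integral>\<^sup>+\<omega>. ennreal ((exp (B s \<omega>) - r \<omega> s)\<^sup>2) \<partial>N)
            \<le> ennreal (exp (2 * grid t m k) * (exp (2 * (s - grid t m k)) - 1))"
          using brownian_exp_increment[OF B _ less_imp_le[OF k(2)]] t by simp
        also have "\<dots> \<le> ennreal C"
          unfolding C_def using s k(2,3) grid_step[of t m k]
          by (intro ennreal_leI mult_mono) auto
        finally show ?thesis .
      qed
      show "AE s in Lt. (\<integral>\<^sup>+\<omega>. ennreal ((exp (B s \<omega>) - r \<omega> s)\<^sup>2) \<partial>N) \<le> ennreal C"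
        by (rule AE_mp[OF ae]) (auto intro!: AE_I2 key)
    qed
    also have "\<dots> = ennreal (t * C)"
      using t C by (simp add: Lt_def emeasure_restrict_space space_restrict_space ennreal_mult mult.commute)
    finally show ?thesis .
  qed
  from b obtain mm \<tau> \<xi> where simple: "\<And>k::nat. simple_integrand N F t (mm k) (\<tau> k) (\<xi> k)"
    and limH: "(\<lambda>k. \<integral>\<^sup>+\<omega>. (\<integral>\<^sup>+s\<in>{0..t}. ennreal ((exp (B s \<omega>) - simple_process (mm k) (\<tau> k) (\<xi> k) s \<omega>)\<^sup>2) \<partial>lborel) \<partial>N) \<longlonglongrightarrow> 0"
    and limb: "(\<lambda>k. \<integral>\<^sup>+\<omega>. ennreal ((b \<omega> - simple_integral W (mm k) (\<tau> k) (\<xi> k) \<omega>)\<^sup>2) \<partial>N) \<longlonglongrightarrow> 0"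
    unfolding has_ito_integral_def by blast
  define \<alpha> where "\<alpha> k = (\<integral>\<^sup>+\<omega>. ennreal ((b \<omega> - simple_integral W (mm k) (\<tau> k) (\<xi> k) \<omega>)\<^sup>2) \<partial>N)" for k
  define \<beta> where "\<beta> k = (\<integral>\<^sup>+\<omega>. (\<integral>\<^sup>+s. ennreal ((exp (B s \<omega>) - simple_process (mm k) (\<tau> k) (\<xi> k) s \<omega>)\<^sup>2) \<partial>Lt) \<partial>N)" for k
  have sq2: "(x - z)\<^sup>2 \<le> 2 * (x - y)\<^sup>2 + 2 * (y - z)\<^sup>2" for x y z :: real
    using zero_le_power2[of "x - y - (y - z)"] by (simp add: power2_eq_square algebra_simps)
  have bound: "(\<integral>\<^sup>+\<omega>. ennreal ((b \<omega> - riemann_integral t m \<omega>)\<^sup>2) \<partial>N) \<le> 2 * \<alpha> k + 2 * (2 * \<beta> k + 2 * ennreal (t * C))" for k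
  proof -
    have \<tau>: "\<tau> k 0 = 0" "\<tau> k (mm k) = t" "\<And>i. i < mm k \<Longrightarrow> \<tau> k i < \<tau> k (Suc i)"
      and \<xi>: "\<And>i. i < mm k \<Longrightarrow> \<xi> k i \<in> borel_measurable (F (\<tau> k i))" "\<And>i. i < mm k \<Longrightarrow> integrable N (\<lambda>\<omega>. (\<xi> k i \<omega>)\<^sup>2)"
      using simple[of k] by (auto simp: simple_integrand_def)
    have \<tau>_ge: "i \<le> mm k \<Longrightarrow> 0 \<le> \<tau> k i" for i
      using \<tau>(1) \<tau>(3) by (induct i) (auto, smt (verit) Suc_le_lessD)
    have \<tau>_le: "\<tau> k i \<le> t" if "i \<le> mm k" for i
      using that
    proof (induct i rule: inc_induct)
      case (step n)
      with \<tau>(3)[of n] show ?case by simp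
    qed (simp add: \<tau>(2))
    have \<xi>_m: "\<xi> k i \<in> borel_measurable N" if "i < mm k" for i
      using adapted_measurable[OF \<tau>_ge \<xi>(1)[OF that]] that by simp
    let ?S = "simple_process (mm k) (\<tau> k) (\<xi> k)" and ?I = "simple_integral W (mm k) (\<tau> k) (\<xi> k)"
    have S_m[measurable]: "(\<lambda>(\<omega>, s). ?S s \<omega>) \<in> borel_measurable (N \<Otimes>\<^sub>M Lt)"
      unfolding simple_process_def case_prod_beta
      by (intro borel_measurable_sum borel_measurable_times measurable_compose[OF measurable_fst] measurable_compose[OF measurable_snd] \<xi>_m ind) auto
    have I_m[measurable]: "?I \<in> borel_measurable N"
      unfolding simple_integral_def
      by (intro borel_measurable_sum borel_measurable_times borel_measurable_diff \<xi>_m BW_m \<tau>_ge) auto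
    have R_m[measurable]: "riemann_integral t m \<in> borel_measurable N"
      unfolding riemann_integral_def[abs_def] by measurable
    have iso: "(\<integral>\<^sup>+\<omega>. ennreal ((?I \<omega> - riemann_integral t m \<omega>)\<^sup>2) \<partial>N)
        = (\<integral>\<^sup>+\<omega>. (\<integral>\<^sup>+s. ennreal ((?S s \<omega> - r \<omega> s)\<^sup>2) \<partial>Lt) \<partial>N)"
    proof -
      \<comment> \<open>The disjoint sum of the two index sets, with the coefficients of the
        left-endpoint sum negated, makes the difference a single family for the isometry.\<close>
      let ?J = "{..<mm k} <+> {..<m}"
      let ?u = "case_sum (\<tau> k) (grid t m)" and ?v = "case_sum (\<lambda>i. \<tau> k (Suc i)) (\<lambda>i. grid t m (Suc i))"
      let ?x = "case_sum (\<xi> k) (\<lambda>i \<omega>. - exp (B (grid t m i) \<omega>))"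
      have "(\<integral>\<^sup>+\<omega>. ennreal ((\<Sum>i\<in>?J. ?x i \<omega> * (W (?v i) \<omega> - W (?u i) \<omega>))\<^sup>2) \<partial>N)
        = (\<integral>\<^sup>+\<omega>. (\<integral>\<^sup>+s\<in>{0..t}. ennreal ((\<Sum>i\<in>?J. ?x i \<omega> * indicator {?u i<..?v i} s)\<^sup>2) \<partial>lborel) \<partial>N)"
      proof (rule ito_isometry)
        fix i assume i: "i \<in> ?J"
        show "0 \<le> ?u i \<and> ?u i \<le> ?v i \<and> ?v i \<le> t"
          using i \<tau>_ge \<tau>_le \<tau>(3) t grid_mono[of t _ m m] grid_mono[of t _ "Suc _" m] m
          by (auto simp: Suc_le_eq less_imp_le)
        show "?x i \<in> borel_measurable (F (?u i))"
          using i t by (auto intro!: \<xi> borel_measurable_uminus borel_measurable_exp measurable_compose[OF measurable_natural_filtration(1)])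
        have "integrable N (\<lambda>\<omega>. (exp (B (grid t m j) \<omega>))\<^sup>2)" for j
          unfolding exp_double[symmetric]
          by (rule integrable_of_nn_integral_eq[OF _ _ brownian_exp_moment_0[OF B]]) (use t in auto)
        then show "integrable N (\<lambda>\<omega>. (?x i \<omega>)\<^sup>2)" using i by (auto intro: \<xi>)
      qed simp
      moreover have "(\<Sum>i\<in>?J. ?x i \<omega> * (W (?v i) \<omega> - W (?u i) \<omega>)) = ?I \<omega> - riemann_integral t m \<omega>" for \<omega>
        by (subst sum.Plus) (simp_all add: simple_integral_def riemann_integral_def sum_negf)
      moreover have "(\<Sum>i\<in>?J. ?x i \<omega> * indicator {?u i<..?v i} s) = ?S s \<omega> - r \<omega> s" for \<omega> s
        by (subst sum.Plus) (simp_all add: simple_process_def r_def sum_negf)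
      ultimately show ?thesis
        unfolding Lt by simp
    qed
    have "(\<integral>\<^sup>+\<omega>. (\<integral>\<^sup>+s. ennreal ((?S s \<omega> - r \<omega> s)\<^sup>2) \<partial>Lt) \<partial>N)
        \<le> (\<integral>\<^sup>+\<omega>. (\<integral>\<^sup>+s. 2 * ennreal ((exp (B s \<omega>) - ?S s \<omega>)\<^sup>2) + 2 * ennreal ((exp (B s \<omega>) - r \<omega> s)\<^sup>2) \<partial>Lt) \<partial>N)"
    proof (intro nn_integral_mono)
      fix \<omega> s
      have "ennreal ((?S s \<omega> - r \<omega> s)\<^sup>2) \<le> ennreal (2 * (?S s \<omega> - exp (B s \<omega>))\<^sup>2 + 2 * (exp (B s \<omega>) - r \<omega> s)\<^sup>2)"
        by (intro ennreal_leI sq2)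
      then show "ennreal ((?S s \<omega> - r \<omega> s)\<^sup>2) \<le> 2 * ennreal ((exp (B s \<omega>) - ?S s \<omega>)\<^sup>2) + 2 * ennreal ((exp (B s \<omega>) - r \<omega> s)\<^sup>2)"
        by (simp add: ennreal_plus ennreal_mult power2_commute)
    qed
    also have "\<dots> = 2 * \<beta> k + 2 * (\<integral>\<^sup>+\<omega>. (\<integral>\<^sup>+s. ennreal ((exp (B s \<omega>) - r \<omega> s)\<^sup>2) \<partial>Lt) \<partial>N)"
      unfolding \<beta>_def
    proof (rule nn_integral_iterated_linear[OF Lt.sigma_finite_measure_axioms])
      show "(\<lambda>(\<omega>, s). ennreal ((exp (B s \<omega>) - ?S s \<omega>)\<^sup>2)) \<in> borel_measurable (N \<Otimes>\<^sub>M Lt)"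
        using S_m B_m by (simp add: case_prod_beta)
      show "(\<lambda>(\<omega>, s). ennreal ((exp (B s \<omega>) - r \<omega> s)\<^sup>2)) \<in> borel_measurable (N \<Otimes>\<^sub>M Lt)"
        using r_m B_m by (simp add: case_prod_beta)
    qed
    also have "\<dots> \<le> 2 * \<beta> k + 2 * ennreal (t * C)"
      by (intro add_left_mono mult_left_mono Hr) auto
    finally have 1: "(\<integral>\<^sup>+\<omega>. ennreal ((?I \<omega> - riemann_integral t m \<omega>)\<^sup>2) \<partial>N) \<le> 2 * \<beta> k + 2 * ennreal (t * C)"
      unfolding iso .
    have "(\<integral>\<^sup>+\<omega>. ennreal ((b \<omega> - riemann_integral t m \<omega>)\<^sup>2) \<partial>N)
        \<le> (\<integral>\<^sup>+\<omega>. 2 * ennreal ((b \<omega> - ?I \<omega>)\<^sup>2) + 2 * ennreal ((?I \<omega> - riemann_integral t m \<omega>)\<^sup>2) \<partial>N)"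
    proof (intro nn_integral_mono)
      fix \<omega>
      have "ennreal ((b \<omega> - riemann_integral t m \<omega>)\<^sup>2) \<le> ennreal (2 * (b \<omega> - ?I \<omega>)\<^sup>2 + 2 * (?I \<omega> - riemann_integral t m \<omega>)\<^sup>2)"
        by (intro ennreal_leI sq2)
      then show "ennreal ((b \<omega> - riemann_integral t m \<omega>)\<^sup>2) \<le> 2 * ennreal ((b \<omega> - ?I \<omega>)\<^sup>2) + 2 * ennreal ((?I \<omega> - riemann_integral t m \<omega>)\<^sup>2)"
        by (simp add: ennreal_plus ennreal_mult)
    qed
    also have "\<dots> = 2 * \<alpha> k + 2 * (\<integral>\<^sup>+\<omega>. ennreal ((?I \<omega> - riemann_integral t m \<omega>)\<^sup>2) \<partial>N)"
      unfolding \<alpha>_def by (simp add: nn_integral_add nn_integral_cmult)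
    also have "\<dots> \<le> 2 * \<alpha> k + 2 * (2 * \<beta> k + 2 * ennreal (t * C))"
      by (intro add_left_mono mult_left_mono 1) auto
    finally show ?thesis .
  qed
  have "(\<lambda>k. 2 * \<alpha> k + 2 * (2 * \<beta> k + 2 * ennreal (t * C))) \<longlonglongrightarrow> 2 * 0 + 2 * (2 * 0 + 2 * ennreal (t * C))"
    using limH limb unfolding Lt \<alpha>_def[symmetric] \<beta>_def[symmetric]
    by (intro tendsto_add ennreal_tendsto_cmult tendsto_const) auto
  then have "(\<integral>\<^sup>+\<omega>. ennreal ((b \<omega> - riemann_integral t m \<omega>)\<^sup>2) \<partial>N) \<le> 2 * 0 + 2 * (2 * 0 + 2 * ennreal (t * C))"
    by (rule LIMSEQ_le_const) (use bound in auto)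
  also have "\<dots> = ennreal (4 * (t * C))"
    using t C by (simp add: ennreal_mult mult.assoc[symmetric])
  finally show ?thesis by (simp add: C_def mult.assoc)
qed

end

section \<open>Exponential functionals of the Brownian bridge\<close>

text \<open>The sums are integrals of step functions that are bounded by a bound for
  \<open>\<bar>f\<bar>\<close> and converge to \<open>f\<close> at every point of the half-open
  interval by continuity, so dominated convergence applies.\<close>

lemma riemann_sum_LIMSEQ:
  fixes f :: "real \<Rightarrow> real"
  assumes t: "t > 0" and f: "continuous_on {0..t} f"
  shows "(\<lambda>m. \<Sum>k<m. f (grid t m k) * (t / real m)) \<longlonglongrightarrow> (LINT s:{0..t}|lborel. f s)"
proof -
  define F where "F m s = (\<Sum>k<m. f (grid t m k) * indicator {grid t m k<..grid t m (Suc k)} s)" for m s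
  obtain K where "\<forall>y\<in>f ` {0..t}. norm y \<le> K"
    using compact_imp_bounded[OF compact_continuous_image[OF f compact_Icc]]
    unfolding bounded_iff by blast
  then have K: "\<bar>f s\<bar> \<le> K" if "s \<in> {0..t}" for s using that by simp
  have "\<bar>f 0\<bar> \<le> K" using t by (intro K) simp
  then have K0: "0 \<le> K" using abs_ge_zero[of "f 0"] by linarith
  have cell: "\<exists>k. k < m \<and> F m s = f (grid t m k) \<and> grid t m k < s \<and> s \<le> grid t m (Suc k)"
    if m: "m > 0" and s: "0 < s" "s \<le> t" for m s
  proof -
    from grid_cell[OF t m s] obtain k where k: "k < m" "grid t m k < s" "s \<le> grid t m (Suc k)"
      "\<And>j. s \<in> {grid t m j<..grid t m (Suc j)} \<longleftrightarrow> j = k" by blast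
    have ind_eq: "indicator {grid t m j<..grid t m (Suc j)} s = (if j = k then 1 else 0 :: real)" for j
      by (simp only: indicator_def k(4)) simp
    have "F m s = (\<Sum>j<m. if j = k then f (grid t m k) else 0)"
      unfolding F_def ind_eq by (rule sum.cong) auto
    then show ?thesis using k by auto
  qed
  have outside: "F m s = 0" if "s \<notin> {0<..t}" for m s
  proof -
    have "indicator {grid t m k<..grid t m (Suc k)} s = (0::real)" if "k < m" for k
    proof -
      have "s \<notin> {grid t m k<..grid t m (Suc k)}"
      proof
        assume "s \<in> {grid t m k<..grid t m (Suc k)}"
        then have "0 < s" "s \<le> t"
          using grid_nonneg[OF less_imp_le[OF t], of m k] grid_mono[of t "Suc k" m m] t \<open>k < m\<close>
          by (auto simp del: grid_nonneg)
        with \<open>s \<notin> {0<..t}\<close> show False by simp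
      qed
      then show ?thesis by (rule indicator_simps(2))
    qed
    then show ?thesis by (simp add: F_def)
  qed
  have F_bound: "\<bar>F m s\<bar> \<le> K * indicator {0..t} s" for m s
  proof (cases "m > 0 \<and> 0 < s \<and> s \<le> t")
    case True
    then obtain k where "k < m" "F m s = f (grid t m k)" "grid t m k < s" using cell by blast
    with K[of "grid t m k"] True t show ?thesis by auto
  next
    case False
    then have "F m s = 0" using outside[of s m] by (cases "m = 0") (auto simp: F_def)
    with K0 show ?thesis by (auto simp: indicator_def)
  qed
  have "(\<lambda>m. integral\<^sup>L lborel (F m)) \<longlonglongrightarrow> integral\<^sup>L lborel (\<lambda>s. indicator {0..t} s * f s)"
  proof (rule integral_dominated_convergence)
    show "(\<lambda>s. indicator {0..t} s * f s) \<in> borel_measurable lborel"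
      using borel_measurable_continuous_on_indicator[OF _ f] by (simp add: scaleR_conv_of_real)
    show "F m \<in> borel_measurable lborel" for m unfolding F_def[abs_def] by measurable
    show "integrable lborel (\<lambda>s. K * indicator {0..t} s)"
      using t by (intro integrable_mult_right integrable_real_indicator) auto
    show "AE s in lborel. norm (F m s) \<le> K * indicator {0..t} s" for m using F_bound by simp
    show "AE s in lborel. (\<lambda>m. F m s) \<longlonglongrightarrow> indicator {0..t} s * f s"
    proof (rule AE_mp[OF AE_lborel_singleton[of 0]], rule AE_I2, rule impI)
      fix s :: real assume "s \<noteq> 0"
      show "(\<lambda>m. F m s) \<longlonglongrightarrow> indicator {0..t} s * f s"
      proof (cases "s \<in> {0<..t}")
        case False
        then show ?thesis using outside[OF False] \<open>s \<noteq> 0\<close> by (auto simp: indicator_def)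
      next
        case True
        \<comment> \<open>The witness is the left end of the cell that contains \<open>s\<close>; it
          tends to \<open>s\<close> as the mesh shrinks.\<close>
        have "\<exists>r. m > 0 \<longrightarrow> r \<in> {0..t} \<and> F m s = f r \<and> \<bar>r - s\<bar> \<le> t / real m" for m
        proof (cases "m > 0")
          case m: True
          then obtain k where "k < m" "F m s = f (grid t m k)" "grid t m k < s" "s \<le> grid t m (Suc k)"
            using cell True by (metis greaterThanAtMost_iff)
          then show ?thesis using True t grid_step[of t m k] by (intro exI[of _ "grid t m k"]) auto
        qed simp
        then obtain r where r: "\<And>m. m > 0 \<Longrightarrow> r m \<in> {0..t} \<and> F m s = f (r m) \<and> \<bar>r m - s\<bar> \<le> t / real m"
          by metis
        have "(\<lambda>m. t / real m) \<longlonglongrightarrow> 0" by (rule lim_const_over_n)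
        then have "(\<lambda>m. r m - s) \<longlonglongrightarrow> 0"
          by (rule Lim_null_comparison[rotated]) (use r in \<open>auto intro!: eventually_sequentiallyI[of 1]\<close>)
        then have "r \<longlonglongrightarrow> s" by (simp add: LIM_zero_iff)
        then have "(\<lambda>m. f (r m)) \<longlonglongrightarrow> f s"
          by (rule continuous_on_tendsto_compose[OF f])
             (use r True in \<open>auto intro!: eventually_sequentiallyI[of 1]\<close>)
        then have "(\<lambda>m. F m s) \<longlonglongrightarrow> f s"
          by (rule Lim_transform_eventually) (use r in \<open>auto intro!: eventually_sequentiallyI[of 1]\<close>)
        then show ?thesis using True by simp
      qed
    qed
  qed
  moreover have "integral\<^sup>L lborel (F m) = (\<Sum>k<m. f (grid t m k) * (t / real m))" for m
  proof -
    have "integral\<^sup>L lborel (F m) = (\<Sum>k<m. f (grid t m k) * (grid t m (Suc k) - grid t m k))"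
      unfolding F_def[abs_def] using grid_mono[of t _ "Suc _" m] t
      by (subst Bochner_Integration.integral_sum) (auto intro!: sum.cong)
    then show ?thesis by (simp only: grid_step)
  qed
  ultimately show ?thesis by (simp add: set_lebesgue_integral_def)
qed

text \<open>If \<open>f\<close> is a Brownian path, then \<open>bridge_path t x f\<close> is a Brownian bridge from \<open>0\<close> to \<open>x\<close> that is independent
  of \<open>f t\<close>.\<close>

definition bridge_path :: "real \<Rightarrow> real \<Rightarrow> (real \<Rightarrow> real) \<Rightarrow> real \<Rightarrow> real" where
  "bridge_path t x f s = f s + s / t * (x - f t)"

definition bridge_var :: "real \<Rightarrow> real \<Rightarrow> (real \<Rightarrow> real) \<Rightarrow> real" where
  "bridge_var t x f = (LINT s:{0..t}|lborel. exp (2 * bridge_path t x f s))"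

definition bridge_sum :: "real \<Rightarrow> nat \<Rightarrow> real \<Rightarrow> (real \<Rightarrow> real) \<Rightarrow> real" where
  "bridge_sum t m x f = (\<Sum>k<m. exp (2 * bridge_path t x f (grid t m k)) * (t / real m))"

lemma bridge_sum_LIMSEQ:
  assumes "t > 0" "continuous_on {0..t} f"
  shows "(\<lambda>m. bridge_sum t m x f) \<longlonglongrightarrow> bridge_var t x f"
  unfolding bridge_sum_def bridge_var_def
  by (rule riemann_sum_LIMSEQ[OF assms(1)]) (use assms in \<open>auto simp: bridge_path_def intro!: continuous_intros\<close>)

text \<open>Changing the endpoint from \<open>x'\<close> to \<open>x\<close> moves the path at time
  \<open>s\<close> by \<open>s / t * (x - x')\<close>, at most \<open>\<bar>x - x'\<bar>\<close> in
  size. This multiplicative comparison later yields positivity, continuity and domination with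
  respect to the endpoint.\<close>

lemma bridge_sum_shift:
  assumes t: "t > 0"
  shows "bridge_sum t m x f \<le> exp (2 * \<bar>x - x'\<bar>) * bridge_sum t m x' f"
  unfolding bridge_sum_def sum_distrib_left
proof (rule sum_mono)
  fix k assume "k \<in> {..<m}"
  then have k: "0 \<le> grid t m k" "grid t m k \<le> t" using t grid_mono[of t k m m] by auto
  have "grid t m k / t * (x - x') \<le> 1 * \<bar>x - x'\<bar>"
  proof -
    have "grid t m k / t * (x - x') \<le> grid t m k / t * \<bar>x - x'\<bar>" using k t by (intro mult_left_mono) auto
    also have "\<dots> \<le> 1 * \<bar>x - x'\<bar>" using k t by (intro mult_right_mono) auto
    finally show ?thesis .
  qed
  then have "2 * bridge_path t x f (grid t m k) \<le> 2 * \<bar>x - x'\<bar> + 2 * bridge_path t x' f (grid t m k)"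
  proof -
    have *: "2 * (p + a * (x - q)) = 2 * (p + a * (x' - q)) + 2 * (a * (x - x'))" for a p q :: real
      by (simp add: algebra_simps)
    show ?thesis
      using \<open>grid t m k / t * (x - x') \<le> 1 * \<bar>x - x'\<bar>\<close>
      unfolding bridge_path_def *[of _ "grid t m k / t"] by simp
  qed
  then have "exp (2 * bridge_path t x f (grid t m k)) \<le> exp (2 * \<bar>x - x'\<bar>) * exp (2 * bridge_path t x' f (grid t m k))"
    by (simp add: exp_add[symmetric])
  then show "exp (2 * bridge_path t x f (grid t m k)) * (t / real m)
      \<le> exp (2 * \<bar>x - x'\<bar>) * (exp (2 * bridge_path t x' f (grid t m k)) * (t / real m))"
    using t by (simp add: mult_right_mono mult.assoc[symmetric] divide_right_mono)
qed

lemma bridge_var_shift: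
  assumes t: "t > 0" and f: "continuous_on {0..t} f"
  shows "bridge_var t x f \<le> exp (2 * \<bar>x - x'\<bar>) * bridge_var t x' f"
  by (rule LIMSEQ_le[OF bridge_sum_LIMSEQ[OF t f] tendsto_mult_left[OF bridge_sum_LIMSEQ[OF t f]]])
     (use bridge_sum_shift[OF t] in auto)

lemma sum_times_sum_inverse:
  fixes a :: "nat \<Rightarrow> real"
  assumes "\<And>k. k < m \<Longrightarrow> a k > 0"
  shows "(real m)\<^sup>2 \<le> (\<Sum>k<m. a k) * (\<Sum>k<m. 1 / a k)"
proof -
  have "real m = (\<Sum>k<m. sqrt (a k) * sqrt (1 / a k))"
    using assms by (subst sum.cong[OF refl, of _ _ "\<lambda>_. 1"]) (auto simp: real_sqrt_mult[symmetric] less_imp_neq[symmetric])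
  then have "(real m)\<^sup>2 \<le> (\<Sum>k<m. (sqrt (a k))\<^sup>2) * (\<Sum>k<m. (sqrt (1 / a k))\<^sup>2)"
    using Cauchy_Schwarz_ineq_sum[of "\<lambda>k. sqrt (a k)" "\<lambda>k. sqrt (1 / a k)" "{..<m}"] by simp
  also have "\<dots> = (\<Sum>k<m. a k) * (\<Sum>k<m. 1 / a k)"
    using assms by (intro arg_cong2[where f=times] sum.cong) (auto simp: less_imp_le)
  finally show ?thesis .
qed

text \<open>The Riemann sum of the reciprocals bounds \<open>1 / bridge_sum\<close> by Cauchy--Schwarz and has an explicit
  expectation, which makes \<open>1 / bridge_var\<close> integrable.\<close>

definition bridge_dual :: "real \<Rightarrow> nat \<Rightarrow> (real \<Rightarrow> real) \<Rightarrow> real" where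
  "bridge_dual t m f = (\<Sum>k<m. exp (- 2 * bridge_path t 0 f (grid t m k)) * (t / real m))"

lemma bridge_sum_dual:
  assumes t: "t > 0" "m > 0"
  shows "t\<^sup>2 \<le> bridge_sum t m 0 f * bridge_dual t m f"
proof -
  let ?a = "\<lambda>k. exp (2 * bridge_path t 0 f (grid t m k))"
  have "t\<^sup>2 = (real m)\<^sup>2 * (t / real m)\<^sup>2" using t by (simp add: power_divide)
  also have "\<dots> \<le> ((\<Sum>k<m. ?a k) * (\<Sum>k<m. 1 / ?a k)) * (t / real m)\<^sup>2"
    by (intro mult_right_mono sum_times_sum_inverse) auto
  also have "\<dots> = bridge_sum t m 0 f * bridge_dual t m f"
  proof -
    have "bridge_sum t m 0 f = (\<Sum>k<m. ?a k) * (t / real m)"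
      "bridge_dual t m f = (\<Sum>k<m. 1 / ?a k) * (t / real m)"
      unfolding bridge_sum_def bridge_dual_def sum_distrib_right
      by (auto intro!: sum.cong simp: exp_minus inverse_eq_divide)
    then show ?thesis by (simp only: power2_eq_square mult_ac)
  qed
  finally show ?thesis .
qed

text \<open>In the limit the Cauchy--Schwarz bound reads \<open>t\<^sup>2 \<le> A * D\<close>, with
  \<open>A\<close> for \<open>bridge_var\<close> and \<open>D\<close> the limit of
  \<open>bridge_dual\<close>; so \<open>A\<close> cannot vanish. The bound on \<open>1 / A\<close>
  is stated with a limit inferior, ready for Fatou's lemma.\<close>

lemma
  assumes t: "t > 0" and f: "continuous_on {0..t} f"
  shows bridge_var_0_pos: "bridge_var t 0 f > 0"
    and inverse_bridge_var: "ennreal (1 / bridge_var t 0 f) \<le> liminf (\<lambda>m. ennreal (bridge_dual t m f / t\<^sup>2))"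
proof -
  define D where "D = (LINT s:{0..t}|lborel. exp (- 2 * bridge_path t 0 f s))"
  have D: "(\<lambda>m. bridge_dual t m f) \<longlonglongrightarrow> D"
    unfolding bridge_dual_def D_def
    by (rule riemann_sum_LIMSEQ[OF t]) (use f t in \<open>auto simp: bridge_path_def intro!: continuous_intros\<close>)
  have le: "t\<^sup>2 \<le> bridge_var t 0 f * D"
    by (rule LIMSEQ_le_const[OF tendsto_mult[OF bridge_sum_LIMSEQ[OF t f] D]])
       (use bridge_sum_dual[OF t] in \<open>auto intro!: exI[of _ 1]\<close>)
  have ge: "0 \<le> bridge_var t 0 f"
    unfolding bridge_var_def set_lebesgue_integral_def by (rule integral_nonneg_AE) auto
  have "bridge_var t 0 f \<noteq> 0" using le zero_less_power[OF t, of 2] by auto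
  with ge show pos: "bridge_var t 0 f > 0" by simp
  have "1 / bridge_var t 0 f \<le> D / t\<^sup>2" using le pos t by (simp add: field_simps)
  moreover have "(\<lambda>m. ennreal (bridge_dual t m f / t\<^sup>2)) \<longlonglongrightarrow> ennreal (D / t\<^sup>2)"
    using t by (intro tendsto_ennrealI tendsto_divide D tendsto_const) simp
  ultimately show "ennreal (1 / bridge_var t 0 f) \<le> liminf (\<lambda>m. ennreal (bridge_dual t m f / t\<^sup>2))"
    by (simp add: lim_imp_Liminf ennreal_leI)
qed

lemma bridge_var_lower:
  assumes t: "t > 0" and f: "continuous_on {0..t} f"
  shows "exp (- 2 * \<bar>x\<bar>) * bridge_var t 0 f \<le> bridge_var t x f"
proof -
  have "bridge_var t 0 f \<le> exp (2 * \<bar>x\<bar>) * bridge_var t x f"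
    using bridge_var_shift[OF t f, of 0 x] by simp
  then have "exp (- 2 * \<bar>x\<bar>) * bridge_var t 0 f \<le> exp (- 2 * \<bar>x\<bar>) * (exp (2 * \<bar>x\<bar>) * bridge_var t x f)"
    by (rule mult_left_mono) simp
  also have "\<dots> = bridge_var t x f" by (simp add: mult.assoc[symmetric] exp_add[symmetric])
  finally show ?thesis .
qed

lemma bridge_var_pos:
  assumes t: "t > 0" and f: "continuous_on {0..t} f"
  shows "bridge_var t x f > 0"
  using bridge_var_lower[OF assms, of x] bridge_var_0_pos[OF assms]
  by (smt (verit) exp_gt_zero mult_pos_pos)

lemma continuous_bridge_var:
  assumes t: "t > 0" and f: "continuous_on {0..t} f"
  shows "continuous_on UNIV (\<lambda>x. bridge_var t x f)"
proof (rule continuous_at_imp_continuous_on, rule ballI)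
  fix x0 :: real
  have "((\<lambda>x. bridge_var t x f) \<longlongrightarrow> bridge_var t x0 f) (at x0)"
  proof (rule tendsto_sandwich)
    show "\<forall>\<^sub>F x in at x0. exp (- 2 * \<bar>x - x0\<bar>) * bridge_var t x0 f \<le> bridge_var t x f"
    proof (rule always_eventually, rule allI)
      fix x
      have "exp (- 2 * \<bar>x - x0\<bar>) * bridge_var t x0 f
          \<le> exp (- 2 * \<bar>x - x0\<bar>) * (exp (2 * \<bar>x0 - x\<bar>) * bridge_var t x f)"
        by (intro mult_left_mono bridge_var_shift[OF t f]) simp
      also have "\<dots> = bridge_var t x f"
        by (simp add: mult.assoc[symmetric] exp_add[symmetric] abs_minus_commute)
      finally show "exp (- 2 * \<bar>x - x0\<bar>) * bridge_var t x0 f \<le> bridge_var t x f" .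
    qed
    show "\<forall>\<^sub>F x in at x0. bridge_var t x f \<le> exp (2 * \<bar>x - x0\<bar>) * bridge_var t x0 f"
      by (intro always_eventually allI bridge_var_shift[OF t f])
    show "((\<lambda>x. exp (- 2 * \<bar>x - x0\<bar>) * bridge_var t x0 f) \<longlongrightarrow> bridge_var t x0 f) (at x0)"
      "((\<lambda>x. exp (2 * \<bar>x - x0\<bar>) * bridge_var t x0 f) \<longlongrightarrow> bridge_var t x0 f) (at x0)"
      by (rule tendsto_eq_rhs, (rule tendsto_intros)+, simp)+
  qed
  then show "isCont (\<lambda>x. bridge_var t x f) x0" by (simp add: isCont_def)
qed

text \<open>The Riemann sum as a function of the increments. With \<open>m\<close> cells it reads
  only the first \<open>m - 1\<close> of them, because left endpoints never include the terminal
  value; the last increment is free to carry the endpoint condition.\<close>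

definition step_var :: "real \<Rightarrow> nat \<Rightarrow> (nat \<Rightarrow> real) \<Rightarrow> real" where
  "step_var t m d = (\<Sum>j<m. exp (2 * (\<Sum>i<j. d i)) * (t / real m))"

section \<open>Brownian increments on a grid and their law given the endpoint\<close>

definition increment :: "real \<Rightarrow> nat \<Rightarrow> (real \<Rightarrow> 'b \<Rightarrow> real) \<Rightarrow> nat \<Rightarrow> 'b \<Rightarrow> real" where
  "increment t m B i \<omega> = B (grid t m (Suc i)) \<omega> - B (grid t m i) \<omega>"

lemma nn_integral_gauss_vec_Suc:
  assumes s: "s > 0" and \<Phi>[measurable]: "\<Phi> \<in> borel_measurable (PiM {..<k} (\<lambda>_. borel) \<Otimes>\<^sub>M borel)"
  shows "(\<integral>\<^sup>+d. \<Phi> (\<lambda>i\<in>{..<k}. d i, d k) \<partial>gauss_vec (Suc k) s) = (\<integral>\<^sup>+d. (\<integral>\<^sup>+u. \<Phi> (d, u) \<partial>gauss s) \<partial>gauss_vec k s)"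
proof -
  interpret g: prob_space "gauss s" by (rule prob_space_gauss[OF s])
  interpret product_sigma_finite "\<lambda>_::nat. gauss s" ..
  have c: "(\<lambda>d. d i) \<in> measurable (PiM (insert k {..<k}) (\<lambda>_. gauss s)) borel" if "i \<in> insert k {..<k}" for i
    using measurable_component_singleton[OF that, of "\<lambda>_. gauss s"] by (simp cong: measurable_cong_sets)
  have [measurable]: "(\<lambda>d. \<lambda>i\<in>{..<k}. d i) \<in> measurable (PiM (insert k {..<k}) (\<lambda>_. gauss s)) (PiM {..<k} (\<lambda>_. borel))"
    "(\<lambda>d. d k) \<in> measurable (PiM (insert k {..<k}) (\<lambda>_. gauss s)) borel"
    by (intro measurable_restrict c; simp)+
  have "(\<integral>\<^sup>+d. \<Phi> (\<lambda>i\<in>{..<k}. d i, d k) \<partial>gauss_vec (Suc k) s)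
      = (\<integral>\<^sup>+d. \<Phi> (\<lambda>i\<in>{..<k}. d i, d k) \<partial>PiM (insert k {..<k}) (\<lambda>_. gauss s))"
    by (simp add: gauss_vec_def lessThan_Suc)
  also have "\<dots> = (\<integral>\<^sup>+d. (\<integral>\<^sup>+u. \<Phi> (\<lambda>i\<in>{..<k}. (d(k := u)) i, (d(k := u)) k) \<partial>gauss s) \<partial>PiM {..<k} (\<lambda>_. gauss s))"
    by (rule product_nn_integral_insert) auto
  also have "\<dots> = (\<integral>\<^sup>+d. (\<integral>\<^sup>+u. \<Phi> (d, u) \<partial>gauss s) \<partial>gauss_vec k s)"
    unfolding gauss_vec_def
  proof (intro nn_integral_cong)
    fix d u assume "d \<in> space (PiM {..<k} (\<lambda>_. gauss s))"
    then have "d \<in> extensional {..<k}" by (simp add: space_PiM PiE_def)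
    then have "(\<lambda>i\<in>{..<k}. (d(k := u)) i) = d"
      by (auto simp: fun_eq_iff extensional_def)
    then show "\<Phi> (\<lambda>i\<in>{..<k}. (d(k := u)) i, (d(k := u)) k) = \<Phi> (d, u)" by simp
  qed
  finally show ?thesis .
qed

lemma brownian_increments:
  assumes B: "brownian_motion N B" and t: "t > 0" and m: "m > 0"
  shows "prob_space.indep_vars N (\<lambda>_. borel) (increment t m B) {..<m}"
    and "distributed N lborel (increment t m B i) (normal_density 0 (sqrt (t / real m)))"
    and "distr N (PiM {..<m} (\<lambda>_. borel)) (\<lambda>\<omega>. \<lambda>i\<in>{..<m}. increment t m B i \<omega>) = gauss_vec m (sqrt (t / real m))"
    and "increment t m B i \<in> borel_measurable N"
proof -
  interpret prob_space N using B by (simp add: brownian_motion_def)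
  have "mono (grid t m)" using t by (intro monoI grid_mono) auto
  then show iv: "indep_vars (\<lambda>_. borel) (increment t m B) {..<m}"
    using B unfolding brownian_motion_def increment_def[abs_def] by simp
  have "grid t m i < grid t m (Suc i)" for i using grid_step[of t m i] t m by (smt (verit) divide_pos_pos of_nat_0_less_iff)
  then show d: "distributed N lborel (increment t m B i) (normal_density 0 (sqrt (t / real m)))" for i
    using B t grid_step[of t m i] unfolding brownian_motion_def increment_def[abs_def] by (metis grid_nonneg less_imp_le)
  then show rv: "increment t m B i \<in> borel_measurable N" for i
    by (simp add: distributed_gauss_iff)
  have "distr N (PiM {..<m} (\<lambda>_. borel)) (\<lambda>\<omega>. \<lambda>i\<in>{..<m}. increment t m B i \<omega>)
      = PiM {..<m} (\<lambda>i. distr N borel (increment t m B i))"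
    using iv by (subst indep_vars_iff_distr_eq_PiM'[symmetric]) (use m rv in auto)
  also have "\<dots> = gauss_vec m (sqrt (t / real m))"
    unfolding gauss_vec_def using d by (simp add: distributed_gauss_iff)
  finally show "distr N (PiM {..<m} (\<lambda>_. borel)) (\<lambda>\<omega>. \<lambda>i\<in>{..<m}. increment t m B i \<omega>) = gauss_vec m (sqrt (t / real m))" .
qed

lemma increment_sum:
  assumes B: "brownian_motion N B" and \<omega>: "\<omega> \<in> space N"
  shows "(\<Sum>i<j. increment t m B i \<omega>) = B (grid t m j) \<omega>"
proof -
  have "(\<Sum>i<j. increment t m B i \<omega>) = B (grid t m j) \<omega> - B (grid t m 0) \<omega>"
    unfolding increment_def by (rule sum_lessThan_telescope)
  then show ?thesis using B \<omega> by (simp add: brownian_motion_def)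
qed

text \<open>On the grid the linear correction of the bridge adds the same amount
  \<open>(x - B t) / (k + 1)\<close> to every increment, which is the correction that appears in
  \<open>nn_integral_bridge\<close>.\<close>

lemma bridge_sum_eq_step_var:
  assumes B: "brownian_motion N B" and \<omega>: "\<omega> \<in> space N" and t: "t > 0"
  shows "bridge_sum t (Suc k) x (\<lambda>s. B s \<omega>)
    = step_var t (Suc k) (\<lambda>i\<in>{..<k}. increment t (Suc k) B i \<omega> + (x - B t \<omega>) / real (Suc k))"
  unfolding bridge_sum_def step_var_def
proof (intro sum.cong refl)
  fix j assume "j \<in> {..<Suc k}"
  then have j: "{..<j} \<subseteq> {..<k}" by auto
  have "(\<Sum>i<j. (\<lambda>i\<in>{..<k}. increment t (Suc k) B i \<omega> + (x - B t \<omega>) / real (Suc k)) i)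
      = (\<Sum>i<j. increment t (Suc k) B i \<omega> + (x - B t \<omega>) / real (Suc k))"
    using j by (intro sum.cong) auto
  also have "\<dots> = B (grid t (Suc k) j) \<omega> + real j * ((x - B t \<omega>) / real (Suc k))"
    by (simp add: sum.distrib increment_sum[OF B \<omega>])
  also have "\<dots> = bridge_path t x (\<lambda>s. B s \<omega>) (grid t (Suc k) j)"
    using t by (simp add: bridge_path_def grid_def)
  finally show "exp (2 * bridge_path t x (\<lambda>s. B s \<omega>) (grid t (Suc k) j)) * (t / real (Suc k))
    = exp (2 * (\<Sum>i<j. (\<lambda>i\<in>{..<k}. increment t (Suc k) B i \<omega> + (x - B t \<omega>) / real (Suc k)) i)) * (t / real (Suc k))"
    by simp
qed

lemma sum_restrict_lessThan: "(\<Sum>i<k. (\<lambda>i\<in>{..<k}. f i) i) = (\<Sum>i<k. f i)"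
  by (intro sum.cong) auto

lemma nn_integral_increments:
  assumes B: "brownian_motion N B" and t: "t > 0"
    and \<Phi>[measurable]: "\<Phi> \<in> borel_measurable (PiM {..<k} (\<lambda>_. borel) \<Otimes>\<^sub>M borel)"
  shows "(\<integral>\<^sup>+\<omega>. \<Phi> (\<lambda>i\<in>{..<k}. increment t (Suc k) B i \<omega>, B t \<omega> - B (grid t (Suc k) k) \<omega>) \<partial>N)
    = (\<integral>\<^sup>+d. (\<integral>\<^sup>+u. \<Phi> (d, u) \<partial>gauss (sqrt (t / real (Suc k)))) \<partial>gauss_vec k (sqrt (t / real (Suc k))))"
proof -
  note bi = brownian_increments[OF B t zero_less_Suc[of k]]
  have [measurable]: "(\<lambda>\<omega>. \<lambda>i\<in>{..<Suc k}. increment t (Suc k) B i \<omega>) \<in> measurable N (PiM {..<Suc k} (\<lambda>_. borel))"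
    by (intro measurable_restrict bi(4))
  have [measurable]: "(\<lambda>d. \<lambda>i\<in>{..<k}. d i) \<in> measurable (PiM {..<Suc k} (\<lambda>_. borel :: real measure)) (PiM {..<k} (\<lambda>_. borel))"
    "(\<lambda>d. d k) \<in> borel_measurable (PiM {..<Suc k} (\<lambda>_. borel :: real measure))"
    by (intro measurable_restrict measurable_component_singleton; simp)+
  have "B t \<omega> - B (grid t (Suc k) k) \<omega> = increment t (Suc k) B k \<omega>" for \<omega>
    by (simp add: increment_def del: of_nat_Suc)
  then have "(\<integral>\<^sup>+\<omega>. \<Phi> (\<lambda>i\<in>{..<k}. increment t (Suc k) B i \<omega>, B t \<omega> - B (grid t (Suc k) k) \<omega>) \<partial>N)
    = (\<integral>\<^sup>+\<omega>. (\<lambda>d. \<Phi> (\<lambda>i\<in>{..<k}. d i, d k)) (\<lambda>i\<in>{..<Suc k}. increment t (Suc k) B i \<omega>) \<partial>N)"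
    by (intro nn_integral_cong arg_cong[where f=\<Phi>]) (auto simp: fun_eq_iff)
  also have "\<dots> = (\<integral>\<^sup>+d. \<Phi> (\<lambda>i\<in>{..<k}. d i, d k) \<partial>distr N (PiM {..<Suc k} (\<lambda>_. borel)) (\<lambda>\<omega>. \<lambda>i\<in>{..<Suc k}. increment t (Suc k) B i \<omega>))"
    by (rule nn_integral_distr[symmetric]) measurable
  also have "\<dots> = (\<integral>\<^sup>+d. (\<integral>\<^sup>+u. \<Phi> (d, u) \<partial>gauss (sqrt (t / real (Suc k)))) \<partial>gauss_vec k (sqrt (t / real (Suc k))))"
    unfolding bi(3) by (rule nn_integral_gauss_vec_Suc) (use t in auto)
  finally show ?thesis .
qed

text \<open>The Gaussian identity \<open>nn_integral_bridge\<close> for Brownian increments: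
  \<open>B t\<close> is the sum of the first \<open>k\<close> increments and the last one, and the
  sum of all \<open>k + 1\<close> has standard deviation \<open>sqrt t\<close>.\<close>

lemma brownian_bridge_kernel:
  assumes B: "brownian_motion N B" and t: "t > 0" and F[measurable]: "F \<in> borel_measurable (PiM {..<k} (\<lambda>_. borel))"
  shows "(\<integral>\<^sup>+d. F d * ennreal (normal_density 0 (sqrt (t / real (Suc k))) (x - (\<Sum>i<k. d i))) \<partial>gauss_vec k (sqrt (t / real (Suc k))))
    = ennreal (normal_density 0 (sqrt t) x) *
      (\<integral>\<^sup>+\<omega>. F (\<lambda>i\<in>{..<k}. increment t (Suc k) B i \<omega> + (x - B t \<omega>) / real (Suc k)) \<partial>N)"
proof -
  let ?s = "sqrt (t / real (Suc k))"
  have s: "?s > 0" using t by simp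
  have "?s * sqrt (real (Suc k)) = sqrt t"
    by (simp add: real_sqrt_mult[symmetric] del: of_nat_Suc)
  then have "(\<integral>\<^sup>+d. F d * ennreal (normal_density 0 ?s (x - (\<Sum>i<k. d i))) \<partial>gauss_vec k ?s)
    = ennreal (normal_density 0 (sqrt t) x) *
      (\<integral>\<^sup>+d. (\<integral>\<^sup>+u. (\<lambda>(d, u). F (\<lambda>i\<in>{..<k}. d i + (x - (\<Sum>i<k. d i) - u) / real (Suc k))) (d, u) \<partial>gauss ?s) \<partial>gauss_vec k ?s)"
    using nn_integral_bridge[OF s F, of x] by simp
  also have "(\<integral>\<^sup>+d. (\<integral>\<^sup>+u. (\<lambda>(d, u). F (\<lambda>i\<in>{..<k}. d i + (x - (\<Sum>i<k. d i) - u) / real (Suc k))) (d, u) \<partial>gauss ?s) \<partial>gauss_vec k ?s)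
     = (\<integral>\<^sup>+\<omega>. (\<lambda>(d, u). F (\<lambda>i\<in>{..<k}. d i + (x - (\<Sum>i<k. d i) - u) / real (Suc k)))
        (\<lambda>i\<in>{..<k}. increment t (Suc k) B i \<omega>, B t \<omega> - B (grid t (Suc k) k) \<omega>) \<partial>N)"
    by (rule nn_integral_increments[OF B t, symmetric]) measurable
  also have "\<dots> = (\<integral>\<^sup>+\<omega>. F (\<lambda>i\<in>{..<k}. increment t (Suc k) B i \<omega> + (x - B t \<omega>) / real (Suc k)) \<partial>N)"
  proof (intro nn_integral_cong)
    fix \<omega> assume "\<omega> \<in> space N"
    then have "(\<Sum>i<k. (\<lambda>i\<in>{..<k}. increment t (Suc k) B i \<omega>) i) = B (grid t (Suc k) k) \<omega>"
      unfolding sum_restrict_lessThan by (simp add: increment_sum[OF B])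
    then show "(\<lambda>(d, u). F (\<lambda>i\<in>{..<k}. d i + (x - (\<Sum>i<k. d i) - u) / real (Suc k)))
        (\<lambda>i\<in>{..<k}. increment t (Suc k) B i \<omega>, B t \<omega> - B (grid t (Suc k) k) \<omega>)
       = F (\<lambda>i\<in>{..<k}. increment t (Suc k) B i \<omega> + (x - B t \<omega>) / real (Suc k))"
      by (auto intro!: arg_cong[where f=F] simp: fun_eq_iff simp del: of_nat_Suc)
  qed
  finally show ?thesis .
qed

text \<open>Disintegration with respect to \<open>B t\<close>. For fixed first \<open>k\<close>
  increments the last one is replaced by the endpoint \<open>x\<close> as integration variable; its
  density then becomes the weight that \<open>brownian_bridge_kernel\<close> converts into the
  density of \<open>B t\<close> and a mean over the bridge to \<open>x\<close>.\<close>

lemma brownian_bridge_disintegration: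
  assumes B: "brownian_motion N B" and t: "t > 0" and F[measurable]: "F \<in> borel_measurable (PiM {..<k} (\<lambda>_. borel))"
    and C[measurable]: "C \<in> sets borel"
  shows "(\<integral>\<^sup>+\<omega>. indicator C (B t \<omega>) * F (\<lambda>i\<in>{..<k}. increment t (Suc k) B i \<omega>) \<partial>N)
    = (\<integral>\<^sup>+x. indicator C x * (ennreal (normal_density 0 (sqrt t) x) *
       (\<integral>\<^sup>+\<omega>. F (\<lambda>i\<in>{..<k}. increment t (Suc k) B i \<omega> + (x - B t \<omega>) / real (Suc k)) \<partial>N)) \<partial>lborel)"
proof -
  let ?s = "sqrt (t / real (Suc k))"
  have s: "?s > 0" using t by simp
  interpret P: prob_space "gauss_vec k ?s" by (rule prob_space_gauss_vec[OF s])
  interpret PL: pair_sigma_finite "gauss_vec k ?s" lborel ..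
  have "(\<integral>\<^sup>+\<omega>. indicator C (B t \<omega>) * F (\<lambda>i\<in>{..<k}. increment t (Suc k) B i \<omega>) \<partial>N)
      = (\<integral>\<^sup>+\<omega>. (\<lambda>(d, u). indicator C ((\<Sum>i<k. d i) + u) * F d)
        (\<lambda>i\<in>{..<k}. increment t (Suc k) B i \<omega>, B t \<omega> - B (grid t (Suc k) k) \<omega>) \<partial>N)"
    unfolding prod.case sum_restrict_lessThan by (intro nn_integral_cong) (simp add: increment_sum[OF B])
  also have "\<dots> = (\<integral>\<^sup>+d. (\<integral>\<^sup>+u. (\<lambda>(d, u). indicator C ((\<Sum>i<k. d i) + u) * F d) (d, u) \<partial>gauss ?s) \<partial>gauss_vec k ?s)"
    by (rule nn_integral_increments[OF B t]) measurable
  also have "\<dots> = (\<integral>\<^sup>+d. (\<integral>\<^sup>+x. indicator C x * (F d * ennreal (normal_density 0 ?s (x - (\<Sum>i<k. d i)))) \<partial>lborel) \<partial>gauss_vec k ?s)"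
  proof (intro nn_integral_cong)
    fix d
    have "(\<integral>\<^sup>+u. (\<lambda>(d, u). indicator C ((\<Sum>i<k. d i) + u) * F d) (d, u) \<partial>gauss ?s)
        = (\<integral>\<^sup>+u. ennreal (normal_density 0 ?s u) * (indicator C ((\<Sum>i<k. d i) + u) * F d) \<partial>lborel)"
      unfolding prod.case by (rule nn_integral_gauss) measurable
    also have "\<dots> = ennreal \<bar>1\<bar> * (\<integral>\<^sup>+x. ennreal (normal_density 0 ?s (- (\<Sum>i<k. d i) + 1 * x))
        * (indicator C ((\<Sum>i<k. d i) + (- (\<Sum>i<k. d i) + 1 * x)) * F d) \<partial>lborel)"
      by (intro nn_integral_real_affine) auto
    also have "\<dots> = (\<integral>\<^sup>+x. indicator C x * (F d * ennreal (normal_density 0 ?s (x - (\<Sum>i<k. d i)))) \<partial>lborel)"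
      by (simp add: mult_ac)
    finally show "(\<integral>\<^sup>+u. (\<lambda>(d, u). indicator C ((\<Sum>i<k. d i) + u) * F d) (d, u) \<partial>gauss ?s)
      = (\<integral>\<^sup>+x. indicator C x * (F d * ennreal (normal_density 0 ?s (x - (\<Sum>i<k. d i)))) \<partial>lborel)" .
  qed
  also have "\<dots> = (\<integral>\<^sup>+x. (\<integral>\<^sup>+d. indicator C x * (F d * ennreal (normal_density 0 ?s (x - (\<Sum>i<k. d i)))) \<partial>gauss_vec k ?s) \<partial>lborel)"
    by (rule PL.Fubini'[symmetric]) measurable
  also have "\<dots> = (\<integral>\<^sup>+x. indicator C x * (\<integral>\<^sup>+d. F d * ennreal (normal_density 0 ?s (x - (\<Sum>i<k. d i))) \<partial>gauss_vec k ?s) \<partial>lborel)"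
    by (intro nn_integral_cong nn_integral_cmult) measurable
  finally show ?thesis
    unfolding brownian_bridge_kernel[OF B t F] .
qed

section \<open>The joint law of Brownian motion and the Ito integral\<close>

text \<open>The mean of \<open>g\<close> under the centred normal law of variance \<open>a\<close>,
  written with a standard normal variable rather than with a density: in this form it makes sense at
  \<open>a = 0\<close> as well, and its continuity in \<open>a\<close> follows from dominated
  convergence.\<close>

definition gauss_mean :: "(real \<Rightarrow> ennreal) \<Rightarrow> real \<Rightarrow> ennreal" where
  "gauss_mean g a = (\<integral>\<^sup>+z. g (sqrt a * z) \<partial>gauss 1)"

lemma gauss_mean_measurable [measurable]:
  assumes [measurable]: "g \<in> borel_measurable borel"
  shows "gauss_mean g \<in> borel_measurable borel"
proof -
  interpret g: prob_space "gauss 1" by (rule prob_space_gauss) simp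
  show ?thesis unfolding gauss_mean_def[abs_def] by measurable
qed

lemma gauss_mean_density:
  assumes a: "a > 0" and [measurable]: "g \<in> borel_measurable borel"
  shows "gauss_mean g a = (\<integral>\<^sup>+y. g y * ennreal (normal_density 0 (sqrt a) y) \<partial>lborel)"
proof -
  have "(\<integral>\<^sup>+y. g y * ennreal (normal_density 0 (sqrt a) y) \<partial>lborel)
      = ennreal \<bar>sqrt a\<bar> * (\<integral>\<^sup>+z. g (0 + sqrt a * z) * ennreal (normal_density 0 (sqrt a) (0 + sqrt a * z)) \<partial>lborel)"
    using a by (intro nn_integral_real_affine) auto
  also have "\<dots> = (\<integral>\<^sup>+z. ennreal (sqrt a) * (g (sqrt a * z) * ennreal (normal_density 0 (sqrt a) (sqrt a * z))) \<partial>lborel)"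
    using a by (subst nn_integral_cmult) auto
  also have "\<dots> = (\<integral>\<^sup>+z. ennreal (normal_density 0 1 z) * g (sqrt a * z) \<partial>lborel)"
  proof (intro nn_integral_cong)
    fix z
    have "sqrt a * normal_density 0 (sqrt a) (sqrt a * z) = normal_density 0 1 z"
      using a by (simp add: normal_density_def real_sqrt_mult power_mult_distrib)
    moreover have "ennreal (sqrt a) * (g (sqrt a * z) * ennreal (normal_density 0 (sqrt a) (sqrt a * z)))
       = ennreal (sqrt a * normal_density 0 (sqrt a) (sqrt a * z)) * g (sqrt a * z)"
      using a by (simp add: ennreal_mult mult_ac)
    ultimately show "ennreal (sqrt a) * (g (sqrt a * z) * ennreal (normal_density 0 (sqrt a) (sqrt a * z)))
       = ennreal (normal_density 0 1 z) * g (sqrt a * z)" by (simp only:)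
  qed
  also have "\<dots> = gauss_mean g a"
    unfolding gauss_mean_def by (rule nn_integral_gauss[symmetric]) measurable
  finally show ?thesis ..
qed

lemma gauss_mean_le_1: "(\<And>y. g y \<le> 1) \<Longrightarrow> gauss_mean g a \<le> 1"
proof -
  assume g: "\<And>y. g y \<le> 1"
  interpret g: prob_space "gauss 1" by (rule prob_space_gauss) simp
  have "gauss_mean g a \<le> (\<integral>\<^sup>+z. 1 \<partial>gauss 1)"
    unfolding gauss_mean_def by (intro nn_integral_mono g)
  then show ?thesis using g.emeasure_space_1 by simp
qed

lemma gauss_mean_tendsto:
  fixes g :: "real \<Rightarrow> ennreal"
  assumes g: "continuous_on UNIV g" "\<And>y. g y \<le> 1" and u: "u \<longlonglongrightarrow> a"
  shows "(\<lambda>n. gauss_mean g (u n)) \<longlonglongrightarrow> gauss_mean g a"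
proof -
  interpret g: prob_space "gauss 1" by (rule prob_space_gauss) simp
  have [measurable]: "g \<in> borel_measurable borel" by (rule borel_measurable_continuous_onI[OF g(1)])
  show ?thesis
    unfolding gauss_mean_def
  proof (rule nn_integral_dominated_convergence[where w="\<lambda>_. 1"])
    show "AE z in gauss 1. (\<lambda>n. g (sqrt (u n) * z)) \<longlonglongrightarrow> g (sqrt a * z)"
      by (intro AE_I2 continuous_on_tendsto_compose[OF g(1)] tendsto_intros u) auto
  qed (use g(2) g.emeasure_space_1 in auto)
qed

context two_brownian
begin

lemma B_measurable [measurable]: "0 \<le> s \<Longrightarrow> B s \<in> borel_measurable N"
  by (rule brownian_motion_measurable[OF B])

lemma B_continuous: "\<omega> \<in> space N \<Longrightarrow> continuous_on {0..t} (\<lambda>s. B s \<omega>)"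
  using B by (auto simp: brownian_motion_def intro: continuous_on_subset)

lemma bridge_sum_measurable:
  assumes t: "t > 0"
  shows "(\<lambda>(x, \<omega>). bridge_sum t m x (\<lambda>s. B s \<omega>)) \<in> borel_measurable (borel \<Otimes>\<^sub>M N)"
proof -
  have [measurable]: "B t \<in> borel_measurable N" "B (grid t m k) \<in> borel_measurable N" for k
    using t by simp_all
  show ?thesis
    unfolding bridge_sum_def bridge_path_def by measurable
qed

lemma bridge_var_measurable:
  assumes t: "t > 0"
  shows "(\<lambda>(x, \<omega>). bridge_var t x (\<lambda>s. B s \<omega>)) \<in> borel_measurable (borel \<Otimes>\<^sub>M N)"
proof (rule borel_measurable_LIMSEQ_real)
  fix z :: "real \<times> 'b" assume "z \<in> space (borel \<Otimes>\<^sub>M N)"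
  then have "snd z \<in> space N" by (auto simp: space_pair_measure)
  then show "(\<lambda>m. (\<lambda>(x, \<omega>). bridge_sum t m x (\<lambda>s. B s \<omega>)) z) \<longlonglongrightarrow> (\<lambda>(x, \<omega>). bridge_var t x (\<lambda>s. B s \<omega>)) z"
    unfolding case_prod_beta by (intro bridge_sum_LIMSEQ[OF t] B_continuous)
qed (rule bridge_sum_measurable[OF t])

lemma bridge_var_measurable_section:
  assumes t: "t > 0"
  shows "(\<lambda>\<omega>. bridge_var t x (\<lambda>s. B s \<omega>)) \<in> borel_measurable N"
  using measurable_Pair2[OF bridge_var_measurable[OF t], of x] by simp

text \<open>Given the values of \<open>B\<close> on the grid, the left-endpoint sum is a Gaussian
  mixture in the increments of \<open>W\<close>. Its conditional variance is the Riemann sum of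
  \<open>exp (2 * B s)\<close>, written as \<open>bridge_sum\<close> with endpoint
  \<open>B t\<close>, for which the bridge correction is zero.\<close>

lemma riemann_integral_law:
  assumes t: "t > 0" and C[measurable]: "C \<in> sets borel" and g[measurable]: "g \<in> borel_measurable borel"
  shows "(\<integral>\<^sup>+\<omega>. indicator C (B t \<omega>) * g (riemann_integral t (Suc k) \<omega>) \<partial>N)
    = (\<integral>\<^sup>+\<omega>. indicator C (B t \<omega>) * gauss_mean g (bridge_sum t (Suc k) (B t \<omega>) (\<lambda>s. B s \<omega>)) \<partial>N)"
proof -
  let ?m = "Suc k"
  let ?U = "\<lambda>\<omega>. \<lambda>j\<in>{..?m}. B (grid t ?m j) \<omega>" and ?V = "increment t ?m W"
  let ?S = "PiM {..?m} (\<lambda>_. borel :: real measure)"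
  note bi = brownian_increments[OF W t zero_less_Suc[of k]]
  have t0: "0 \<le> t" using t by simp
  have "indep2 ?S (\<lambda>\<omega>. (\<lambda>f. \<lambda>j\<in>{..?m}. f (grid t ?m j)) (\<lambda>i\<in>{0..}. B i \<omega>))
     (PiM {..<?m} (\<lambda>_. borel)) (\<lambda>\<omega>. (\<lambda>f. \<lambda>j\<in>{..<?m}. f (grid t ?m (Suc j)) - f (grid t ?m j)) (\<lambda>i\<in>{0..}. W i \<omega>))"
  proof (rule indep2_compose[OF BW[unfolded indep_processes_def, folded indep2_iff_indep_var]])
    show "(\<lambda>f. \<lambda>j\<in>{..?m}. f (grid t ?m j)) \<in> measurable (PiM {0..} (\<lambda>_. borel)) ?S"
      using t0 by (intro measurable_restrict measurable_component_singleton) simp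
    show "(\<lambda>f. \<lambda>j\<in>{..<?m}. f (grid t ?m (Suc j)) - f (grid t ?m j)) \<in> measurable (PiM {0..} (\<lambda>_. borel)) (PiM {..<?m} (\<lambda>_. borel :: real measure))"
      using t0 by (intro measurable_restrict borel_measurable_diff measurable_component_singleton) simp_all
  qed
  moreover have "(\<lambda>f. \<lambda>j\<in>{..?m}. f (grid t ?m j)) (\<lambda>i\<in>{0..}. B i \<omega>) = ?U \<omega>"
    "(\<lambda>f. \<lambda>j\<in>{..<?m}. f (grid t ?m (Suc j)) - f (grid t ?m j)) (\<lambda>i\<in>{0..}. W i \<omega>) = (\<lambda>j\<in>{..<?m}. ?V j \<omega>)" for \<omega>
    using t0 by (auto simp: fun_eq_iff increment_def)
  ultimately have UV: "indep_var ?S ?U (PiM {..<?m} (\<lambda>_. borel)) (\<lambda>\<omega>. \<lambda>j\<in>{..<?m}. ?V j \<omega>)"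
    by (simp add: indep2_iff_indep_var)
  have Uj: "?U \<omega> j = B (grid t ?m j) \<omega>" if "j \<le> ?m" for j \<omega> using that by simp
  have gt: "grid t ?m ?m = t" by (rule grid_end) simp
  have [measurable]: "(\<lambda>u. u j) \<in> borel_measurable ?S" if "j \<le> ?m" for j
    using that by (intro measurable_component_singleton) simp
  define \<Phi> where "\<Phi> = (\<lambda>(u, y). indicator C (u ?m) * g y :: ennreal)"
  have \<Phi>[measurable]: "\<Phi> \<in> borel_measurable (?S \<Otimes>\<^sub>M borel)" unfolding \<Phi>_def by measurable
  have "(\<integral>\<^sup>+\<omega>. indicator C (B t \<omega>) * g (riemann_integral t ?m \<omega>) \<partial>N)
     = (\<integral>\<^sup>+\<omega>. \<Phi> (?U \<omega>, \<Sum>j\<in>{..<?m}. exp (?U \<omega> j) * ?V j \<omega>) \<partial>N)"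
  proof -
    have "(\<Sum>j\<in>{..<?m}. exp (?U \<omega> j) * ?V j \<omega>) = riemann_integral t ?m \<omega>" for \<omega>
      unfolding riemann_integral_def by (intro sum.cong) (auto simp: increment_def)
    then show ?thesis by (simp add: \<Phi>_def gt del: sum.lessThan_Suc)
  qed
  also have "\<dots> = (\<integral>\<^sup>+\<omega>. (\<integral>\<^sup>+y. \<Phi> (?U \<omega>, y) * ennreal (normal_density 0 (sqrt (t / real ?m) * sqrt (\<Sum>j\<in>{..<?m}. (exp (?U \<omega> j))\<^sup>2)) y) \<partial>lborel) \<partial>N)"
    by (rule nn_integral_gaussian_mixture[OF prob_space_axioms UV bi(1)])
       (use t bi(2) in \<open>auto intro!: measurable_component_singleton\<close>)
  also have "\<dots> = (\<integral>\<^sup>+\<omega>. indicator C (B t \<omega>) * gauss_mean g (bridge_sum t ?m (B t \<omega>) (\<lambda>s. B s \<omega>)) \<partial>N)"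
  proof (intro nn_integral_cong)
    fix \<omega>
    have v: "sqrt (t / real ?m) * sqrt (\<Sum>j\<in>{..<?m}. (exp (?U \<omega> j))\<^sup>2) = sqrt (bridge_sum t ?m (B t \<omega>) (\<lambda>s. B s \<omega>))"
      unfolding real_sqrt_mult[symmetric] bridge_sum_def bridge_path_def sum_distrib_left
      by (intro arg_cong[where f=sqrt] sum.cong) (simp_all add: exp_double mult.commute)
    have pos: "bridge_sum t ?m (B t \<omega>) (\<lambda>s. B s \<omega>) > 0"
      unfolding bridge_sum_def using t by (intro sum_pos) auto
    show "(\<integral>\<^sup>+y. \<Phi> (?U \<omega>, y) * ennreal (normal_density 0 (sqrt (t / real ?m) * sqrt (\<Sum>j\<in>{..<?m}. (exp (?U \<omega> j))\<^sup>2)) y) \<partial>lborel)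
      = indicator C (B t \<omega>) * gauss_mean g (bridge_sum t ?m (B t \<omega>) (\<lambda>s. B s \<omega>))"
      unfolding v gauss_mean_density[OF pos g]
      by (subst nn_integral_cmult[symmetric]) (auto simp: \<Phi>_def gt mult.assoc)
  qed
  finally show ?thesis .
qed

lemma riemann_integral_bridge_law:
  assumes t: "t > 0" and C[measurable]: "C \<in> sets borel" and g[measurable]: "g \<in> borel_measurable borel"
  shows "(\<integral>\<^sup>+\<omega>. indicator C (B t \<omega>) * g (riemann_integral t (Suc k) \<omega>) \<partial>N)
    = (\<integral>\<^sup>+x. indicator C x * (ennreal (normal_density 0 (sqrt t) x) *
        (\<integral>\<^sup>+\<omega>. gauss_mean g (bridge_sum t (Suc k) x (\<lambda>s. B s \<omega>)) \<partial>N)) \<partial>lborel)"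
proof -
  let ?F = "\<lambda>d. gauss_mean g (step_var t (Suc k) d)"
  have [measurable]: "?F \<in> borel_measurable (PiM {..<k} (\<lambda>_. borel))"
  proof -
    have "step_var t (Suc k) \<in> borel_measurable (PiM {..<k} (\<lambda>_. borel))"
      unfolding step_var_def[abs_def]
      by (intro borel_measurable_sum borel_measurable_times borel_measurable_const
            measurable_compose[OF _ borel_measurable_exp] measurable_component_singleton) auto
    then show ?thesis by measurable
  qed
  have "(\<integral>\<^sup>+\<omega>. indicator C (B t \<omega>) * g (riemann_integral t (Suc k) \<omega>) \<partial>N)
     = (\<integral>\<^sup>+\<omega>. indicator C (B t \<omega>) * ?F (\<lambda>i\<in>{..<k}. increment t (Suc k) B i \<omega>) \<partial>N)"
    unfolding riemann_integral_law[OF t C g]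
    by (intro nn_integral_cong) (simp add: bridge_sum_eq_step_var[OF B _ t])
  also have "\<dots> = (\<integral>\<^sup>+x. indicator C x * (ennreal (normal_density 0 (sqrt t) x) *
       (\<integral>\<^sup>+\<omega>. ?F (\<lambda>i\<in>{..<k}. increment t (Suc k) B i \<omega> + (x - B t \<omega>) / real (Suc k)) \<partial>N)) \<partial>lborel)"
    by (rule brownian_bridge_disintegration[OF B t]) measurable
  also have "\<dots> = (\<integral>\<^sup>+x. indicator C x * (ennreal (normal_density 0 (sqrt t) x) *
        (\<integral>\<^sup>+\<omega>. gauss_mean g (bridge_sum t (Suc k) x (\<lambda>s. B s \<omega>)) \<partial>N)) \<partial>lborel)"
    by (intro nn_integral_cong arg_cong2[where f=times] refl) (simp add: bridge_sum_eq_step_var[OF B _ t])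
  finally show ?thesis .
qed

text \<open>Mean square convergence gives convergence in mean through
  \<open>\<bar>z\<bar> \<le> d + z\<^sup>2 / d\<close>; the choice \<open>d = sqrt (c k)\<close>
  balances the two terms.\<close>

lemma ito_integral_L1_approximation:
  assumes t: "t > 0" and b: "has_ito_integral N F W (\<lambda>s \<omega>. exp (B s \<omega>)) t b"
  shows "(\<lambda>k. \<integral>\<^sup>+\<omega>. ennreal \<bar>b \<omega> - riemann_integral t (Suc k) \<omega>\<bar> \<partial>N) \<longlonglongrightarrow> 0"
proof -
  define c where "c k = 4 * t * (exp (2 * t) * (exp (2 * (t / real (Suc k))) - 1))" for k
  have [measurable]: "b \<in> borel_measurable N" using b by (simp add: has_ito_integral_def)
  have [measurable]: "riemann_integral t m \<in> borel_measurable N" for m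
  proof -
    have [measurable]: "B (grid t m k) \<in> borel_measurable N" "W (grid t m k) \<in> borel_measurable N" for k
      using t brownian_motion_measurable[OF W] by simp_all
    show ?thesis unfolding riemann_integral_def[abs_def] by measurable
  qed
  have c: "c k > 0" for k using t by (simp add: c_def)
  have "(\<lambda>k. t / real (Suc k)) \<longlonglongrightarrow> 0"
    using LIMSEQ_Suc[OF lim_const_over_n[of t]] by simp
  then have "c \<longlonglongrightarrow> 4 * t * (exp (2 * t) * (exp (2 * 0) - 1))"
    unfolding c_def[abs_def] by (intro tendsto_intros)
  then have c0: "(\<lambda>k. ennreal (2 * sqrt (c k))) \<longlonglongrightarrow> 0"
    using tendsto_ennrealI[OF tendsto_mult_left[OF tendsto_real_sqrt, of c 0 sequentially 2]] by simp
  have le: "(\<integral>\<^sup>+\<omega>. ennreal \<bar>b \<omega> - riemann_integral t (Suc k) \<omega>\<bar> \<partial>N) \<le> ennreal (2 * sqrt (c k))" for k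
  proof -
    define d where "d = sqrt (c k)"
    have d: "d > 0" and dc: "1 / d * c k = d" using c[of k] by (simp_all add: d_def real_div_sqrt)
    have ineq: "\<bar>z\<bar> \<le> d + 1 / d * z\<^sup>2" for z :: real
    proof -
      have "\<bar>z\<bar> * d \<le> d\<^sup>2 + z\<^sup>2"
      proof -
        have "0 \<le> \<bar>z\<bar> * d" using d by simp
        then show ?thesis using sum_squares_bound[of "\<bar>z\<bar>" d] by (simp add: mult.assoc)
      qed
      then show ?thesis using d by (simp add: field_simps power2_eq_square)
    qed
    have "(\<integral>\<^sup>+\<omega>. ennreal \<bar>b \<omega> - riemann_integral t (Suc k) \<omega>\<bar> \<partial>N)
       \<le> (\<integral>\<^sup>+\<omega>. ennreal d + ennreal (1 / d) * ennreal ((b \<omega> - riemann_integral t (Suc k) \<omega>)\<^sup>2) \<partial>N)"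
    proof (intro nn_integral_mono)
      fix \<omega>
      have "ennreal \<bar>b \<omega> - riemann_integral t (Suc k) \<omega>\<bar> \<le> ennreal (d + 1 / d * (b \<omega> - riemann_integral t (Suc k) \<omega>)\<^sup>2)"
        by (intro ennreal_leI ineq)
      also have "\<dots> = ennreal d + ennreal (1 / d) * ennreal ((b \<omega> - riemann_integral t (Suc k) \<omega>)\<^sup>2)"
        using d by (subst ennreal_plus) (auto simp: ennreal_mult[symmetric])
      finally show "ennreal \<bar>b \<omega> - riemann_integral t (Suc k) \<omega>\<bar> \<le> \<dots>" .
    qed
    also have "\<dots> = ennreal d + ennreal (1 / d) * (\<integral>\<^sup>+\<omega>. ennreal ((b \<omega> - riemann_integral t (Suc k) \<omega>)\<^sup>2) \<partial>N)"
      by (simp add: nn_integral_add nn_integral_cmult emeasure_space_1)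
    also have "\<dots> \<le> ennreal d + ennreal (1 / d) * ennreal (c k)"
      using riemann_integral_approximation[OF t zero_less_Suc b, of k]
      by (intro add_left_mono mult_left_mono) (auto simp: c_def)
    also have "\<dots> = ennreal (d + 1 / d * c k)"
      using d c[of k] by (subst ennreal_plus) (auto simp: ennreal_mult[symmetric] less_imp_le)
    finally show ?thesis unfolding dc by (simp add: d_def)
  qed
  show ?thesis
    by (rule tendsto_sandwich[OF _ _ tendsto_const c0]) (use le in auto)
qed

text \<open>The Lipschitz bound turns convergence in mean of the left-endpoint sums into convergence
  of the left-hand side; continuity of \<open>g\<close> with values in \<open>[0, 1]\<close> lets
  the right-hand side pass to the limit by dominated convergence, over \<omega> and then over
  \<open>x\<close>.\<close>

lemma ito_integral_bridge_law:
  assumes t: "t > 0" and b: "has_ito_integral N F W (\<lambda>s \<omega>. exp (B s \<omega>)) t b"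
    and C[measurable]: "C \<in> sets borel"
    and g: "L-lipschitz_on UNIV g" "\<And>y. 0 \<le> g y" "\<And>y. g y \<le> 1"
  shows "(\<integral>\<^sup>+\<omega>. indicator C (B t \<omega>) * ennreal (g (b \<omega>)) \<partial>N)
    = (\<integral>\<^sup>+x. indicator C x * (ennreal (normal_density 0 (sqrt t) x) *
        (\<integral>\<^sup>+\<omega>. gauss_mean (\<lambda>y. ennreal (g y)) (bridge_var t x (\<lambda>s. B s \<omega>)) \<partial>N)) \<partial>lborel)"
    (is "?L = ?R")
proof -
  let ?g = "\<lambda>y. ennreal (g y)" and ?R' = "\<lambda>k. riemann_integral t (Suc k)"
  have gc: "continuous_on UNIV g" by (rule lipschitz_on_continuous_on[OF g(1)])
  then have gc': "continuous_on UNIV ?g" by (intro continuous_on_ennreal)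
  have [measurable]: "g \<in> borel_measurable borel" by (rule borel_measurable_continuous_onI[OF gc])
  have [measurable]: "b \<in> borel_measurable N" using b by (simp add: has_ito_integral_def)
  have Bt[measurable]: "B t \<in> borel_measurable N" using t by simp
  have R_m[measurable]: "riemann_integral t m \<in> borel_measurable N" for m
  proof -
    have [measurable]: "B (grid t m k) \<in> borel_measurable N" "W (grid t m k) \<in> borel_measurable N" for k
      using t brownian_motion_measurable[OF W] by simp_all
    show ?thesis unfolding riemann_integral_def[abs_def] by measurable
  qed
  have bs[measurable]: "(\<lambda>(x, \<omega>). bridge_sum t m x (\<lambda>s. B s \<omega>)) \<in> borel_measurable (borel \<Otimes>\<^sub>M N)" for m
    by (rule bridge_sum_measurable[OF t])
  have bv[measurable]: "(\<lambda>(x, \<omega>). bridge_var t x (\<lambda>s. B s \<omega>)) \<in> borel_measurable (borel \<Otimes>\<^sub>M N)"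
    by (rule bridge_var_measurable[OF t])
  have bs1[measurable]: "(\<lambda>\<omega>. bridge_sum t m x (\<lambda>s. B s \<omega>)) \<in> borel_measurable N" for m x
    using measurable_Pair2[OF bs, of x] by simp
  have bv1[measurable]: "(\<lambda>\<omega>. bridge_var t x (\<lambda>s. B s \<omega>)) \<in> borel_measurable N" for x
    by (rule bridge_var_measurable_section[OF t])
  define E where "E k = (\<integral>\<^sup>+\<omega>. indicator C (B t \<omega>) * ?g (?R' k \<omega>) \<partial>N)" for k
  define e where "e k = ennreal L * (\<integral>\<^sup>+\<omega>. ennreal \<bar>b \<omega> - ?R' k \<omega>\<bar> \<partial>N)" for k
  have L: "0 \<le> L" by (rule lipschitz_on_nonneg[OF g(1)])
  \<comment> \<open>Used with \<open>b\<close> and the left-endpoint sum in both orders, to bound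
    the difference of the expectations from both sides.\<close>
  have cmp: "(\<integral>\<^sup>+\<omega>. indicator C (B t \<omega>) * ?g (u \<omega>) \<partial>N) \<le> (\<integral>\<^sup>+\<omega>. indicator C (B t \<omega>) * ?g (v \<omega>) \<partial>N)
       + ennreal L * (\<integral>\<^sup>+\<omega>. ennreal \<bar>b \<omega> - ?R' k \<omega>\<bar> \<partial>N)"
    if uv: "\<And>\<omega>. \<bar>u \<omega> - v \<omega>\<bar> = \<bar>b \<omega> - ?R' k \<omega>\<bar>" and [measurable]: "v \<in> borel_measurable N" for u v :: "'b \<Rightarrow> real" and k
  proof -
    have "(\<integral>\<^sup>+\<omega>. indicator C (B t \<omega>) * ?g (u \<omega>) \<partial>N)
      \<le> (\<integral>\<^sup>+\<omega>. indicator C (B t \<omega>) * ?g (v \<omega>) + ennreal L * ennreal \<bar>b \<omega> - ?R' k \<omega>\<bar> \<partial>N)"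
    proof (intro nn_integral_mono)
      fix \<omega>
      have "\<bar>g (u \<omega>) - g (v \<omega>)\<bar> \<le> L * \<bar>u \<omega> - v \<omega>\<bar>"
        using lipschitz_onD[OF g(1), of "u \<omega>" "v \<omega>"] by (simp add: dist_real_def)
      then have "g (u \<omega>) \<le> g (v \<omega>) + L * \<bar>b \<omega> - ?R' k \<omega>\<bar>" unfolding uv by linarith
      then have "?g (u \<omega>) \<le> ?g (v \<omega>) + ennreal L * ennreal \<bar>b \<omega> - ?R' k \<omega>\<bar>"
        using L g(2) by (metis abs_ge_zero ennreal_leI ennreal_mult ennreal_plus mult_nonneg_nonneg)
      then show "indicator C (B t \<omega>) * ?g (u \<omega>) \<le> indicator C (B t \<omega>) * ?g (v \<omega>) + ennreal L * ennreal \<bar>b \<omega> - ?R' k \<omega>\<bar>"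
        by (auto simp: indicator_def)
    qed
    also have "\<dots> = (\<integral>\<^sup>+\<omega>. indicator C (B t \<omega>) * ?g (v \<omega>) \<partial>N) + ennreal L * (\<integral>\<^sup>+\<omega>. ennreal \<bar>b \<omega> - ?R' k \<omega>\<bar> \<partial>N)"
      by (simp add: nn_integral_add nn_integral_cmult)
    finally show ?thesis .
  qed
  have le1: "?L \<le> E k + e k" for k
    unfolding E_def e_def by (rule cmp) auto
  have le2: "E k \<le> ?L + e k" for k
    unfolding E_def e_def by (rule cmp) (auto simp: abs_minus_commute)
  have e0: "e \<longlonglongrightarrow> 0"
    using ennreal_tendsto_cmult[of "ennreal L", OF _ ito_integral_L1_approximation[OF t b]] by (simp add: e_def[abs_def])
  have E: "E \<longlonglongrightarrow> ?R"
    unfolding E_def[abs_def] riemann_integral_bridge_law[OF t C borel_measurable_continuous_onI[OF gc']]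
  proof (rule nn_integral_dominated_convergence[where w="\<lambda>x. ennreal (normal_density 0 (sqrt t) x)"])
    have le1: "(\<integral>\<^sup>+\<omega>. gauss_mean ?g (h \<omega>) \<partial>N) \<le> 1" for h
    proof -
      have "(\<integral>\<^sup>+\<omega>. gauss_mean ?g (h \<omega>) \<partial>N) \<le> (\<integral>\<^sup>+\<omega>. 1 \<partial>N)"
        by (intro nn_integral_mono gauss_mean_le_1) (use g(3) in \<open>simp add: ennreal_le_1\<close>)
      then show ?thesis by (simp add: emeasure_space_1)
    qed
    show "AE x in lborel. indicator C x * (ennreal (normal_density 0 (sqrt t) x) *
        (\<integral>\<^sup>+\<omega>. gauss_mean ?g (bridge_sum t (Suc k) x (\<lambda>s. B s \<omega>)) \<partial>N)) \<le> ennreal (normal_density 0 (sqrt t) x)" for k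
      using mult_left_mono[OF le1] by (auto simp: indicator_def)
    show "(\<integral>\<^sup>+x. ennreal (normal_density 0 (sqrt t) x) \<partial>lborel) < \<infinity>"
      using t by (subst nn_integral_eq_integral) auto
    show "AE x in lborel. (\<lambda>k. indicator C x * (ennreal (normal_density 0 (sqrt t) x) *
        (\<integral>\<^sup>+\<omega>. gauss_mean ?g (bridge_sum t (Suc k) x (\<lambda>s. B s \<omega>)) \<partial>N)))
      \<longlonglongrightarrow> indicator C x * (ennreal (normal_density 0 (sqrt t) x) * (\<integral>\<^sup>+\<omega>. gauss_mean ?g (bridge_var t x (\<lambda>s. B s \<omega>)) \<partial>N))"
    proof (rule AE_I2)
      fix x
      have "(\<lambda>k. \<integral>\<^sup>+\<omega>. gauss_mean ?g (bridge_sum t (Suc k) x (\<lambda>s. B s \<omega>)) \<partial>N)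
        \<longlonglongrightarrow> (\<integral>\<^sup>+\<omega>. gauss_mean ?g (bridge_var t x (\<lambda>s. B s \<omega>)) \<partial>N)"
      proof (rule nn_integral_dominated_convergence[where w="\<lambda>_. 1"])
        show "AE \<omega> in N. (\<lambda>k. gauss_mean ?g (bridge_sum t (Suc k) x (\<lambda>s. B s \<omega>))) \<longlonglongrightarrow> gauss_mean ?g (bridge_var t x (\<lambda>s. B s \<omega>))"
          by (intro AE_I2 gauss_mean_tendsto[OF gc'] LIMSEQ_Suc[OF bridge_sum_LIMSEQ[OF t B_continuous]])
             (use g(3) in \<open>auto simp: ennreal_le_1\<close>)
        show "AE \<omega> in N. gauss_mean ?g (bridge_sum t (Suc k) x (\<lambda>s. B s \<omega>)) \<le> 1" for k
          by (intro AE_I2 gauss_mean_le_1) (use g(3) in \<open>simp add: ennreal_le_1\<close>)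
      qed (auto simp: emeasure_space_1)
      then show "(\<lambda>k. indicator C x * (ennreal (normal_density 0 (sqrt t) x) *
          (\<integral>\<^sup>+\<omega>. gauss_mean ?g (bridge_sum t (Suc k) x (\<lambda>s. B s \<omega>)) \<partial>N)))
        \<longlonglongrightarrow> indicator C x * (ennreal (normal_density 0 (sqrt t) x) * (\<integral>\<^sup>+\<omega>. gauss_mean ?g (bridge_var t x (\<lambda>s. B s \<omega>)) \<partial>N))"
        by (intro ennreal_tendsto_cmult) (auto simp: indicator_def)
    qed
  qed measurable
  show ?thesis
  proof (rule antisym)
    show "?L \<le> ?R"
      using LIMSEQ_le_const[OF tendsto_add[OF E e0], of ?L] le1 by auto
    show "?R \<le> ?L"
      using LIMSEQ_le[OF E tendsto_add[OF tendsto_const[of ?L] e0]] le2 by auto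
  qed
qed

end

text \<open>The indicator of a half-line is the pointwise limit of the functions \<open>h n\<close>,
  which equal 1 up to \<open>c\<close> and then fall linearly to 0 with slope
  \<open>- (n + 1)\<close>. Hence the distribution functions agree.\<close>

lemma finite_borel_measure_eqI_lipschitz:
  assumes M: "finite_borel_measure M1" "finite_borel_measure M2"
    and eq: "\<And>L g. L-lipschitz_on UNIV g \<Longrightarrow> (\<And>y::real. 0 \<le> g y) \<Longrightarrow> (\<And>y. g y \<le> 1) \<Longrightarrow>
      (\<integral>\<^sup>+y. ennreal (g y) \<partial>M1) = (\<integral>\<^sup>+y. ennreal (g y) \<partial>M2)"
  shows "M1 = M2"
proof (rule cdf_unique'[OF M], rule ext)
  fix c :: real
  interpret M1: finite_borel_measure M1 by fact
  interpret M2: finite_borel_measure M2 by fact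
  define h where "h n y = max 0 (min 1 (1 - real (Suc n) * (y - c)))" for n y
  have lip: "(real (Suc n))-lipschitz_on UNIV (h n)" for n
  proof (rule lipschitz_onI)
    fix x y :: real
    have "\<bar>h n x - h n y\<bar> \<le> \<bar>(1 - real (Suc n) * (x - c)) - (1 - real (Suc n) * (y - c))\<bar>"
      unfolding h_def by linarith
    also have "\<dots> = \<bar>real (Suc n) * (x - y)\<bar>" by (simp add: algebra_simps abs_minus_commute)
    finally show "dist (h n x) (h n y) \<le> real (Suc n) * dist x y"
      by (simp add: dist_real_def abs_mult)
  qed simp
  have h_meas[measurable]: "h n \<in> borel_measurable borel" for n
    by (rule borel_measurable_continuous_onI[OF lipschitz_on_continuous_on[OF lip]])
  have lim: "(\<lambda>n. \<integral>\<^sup>+y. ennreal (h n y) \<partial>M) \<longlonglongrightarrow> emeasure M {..c}" if "finite_borel_measure M" for M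
  proof -
    interpret finite_borel_measure M by fact
    have "(\<lambda>n. \<integral>\<^sup>+y. ennreal (h n y) \<partial>M) \<longlonglongrightarrow> (\<integral>\<^sup>+y. indicator {..c} y \<partial>M)"
    proof (rule nn_integral_dominated_convergence[where w="\<lambda>_. 1"])
      show "AE y in M. (\<lambda>n. ennreal (h n y)) \<longlonglongrightarrow> indicator {..c} y"
      proof (rule AE_I2)
        fix y
        have "eventually (\<lambda>n. h n y = indicator {..c} y) sequentially"
        proof (cases "y \<le> c")
          case True
          then have "real (Suc n) * (y - c) \<le> 0" for n by (intro mult_nonneg_nonpos) auto
          then have "h n y = 1" for n unfolding h_def by (smt (verit))
          then show ?thesis using True by simp
        next
          case False
          then obtain n0 :: nat where n0: "1 / (y - c) < real n0" using reals_Archimedean2 by blast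
          show ?thesis
          proof (rule eventually_sequentiallyI[of n0])
            fix n assume "n0 \<le> n"
            then have "1 / (y - c) < real (Suc n)" using n0 by simp
            then have "1 < real (Suc n) * (y - c)" using False by (simp add: field_simps)
            then show "h n y = indicator {..c} y" using False by (simp add: h_def)
          qed
        qed
        then show "(\<lambda>n. ennreal (h n y)) \<longlonglongrightarrow> indicator {..c} y"
          by (intro tendsto_eventually) (auto elim!: eventually_mono simp: indicator_def)
      qed
      show "(\<integral>\<^sup>+y. 1 \<partial>M) < \<infinity>" by (simp add: emeasure_finite less_top[symmetric])
      show "AE y in M. ennreal (h n y) \<le> 1" for n
        by (rule AE_I2) (simp add: ennreal_le_1 h_def)
      show "(\<lambda>y. ennreal (h n y)) \<in> borel_measurable M" for n
        using M_is_borel by (simp cong: measurable_cong_sets)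
      show "indicator {..c} \<in> borel_measurable M"
        using M_is_borel by (simp cong: measurable_cong_sets)
    qed simp
    then show ?thesis using M_is_borel by simp
  qed
  have "emeasure M1 {..c} = emeasure M2 {..c}"
  proof (rule LIMSEQ_unique[OF lim[OF M(1)]])
    show "(\<lambda>n. \<integral>\<^sup>+y. ennreal (h n y) \<partial>M1) \<longlonglongrightarrow> emeasure M2 {..c}"
      using lim[OF M(2)] eq[OF lip] by (simp add: h_def)
  qed
  then show "cdf M1 c = cdf M2 c"
    by (simp add: cdf_def measure_def)
qed

text \<open>The inverse square root is traded for \<open>1 / a\<close> through
  \<open>z \<le> 1 + z\<^sup>2\<close>, because the reciprocal of the conditional variance is the
  quantity whose expectation can be bounded.\<close>

lemma normal_density_0_le:
  assumes a: "a > 0"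
  shows "normal_density 0 (sqrt a) y \<le> 1 + 1 / a"
proof -
  have "normal_density 0 (sqrt a) y \<le> 1 / sqrt (2 * pi * a)"
    using a by (simp add: normal_density_def divide_right_mono)
  also have "\<dots> \<le> 1 / sqrt a"
  proof (intro divide_left_mono real_sqrt_le_mono)
    have "1 * a \<le> (2 * pi) * a" using a pi_ge_two by (intro mult_right_mono) auto
    then show "a \<le> 2 * pi * a" by simp
  qed (use a in auto)
  also have "\<dots> \<le> 1 + 1 / a"
  proof -
    have "1 / a = (1 / sqrt a)\<^sup>2" using a by (simp add: power_divide)
    moreover have "z \<le> 1 + z\<^sup>2" for z :: real
      using zero_le_power2[of "z - 1/2"] by (simp add: power2_eq_square algebra_simps)
    ultimately show ?thesis by simp
  qed
  finally show ?thesis .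
qed

text \<open>The logarithm carries the measure \<open>da / a\<close> on the positive half-line to
  Lebesgue measure: the interval from \<open>l\<close> to \<open>u\<close> pulls back to the one
  from \<open>exp l\<close> to \<open>exp u\<close>, on which \<open>1 / a\<close> integrates to
  \<open>u - l\<close>.\<close>

lemma lborel_eq_distr_ln: "lborel = distr (density lborel (\<lambda>a. ennreal (indicator {0<..} a / a))) borel ln"
proof (rule lborel_eqI)
  fix l u :: real assume "\<And>b. b \<in> Basis \<Longrightarrow> l \<bullet> b \<le> u \<bullet> b"
  then have lu: "l \<le> u" by simp
  have v: "ln -` {l<..<u} \<inter> {0<..} = {exp l<..<exp u}"
  proof -
    have "ln a < u \<longleftrightarrow> a < exp u" "l < ln a \<longleftrightarrow> exp l < a" if "a > 0" for a
      using that by (metis exp_ln exp_less_cancel_iff)+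
    moreover have "a > 0" if "exp l < a" for a using that exp_gt_zero[of l] by linarith
    ultimately show ?thesis by auto
  qed
  have "emeasure (distr (density lborel (\<lambda>a. ennreal (indicator {0<..} a / a))) borel ln) (box l u)
      = (\<integral>\<^sup>+a. ennreal (indicator {0<..} a / a) * indicator (ln -` {l<..<u}) a \<partial>lborel)"
  proof -
    have "(ln :: real \<Rightarrow> real) \<in> borel_measurable borel" by measurable
    then have "ln -` {l<..<u} \<in> sets borel" by (rule measurable_sets_borel) simp
    then show ?thesis by (simp add: emeasure_distr emeasure_density box_real)
  qed
  also have "\<dots> = (\<integral>\<^sup>+a. ennreal (1 / a) * indicator {exp l<..<exp u} a \<partial>lborel)"
    by (intro nn_integral_cong) (auto simp: indicator_def v[symmetric])
  \<comment> \<open>The fundamental theorem of calculus is applied on the closed interval; the two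
    endpoints that are added form a null set.\<close>
  also have "\<dots> = (\<integral>\<^sup>+a. ennreal (1 / a) * indicator {exp l..exp u} a \<partial>lborel)"
    using AE_lborel_singleton[of "exp l"] AE_lborel_singleton[of "exp u"]
    by (intro nn_integral_cong_AE) (auto simp: indicator_def)
  also have "\<dots> = ennreal (ln (exp u) - ln (exp l))"
  proof (rule nn_integral_FTC_Icc)
    fix x assume "x \<in> {exp l..exp u}"
    then have "x > 0" by (meson atLeastAtMost_iff exp_gt_zero less_le_trans)
    then show "DERIV ln x :> 1 / x" "0 \<le> 1 / x"
      by (auto intro!: derivative_eq_intros simp: divide_inverse)
  qed (use lu in auto)
  finally show "emeasure (distr (density lborel (\<lambda>a. ennreal (indicator {0<..} a / a))) borel ln) (box l u) = (\<Prod>b\<in>Basis. (u - l) \<bullet> b)"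
    by simp
qed simp

lemma nn_integral_ln_substitution:
  assumes [measurable]: "f \<in> borel_measurable borel"
  shows "(\<integral>\<^sup>+a. ennreal (indicator {0<..} a / a) * f (ln a) \<partial>lborel) = (\<integral>\<^sup>+x. f x \<partial>lborel)"
  by (subst (2) lborel_eq_distr_ln) (simp add: nn_integral_distr nn_integral_density)

section \<open>Integrability of the reciprocal functional and the joint density\<close>

context two_brownian
begin

text \<open>The exponent mixes the correlated values of \<open>B\<close> at a grid point and at
  \<open>t\<close>. The inequality \<open>u * v \<le> (u\<^sup>2 + v\<^sup>2) / 2\<close> separates
  them, and both exponential moments are at most \<open>exp (8 * t)\<close> since the grid point
  does not exceed \<open>t\<close>. What matters later is that the bound does not depend on
  \<open>m\<close>.\<close>

lemma nn_integral_bridge_dual: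
  assumes t: "t > 0" and m: "m > 0"
  shows "(\<integral>\<^sup>+\<omega>. ennreal (bridge_dual t m (\<lambda>s. B s \<omega>)) \<partial>N) \<le> ennreal (t * exp (8 * t))"
proof -
  have B_m[measurable]: "B t \<in> borel_measurable N" "B (grid t m k) \<in> borel_measurable N" for k
    using t by simp_all
  have bnd: "(\<integral>\<^sup>+\<omega>. ennreal (exp (- 2 * bridge_path t 0 (\<lambda>s. B s \<omega>) (grid t m k)) * (t / real m)) \<partial>N)
      \<le> ennreal (exp (8 * t) * (t / real m))" if "k < m" for k
  proof -
    let ?g = "grid t m k"
    have g: "0 \<le> ?g" "?g \<le> t" using t grid_mono[of t k m m] that by auto
    have "(\<integral>\<^sup>+\<omega>. ennreal (exp (- 2 * bridge_path t 0 (\<lambda>s. B s \<omega>) ?g) * (t / real m)) \<partial>N)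
        \<le> (\<integral>\<^sup>+\<omega>. ennreal (t / real m / 2) * (ennreal (exp (- 4 * B ?g \<omega>)) + ennreal (exp (4 * ?g / t * B t \<omega>))) \<partial>N)"
    proof (intro nn_integral_mono)
      fix \<omega>
      have "exp (- 2 * bridge_path t 0 (\<lambda>s. B s \<omega>) ?g) = exp (- 2 * B ?g \<omega>) * exp (2 * ?g / t * B t \<omega>)"
        by (simp add: bridge_path_def mult_exp_exp algebra_simps)
      also have "\<dots> \<le> ((exp (- 2 * B ?g \<omega>))\<^sup>2 + (exp (2 * ?g / t * B t \<omega>))\<^sup>2) / 2"
        using sum_squares_bound[of "exp (- 2 * B ?g \<omega>)" "exp (2 * ?g / t * B t \<omega>)"] by simp
      also have "\<dots> = (exp (- 4 * B ?g \<omega>) + exp (4 * ?g / t * B t \<omega>)) / 2"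
        unfolding exp_double[symmetric] by simp
      finally have "exp (- 2 * bridge_path t 0 (\<lambda>s. B s \<omega>) ?g) * (t / real m) \<le> (exp (- 4 * B ?g \<omega>) + exp (4 * ?g / t * B t \<omega>)) / 2 * (t / real m)"
        using t by (intro mult_right_mono) auto
      then have "exp (- 2 * bridge_path t 0 (\<lambda>s. B s \<omega>) ?g) * (t / real m) \<le> t / real m / 2 * (exp (- 4 * B ?g \<omega>) + exp (4 * ?g / t * B t \<omega>))"
        by (simp add: mult.commute)
      then show "ennreal (exp (- 2 * bridge_path t 0 (\<lambda>s. B s \<omega>) ?g) * (t / real m))
        \<le> ennreal (t / real m / 2) * (ennreal (exp (- 4 * B ?g \<omega>)) + ennreal (exp (4 * ?g / t * B t \<omega>)))"
        using t by (subst ennreal_plus[symmetric], simp, simp, subst ennreal_mult[symmetric], simp, simp, intro ennreal_leI)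
    qed
    also have "\<dots> = ennreal (t / real m / 2) * (ennreal (exp ((- 4)\<^sup>2 * ?g / 2)) + ennreal (exp ((4 * ?g / t)\<^sup>2 * t / 2)))"
      using brownian_exp_moment_0[OF B g(1), of "-4"] brownian_exp_moment_0[OF B less_imp_le[OF t], of "4 * ?g / t"]
      by (simp add: nn_integral_cmult nn_integral_add)
    also have "\<dots> \<le> ennreal (t / real m / 2) * (ennreal (exp (8 * t)) + ennreal (exp (8 * t)))"
    proof -
      have "(4 * ?g / t)\<^sup>2 * t / 2 = 8 * ?g * (?g / t)" using t by (simp add: power2_eq_square field_simps)
      also have "\<dots> \<le> 8 * t * 1" using g t by (intro mult_mono) auto
      finally show ?thesis
        using g by (intro mult_left_mono add_mono ennreal_leI) auto
    qed
    also have "\<dots> = ennreal (exp (8 * t) * (t / real m))"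
      using t by (subst ennreal_plus[symmetric], simp, simp, subst ennreal_mult[symmetric], simp, simp) (simp add: field_simps)
    finally show ?thesis .
  qed
  have "(\<integral>\<^sup>+\<omega>. ennreal (bridge_dual t m (\<lambda>s. B s \<omega>)) \<partial>N)
      = (\<Sum>k<m. \<integral>\<^sup>+\<omega>. ennreal (exp (- 2 * bridge_path t 0 (\<lambda>s. B s \<omega>) (grid t m k)) * (t / real m)) \<partial>N)"
    unfolding bridge_dual_def using t
    by (subst nn_integral_sum[symmetric]) (auto simp: bridge_path_def sum_ennreal intro!: nn_integral_cong)
  also have "\<dots> \<le> (\<Sum>k<m. ennreal (exp (8 * t) * (t / real m)))"
    by (intro sum_mono bnd) simp
  also have "\<dots> = ennreal (t * exp (8 * t))"
    using t m by (simp add: ennreal_of_nat_eq_real_of_nat ennreal_mult[symmetric] field_simps)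
  finally show ?thesis .
qed

text \<open>Fatou's lemma for \<open>bridge_dual\<close>, whose means are bounded uniformly in
  \<open>m\<close>.\<close>

lemma integrable_inverse_bridge_var:
  assumes t: "t > 0"
  shows "integrable N (\<lambda>\<omega>. 1 / bridge_var t 0 (\<lambda>s. B s \<omega>))"
proof (rule integrableI_nonneg)
  have [measurable]: "(\<lambda>\<omega>. bridge_var t 0 (\<lambda>s. B s \<omega>)) \<in> borel_measurable N"
    by (rule bridge_var_measurable_section[OF t])
  show "(\<lambda>\<omega>. 1 / bridge_var t 0 (\<lambda>s. B s \<omega>)) \<in> borel_measurable N" by measurable
  show "AE \<omega> in N. 0 \<le> 1 / bridge_var t 0 (\<lambda>s. B s \<omega>)"
    using bridge_var_0_pos[OF t B_continuous] by (auto simp: less_imp_le)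
  have dm[measurable]: "(\<lambda>\<omega>. bridge_dual t m (\<lambda>s. B s \<omega>)) \<in> borel_measurable N" for m
  proof -
    have [measurable]: "B t \<in> borel_measurable N" "B (grid t m k) \<in> borel_measurable N" for k
      using t by simp_all
    show ?thesis unfolding bridge_dual_def bridge_path_def by measurable
  qed
  have "(\<integral>\<^sup>+\<omega>. ennreal (1 / bridge_var t 0 (\<lambda>s. B s \<omega>)) \<partial>N)
      \<le> (\<integral>\<^sup>+\<omega>. liminf (\<lambda>m. ennreal (bridge_dual t m (\<lambda>s. B s \<omega>) / t\<^sup>2)) \<partial>N)"
  proof (intro nn_integral_mono)
    fix \<omega> assume "\<omega> \<in> space N"
    from inverse_bridge_var[OF t B_continuous[OF this]]
    show "ennreal (1 / bridge_var t 0 (\<lambda>s. B s \<omega>)) \<le> liminf (\<lambda>m. ennreal (bridge_dual t m (\<lambda>s. B s \<omega>) / t\<^sup>2))"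
      .
  qed
  also have "\<dots> \<le> liminf (\<lambda>m. \<integral>\<^sup>+\<omega>. ennreal (bridge_dual t m (\<lambda>s. B s \<omega>) / t\<^sup>2) \<partial>N)"
    by (rule nn_integral_liminf) measurable
  also have "\<dots> \<le> liminf (\<lambda>m. ennreal (1 / t\<^sup>2) * ennreal (t * exp (8 * t)))"
  proof (intro Liminf_mono eventually_sequentiallyI[of 1])
    fix m :: nat assume m: "1 \<le> m"
    have "(\<integral>\<^sup>+\<omega>. ennreal (bridge_dual t m (\<lambda>s. B s \<omega>) / t\<^sup>2) \<partial>N)
        = ennreal (1 / t\<^sup>2) * (\<integral>\<^sup>+\<omega>. ennreal (bridge_dual t m (\<lambda>s. B s \<omega>)) \<partial>N)"
      by (subst nn_integral_cmult[symmetric]) (auto simp: ennreal_mult'[symmetric])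
    then show "(\<integral>\<^sup>+\<omega>. ennreal (bridge_dual t m (\<lambda>s. B s \<omega>) / t\<^sup>2) \<partial>N) \<le> ennreal (1 / t\<^sup>2) * ennreal (t * exp (8 * t))"
      using nn_integral_bridge_dual[OF t, of m] m by (simp add: mult_left_mono)
  qed
  also have "\<dots> < \<infinity>" by (simp add: Liminf_const ennreal_mult_less_top)
  finally show "(\<integral>\<^sup>+\<omega>. ennreal (1 / bridge_var t 0 (\<lambda>s. B s \<omega>)) \<partial>N) < \<infinity>" .
qed

text \<open>The density of \<open>(B t, b)\<close> with respect to Lebesgue measure, as
  \<open>joint_law\<close> shows: the density of the endpoint \<open>x\<close> times the conditional
  normal density of the integral, averaged over the bridge from 0 to \<open>x\<close>.\<close>

definition joint_density :: "real \<Rightarrow> real \<Rightarrow> real \<Rightarrow> real" where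
  "joint_density t x y = normal_density 0 (sqrt t) x *
     (\<integral>\<omega>. normal_density 0 (sqrt (bridge_var t x (\<lambda>s. B s \<omega>))) y \<partial>N)"

text \<open>One majorant for all \<open>y\<close> and all endpoints in a bounded range: the
  functional at \<open>x\<close> is at least \<open>exp (- 2 * K)\<close> times the one at 0, whose
  reciprocal is integrable.\<close>

lemma normal_density_bridge_le:
  assumes t: "t > 0" and \<omega>: "\<omega> \<in> space N" and x: "\<bar>x\<bar> \<le> K"
  shows "normal_density 0 (sqrt (bridge_var t x (\<lambda>s. B s \<omega>))) y \<le> 1 + exp (2 * K) * (1 / bridge_var t 0 (\<lambda>s. B s \<omega>))"
proof -
  let ?A = "\<lambda>x. bridge_var t x (\<lambda>s. B s \<omega>)"
  have pos: "?A x > 0" "?A 0 > 0" using bridge_var_pos[OF t B_continuous[OF \<omega>]] by blast+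
  have "exp (- 2 * K) * ?A 0 \<le> exp (- 2 * \<bar>x\<bar>) * ?A 0"
    using x pos by (intro mult_right_mono) auto
  also have "\<dots> \<le> ?A x" by (rule bridge_var_lower[OF t B_continuous[OF \<omega>]])
  finally have "1 / ?A x \<le> 1 / (exp (- 2 * K) * ?A 0)" using pos by (intro divide_left_mono) auto
  also have "\<dots> = exp (2 * K) * (1 / ?A 0)" by (simp add: exp_minus field_simps)
  finally show ?thesis using normal_density_0_le[OF pos(1), of y] by linarith
qed

lemma integrable_normal_density_bridge:
  assumes t: "t > 0"
  shows "integrable N (\<lambda>\<omega>. normal_density 0 (sqrt (bridge_var t x (\<lambda>s. B s \<omega>))) y)"
proof (rule Bochner_Integration.integrable_bound)
  have [measurable]: "(\<lambda>\<omega>. bridge_var t x (\<lambda>s. B s \<omega>)) \<in> borel_measurable N"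
    by (rule bridge_var_measurable_section[OF t])
  show "(\<lambda>\<omega>. normal_density 0 (sqrt (bridge_var t x (\<lambda>s. B s \<omega>))) y) \<in> borel_measurable N" by measurable
  show "integrable N (\<lambda>\<omega>. 1 + exp (2 * \<bar>x\<bar>) * (1 / bridge_var t 0 (\<lambda>s. B s \<omega>)))"
    by (intro Bochner_Integration.integrable_add integrable_mult_right integrable_inverse_bridge_var[OF t]) simp
  show "AE \<omega> in N. norm (normal_density 0 (sqrt (bridge_var t x (\<lambda>s. B s \<omega>))) y)
      \<le> norm (1 + exp (2 * \<bar>x\<bar>) * (1 / bridge_var t 0 (\<lambda>s. B s \<omega>)))"
    using normal_density_bridge_le[OF t _ order_refl, of _ x y] by (auto intro!: order_trans[OF _ abs_ge_self])
qed

lemma continuous_joint_density: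
  assumes t: "t > 0"
  shows "continuous_on UNIV (\<lambda>z. joint_density t (fst z) (snd z))"
proof -
  have "continuous_on UNIV (\<lambda>z. \<integral>\<omega>. normal_density 0 (sqrt (bridge_var t (fst z) (\<lambda>s. B s \<omega>))) (snd z) \<partial>N)"
    unfolding continuous_on_sequentially
  proof (intro ballI allI impI, elim conjE)
    fix z :: "real \<times> real" and u :: "nat \<Rightarrow> real \<times> real" assume u: "u \<longlonglongrightarrow> z"
    have uf: "(\<lambda>n. fst (u n)) \<longlonglongrightarrow> fst z" and us: "(\<lambda>n. snd (u n)) \<longlonglongrightarrow> snd z"
      by (intro tendsto_intros u)+
    \<comment> \<open>A convergent sequence of endpoints is bounded, which yields one majorant for
      all \<open>n\<close>.\<close>
    from convergent_imp_Bseq[OF convergentI[OF uf]] obtain K where K: "\<And>n. \<bar>fst (u n)\<bar> \<le> K"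
      unfolding Bseq_def by auto
    have [measurable]: "(\<lambda>\<omega>. bridge_var t x (\<lambda>s. B s \<omega>)) \<in> borel_measurable N" for x
      by (rule bridge_var_measurable_section[OF t])
    have "(\<lambda>n. \<integral>\<omega>. normal_density 0 (sqrt (bridge_var t (fst (u n)) (\<lambda>s. B s \<omega>))) (snd (u n)) \<partial>N)
      \<longlonglongrightarrow> (\<integral>\<omega>. normal_density 0 (sqrt (bridge_var t (fst z) (\<lambda>s. B s \<omega>))) (snd z) \<partial>N)"
    proof (rule integral_dominated_convergence)
      show "integrable N (\<lambda>\<omega>. 1 + exp (2 * K) * (1 / bridge_var t 0 (\<lambda>s. B s \<omega>)))"
        by (intro Bochner_Integration.integrable_add integrable_mult_right integrable_inverse_bridge_var[OF t]) simp
      show "AE \<omega> in N. norm (normal_density 0 (sqrt (bridge_var t (fst (u n)) (\<lambda>s. B s \<omega>))) (snd (u n)))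
          \<le> 1 + exp (2 * K) * (1 / bridge_var t 0 (\<lambda>s. B s \<omega>))" for n
        using normal_density_bridge_le[OF t _ K] by auto
      show "AE \<omega> in N. (\<lambda>n. normal_density 0 (sqrt (bridge_var t (fst (u n)) (\<lambda>s. B s \<omega>))) (snd (u n)))
         \<longlonglongrightarrow> normal_density 0 (sqrt (bridge_var t (fst z) (\<lambda>s. B s \<omega>))) (snd z)"
      proof (rule AE_I2)
        fix \<omega> assume \<omega>: "\<omega> \<in> space N"
        have "(\<lambda>n. bridge_var t (fst (u n)) (\<lambda>s. B s \<omega>)) \<longlonglongrightarrow> bridge_var t (fst z) (\<lambda>s. B s \<omega>)"
          by (rule continuous_on_tendsto_compose[OF continuous_bridge_var[OF t B_continuous[OF \<omega>]] uf]) auto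
        moreover have "bridge_var t (fst z) (\<lambda>s. B s \<omega>) > 0"
          by (rule bridge_var_pos[OF t B_continuous[OF \<omega>]])
        ultimately show "(\<lambda>n. normal_density 0 (sqrt (bridge_var t (fst (u n)) (\<lambda>s. B s \<omega>))) (snd (u n)))
         \<longlonglongrightarrow> normal_density 0 (sqrt (bridge_var t (fst z) (\<lambda>s. B s \<omega>))) (snd z)"
          unfolding normal_density_def by (intro tendsto_intros us) auto
      qed
    qed measurable
    then show "((\<lambda>z. \<integral>\<omega>. normal_density 0 (sqrt (bridge_var t (fst z) (\<lambda>s. B s \<omega>))) (snd z) \<partial>N) \<circ> u)
      \<longlonglongrightarrow> (\<integral>\<omega>. normal_density 0 (sqrt (bridge_var t (fst z) (\<lambda>s. B s \<omega>))) (snd z) \<partial>N)"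
      by (simp add: comp_def)
  qed
  then show ?thesis
    unfolding joint_density_def normal_density_def[of 0 "sqrt t"]
    by (intro continuous_intros) (use t in auto)
qed

lemma measurable_joint_density [measurable (raw)]:
  assumes t: "t > 0" and [measurable]: "f \<in> borel_measurable M" "g \<in> borel_measurable M"
  shows "(\<lambda>w. joint_density t (f w) (g w)) \<in> borel_measurable M"
proof -
  have "(\<lambda>z. joint_density t (fst z) (snd z)) \<in> borel_measurable (borel \<Otimes>\<^sub>M borel)"
    unfolding borel_prod by (rule borel_measurable_continuous_onI[OF continuous_joint_density[OF t]])
  from measurable_compose[OF _ this, of "\<lambda>w. (f w, g w)" M] show ?thesis by simp
qed

lemma joint_density_nonneg: "0 \<le> joint_density t x y"
  unfolding joint_density_def by (intro mult_nonneg_nonneg integral_nonneg_AE) auto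

text \<open>For a fixed Borel set \<open>C\<close> of endpoints both sides are finite measures in
  the second variable. By \<open>ito_integral_bridge_law\<close> and Fubini they agree on Lipschitz
  functions, hence they are equal; this settles all rectangles, which generate the product
  \<sigma>-algebra.\<close>

lemma joint_law:
  assumes t: "t > 0" and b: "has_ito_integral N F W (\<lambda>s \<omega>. exp (B s \<omega>)) t b"
  shows "distr N (borel \<Otimes>\<^sub>M borel) (\<lambda>\<omega>. (B t \<omega>, b \<omega>))
    = density (lborel \<Otimes>\<^sub>M lborel) (\<lambda>z. ennreal (joint_density t (fst z) (snd z)))"
    (is "?L = ?R")
proof -
  have b_m[measurable]: "b \<in> borel_measurable N" using b by (simp add: has_ito_integral_def)
  have Bt[measurable]: "B t \<in> borel_measurable N" using t by simp
  note t [measurable]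
  have bv[measurable]: "(\<lambda>(x, \<omega>). bridge_var t x (\<lambda>s. B s \<omega>)) \<in> borel_measurable (borel \<Otimes>\<^sub>M N)"
    by (rule bridge_var_measurable[OF t])
  have bv1[measurable]: "(\<lambda>\<omega>. bridge_var t x (\<lambda>s. B s \<omega>)) \<in> borel_measurable N" for x
    by (rule bridge_var_measurable_section[OF t])
  interpret LN: pair_sigma_finite lborel N ..
  have key: "(\<integral>\<^sup>+\<omega>. indicator C (B t \<omega>) * ennreal (g (b \<omega>)) \<partial>N)
      = (\<integral>\<^sup>+y. ennreal (g y) * (\<integral>\<^sup>+x. indicator C x * ennreal (joint_density t x y) \<partial>lborel) \<partial>lborel)"
    if C[measurable]: "C \<in> sets borel" and g: "L-lipschitz_on UNIV g" "\<And>y. 0 \<le> g y" "\<And>y. g y \<le> 1" for C L g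
  proof -
    have [measurable]: "g \<in> borel_measurable borel"
      by (rule borel_measurable_continuous_onI[OF lipschitz_on_continuous_on[OF g(1)]])
    have inner: "ennreal (normal_density 0 (sqrt t) x) * (\<integral>\<^sup>+\<omega>. gauss_mean (\<lambda>y. ennreal (g y)) (bridge_var t x (\<lambda>s. B s \<omega>)) \<partial>N)
        = (\<integral>\<^sup>+y. ennreal (g y) * ennreal (joint_density t x y) \<partial>lborel)" for x
    proof -
      have "(\<integral>\<^sup>+\<omega>. gauss_mean (\<lambda>y. ennreal (g y)) (bridge_var t x (\<lambda>s. B s \<omega>)) \<partial>N)
          = (\<integral>\<^sup>+\<omega>. (\<integral>\<^sup>+y. ennreal (g y) * ennreal (normal_density 0 (sqrt (bridge_var t x (\<lambda>s. B s \<omega>))) y) \<partial>lborel) \<partial>N)"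
        by (intro nn_integral_cong gauss_mean_density bridge_var_pos[OF t B_continuous]) auto
      also have "\<dots> = (\<integral>\<^sup>+y. (\<integral>\<^sup>+\<omega>. ennreal (g y) * ennreal (normal_density 0 (sqrt (bridge_var t x (\<lambda>s. B s \<omega>))) y) \<partial>N) \<partial>lborel)"
        by (rule LN.Fubini') measurable
      also have "\<dots> = (\<integral>\<^sup>+y. ennreal (g y) * ennreal (\<integral>\<omega>. normal_density 0 (sqrt (bridge_var t x (\<lambda>s. B s \<omega>))) y \<partial>N) \<partial>lborel)"
        by (intro nn_integral_cong)
           (simp add: nn_integral_cmult nn_integral_eq_integral[OF integrable_normal_density_bridge[OF t]])
      finally have "ennreal (normal_density 0 (sqrt t) x) * (\<integral>\<^sup>+\<omega>. gauss_mean (\<lambda>y. ennreal (g y)) (bridge_var t x (\<lambda>s. B s \<omega>)) \<partial>N)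
        = (\<integral>\<^sup>+y. ennreal (normal_density 0 (sqrt t) x) * (ennreal (g y) * ennreal (\<integral>\<omega>. normal_density 0 (sqrt (bridge_var t x (\<lambda>s. B s \<omega>))) y \<partial>N)) \<partial>lborel)"
        by (subst nn_integral_cmult) auto
      then show ?thesis
        by (simp add: joint_density_def ennreal_mult' mult_ac)
    qed
    have "(\<integral>\<^sup>+\<omega>. indicator C (B t \<omega>) * ennreal (g (b \<omega>)) \<partial>N)
      = (\<integral>\<^sup>+x. (\<integral>\<^sup>+y. indicator C x * (ennreal (g y) * ennreal (joint_density t x y)) \<partial>lborel) \<partial>lborel)"
      unfolding ito_integral_bridge_law[OF t b C g] inner
      by (intro nn_integral_cong nn_integral_cmult[symmetric]) measurable
    also have "\<dots> = (\<integral>\<^sup>+y. (\<integral>\<^sup>+x. indicator C x * (ennreal (g y) * ennreal (joint_density t x y)) \<partial>lborel) \<partial>lborel)"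
      by (rule lborel_pair.Fubini'[symmetric]) measurable
    also have "\<dots> = (\<integral>\<^sup>+y. ennreal (g y) * (\<integral>\<^sup>+x. indicator C x * ennreal (joint_density t x y) \<partial>lborel) \<partial>lborel)"
      by (intro nn_integral_cong, subst nn_integral_cmult[symmetric]) (auto simp: mult_ac)
    finally show ?thesis .
  qed
  have rect: "emeasure ?L (C \<times> D) = emeasure ?R (C \<times> D)" if C[measurable]: "C \<in> sets borel" and D[measurable]: "D \<in> sets borel" for C D
  proof -
    define M1 where "M1 = distr (density N (\<lambda>\<omega>. indicator C (B t \<omega>))) borel b"
    define M2 where "M2 = density lborel (\<lambda>y. \<integral>\<^sup>+x. indicator C x * ennreal (joint_density t x y) \<partial>lborel)"
    have i1: "(\<integral>\<^sup>+y. h y \<partial>M1) = (\<integral>\<^sup>+\<omega>. indicator C (B t \<omega>) * h (b \<omega>) \<partial>N)" if [measurable]: "h \<in> borel_measurable borel" for h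
      unfolding M1_def by (simp add: nn_integral_distr nn_integral_density)
    have i2: "(\<integral>\<^sup>+y. h y \<partial>M2) = (\<integral>\<^sup>+y. h y * (\<integral>\<^sup>+x. indicator C x * ennreal (joint_density t x y) \<partial>lborel) \<partial>lborel)"
      if [measurable]: "h \<in> borel_measurable borel" for h
      unfolding M2_def by (simp add: nn_integral_density mult.commute)
    have eq: "(\<integral>\<^sup>+y. ennreal (g y) \<partial>M1) = (\<integral>\<^sup>+y. ennreal (g y) \<partial>M2)"
      if g: "L-lipschitz_on UNIV g" "\<And>y::real. 0 \<le> g y" "\<And>y. g y \<le> 1" for L g
    proof -
      have [measurable]: "g \<in> borel_measurable borel"
        by (rule borel_measurable_continuous_onI[OF lipschitz_on_continuous_on[OF g(1)]])
      show ?thesis using key[OF C g] by (simp add: i1 i2)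
    qed
    have fin1: "emeasure M1 UNIV < \<infinity>"
    proof -
      have "emeasure M1 UNIV = (\<integral>\<^sup>+\<omega>. indicator C (B t \<omega>) \<partial>N)"
        using i1[of "\<lambda>_. 1"] by (simp add: M1_def)
      also have "\<dots> \<le> (\<integral>\<^sup>+\<omega>. 1 \<partial>N)" by (intro nn_integral_mono) (simp add: indicator_def)
      finally show ?thesis by (simp add: emeasure_space_1 order.strict_trans1)
    qed
    \<comment> \<open>The constant 1 is an admissible Lipschitz function, so finiteness passes from
      \<open>M1\<close> to \<open>M2\<close>.\<close>
    have "emeasure M1 UNIV = emeasure M2 UNIV"
      using eq[OF lipschitz_on_constant[of UNIV 1]] by (simp add: M1_def M2_def)
    with fin1 have "finite_borel_measure M1" "finite_borel_measure M2"
      by (auto intro!: finite_borel_measure.intro finite_measureI finite_borel_measure_axioms.intro simp: M1_def M2_def)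
    then have "M1 = M2" by (rule finite_borel_measure_eqI_lipschitz) (rule eq)
    then have "emeasure M1 D = emeasure M2 D" by simp
    moreover have "emeasure M1 D = emeasure ?L (C \<times> D)"
    proof -
      have "emeasure M1 D = (\<integral>\<^sup>+y. indicator D y \<partial>M1)" by (simp add: M1_def)
      also have "\<dots> = (\<integral>\<^sup>+\<omega>. indicator C (B t \<omega>) * indicator D (b \<omega>) \<partial>N)" by (rule i1) measurable
      also have "\<dots> = (\<integral>\<^sup>+\<omega>. indicator (C \<times> D) (B t \<omega>, b \<omega>) \<partial>N)" by (simp add: indicator_times)
      also have "\<dots> = (\<integral>\<^sup>+z. indicator (C \<times> D) z \<partial>?L)" by (subst nn_integral_distr) auto
      finally show ?thesis by simp
    qed
    moreover have "emeasure M2 D = emeasure ?R (C \<times> D)"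
    proof -
      have "emeasure M2 D = (\<integral>\<^sup>+y. indicator D y \<partial>M2)" by (simp add: M2_def)
      also have "\<dots> = (\<integral>\<^sup>+y. indicator D y * (\<integral>\<^sup>+x. indicator C x * ennreal (joint_density t x y) \<partial>lborel) \<partial>lborel)"
        by (rule i2) measurable
      also have "\<dots> = (\<integral>\<^sup>+y. (\<integral>\<^sup>+x. ennreal (joint_density t x y) * indicator (C \<times> D) (x, y) \<partial>lborel) \<partial>lborel)"
        by (intro nn_integral_cong, subst nn_integral_cmult[symmetric]) (auto simp: indicator_times mult_ac)
      also have "\<dots> = (\<integral>\<^sup>+z. ennreal (joint_density t (fst z) (snd z)) * indicator (C \<times> D) z \<partial>(lborel \<Otimes>\<^sub>M lborel))"
        by (subst lborel_pair.nn_integral_snd[symmetric]) auto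
      also have "\<dots> = emeasure ?R (C \<times> D)"
        by (subst emeasure_density) auto
      finally show ?thesis .
    qed
    ultimately show ?thesis by simp
  qed
  show ?thesis
  proof (rule measure_eqI_generator_eq[OF Int_stable_pair_measure_generator[of borel borel]])
    show "{a \<times> b |a b. a \<in> sets borel \<and> b \<in> sets borel} \<subseteq> Pow (UNIV :: (real \<times> real) set)" by simp
    show "sets ?L = sigma_sets UNIV {a \<times> b |a b. a \<in> sets borel \<and> b \<in> sets borel}"
      by (simp add: sets_pair_measure)
    show "sets ?R = sigma_sets UNIV {a \<times> b |a b. a \<in> sets borel \<and> b \<in> sets borel}"
      by (simp add: sets_pair_measure)
    show "range (\<lambda>_::nat. UNIV \<times> UNIV) \<subseteq> {a \<times> b |a b. a \<in> sets (borel :: real measure) \<and> b \<in> sets (borel :: real measure)}"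
      by (auto intro!: exI[of _ UNIV])
    show "emeasure ?L (UNIV \<times> UNIV) \<noteq> \<infinity>"
      using finite_measure.emeasure_finite[of ?L] prob_space_distr[of "\<lambda>\<omega>. (B t \<omega>, b \<omega>)" "borel \<Otimes>\<^sub>M borel"]
      by (auto simp: prob_space_def)
  qed (use rect in auto)
qed

end

section \<open>The heat kernel on the affine group\<close>

text \<open>If \<open>g\<close> exceeded \<open>f\<close> at \<open>x0\<close>, two levels
  \<open>c < d\<close> would separate the functions on a whole ball, whose volume is positive and
  finite. Nonnegativity of \<open>f\<close> makes both levels nonnegative, so that
  \<open>ennreal\<close> does not truncate them.\<close>

lemma continuous_density_le:
  fixes f g :: "'a::euclidean_space \<Rightarrow> real"
  assumes S: "open S" and cont: "continuous_on S f" "continuous_on S g" and x0: "x0 \<in> S"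
    and f0: "\<And>x. x \<in> S \<Longrightarrow> 0 \<le> f x"
    and eq: "\<And>A. A \<in> sets borel \<Longrightarrow> A \<subseteq> S \<Longrightarrow>
      (\<integral>\<^sup>+x. ennreal (f x) * indicator A x \<partial>lborel) = (\<integral>\<^sup>+x. ennreal (g x) * indicator A x \<partial>lborel)"
  shows "g x0 \<le> f x0"
proof (rule ccontr)
  assume "\<not> g x0 \<le> f x0"
  then obtain c where c: "f x0 < c" "c < g x0" using dense by (metis not_le)
  then obtain d where d: "c < d" "d < g x0" using dense by blast
  have c0: "0 \<le> c" using f0[OF x0] c by simp
  have "open (S \<inter> f -` {..<c})" "open (S \<inter> g -` {d<..})"
    by (intro continuous_open_preimage cont S; simp)+
  then have "open (S \<inter> f -` {..<c} \<inter> (S \<inter> g -` {d<..}))" by (rule open_Int)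
  moreover have "x0 \<in> S \<inter> f -` {..<c} \<inter> (S \<inter> g -` {d<..})" using x0 c d by auto
  ultimately obtain r where r: "r > 0" "ball x0 r \<subseteq> S \<inter> f -` {..<c} \<inter> (S \<inter> g -` {d<..})"
    using open_contains_ball by blast
  define v where "v = measure lborel (ball x0 r)"
  have v: "v > 0" unfolding v_def using r(1) by (rule content_ball_pos)
  have ev: "emeasure lborel (ball x0 r) = ennreal v"
    unfolding v_def by (intro emeasure_eq_ennreal_measure) (use emeasure_lborel_ball_finite[of x0 r] in auto)
  have "ennreal (d * v) = (\<integral>\<^sup>+x. ennreal d * indicator (ball x0 r) x \<partial>lborel)"
    using c0 d v by (simp add: nn_integral_cmult_indicator ev ennreal_mult)
  also have "\<dots> \<le> (\<integral>\<^sup>+x. ennreal (g x) * indicator (ball x0 r) x \<partial>lborel)"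
    using r by (intro nn_integral_mono) (auto simp: indicator_def intro!: ennreal_leI)
  also have "\<dots> = (\<integral>\<^sup>+x. ennreal (f x) * indicator (ball x0 r) x \<partial>lborel)"
    using r by (intro eq[symmetric]) auto
  also have "\<dots> \<le> (\<integral>\<^sup>+x. ennreal c * indicator (ball x0 r) x \<partial>lborel)"
    using r by (intro nn_integral_mono) (auto simp: indicator_def intro!: ennreal_leI)
  also have "\<dots> = ennreal (c * v)"
    using c0 v by (simp add: nn_integral_cmult_indicator ev ennreal_mult)
  finally have "d * v \<le> c * v" using c0 v by simp
  with v d show False by simp
qed

lemma continuous_density_unique:
  fixes f g :: "'a::euclidean_space \<Rightarrow> real"
  assumes "open S" "continuous_on S f" "continuous_on S g" "x0 \<in> S"
    and "\<And>x. x \<in> S \<Longrightarrow> 0 \<le> f x" "\<And>x. x \<in> S \<Longrightarrow> 0 \<le> g x"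
    and "\<And>A. A \<in> sets borel \<Longrightarrow> A \<subseteq> S \<Longrightarrow>
      (\<integral>\<^sup>+x. ennreal (f x) * indicator A x \<partial>lborel) = (\<integral>\<^sup>+x. ennreal (g x) * indicator A x \<partial>lborel)"
  shows "f x0 = g x0"
  using continuous_density_le[of S f g x0] continuous_density_le[of S g f x0] assms by (simp add: antisym)

section \<open>Densities with respect to the volume of the affine group\<close>

lemma aff_group_borel [measurable]: "aff_group \<in> sets borel"
  unfolding aff_group_def borel_prod[symmetric] by measurable

lemma open_aff_group: "open aff_group"
  unfolding aff_group_def by (intro open_Times) auto

lemma sets_aff_volume [simp, measurable_cong]: "sets aff_volume = sets borel"
  by (simp add: aff_volume_def)

lemma aff_volume_weight_measurable [measurable]:
  "(\<lambda>x :: real \<times> real. ennreal (indicator aff_group x / (fst x)\<^sup>2)) \<in> borel_measurable borel"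
proof -
  have "(\<lambda>x :: real \<times> real. fst x) \<in> borel_measurable borel" unfolding borel_prod[symmetric] by measurable
  then show ?thesis by measurable
qed

lemma aff_continuous_density_unique:
  assumes p: "aff_continuous_density N G p" and p': "aff_continuous_density N G p'" and g: "g \<in> aff_group"
  shows "p g = p' g"
proof -
  have int: "(\<integral>\<^sup>+x. ennreal (p x / (fst x)\<^sup>2) * indicator A x \<partial>lborel) = emeasure (distr N aff_volume G) A"
    if p: "aff_continuous_density N G p" and A[measurable]: "A \<in> sets borel" and AG: "A \<subseteq> aff_group" for p A
  proof -
    have D: "distr N aff_volume G = density aff_volume (\<lambda>g. ennreal (p g))"
      and [measurable]: "(\<lambda>g. ennreal (p g)) \<in> borel_measurable borel"
      and nn: "\<And>g. g \<in> aff_group \<Longrightarrow> 0 \<le> p g"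
      using p by (auto simp: aff_continuous_density_def distributed_def cong: measurable_cong_sets)
    have "emeasure (distr N aff_volume G) A = (\<integral>\<^sup>+x. ennreal (p x) * indicator A x \<partial>aff_volume)"
      unfolding D by (rule emeasure_density) (auto cong: measurable_cong_sets)
    also have "\<dots> = (\<integral>\<^sup>+x. ennreal (indicator aff_group x / (fst x)\<^sup>2) * (ennreal (p x) * indicator A x) \<partial>lborel)"
      unfolding aff_volume_def by (rule nn_integral_density) measurable
    also have "\<dots> = (\<integral>\<^sup>+x. ennreal (p x / (fst x)\<^sup>2) * indicator A x \<partial>lborel)"
      using AG nn by (intro nn_integral_cong) (auto simp: indicator_def ennreal_mult'[symmetric] mult.commute subset_eq)
    finally show ?thesis by simp
  qed
  have c: "continuous_on aff_group (\<lambda>x. p x / (fst x)\<^sup>2)" if "aff_continuous_density N G p" for p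
    using that by (auto simp: aff_continuous_density_def aff_group_def intro!: continuous_intros)
  have n: "0 \<le> p x / (fst x)\<^sup>2" if "aff_continuous_density N G p" "x \<in> aff_group" for p x
    using that by (simp add: aff_continuous_density_def)
  have "p g / (fst g)\<^sup>2 = p' g / (fst g)\<^sup>2"
    by (rule continuous_density_unique[OF open_aff_group c[OF p] c[OF p'] g]) (use int p p' n in auto)
  then show ?thesis using g by (simp add: aff_group_def mem_Times_iff)
qed

lemma continuous_density_on_event_unique:
  assumes q: "continuous_density_on_event M P Z q" and q': "continuous_density_on_event M P Z q'"
  shows "q x = q' x"
  by (rule continuous_density_unique[of UNIV])
     (use q q' in \<open>auto simp: continuous_density_on_event_def\<close>)

context two_brownian
begin

text \<open>Under \<open>a = exp x\<close> the measure \<open>dx dy\<close> becomes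
  \<open>da dy / a\<close>, which is \<open>a\<close> times the volume
  \<open>da dy / a\<^sup>2\<close>; this is the origin of the factor \<open>fst g\<close>.\<close>

lemma aff_heat_kernel_joint_density:
  assumes t: "t > 0" and b: "has_ito_integral N F W (\<lambda>s \<omega>. exp (B s \<omega>)) t b"
  shows "aff_heat_kernel N B b t (\<lambda>g. fst g * joint_density t (ln (fst g)) (snd g))"
  unfolding aff_heat_kernel_def aff_continuous_density_def distributed_def
proof (intro conjI ballI)
  let ?p = "\<lambda>g. fst g * joint_density t (ln (fst g)) (snd g)" and ?G = "\<lambda>\<omega>. (exp (B t \<omega>), b \<omega>)"
  note t [measurable]
  have b_m[measurable]: "b \<in> borel_measurable N" using b by (simp add: has_ito_integral_def)
  have Bt[measurable]: "B t \<in> borel_measurable N" using t by simp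
  have fst_snd[measurable]: "(\<lambda>g :: real \<times> real. fst g) \<in> borel_measurable borel" "(\<lambda>g :: real \<times> real. snd g) \<in> borel_measurable borel"
    unfolding borel_prod[symmetric] by measurable
  show "continuous_on aff_group ?p"
  proof (intro continuous_on_mult continuous_on_fst continuous_on_id)
    have "continuous_on aff_group ((\<lambda>z. joint_density t (fst z) (snd z)) \<circ> (\<lambda>g. (ln (fst g), snd g)))"
    proof (rule continuous_on_compose)
      show "continuous_on aff_group (\<lambda>g. (ln (fst g), snd g :: real))"
        by (intro continuous_intros) (auto simp: aff_group_def)
    qed (rule continuous_on_subset[OF continuous_joint_density[OF t]], simp)
    then show "continuous_on aff_group (\<lambda>g. joint_density t (ln (fst g)) (snd g))" by (simp add: comp_def)
  qed
  show "0 \<le> ?p g" if "g \<in> aff_group" for g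
    using that by (intro mult_nonneg_nonneg joint_density_nonneg) (auto simp: aff_group_def)
  show p_m: "(\<lambda>g. ennreal (?p g)) \<in> borel_measurable aff_volume" by measurable
  then have p_m'[measurable]: "(\<lambda>g. ennreal (?p g)) \<in> borel_measurable borel" by (simp cong: measurable_cong_sets)
  have G_b: "?G \<in> borel_measurable N" unfolding borel_prod[symmetric] by measurable
  then show G_m: "?G \<in> measurable N aff_volume" by (simp cong: measurable_cong_sets)
  show "distr N aff_volume ?G = density aff_volume (\<lambda>g. ennreal (?p g))"
  proof (rule measure_eqI)
    fix A assume "A \<in> sets (distr N aff_volume ?G)"
    then have A[measurable]: "A \<in> sets borel" by simp
    then have A'[measurable]: "A \<in> sets (borel \<Otimes>\<^sub>M borel)" by (subst borel_prod)
    have E[measurable]: "(\<lambda>z :: real \<times> real. (exp (fst z), snd z)) \<in> measurable (borel \<Otimes>\<^sub>M borel) (borel \<Otimes>\<^sub>M borel)"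
      by measurable
    have "emeasure (distr N aff_volume ?G) A = (\<integral>\<^sup>+\<omega>. indicator A (?G \<omega>) \<partial>N)"
      using G_m by (subst emeasure_distr) (auto simp: nn_integral_indicator[symmetric] indicator_def intro!: nn_integral_cong simp del: nn_integral_indicator)
    also have "\<dots> = (\<integral>\<^sup>+\<omega>. (\<lambda>z. indicator A (exp (fst z), snd z)) (B t \<omega>, b \<omega>) \<partial>N)" by simp
    also have "\<dots> = (\<integral>\<^sup>+z. indicator A (exp (fst z), snd z) \<partial>distr N (borel \<Otimes>\<^sub>M borel) (\<lambda>\<omega>. (B t \<omega>, b \<omega>)))"
      by (rule nn_integral_distr[symmetric]) measurable
    also have "\<dots> = (\<integral>\<^sup>+z. ennreal (joint_density t (fst z) (snd z)) * indicator A (exp (fst z), snd z) \<partial>(lborel \<Otimes>\<^sub>M lborel))"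
      unfolding joint_law[OF t b] by (rule nn_integral_density) measurable
    also have "\<dots> = (\<integral>\<^sup>+x. (\<integral>\<^sup>+y. ennreal (joint_density t x y) * indicator A (exp x, y) \<partial>lborel) \<partial>lborel)"
      by (subst lborel.nn_integral_fst[symmetric]) auto
    also have "\<dots> = (\<integral>\<^sup>+a. ennreal (indicator {0<..} a / a) * (\<integral>\<^sup>+y. ennreal (joint_density t (ln a) y) * indicator A (exp (ln a), y) \<partial>lborel) \<partial>lborel)"
      by (rule nn_integral_ln_substitution[symmetric]) measurable
    also have "\<dots> = (\<integral>\<^sup>+a. (\<integral>\<^sup>+y. ennreal (indicator aff_group (a, y) / (fst (a, y))\<^sup>2) * (ennreal (?p (a, y)) * indicator A (a, y)) \<partial>lborel) \<partial>lborel)"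
    proof (intro nn_integral_cong)
      fix a
      have "(\<integral>\<^sup>+y. ennreal (indicator aff_group (a, y) / (fst (a, y))\<^sup>2) * (ennreal (?p (a, y)) * indicator A (a, y)) \<partial>lborel)
          = (\<integral>\<^sup>+y. ennreal (indicator {0<..} a / a) * (ennreal (joint_density t (ln a) y) * indicator A (exp (ln a), y)) \<partial>lborel)"
      proof (intro nn_integral_cong)
        fix y
        show "ennreal (indicator aff_group (a, y) / (fst (a, y))\<^sup>2) * (ennreal (?p (a, y)) * indicator A (a, y))
          = ennreal (indicator {0<..} a / a) * (ennreal (joint_density t (ln a) y) * indicator A (exp (ln a), y))"
        proof (cases "a > 0")
          case True
          then have "indicator aff_group (a, y) = (1 :: real)" by (simp add: aff_group_def)
          moreover have "ennreal (1 / a\<^sup>2) * ennreal (a * joint_density t (ln a) y) = ennreal (1 / a) * ennreal (joint_density t (ln a) y)"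
            using True joint_density_nonneg[of t "ln a" y] by (simp add: ennreal_mult[symmetric] power2_eq_square)
          ultimately show ?thesis using True by (simp add: mult.assoc[symmetric])
        qed (simp add: aff_group_def)
      qed
      also have "\<dots> = ennreal (indicator {0<..} a / a) * (\<integral>\<^sup>+y. ennreal (joint_density t (ln a) y) * indicator A (exp (ln a), y) \<partial>lborel)"
        by (rule nn_integral_cmult) measurable
      finally show "ennreal (indicator {0<..} a / a) * (\<integral>\<^sup>+y. ennreal (joint_density t (ln a) y) * indicator A (exp (ln a), y) \<partial>lborel)
        = (\<integral>\<^sup>+y. ennreal (indicator aff_group (a, y) / (fst (a, y))\<^sup>2) * (ennreal (?p (a, y)) * indicator A (a, y)) \<partial>lborel)" ..
    qed
    also have "\<dots> = (\<integral>\<^sup>+z. ennreal (indicator aff_group z / (fst z)\<^sup>2) * (ennreal (?p z) * indicator A z) \<partial>(lborel \<Otimes>\<^sub>M lborel))"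
      by (rule lborel.nn_integral_fst) (simp add: lborel_prod)
    also have "\<dots> = (\<integral>\<^sup>+z. ennreal (?p z) * indicator A z \<partial>aff_volume)"
      unfolding aff_volume_def lborel_prod by (rule nn_integral_density[symmetric]) measurable
    also have "\<dots> = emeasure (density aff_volume (\<lambda>g. ennreal (?p g))) A"
      by (rule emeasure_density[symmetric]) (auto cong: measurable_cong_sets)
    finally show "emeasure (distr N aff_volume ?G) A = emeasure (density aff_volume (\<lambda>g. ennreal (?p g))) A" .
  qed simp
qed

lemma aff_heat_kernel_unit:
  assumes t: "t > 0" and b: "has_ito_integral N F W (\<lambda>s \<omega>. exp (B s \<omega>)) t b" and p: "aff_heat_kernel N B b t p"
  shows "p aff_unit = joint_density t 0 0"
proof -
  have "aff_unit \<in> aff_group" by (simp add: aff_unit_def aff_group_def)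
  from aff_continuous_density_unique[OF p[unfolded aff_heat_kernel_def] aff_heat_kernel_joint_density[OF t b, unfolded aff_heat_kernel_def] this]
  show ?thesis by (simp add: aff_unit_def)
qed

text \<open>Two normal densities at 0 make up the constant: that of the endpoint gives
  \<open>1 / sqrt (2 * pi * t)\<close>, and the conditional one of the integral gives
  \<open>1 / sqrt (2 * pi)\<close>.\<close>

lemma joint_density_0:
  assumes t: "t > 0"
  shows "joint_density t 0 0 = (1 / (2 * pi * sqrt t)) * (\<integral>\<omega>. 1 / sqrt (bridge_var t 0 (\<lambda>s. B s \<omega>)) \<partial>N)"
proof -
  have "(\<integral>\<omega>. normal_density 0 (sqrt (bridge_var t 0 (\<lambda>s. B s \<omega>))) 0 \<partial>N)
     = (\<integral>\<omega>. 1 / sqrt (2 * pi) * (1 / sqrt (bridge_var t 0 (\<lambda>s. B s \<omega>))) \<partial>N)"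
    using bridge_var_0_pos[OF t B_continuous]
    by (intro Bochner_Integration.integral_cong refl) (simp add: normal_density_def real_sqrt_mult less_imp_le)
  also have "\<dots> = 1 / sqrt (2 * pi) * (\<integral>\<omega>. 1 / sqrt (bridge_var t 0 (\<lambda>s. B s \<omega>)) \<partial>N)"
    by (rule integral_mult_right_zero)
  finally have "joint_density t 0 0 = normal_density 0 (sqrt t) 0 * (1 / sqrt (2 * pi)) * (\<integral>\<omega>. 1 / sqrt (bridge_var t 0 (\<lambda>s. B s \<omega>)) \<partial>N)"
    by (simp add: joint_density_def)
  also have "normal_density 0 (sqrt t) 0 * (1 / sqrt (2 * pi)) = 1 / (2 * pi * sqrt t)"
  proof -
    have "normal_density 0 (sqrt t) 0 = 1 / (sqrt (2 * pi) * sqrt t)"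
      using t by (simp add: normal_density_def real_sqrt_mult)
    moreover have "sqrt (2 * pi) * sqrt (2 * pi) = 2 * pi" by simp
    ultimately show ?thesis by (metis (no_types, lifting) mult.assoc mult.commute mult.right_neutral times_divide_times_eq)
  qed
  finally show ?thesis .
qed

lemma integrable_inverse_sqrt_bridge_var:
  assumes t: "t > 0"
  shows "integrable N (\<lambda>\<omega>. 1 / sqrt (bridge_var t 0 (\<lambda>s. B s \<omega>)))"
proof -
  have "integrable N (\<lambda>\<omega>. sqrt (2 * pi) * normal_density 0 (sqrt (bridge_var t 0 (\<lambda>s. B s \<omega>))) 0)"
    by (intro integrable_mult_right integrable_normal_density_bridge[OF t])
  moreover have "sqrt (2 * pi) * normal_density 0 (sqrt (bridge_var t 0 (\<lambda>s. B s \<omega>))) 0 = 1 / sqrt (bridge_var t 0 (\<lambda>s. B s \<omega>))"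
    if "\<omega> \<in> space N" for \<omega>
    using bridge_var_0_pos[OF t B_continuous[OF that]] by (simp add: normal_density_def real_sqrt_mult less_imp_le)
  ultimately show ?thesis by (simp cong: Bochner_Integration.integrable_cong)
qed

text \<open>Needed at the end, where the kernel at the unit is a divisor. It holds because the
  bridge functional is finite and positive on every path.\<close>

lemma joint_density_0_pos:
  assumes t: "t > 0"
  shows "joint_density t 0 0 > 0"
proof -
  have "(\<integral>\<omega>. 0 \<partial>N) < (\<integral>\<omega>. 1 / sqrt (bridge_var t 0 (\<lambda>s. B s \<omega>)) \<partial>N)"
  proof (rule integral_less_AE_space)
    show "integrable N (\<lambda>\<omega>. 1 / sqrt (bridge_var t 0 (\<lambda>s. B s \<omega>)))"
      by (rule integrable_inverse_sqrt_bridge_var[OF t])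
    show "AE \<omega> in N. 0 < 1 / sqrt (bridge_var t 0 (\<lambda>s. B s \<omega>))"
      using bridge_var_0_pos[OF t B_continuous] by (intro AE_I2) simp
  qed (simp_all add: emeasure_space_1)
  then show ?thesis unfolding joint_density_0[OF t] using t by simp
qed

end

section \<open>Local limit theorem for the simple random walk\<close>

text \<open>The point probabilities of the simple random walk at time \<open>n\<close>. The argument
  is real because the walk is real valued; the support is described by
  \<open>srw_support\<close>.\<close>

fun srw :: "nat \<Rightarrow> real \<Rightarrow> real" where
  "srw 0 x = (if x = 0 then 1 else 0)"
| "srw (Suc n) x = (srw n (x - 1) + srw n (x + 1)) / 2"

lemma srw_nonneg [simp]: "0 \<le> srw n x"
  by (induction n arbitrary: x) auto

lemma srw_minus [simp]: "srw n (- x) = srw n x"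
proof (induction n arbitrary: x)
  case (Suc n)
  have "- x - 1 = - (x + 1)" "- x + 1 = - (x - 1)" by auto
  then show ?case unfolding srw.simps by (simp only: Suc add.commute)
qed simp

lemma srw_measurable [measurable]: "srw n \<in> borel_measurable borel"
  by (induction n) simp_all

lemma srw_large: "real n < \<bar>x\<bar> \<Longrightarrow> srw n x = 0"
  by (induction n arbitrary: x) auto

lemma srw_binomial: "srw n (real n - 2 * real i) = real (n choose i) / 2 ^ n"
proof (induction n arbitrary: i)
  case 0
  then show ?case by (cases i) auto
next
  case (Suc n)
  show ?case
  proof (cases i)
    case 0
    have "srw n (real n + 2) = 0" by (rule srw_large) simp
    then show ?thesis using Suc[of 0] 0 by (simp add: add.commute)
  next
    case (Suc l)
    have "srw n (real n - 2 * real (Suc l)) = real (n choose Suc l) / 2 ^ n"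
      "srw n (real n - 2 * real l) = real (n choose l) / 2 ^ n" by (rule Suc.IH)+
    moreover have a: "real (Suc n) - 2 * real i - 1 = real n - 2 * real (Suc l)"
      "real (Suc n) - 2 * real i + 1 = real n - 2 * real l" using Suc by auto
    ultimately show ?thesis unfolding srw.simps a by (simp add: Suc add_divide_distrib)
  qed
qed

lemma srw_support: "srw n x \<noteq> 0 \<Longrightarrow> \<exists>i\<le>n. x = real n - 2 * real i"
proof (induction n arbitrary: x)
  case (Suc n)
  then have "srw n (x - 1) \<noteq> 0 \<or> srw n (x + 1) \<noteq> 0" by auto
  then show ?case
  proof
    assume "srw n (x - 1) \<noteq> 0"
    then obtain i where "i \<le> n" "x - 1 = real n - 2 * real i" using Suc.IH by blast
    then show ?thesis by (intro exI[of _ i]) auto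
  next
    assume "srw n (x + 1) \<noteq> 0"
    then obtain i where "i \<le> n" "x + 1 = real n - 2 * real i" using Suc.IH by blast
    then show ?thesis by (intro exI[of _ "Suc i"]) auto
  qed
qed (auto split: if_splits)

section \<open>Central binomial coefficients and the uniform bound on point probabilities\<close>

definition central_binomial :: "nat \<Rightarrow> real" where
  "central_binomial k = real ((2 * k) choose k) / 4 ^ k"

lemma central_binomial_0 [simp]: "central_binomial 0 = 1"
  by (simp add: central_binomial_def)

lemma central_binomial_Suc: "central_binomial (Suc k) = central_binomial k * ((2 * real k + 1) / (2 * real k + 2))"
proof -
  have 1: "real ((2 * k) choose k) = fact (2 * k) / (fact k * fact k)"
    by (subst binomial_fact) auto
  have 2: "real ((2 * Suc k) choose (Suc k)) = fact (2 * Suc k) / (fact (Suc k) * fact (Suc k))"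
    by (subst binomial_fact) auto
  have 3: "fact (2 * Suc k) = (2 * real k + 2) * ((2 * real k + 1) * fact (2 * k))"
    by (simp add: algebra_simps)
  have "real ((2 * Suc k) choose (Suc k)) = real ((2 * k) choose k) * 4 * ((2 * real k + 1) / (2 * real k + 2))"
  proof -
    have "(2 * K + 2) * ((2 * K + 1) * f) / (((K + 1) * c) * ((K + 1) * c)) = f / (c * c) * 4 * ((2 * K + 1) / (2 * K + 2))"
      if "c \<noteq> 0" "K \<ge> 0" for K c f :: real
    proof -
      have "K + 1 \<noteq> 0" "2 * K + 2 = 2 * (K + 1)" using that by auto
      then show ?thesis using that(1) by (simp add: divide_simps) (simp add: algebra_simps)
    qed
    from this[of "fact k" "real k" "fact (2 * k)"] show ?thesis
      unfolding 1 2 3 by (simp add: add.commute)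
  qed
  then show ?thesis by (simp add: central_binomial_def)
qed

lemma central_binomial_pos: "central_binomial k > 0"
  by (simp add: central_binomial_def)

text \<open>The step from \<open>k\<close> to \<open>k + 1\<close> multiplies
  \<open>(central_binomial k)\<^sup>2 * (2 * k + 1)\<close> by
  \<open>(2 * k + 1) * (2 * k + 3) / (2 * k + 2)\<^sup>2\<close>, which is the reciprocal of the
  next factor of Wallis' product.\<close>

lemma central_binomial_wallis:
  "(central_binomial k)\<^sup>2 * (2 * real k + 1) * (\<Prod>j=1..k. (4 * real j ^ 2) / (4 * real j ^ 2 - 1)) = 1"
proof (induction k)
  case (Suc k)
  have f: "4 * real (Suc k) ^ 2 - 1 = (2 * real k + 1) * (2 * real k + 3)" "4 * real (Suc k) ^ 2 = (2 * real k + 2)\<^sup>2"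
    by (simp_all add: power2_eq_square algebra_simps)
  have e: "((2 * real k + 1) / (2 * real k + 2))\<^sup>2 * (2 * real (Suc k) + 1) * ((4 * real (Suc k) ^ 2) / (4 * real (Suc k) ^ 2 - 1)) = 2 * real k + 1"
  proof -
    have gen: "(a / b)\<^sup>2 * d * (b\<^sup>2 / (a * d)) = a" if "a > 0" "b > 0" "d > 0" for a b d :: real
      using that by (simp add: power_divide power2_eq_square)
    have g: "2 * real (Suc k) + 1 = 2 * real k + 3" by simp
    show ?thesis unfolding f(1) unfolding f(2) g by (rule gen) auto
  qed
  have P: "(\<Prod>j=1..Suc k. (4 * real j ^ 2) / (4 * real j ^ 2 - 1))
      = (4 * real (Suc k) ^ 2) / (4 * real (Suc k) ^ 2 - 1) * (\<Prod>j=1..k. (4 * real j ^ 2) / (4 * real j ^ 2 - 1))"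
    by (rule prod.nat_ivl_Suc') simp
  have "(central_binomial (Suc k))\<^sup>2 * (2 * real (Suc k) + 1) * (\<Prod>j=1..Suc k. (4 * real j ^ 2) / (4 * real j ^ 2 - 1))
    = (central_binomial k)\<^sup>2 * (((2 * real k + 1) / (2 * real k + 2))\<^sup>2 * (2 * real (Suc k) + 1) * ((4 * real (Suc k) ^ 2) / (4 * real (Suc k) ^ 2 - 1)))
      * (\<Prod>j=1..k. (4 * real j ^ 2) / (4 * real j ^ 2 - 1))"
  proof -
    have gen: "(c * r)\<^sup>2 * d * (w * p) = c\<^sup>2 * (r\<^sup>2 * d * w) * p" for c r d w p :: real
      by (simp add: power_mult_distrib)
    show ?thesis unfolding P central_binomial_Suc by (rule gen)
  qed
  also have "\<dots> = 1" unfolding e by (rule Suc)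
  finally show ?case .
qed simp

text \<open>Wallis' product gives the limit \<open>2 / pi\<close> of
  \<open>(central_binomial k)\<^sup>2 * (2 * k + 1)\<close>; replacing \<open>2 * k + 1\<close> by
  \<open>2 * k\<close> does not change it.\<close>

lemma central_binomial_LIMSEQ: "(\<lambda>k. sqrt (real (2 * k)) * central_binomial k) \<longlonglongrightarrow> sqrt (2 / pi)"
proof -
  let ?P = "\<lambda>k. \<Prod>j=1..k. (4 * real j ^ 2) / (4 * real j ^ 2 - 1)"
  have e: "(central_binomial k)\<^sup>2 * (2 * real k + 1) = inverse (?P k)" for k
  proof -
    have "?P k * ((central_binomial k)\<^sup>2 * (2 * real k + 1)) = 1"
      by (subst mult.commute) (rule central_binomial_wallis)
    then show ?thesis by (rule inverse_unique[symmetric])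
  qed
  have "(\<lambda>k. inverse (?P k)) \<longlonglongrightarrow> inverse (pi / 2)"
    by (intro tendsto_inverse wallis) simp
  then have "(\<lambda>k. (central_binomial k)\<^sup>2 * (2 * real k + 1)) \<longlonglongrightarrow> 2 / pi"
    unfolding e by simp
  moreover have "(\<lambda>k. 2 * real k / (2 * real k + 1)) \<longlonglongrightarrow> 1"
  proof -
    have "(\<lambda>k. 1 - 1 / (2 * real k + 1)) \<longlonglongrightarrow> 1 - 0"
    proof (intro tendsto_diff tendsto_const)
      show "(\<lambda>k. 1 / (2 * real k + 1)) \<longlonglongrightarrow> 0"
        by (rule tendsto_sandwich[of "\<lambda>_. 0" _ _ "\<lambda>k. 1 / real (Suc k)"])
           (use LIMSEQ_Suc[OF lim_const_over_n[of "1 :: real"]] in \<open>auto intro!: always_eventually frac_le\<close>)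
    qed
    moreover have "1 - 1 / (2 * real k + 1) = 2 * real k / (2 * real k + 1)" for k
      by (simp add: field_simps)
    ultimately show ?thesis by simp
  qed
  ultimately have "(\<lambda>k. (central_binomial k)\<^sup>2 * (2 * real k + 1) * (2 * real k / (2 * real k + 1))) \<longlonglongrightarrow> 2 / pi * 1"
    by (rule tendsto_mult)
  moreover have "(central_binomial k)\<^sup>2 * (2 * real k + 1) * (2 * real k / (2 * real k + 1)) = (central_binomial k)\<^sup>2 * (2 * real k)" for k
    by (simp add: field_simps)
  ultimately have "(\<lambda>k. sqrt ((central_binomial k)\<^sup>2 * (2 * real k))) \<longlonglongrightarrow> sqrt (2 / pi)"
    by (intro tendsto_real_sqrt) simp
  then show ?thesis
    using central_binomial_pos by (simp add: real_sqrt_mult mult.commute less_imp_le)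
qed

text \<open>The square times \<open>2 * k + 1\<close> equals 1 at \<open>k = 0\<close> and does not
  increase. Keeping \<open>2 * k + 1\<close> instead of \<open>2 * k\<close> lets the bound serve
  the odd time \<open>2 * k + 1\<close> as well.\<close>

lemma central_binomial_le: "central_binomial k \<le> 1 / sqrt (real (2 * k + 1))"
proof -
  have "(central_binomial k)\<^sup>2 * (2 * real k + 1) \<le> 1"
  proof (induction k)
    case (Suc k)
    have "((2 * real k + 1) / (2 * real k + 2))\<^sup>2 * (2 * real (Suc k) + 1) \<le> 2 * real k + 1"
      by (simp add: power_divide divide_le_eq) (simp add: power2_eq_square algebra_simps)
    then have "(central_binomial k)\<^sup>2 * (((2 * real k + 1) / (2 * real k + 2))\<^sup>2 * (2 * real (Suc k) + 1)) \<le> (central_binomial k)\<^sup>2 * (2 * real k + 1)"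
      by (rule mult_left_mono) simp
    with Suc show ?case by (simp only: central_binomial_Suc power_mult_distrib mult.assoc)
  qed simp
  then have "sqrt ((central_binomial k)\<^sup>2 * (2 * real k + 1)) \<le> 1" by simp
  then show ?thesis
    using central_binomial_pos[of k] by (simp add: real_sqrt_mult pos_le_divide_eq less_imp_le add_pos_nonneg add.commute)
qed

lemma srw_le_central: "srw (2 * k) x \<le> central_binomial k"
proof (cases "srw (2 * k) x = 0")
  case False
  then obtain i where i: "x = real (2 * k) - 2 * real i" using srw_support by blast
  have "(2 * k) choose i \<le> (2 * k) choose k" using binomial_maximum[of "2 * k" i] by simp
  then show ?thesis
    unfolding i srw_binomial central_binomial_def by (simp add: power_mult divide_right_mono)
qed (use central_binomial_pos[of k] in simp)

text \<open>At even times the central coefficient is the largest; at an odd time the value is the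
  average of two values one step earlier.\<close>

lemma srw_le:
  assumes "n > 0"
  shows "srw n x \<le> 1 / sqrt (real n)"
proof -
  define k where "k = n div 2"
  have "srw n x \<le> central_binomial k"
  proof (cases "even n")
    case True
    then show ?thesis using srw_le_central[of k x] by (simp add: k_def)
  next
    case False
    then have "n = Suc (2 * k)" by (simp add: k_def)
    then show ?thesis using srw_le_central[of k "x - 1"] srw_le_central[of k "x + 1"] by simp
  qed
  also have "\<dots> \<le> 1 / sqrt (real (2 * k + 1))" by (rule central_binomial_le)
  also have "\<dots> \<le> 1 / sqrt (real n)"
    using assms by (intro divide_left_mono mult_pos_pos real_sqrt_le_mono) (auto simp: k_def)
  finally show ?thesis .
qed

text \<open>Splitting off the common part of the factorials turns the quotient by the central
  coefficient into the product of \<open>(k - j + i) / (k + i)\<close> over \<open>i\<close> from 1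
  to \<open>j\<close>.\<close>

lemma srw_ratio:
  assumes "j \<le> k"
  shows "srw (2 * k) (2 * real j) = central_binomial k * (\<Prod>i=1..j. 1 - real j / real (k + i))"
proof -
  have "srw (2 * k) (2 * real j) = real ((2 * k) choose (k - j)) / 4 ^ k"
  proof -
    have "(2::real) ^ (2 * k) = 4 ^ k" by (simp add: power_mult)
    moreover have "real (2 * k) - 2 * real (k - j) = 2 * real j" using assms by (simp add: of_nat_diff)
    ultimately show ?thesis using srw_binomial[of "2 * k" "k - j"] by (simp only:)
  qed
  moreover have "real ((2 * k) choose (k - j)) = real ((2 * k) choose k) * (\<Prod>i=1..j. 1 - real j / real (k + i))"
  proof -
    have f1: "fact (k + j) = fact k * (\<Prod>i=1..j. real (k + i))" for j
      by (induction j) (simp_all add: algebra_simps)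
    have f2: "fact k = fact (k - j) * (\<Prod>i=1..j. real (k - j + i))"
    proof -
      have "fact (m + j) = fact m * (\<Prod>i=1..j. real (m + i))" for m
        by (induction j) (simp_all add: algebra_simps)
      from this[of "k - j"] show ?thesis using assms by simp
    qed
    have p: "(\<Prod>i=1..j. 1 - real j / real (k + i)) = (\<Prod>i=1..j. real (k - j + i)) / (\<Prod>i=1..j. real (k + i))"
      unfolding prod_dividef[symmetric] using assms
      by (intro prod.cong) (auto simp: of_nat_diff field_simps)
    have "real ((2 * k) choose (k - j)) = fact (2 * k) / (fact (k - j) * fact (k + j))"
      using assms by (subst binomial_fact) (auto simp: of_nat_diff mult_2 algebra_simps)
    moreover have "real ((2 * k) choose k) = fact (2 * k) / (fact k * fact k)"
      by (subst binomial_fact) auto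
    moreover have "fact (2 * k) / (fact (k - j) * fact (k + j)) = fact (2 * k) / (fact k * fact k) * ((\<Prod>i=1..j. real (k - j + i)) / (\<Prod>i=1..j. real (k + i)))"
    proof -
      have gen: "F / (a * (c * q)) = F / (c * c) * (p / q)" if "c = a * p" "c \<noteq> 0" for F a c p q :: real
        using that by simp
      show ?thesis unfolding f1[of j] by (rule gen[OF f2]) simp
    qed
    ultimately show ?thesis unfolding p by simp
  qed
  ultimately show ?thesis by (simp add: central_binomial_def)
qed

text \<open>Each factor lies between \<open>1 - j / k\<close> and \<open>1 - j / (k + j)\<close>.
  From above one uses \<open>1 - x \<le> exp (- x)\<close>, from below
  \<open>ln (1 - x) \<ge> - x - 2 * x\<^sup>2\<close> for \<open>x \<le> 1 / 2\<close>, which is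
  where \<open>2 * j \<le> k\<close> enters. Both exponents equal \<open>- j\<^sup>2 / k\<close> up
  to terms that vanish when \<open>j\<close> is of order \<open>sqrt k\<close>.\<close>

lemma srw_ratio_bounds:
  assumes j: "2 * j \<le> k" and k: "k > 0"
  shows "srw (2 * k) (2 * real j) \<le> central_binomial k * exp (- (real j)\<^sup>2 / (real k + real j))"
    and "central_binomial k * exp (- (real j)\<^sup>2 / real k - 2 * real j ^ 3 / (real k)\<^sup>2) \<le> srw (2 * k) (2 * real j)"
proof -
  have jk: "j \<le> k" using j by simp
  have "(\<Prod>i=1..j. 1 - real j / real (k + i)) \<le> (\<Prod>i=1..j. exp (- real j / (real k + real j)))"
  proof (rule prod_mono)
    fix i assume i: "i \<in> {1..j}"
    have "real j / real (k + i) \<le> 1" using jk i by (simp add: divide_le_eq)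
    moreover have "1 - real j / real (k + i) \<le> exp (- (real j / real (k + i)))"
      using exp_ge_add_one_self[of "- (real j / real (k + i))"] by simp
    moreover have "real j / (real k + real j) \<le> real j / real (k + i)"
      using i k by (intro divide_left_mono) auto
    then have "exp (- (real j / real (k + i))) \<le> exp (- real j / (real k + real j))" by simp
    ultimately show "0 \<le> 1 - real j / real (k + i) \<and> 1 - real j / real (k + i) \<le> exp (- real j / (real k + real j))"
      by linarith
  qed
  also have "\<dots> = exp (- (real j)\<^sup>2 / (real k + real j))"
    by (simp add: exp_of_nat_mult[symmetric] power2_eq_square)
  finally show "srw (2 * k) (2 * real j) \<le> central_binomial k * exp (- (real j)\<^sup>2 / (real k + real j))"
    unfolding srw_ratio[OF jk] using central_binomial_pos[of k] by (intro mult_left_mono) auto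
  have "exp (- (real j)\<^sup>2 / real k - 2 * real j ^ 3 / (real k)\<^sup>2) = (\<Prod>i=1..j. exp (- (real j / real k) - 2 * (real j / real k)\<^sup>2))"
    by (simp add: exp_of_nat_mult[symmetric] power2_eq_square power3_eq_cube algebra_simps)
  also have "\<dots> \<le> (\<Prod>i=1..j. 1 - real j / real (k + i))"
  proof (rule prod_mono)
    fix i assume i: "i \<in> {1..j}"
    have "2 * real j \<le> real k" using j by linarith
    then have half: "real j / real k \<le> 1 / 2" using k by (simp add: divide_le_eq)
    then have lt1: "real j / real k < 1" by linarith
    have "- (real j / real k) - 2 * (real j / real k)\<^sup>2 \<le> ln (1 - real j / real k)"
      by (rule ln_one_minus_pos_lower_bound) (use half in auto)
    then have "exp (- (real j / real k) - 2 * (real j / real k)\<^sup>2) \<le> exp (ln (1 - real j / real k))"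
      by (simp only: exp_le_cancel_iff)
    also have "\<dots> = 1 - real j / real k" by (rule exp_ln) (use lt1 in linarith)
    also have "\<dots> \<le> 1 - real j / real (k + i)" using k by (simp add: divide_left_mono)
    finally show "0 \<le> exp (- (real j / real k) - 2 * (real j / real k)\<^sup>2) \<and> exp (- (real j / real k) - 2 * (real j / real k)\<^sup>2) \<le> 1 - real j / real (k + i)"
      by simp
  qed
  finally show "central_binomial k * exp (- (real j)\<^sup>2 / real k - 2 * real j ^ 3 / (real k)\<^sup>2) \<le> srw (2 * k) (2 * real j)"
    unfolding srw_ratio[OF jk] using central_binomial_pos[of k] by (intro mult_left_mono) auto
qed

text \<open>The position varies with \<open>n\<close>, since in the application it is the rescaled
  sum of the earlier blocks. The bounds of \<open>srw_ratio_bounds\<close> squeeze the value once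
  \<open>j\<^sup>2 / k\<close> converges, which forces \<open>j / k\<close> to 0. The constant
  \<open>sqrt (2 / pi)\<close> is twice the standard normal density at 0, as only even integers are
  reached.\<close>

lemma srw_local_limit:
  fixes h :: "nat \<Rightarrow> nat" and x :: "nat \<Rightarrow> real"
  assumes h: "filterlim h at_top sequentially" "\<And>n. even (h n)"
    and x: "\<And>n. \<exists>j::int. x n = 2 * of_int j"
    and lim: "(\<lambda>n. x n / sqrt (real (h n))) \<longlonglongrightarrow> z"
  shows "(\<lambda>n. sqrt (real (h n)) * srw (h n) (x n)) \<longlonglongrightarrow> sqrt (2 / pi) * exp (- z\<^sup>2 / 2)"
proof -
  define k where "k n = h n div 2" for n
  have hk: "h n = 2 * k n" for n using h(2) by (simp add: k_def)
  have "\<exists>j::nat. \<bar>x n\<bar> = 2 * real j" for n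
  proof -
    obtain i :: int where "x n = 2 * of_int i" using x by blast
    then have "\<bar>x n\<bar> = 2 * real (nat \<bar>i\<bar>)" by (simp add: abs_mult)
    then show ?thesis by blast
  qed
  then obtain j :: "nat \<Rightarrow> nat" where j: "\<And>n. \<bar>x n\<bar> = 2 * real (j n)" by metis
  have srw_j: "srw (h n) (x n) = srw (2 * k n) (2 * real (j n))" for n
    unfolding hk j[symmetric] by (cases "0 \<le> x n") (auto simp: abs_if)
  have kinf: "filterlim k at_top sequentially"
    unfolding filterlim_at_top
  proof
    fix Z
    show "\<forall>\<^sub>F n in sequentially. Z \<le> k n"
      using h(1)[unfolded filterlim_at_top, rule_format, of "2 * Z"] by (rule eventually_mono) (simp add: hk)
  qed
  have kpos: "\<forall>\<^sub>F n in sequentially. k n > 0"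
    using kinf[unfolded filterlim_at_top, rule_format, of 1] by (rule eventually_mono) simp
  have kr: "filterlim (\<lambda>n. real (k n)) at_top sequentially"
    by (rule filterlim_compose[OF filterlim_real_sequentially kinf])
  have r1: "(\<lambda>n. (real (j n))\<^sup>2 / real (k n)) \<longlonglongrightarrow> z\<^sup>2 / 2"
  proof -
    have "(\<lambda>n. (x n / sqrt (real (h n)))\<^sup>2 / 2) \<longlonglongrightarrow> z\<^sup>2 / 2" by (intro tendsto_intros lim) simp
    moreover have "(x n / sqrt (real (h n)))\<^sup>2 / 2 = (real (j n))\<^sup>2 / real (k n)" for n
    proof -
      have "(x n)\<^sup>2 = (2 * real (j n))\<^sup>2" by (metis j power2_abs)
      then show ?thesis by (simp add: power_divide hk power_mult_distrib)
    qed
    ultimately show ?thesis by simp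
  qed
  have r2: "(\<lambda>n. real (j n) / real (k n)) \<longlonglongrightarrow> 0"
  proof -
    have "(\<lambda>n. sqrt ((real (j n))\<^sup>2 / real (k n) * inverse (real (k n)))) \<longlonglongrightarrow> sqrt (z\<^sup>2 / 2 * 0)"
      by (intro tendsto_real_sqrt tendsto_mult r1 tendsto_inverse_0_at_top kr)
    moreover have "sqrt ((real (j n))\<^sup>2 / real (k n) * inverse (real (k n))) = real (j n) / real (k n)" for n
    proof -
      have "(real (j n))\<^sup>2 / real (k n) * inverse (real (k n)) = (real (j n) / real (k n))\<^sup>2"
        by (simp add: power2_eq_square divide_inverse)
      then show ?thesis by simp
    qed
    ultimately show ?thesis by simp
  qed
  have small: "\<forall>\<^sub>F n in sequentially. 2 * j n \<le> k n \<and> k n > 0"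
  proof -
    have "\<forall>\<^sub>F n in sequentially. real (j n) / real (k n) < 1 / 2" using r2 by (rule order_tendstoD) simp
    with kpos show ?thesis
      by eventually_elim (simp add: field_simps del: of_nat_mult flip: of_nat_mult, linarith?)
  qed
  have cb: "(\<lambda>n. sqrt (real (h n)) * central_binomial (k n)) \<longlonglongrightarrow> sqrt (2 / pi)"
    using filterlim_compose[OF central_binomial_LIMSEQ kinf] by (simp add: hk)
  show ?thesis
  proof (rule tendsto_sandwich)
    show "\<forall>\<^sub>F n in sequentially. sqrt (real (h n)) * central_binomial (k n) * exp (- (real (j n))\<^sup>2 / real (k n) - 2 * real (j n) ^ 3 / (real (k n))\<^sup>2)
        \<le> sqrt (real (h n)) * srw (h n) (x n)"
      using small by eventually_elim (unfold srw_j mult.assoc, intro mult_left_mono srw_ratio_bounds(2), auto)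
    show "\<forall>\<^sub>F n in sequentially. sqrt (real (h n)) * srw (h n) (x n)
        \<le> sqrt (real (h n)) * central_binomial (k n) * exp (- (real (j n))\<^sup>2 / (real (k n) + real (j n)))"
      using small by eventually_elim (unfold srw_j mult.assoc, intro mult_left_mono srw_ratio_bounds(1), auto)
    have "(\<lambda>n. (real (j n))\<^sup>2 / real (k n) * (real (j n) / real (k n))) \<longlonglongrightarrow> z\<^sup>2 / 2 * 0"
      by (intro tendsto_mult r1 r2)
    then have r3: "(\<lambda>n. 2 * real (j n) ^ 3 / (real (k n))\<^sup>2) \<longlonglongrightarrow> 2 * 0"
    proof -
      assume *: "(\<lambda>n. (real (j n))\<^sup>2 / real (k n) * (real (j n) / real (k n))) \<longlonglongrightarrow> z\<^sup>2 / 2 * 0"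
      have "2 * real (j n) ^ 3 / (real (k n))\<^sup>2 = 2 * ((real (j n))\<^sup>2 / real (k n) * (real (j n) / real (k n)))" for n
        by (simp add: power3_eq_cube power2_eq_square)
      then show ?thesis using tendsto_mult_left[OF *, of 2] by simp
    qed
    have "(\<lambda>n. exp (- ((real (j n))\<^sup>2 / real (k n)) - 2 * real (j n) ^ 3 / (real (k n))\<^sup>2)) \<longlonglongrightarrow> exp (- (z\<^sup>2 / 2) - 2 * 0)"
      by (intro tendsto_intros r1 r3)
    from tendsto_mult[OF cb this]
    show "(\<lambda>n. sqrt (real (h n)) * central_binomial (k n) * exp (- (real (j n))\<^sup>2 / real (k n) - 2 * real (j n) ^ 3 / (real (k n))\<^sup>2))
        \<longlonglongrightarrow> sqrt (2 / pi) * exp (- z\<^sup>2 / 2)" by simp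
    have "(\<lambda>n. exp (- ((real (j n))\<^sup>2 / real (k n) / (1 + real (j n) / real (k n))))) \<longlonglongrightarrow> exp (- (z\<^sup>2 / 2 / (1 + 0)))"
      by (intro tendsto_intros r1 r2) simp
    from tendsto_mult[OF cb this]
    show "(\<lambda>n. sqrt (real (h n)) * central_binomial (k n) * exp (- (real (j n))\<^sup>2 / (real (k n) + real (j n))))
        \<longlonglongrightarrow> sqrt (2 / pi) * exp (- z\<^sup>2 / 2)"
    proof (rule Lim_transform_eventually[OF tendsto_eq_rhs])
      show "\<forall>\<^sub>F n in sequentially. sqrt (real (h n)) * central_binomial (k n) * exp (- ((real (j n))\<^sup>2 / real (k n) / (1 + real (j n) / real (k n))))
        = sqrt (real (h n)) * central_binomial (k n) * exp (- (real (j n))\<^sup>2 / (real (k n) + real (j n)))"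
        using kpos
      proof eventually_elim
        case (elim n)
        have "(real (j n))\<^sup>2 / real (k n) / (1 + real (j n) / real (k n)) = (real (j n))\<^sup>2 / (real (k n) + real (j n))"
          using elim by (simp add: field_simps)
        then show ?case by simp
      qed
    qed simp
  qed
qed

section \<open>Exponential moments of the walk bridge\<close>

text \<open>The symmetric two-point case of Hoeffding's lemma: with weight \<open>1 / 2\<close> and
  parameter \<open>2 * c\<close> the argument of its logarithm is
  \<open>exp c * cosh c\<close>.\<close>

lemma cosh_le_exp: "cosh c \<le> exp (c\<^sup>2 / 2)" for c :: real
proof -
  have "cosh c \<le> exp (c\<^sup>2 / 2)" if "c \<ge> 0" for c :: real
  proof -
    have "- (2 * c) * (1 / 2) + ln (1 + 1 / 2 * (exp (2 * c) - 1)) \<le> (2 * c)\<^sup>2 / 8"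
      by (rule Hoeffdings_lemma_aux) (use that in auto)
    moreover have "1 + 1 / 2 * (exp (2 * c) - 1) = exp c * cosh c"
      by (simp add: cosh_def exp_double power2_eq_square field_simps mult_exp_exp)
    moreover have "ln (exp c * cosh c) = c + ln (cosh c)" by (simp add: ln_mult)
    ultimately have "ln (cosh c) \<le> c\<^sup>2 / 2" by (simp add: power2_eq_square)
    then show ?thesis by (metis cosh_real_pos exp_le_cancel_iff exp_ln)
  qed
  from this[of "\<bar>c\<bar>"] show ?thesis by (simp add: cosh_real_abs)
qed

text \<open>Sums over arbitrary index sets: increments of the walk, blocks, and what remains after
  removing an interval of steps are all of this form.\<close>

definition psum :: "(nat \<Rightarrow> 'a \<Rightarrow> real) \<Rightarrow> nat set \<Rightarrow> 'a \<Rightarrow> real" where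
  "psum X I \<omega> = (\<Sum>i\<in>I. X i \<omega>)"

lemma walk_psum: "walk X n = psum X {1..n}"
  by (simp add: walk_def psum_def fun_eq_iff)

lemma psum_Un: "finite I \<Longrightarrow> finite J \<Longrightarrow> I \<inter> J = {} \<Longrightarrow> psum X (I \<union> J) \<omega> = psum X I \<omega> + psum X J \<omega>"
  by (simp add: psum_def sum.union_disjoint)

section \<open>Sums of random signs and the cost of the return to 0\<close>

locale rademacher =
  fixes M :: "'a measure" and X :: "nat \<Rightarrow> 'a \<Rightarrow> real"
  assumes X: "rademacher_sequence M X"

sublocale rademacher \<subseteq> prob_space M
  using X by (simp add: rademacher_sequence_def)

context rademacher
begin

lemma X_indep: "indep_vars (\<lambda>_. borel) X {1..}"
  using X by (simp add: rademacher_sequence_def)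

lemma X_measurable: "i \<ge> 1 \<Longrightarrow> X i \<in> borel_measurable M"
  using X_indep by (simp add: indep_vars_def)

lemma X_prob: "i \<ge> 1 \<Longrightarrow> prob {\<omega> \<in> space M. X i \<omega> = 1} = 1 / 2" "i \<ge> 1 \<Longrightarrow> prob {\<omega> \<in> space M. X i \<omega> = - 1} = 1 / 2"
  using X by (simp_all add: rademacher_sequence_def)

lemma psum_measurable: "I \<subseteq> {1..} \<Longrightarrow> psum X I \<in> borel_measurable M"
  unfolding psum_def[abs_def] by (intro borel_measurable_sum X_measurable) auto

text \<open>The two disjoint events have total probability 1. Other values can occur only on a null
  set, and one null set serves all indices because they are countable.\<close>

lemma X_values: "AE \<omega> in M. \<forall>i\<ge>1. X i \<omega> = 1 \<or> X i \<omega> = - 1"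
proof -
  have "AE \<omega> in M. i \<ge> 1 \<longrightarrow> X i \<omega> = 1 \<or> X i \<omega> = - 1" for i
  proof (cases "i \<ge> 1")
    case i: True
    note [measurable] = X_measurable[OF i]
    have "prob {\<omega> \<in> space M. X i \<omega> = 1 \<or> X i \<omega> = - 1}
        = prob ({\<omega> \<in> space M. X i \<omega> = 1} \<union> {\<omega> \<in> space M. X i \<omega> = - 1})"
      by (rule arg_cong[where f=prob]) auto
    also have "\<dots> = prob {\<omega> \<in> space M. X i \<omega> = 1} + prob {\<omega> \<in> space M. X i \<omega> = - 1}"
      by (rule finite_measure_Union) auto
    also have "\<dots> = 1" using X_prob[OF i] by simp
    finally have "AE \<omega> in M. X i \<omega> = 1 \<or> X i \<omega> = - 1"
      by (subst prob_Collect_eq_1[symmetric]) auto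
    then show ?thesis by auto
  qed simp
  then show ?thesis by (simp add: AE_all_countable)
qed

lemma nn_integral_X:
  assumes i: "i \<ge> 1" and [measurable]: "f \<in> borel_measurable borel"
  shows "(\<integral>\<^sup>+\<omega>. f (X i \<omega>) \<partial>M) = (f 1 + f (- 1)) / 2"
proof -
  note [measurable] = X_measurable[OF i]
  have "(\<integral>\<^sup>+\<omega>. f (X i \<omega>) \<partial>M)
      = (\<integral>\<^sup>+\<omega>. f 1 * indicator {\<omega> \<in> space M. X i \<omega> = 1} \<omega> + f (- 1) * indicator {\<omega> \<in> space M. X i \<omega> = - 1} \<omega> \<partial>M)"
    using X_values i by (intro nn_integral_cong_AE) (auto simp: indicator_def elim!: eventually_mono)
  also have "\<dots> = f 1 * ennreal (1 / 2) + f (- 1) * ennreal (1 / 2)"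
  proof -
    have "emeasure M {\<omega> \<in> space M. X i \<omega> = 1} = ennreal (1 / 2)" "emeasure M {\<omega> \<in> space M. X i \<omega> = - 1} = ennreal (1 / 2)"
      using X_prob[OF i] by (simp_all only: emeasure_eq_measure)
    moreover have "{\<omega> \<in> space M. X i \<omega> = 1} \<in> events" "{\<omega> \<in> space M. X i \<omega> = - 1} \<in> events" by measurable
    ultimately show ?thesis by (simp only: nn_integral_add nn_integral_cmult_indicator borel_measurable_times_ennreal borel_measurable_const borel_measurable_indicator)
  qed
  also have "\<dots> = (f 1 + f (- 1)) / 2"
  proof -
    have "ennreal (1 / 2) = ennreal (inverse 2)" by (simp only: inverse_eq_divide)
    also have "\<dots> = inverse (ennreal 2)" by (rule inverse_ennreal[symmetric]) simp
    also have "ennreal 2 = 2" by (rule ennreal_numeral)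
    finally have "ennreal (1 / 2) = inverse 2" .
    then show ?thesis by (simp only: divide_ennreal_def distrib_right)
  qed
  finally show ?thesis .
qed

text \<open>Induction on the index set: splitting according to the sign of one inserted variable is
  the recursion of \<open>srw\<close>.\<close>

lemma prob_psum:
  assumes "finite I" "I \<subseteq> {1..}"
  shows "prob {\<omega> \<in> space M. psum X I \<omega> = x} = srw (card I) x"
  using assms
proof (induction I arbitrary: x rule: finite_induct)
  case empty
  then show ?case by (auto simp: psum_def prob_space)
next
  case (insert i I)
  then have i: "i \<ge> 1" and I: "I \<subseteq> {1..}" by auto
  note [measurable] = X_measurable[OF i] psum_measurable[OF I]
  have ind: "indep_var borel (X i) borel (psum X I)"
    unfolding psum_def[abs_def]
    by (rule indep_vars_sum[OF insert(1,2) indep_vars_subset[OF X_indep]]) (use insert in auto)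
  have p: "prob {\<omega> \<in> space M. X i \<omega> = a \<and> psum X I \<omega> = b} = prob {\<omega> \<in> space M. X i \<omega> = a} * srw (card I) b" for a b
  proof -
    have "prob ((\<lambda>\<omega>. (X i \<omega>, psum X I \<omega>)) -` ({a} \<times> {b}) \<inter> space M) = prob (X i -` {a} \<inter> space M) * prob (psum X I -` {b} \<inter> space M)"
      by (rule indep_varD[OF ind]) auto
    moreover have "(\<lambda>\<omega>. (X i \<omega>, psum X I \<omega>)) -` ({a} \<times> {b}) \<inter> space M = {\<omega> \<in> space M. X i \<omega> = a \<and> psum X I \<omega> = b}"
      "X i -` {a} \<inter> space M = {\<omega> \<in> space M. X i \<omega> = a}" "psum X I -` {b} \<inter> space M = {\<omega> \<in> space M. psum X I \<omega> = b}"
      by auto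
    ultimately show ?thesis using insert.IH[OF I] by simp
  qed
  have "prob {\<omega> \<in> space M. psum X (insert i I) \<omega> = x}
      = prob ({\<omega> \<in> space M. X i \<omega> = 1 \<and> psum X I \<omega> = x - 1} \<union> {\<omega> \<in> space M. X i \<omega> = - 1 \<and> psum X I \<omega> = x + 1})"
  proof (rule measure_eq_AE)
    show "AE \<omega> in M. (\<omega> \<in> {\<omega> \<in> space M. psum X (insert i I) \<omega> = x})
      = (\<omega> \<in> {\<omega> \<in> space M. X i \<omega> = 1 \<and> psum X I \<omega> = x - 1} \<union> {\<omega> \<in> space M. X i \<omega> = - 1 \<and> psum X I \<omega> = x + 1})"
      using X_values
    proof eventually_elim
      case (elim \<omega>)
      have "psum X (insert i I) \<omega> = X i \<omega> + psum X I \<omega>" using insert(1,2) by (simp add: psum_def)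
      then show ?case using elim i by auto
    qed
    have "psum X (insert i I) \<in> borel_measurable M" by (rule psum_measurable) fact
    then show "{\<omega> \<in> space M. psum X (insert i I) \<omega> = x} \<in> events" by simp
  qed simp
  also have "\<dots> = prob {\<omega> \<in> space M. X i \<omega> = 1 \<and> psum X I \<omega> = x - 1} + prob {\<omega> \<in> space M. X i \<omega> = - 1 \<and> psum X I \<omega> = x + 1}"
    by (rule finite_measure_Union) auto
  also have "\<dots> = srw (card (insert i I)) x"
    unfolding p X_prob[OF i] using insert(1,2) by simp
  finally show ?case .
qed

text \<open>The steps in \<open>J\<close> are independent of those in \<open>I\<close> and are
  integrated out. What remains is the probability that their sum cancels the sum over
  \<open>I\<close>, and \<open>srw\<close> is even.\<close>

lemma nn_integral_psum_zero:
  assumes I: "finite I" "I \<subseteq> {1..}" and J: "finite J" "J \<subseteq> {1..}" and IJ: "I \<inter> J = {}"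
    and F[measurable]: "F \<in> borel_measurable (PiM I (\<lambda>_. borel))"
  shows "(\<integral>\<^sup>+\<omega>. F (\<lambda>i\<in>I. X i \<omega>) * indicator {0} (psum X I \<omega> + psum X J \<omega>) \<partial>M)
    = (\<integral>\<^sup>+\<omega>. F (\<lambda>i\<in>I. X i \<omega>) * ennreal (srw (card J) (psum X I \<omega>)) \<partial>M)"
proof -
  let ?U = "\<lambda>\<omega>. \<lambda>i\<in>I. X i \<omega>" and ?V = "\<lambda>\<omega>. \<lambda>i\<in>J. X i \<omega>"
  let ?PI = "PiM I (\<lambda>_. borel :: real measure)" and ?PJ = "PiM J (\<lambda>_. borel :: real measure)"
  have UV: "indep_var ?PI ?U ?PJ ?V" by (rule indep_var_restrict[OF X_indep IJ I(2) J(2)])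
  have [measurable]: "?U \<in> measurable M ?PI" "?V \<in> measurable M ?PJ"
    using indep_var_rv1[OF UV] indep_var_rv2[OF UV] .
  interpret DV: prob_space "distr M ?PJ ?V" by (rule prob_space_distr) measurable
  have sI: "psum X I \<omega> = (\<Sum>i\<in>I. ?U \<omega> i)" and sJ: "psum X J \<omega> = (\<Sum>i\<in>J. ?V \<omega> i)" for \<omega>
    by (simp_all add: psum_def)
  have "(\<integral>\<^sup>+\<omega>. F (?U \<omega>) * indicator {0} (psum X I \<omega> + psum X J \<omega>) \<partial>M)
     = (\<integral>\<^sup>+\<omega>. (\<lambda>(u, v). F u * indicator {0} ((\<Sum>i\<in>I. u i) + (\<Sum>i\<in>J. v i))) (?U \<omega>, ?V \<omega>) \<partial>M)"
    unfolding sI sJ by simp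
  also have "\<dots> = (\<integral>\<^sup>+z. (\<lambda>(u, v). F u * indicator {0} ((\<Sum>i\<in>I. u i) + (\<Sum>i\<in>J. v i))) z \<partial>distr M (?PI \<Otimes>\<^sub>M ?PJ) (\<lambda>\<omega>. (?U \<omega>, ?V \<omega>)))"
    by (rule nn_integral_distr[symmetric]) measurable
  also have "distr M (?PI \<Otimes>\<^sub>M ?PJ) (\<lambda>\<omega>. (?U \<omega>, ?V \<omega>)) = distr M ?PI ?U \<Otimes>\<^sub>M distr M ?PJ ?V"
    using UV by (simp add: indep_var_distribution_eq)
  also have "(\<integral>\<^sup>+z. (\<lambda>(u, v). F u * indicator {0} ((\<Sum>i\<in>I. u i) + (\<Sum>i\<in>J. v i))) z \<partial>(distr M ?PI ?U \<Otimes>\<^sub>M distr M ?PJ ?V))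
     = (\<integral>\<^sup>+u. (\<integral>\<^sup>+v. F u * indicator {0} ((\<Sum>i\<in>I. u i) + (\<Sum>i\<in>J. v i)) \<partial>distr M ?PJ ?V) \<partial>distr M ?PI ?U)"
    by (subst DV.nn_integral_fst[symmetric]) auto
  also have "\<dots> = (\<integral>\<^sup>+u. F u * ennreal (srw (card J) (\<Sum>i\<in>I. u i)) \<partial>distr M ?PI ?U)"
  proof (intro nn_integral_cong)
    fix u
    have Jm: "psum X J \<in> borel_measurable M" by (rule psum_measurable[OF J(2)])
    have "(\<integral>\<^sup>+v. F u * indicator {0} ((\<Sum>i\<in>I. u i) + (\<Sum>i\<in>J. v i)) \<partial>distr M ?PJ ?V)
        = (\<integral>\<^sup>+\<omega>. F u * indicator {\<omega> \<in> space M. psum X J \<omega> = - (\<Sum>i\<in>I. u i)} \<omega> \<partial>M)"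
      by (subst nn_integral_distr) (auto simp: indicator_def psum_def intro!: nn_integral_cong)
    also have "\<dots> = F u * ennreal (prob {\<omega> \<in> space M. psum X J \<omega> = - (\<Sum>i\<in>I. u i)})"
      using Jm by (subst nn_integral_cmult_indicator) (auto simp: emeasure_eq_measure)
    finally show "(\<integral>\<^sup>+v. F u * indicator {0} ((\<Sum>i\<in>I. u i) + (\<Sum>i\<in>J. v i)) \<partial>distr M ?PJ ?V)
        = F u * ennreal (srw (card J) (\<Sum>i\<in>I. u i))"
      unfolding prob_psum[OF J] srw_minus .
  qed
  also have "\<dots> = (\<integral>\<^sup>+\<omega>. F (?U \<omega>) * ennreal (srw (card J) (psum X I \<omega>)) \<partial>M)"
    unfolding sI by (subst nn_integral_distr) auto
  finally show ?thesis .
qed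

lemma nn_integral_psum_exp:
  assumes I: "finite I" "I \<subseteq> {1..}"
  shows "(\<integral>\<^sup>+\<omega>. ennreal (exp (c * psum X I \<omega>)) \<partial>M) = ennreal (cosh c ^ card I)"
proof -
  have "(\<integral>\<^sup>+\<omega>. ennreal (exp (c * psum X I \<omega>)) \<partial>M) = (\<integral>\<^sup>+\<omega>. (\<Prod>i\<in>I. ennreal (exp (c * X i \<omega>))) \<partial>M)"
    using I(1) by (simp add: psum_def sum_distrib_left exp_sum prod_ennreal)
  also have "\<dots> = (\<Prod>i\<in>I. \<integral>\<^sup>+\<omega>. ennreal (exp (c * X i \<omega>)) \<partial>M)"
    by (rule indep_vars_nn_integral[OF I(1)])
       (auto intro!: indep_vars_compose2[OF indep_vars_subset[OF X_indep I(2)], where Y="\<lambda>_ x. ennreal (exp (c * x))"])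
  also have "\<dots> = (\<Prod>i\<in>I. ennreal (cosh c))"
  proof (intro prod.cong refl)
    fix i assume "i \<in> I"
    then have "i \<ge> 1" using I by auto
    then have "(\<integral>\<^sup>+\<omega>. ennreal (exp (c * X i \<omega>)) \<partial>M) = (ennreal (exp (c * 1)) + ennreal (exp (c * (- 1)))) / 2"
      by (rule nn_integral_X) measurable
    also have "\<dots> = ennreal ((exp c + exp (- c)) / 2)"
      by (simp add: ennreal_plus[symmetric] divide_ennreal flip: ennreal_numeral del: ennreal_plus)
    finally show "(\<integral>\<^sup>+\<omega>. ennreal (exp (c * X i \<omega>)) \<partial>M) = ennreal (cosh c)" by (simp add: cosh_def)
  qed
  finally show ?thesis by (simp add: ennreal_power)
qed

text \<open>The return to 0 is left to the steps in \<open>J\<close>, at least half of all steps: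
  whatever the sum over \<open>I\<close>, the conditional probability of the return is at most
  \<open>1 / sqrt (card J)\<close>, hence at most \<open>sqrt (2 / n)\<close>. The bound thus keeps
  the true order of the return probability.\<close>

lemma nn_integral_psum_zero_le:
  assumes IJ: "I \<union> J = {1..n}" "I \<inter> J = {}" "n \<le> 2 * card J" "n > 0"
    and f[measurable]: "f \<in> borel_measurable borel"
  shows "(\<integral>\<^sup>+\<omega>. f (psum X I \<omega>) * indicator {0} (walk X n \<omega>) \<partial>M)
    \<le> ennreal (sqrt (2 / real n)) * (\<integral>\<^sup>+\<omega>. f (psum X I \<omega>) \<partial>M)"
proof -
  have sub: "I \<subseteq> {1..n}" "J \<subseteq> {1..n}" using IJ by auto
  then have fin: "finite I" "finite J" by (auto intro: finite_subset)
  have sub1: "I \<subseteq> {1..}" "J \<subseteq> {1..}" using sub by auto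
  have [measurable]: "psum X I \<in> borel_measurable M" by (rule psum_measurable[OF sub1(1)])
  have Fm: "(\<lambda>u. f (\<Sum>i\<in>I. u i)) \<in> borel_measurable (PiM I (\<lambda>_. borel))" by measurable
  have w: "walk X n \<omega> = psum X I \<omega> + psum X J \<omega>" for \<omega>
    unfolding walk_psum IJ(1)[symmetric] by (rule psum_Un[OF fin IJ(2)])
  have "(\<integral>\<^sup>+\<omega>. f (psum X I \<omega>) * indicator {0} (walk X n \<omega>) \<partial>M)
     = (\<integral>\<^sup>+\<omega>. (\<lambda>u. f (\<Sum>i\<in>I. u i)) (\<lambda>i\<in>I. X i \<omega>) * indicator {0} (psum X I \<omega> + psum X J \<omega>) \<partial>M)"
    unfolding w by (simp add: psum_def)
  also have "\<dots> = (\<integral>\<^sup>+\<omega>. (\<lambda>u. f (\<Sum>i\<in>I. u i)) (\<lambda>i\<in>I. X i \<omega>) * ennreal (srw (card J) (psum X I \<omega>)) \<partial>M)"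
    by (rule nn_integral_psum_zero[OF fin(1) sub1(1) fin(2) sub1(2) IJ(2) Fm])
  also have "\<dots> \<le> (\<integral>\<^sup>+\<omega>. ennreal (sqrt (2 / real n)) * f (psum X I \<omega>) \<partial>M)"
  proof (intro nn_integral_mono)
    fix \<omega>
    have cJ: "card J > 0" using IJ by simp
    have "srw (card J) (psum X I \<omega>) \<le> 1 / sqrt (real (card J))" by (rule srw_le[OF cJ])
    also have "\<dots> = sqrt (1 / real (card J))" by (simp add: real_sqrt_divide)
    also have "\<dots> \<le> sqrt (2 / real n)"
    proof (rule real_sqrt_le_mono)
      have "real n \<le> 2 * real (card J)" using IJ(3) by linarith
      then show "1 / real (card J) \<le> 2 / real n" using cJ IJ(4) by (simp add: field_simps)
    qed
    finally have "ennreal (srw (card J) (psum X I \<omega>)) \<le> ennreal (sqrt (2 / real n))" by (rule ennreal_leI)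
    then show "(\<lambda>u. f (\<Sum>i\<in>I. u i)) (\<lambda>i\<in>I. X i \<omega>) * ennreal (srw (card J) (psum X I \<omega>)) \<le> ennreal (sqrt (2 / real n)) * f (psum X I \<omega>)"
      by (simp add: psum_def mult.commute mult_left_mono)
  qed
  also have "\<dots> = ennreal (sqrt (2 / real n)) * (\<integral>\<^sup>+\<omega>. f (psum X I \<omega>) \<partial>M)"
    by (rule nn_integral_cmult) measurable
  finally show ?thesis .
qed

text \<open>For \<open>2 * i \<le> n\<close> the steps after \<open>i\<close> are numerous enough to
  carry the return. Otherwise, on the return event, the walk at time \<open>i\<close> is minus the
  sum of the remaining steps, and the first \<open>i\<close> steps carry the return instead; the
  change of sign is harmless since only \<open>c\<^sup>2\<close> enters the bound.\<close>

lemma walk_bridge_exp_moment: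
  assumes i: "i \<le> n" and n: "n > 0"
  shows "(\<integral>\<^sup>+\<omega>. ennreal (exp (c * walk X i \<omega>)) * indicator {0} (walk X n \<omega>) \<partial>M)
    \<le> ennreal (sqrt (2 / real n) * exp (c\<^sup>2 * real n / 2))"
proof -
  have part: "(\<integral>\<^sup>+\<omega>. ennreal (exp (d * psum X I \<omega>)) * indicator {0} (walk X n \<omega>) \<partial>M)
    \<le> ennreal (sqrt (2 / real n) * exp (c\<^sup>2 * real n / 2))"
    if IJ: "I \<union> J = {1..n}" "I \<inter> J = {}" "n \<le> 2 * card J" and d: "d\<^sup>2 = c\<^sup>2" for I J d
  proof -
    have I: "finite I" "I \<subseteq> {1..}" "card I \<le> n"
      using IJ card_mono[of "{1..n}" I] finite_subset[of I "{1..n}"] by auto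
    have "(\<integral>\<^sup>+\<omega>. ennreal (exp (d * psum X I \<omega>)) * indicator {0} (walk X n \<omega>) \<partial>M)
        \<le> ennreal (sqrt (2 / real n)) * (\<integral>\<^sup>+\<omega>. ennreal (exp (d * psum X I \<omega>)) \<partial>M)"
      by (rule nn_integral_psum_zero_le[OF IJ n, of "\<lambda>x. ennreal (exp (d * x))"]) measurable
    also have "\<dots> = ennreal (sqrt (2 / real n)) * ennreal (cosh d ^ card I)"
      by (simp add: nn_integral_psum_exp[OF I(1,2)])
    also have "\<dots> \<le> ennreal (sqrt (2 / real n)) * ennreal (exp (c\<^sup>2 * real n / 2))"
    proof (intro mult_left_mono ennreal_leI)
      have "cosh d ^ card I \<le> exp (c\<^sup>2 / 2) ^ card I"
        using cosh_le_exp[of d] d by (intro power_mono) auto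
      also have "\<dots> = exp (real (card I) * (c\<^sup>2 / 2))" by (simp add: exp_of_nat_mult[symmetric])
      also have "\<dots> \<le> exp (c\<^sup>2 * real n / 2)"
        using mult_right_mono[of "real (card I)" "real n" "c\<^sup>2 / 2"] I(3) by (simp add: mult.commute)
      finally show "cosh d ^ card I \<le> exp (c\<^sup>2 * real n / 2)" .
    qed simp
    finally show ?thesis by (simp add: ennreal_mult)
  qed
  show ?thesis
  proof (cases "2 * i \<le> n")
    case True
    then show ?thesis
      unfolding walk_psum[of X i] by (intro part[of _ "{Suc i..n}"]) (use i in auto)
  next
    case False
    have "exp (c * walk X i \<omega>) = exp (- c * psum X {Suc i..n} \<omega>)" if "walk X n \<omega> = 0" for \<omega>
    proof -
      have "{1..n} = {1..i} \<union> {Suc i..n}" using i by auto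
      then have "walk X n \<omega> = walk X i \<omega> + psum X {Suc i..n} \<omega>"
        unfolding walk_psum by (simp add: psum_Un)
      then have "walk X i \<omega> = - psum X {Suc i..n} \<omega>" using that by simp
      then show ?thesis by simp
    qed
    then have "(\<integral>\<^sup>+\<omega>. ennreal (exp (c * walk X i \<omega>)) * indicator {0} (walk X n \<omega>) \<partial>M)
       = (\<integral>\<^sup>+\<omega>. ennreal (exp (- c * psum X {Suc i..n} \<omega>)) * indicator {0} (walk X n \<omega>) \<partial>M)"
      by (intro nn_integral_cong) (auto simp: indicator_def)
    also have "\<dots> \<le> ennreal (sqrt (2 / real n) * exp (c\<^sup>2 * real n / 2))"
      by (rule part[of _ "{1..i}"]) (use i False in auto)
    finally show ?thesis .
  qed
qed

text \<open>The increment involves at most half of the steps, so the others carry the return. The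
  free mean is \<open>cosh (2 * a) ^ l - 2 * cosh a ^ l + 1\<close> with \<open>l = j - i\<close>,
  and \<open>cosh a \<ge> 1\<close> bounds the last two terms by \<open>- 1\<close>.\<close>

lemma walk_bridge_increment:
  assumes ij: "i \<le> j" "j \<le> n" "2 * (j - i) \<le> n" and n: "n > 0"
  shows "(\<integral>\<^sup>+\<omega>. ennreal ((exp (a * (walk X j \<omega> - walk X i \<omega>)) - 1)\<^sup>2) * indicator {0} (walk X n \<omega>) \<partial>M)
    \<le> ennreal (sqrt (2 / real n) * (exp (2 * a\<^sup>2 * real (j - i)) - 1))"
proof -
  let ?I = "{Suc i..j}" and ?J = "{1..n} - {Suc i..j}"
  have I: "finite ?I" "?I \<subseteq> {1..}" by auto
  have [measurable]: "psum X ?I \<in> borel_measurable M" by (rule psum_measurable[OF I(2)])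
  have cJ: "card ?J = n - (j - i)" using ij by (subst card_Diff_subset) auto
  have w: "walk X j \<omega> - walk X i \<omega> = psum X ?I \<omega>" for \<omega>
  proof -
    have "{1..j} = {1..i} \<union> ?I" using ij by auto
    then show ?thesis unfolding walk_psum by (simp add: psum_Un)
  qed
  have m: "integrable M (\<lambda>\<omega>. exp (c * psum X ?I \<omega>))" "(\<integral>\<omega>. exp (c * psum X ?I \<omega>) \<partial>M) = cosh c ^ (j - i)" for c
    using nn_integral_psum_exp[OF I, of c] by (auto intro!: integrable_of_nn_integral_eq)
  have e: "(exp (a * z) - 1)\<^sup>2 = exp (2 * a * z) - 2 * exp (a * z) + 1" for z :: real
    by (simp add: power2_eq_square algebra_simps mult_exp_exp)
  have "(\<integral>\<^sup>+\<omega>. ennreal ((exp (a * psum X ?I \<omega>) - 1)\<^sup>2) * indicator {0} (walk X n \<omega>) \<partial>M)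
    \<le> ennreal (sqrt (2 / real n)) * (\<integral>\<^sup>+\<omega>. ennreal ((exp (a * psum X ?I \<omega>) - 1)\<^sup>2) \<partial>M)"
    by (rule nn_integral_psum_zero_le[of _ ?J n "\<lambda>x. ennreal ((exp (a * x) - 1)\<^sup>2)"]) (use ij n cJ in auto)
  also have "(\<integral>\<^sup>+\<omega>. ennreal ((exp (a * psum X ?I \<omega>) - 1)\<^sup>2) \<partial>M) = ennreal (\<integral>\<omega>. (exp (a * psum X ?I \<omega>) - 1)\<^sup>2 \<partial>M)"
  proof (rule nn_integral_eq_integral)
    show "integrable M (\<lambda>\<omega>. (exp (a * psum X ?I \<omega>) - 1)\<^sup>2)"
      unfolding e by (intro Bochner_Integration.integrable_add Bochner_Integration.integrable_diff integrable_mult_right m) simp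
  qed simp
  also have "(\<integral>\<omega>. (exp (a * psum X ?I \<omega>) - 1)\<^sup>2 \<partial>M) = cosh (2 * a) ^ (j - i) - 2 * cosh a ^ (j - i) + 1"
    unfolding e using m[of "2 * a"] m[of a] by (simp add: prob_space)
  also have "ennreal (sqrt (2 / real n)) * ennreal (cosh (2 * a) ^ (j - i) - 2 * cosh a ^ (j - i) + 1)
     \<le> ennreal (sqrt (2 / real n)) * ennreal (exp (2 * a\<^sup>2 * real (j - i)) - 1)"
  proof (intro mult_left_mono ennreal_leI)
    have "cosh (2 * a) ^ (j - i) \<le> exp ((2 * a)\<^sup>2 / 2) ^ (j - i)"
      by (intro power_mono cosh_le_exp) simp
    also have "\<dots> = exp (2 * a\<^sup>2 * real (j - i))" by (simp add: exp_of_nat_mult[symmetric] mult.commute)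
    finally have "cosh (2 * a) ^ (j - i) \<le> exp (2 * a\<^sup>2 * real (j - i))" .
    moreover have "1 \<le> cosh a ^ (j - i)" by (intro one_le_power cosh_real_ge_1)
    ultimately show "cosh (2 * a) ^ (j - i) - 2 * cosh a ^ (j - i) + 1 \<le> exp (2 * a\<^sup>2 * real (j - i)) - 1" by linarith
  qed simp
  also have "\<dots> = ennreal (sqrt (2 / real n) * (exp (2 * a\<^sup>2 * real (j - i)) - 1))"
    by (rule ennreal_mult[symmetric]) auto
  finally show ?thesis unfolding w .
qed

end

section \<open>Convergence of the block increments of the walk bridge\<close>

text \<open>The conditional variance when the walk is frozen at the start of each block:
  \<open>d l\<close> is the increment over block \<open>l\<close>, \<open>a\<close> the weight of
  each of the first \<open>k\<close> blocks and \<open>b\<close> that of the last one, whose own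
  increment is not read. The weights differ because the last block absorbs the remainder.\<close>

definition block_var :: "nat \<Rightarrow> real \<Rightarrow> real \<Rightarrow> (nat \<Rightarrow> real) \<Rightarrow> real" where
  "block_var k a b d = a * (\<Sum>i<k. exp (2 * (\<Sum>l<i. d l))) + b * exp (2 * (\<Sum>l<k. d l))"

lemma block_var_step_var: "block_var k (t / real (Suc k)) (t / real (Suc k)) d = step_var t (Suc k) d"
  by (simp add: block_var_def step_var_def sum_distrib_left algebra_simps)

lemma block_var_measurable [measurable]: "block_var k a b \<in> borel_measurable (PiM {..<k} (\<lambda>_. borel))"
  unfolding block_var_def[abs_def]
  by (intro borel_measurable_add borel_measurable_sum borel_measurable_times borel_measurable_const
        measurable_compose[OF _ borel_measurable_exp] measurable_component_singleton) auto

lemma block_var_cong: "(\<And>i. i < k \<Longrightarrow> d i = d' i) \<Longrightarrow> block_var k a b d = block_var k a b d'"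
  unfolding block_var_def by (intro arg_cong2[where f="(+)"] arg_cong2[where f=times] sum.cong arg_cong[where f=exp]) auto

lemma block_var_tendsto:
  assumes "(\<lambda>n. a n) \<longlonglongrightarrow> a'" "(\<lambda>n. b n) \<longlonglongrightarrow> b'" "\<And>i. i < k \<Longrightarrow> (\<lambda>n. d n i) \<longlonglongrightarrow> d' i"
  shows "(\<lambda>n. block_var k (a n) (b n) (d n)) \<longlonglongrightarrow> block_var k a' b' d'"
  unfolding block_var_def by (intro tendsto_intros assms) auto

lemma nn_integral_PiM_distr:
  assumes M: "prob_space M" and f[measurable]: "f \<in> measurable M borel" and F[measurable]: "F \<in> borel_measurable (PiM {..<k::nat} (\<lambda>_. borel :: real measure))"
  shows "(\<integral>\<^sup>+d. F d \<partial>PiM {..<k} (\<lambda>_. distr M borel f)) = (\<integral>\<^sup>+w. F (\<lambda>i\<in>{..<k}. f (w i)) \<partial>PiM {..<k} (\<lambda>_. M))"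
proof -
  interpret M: prob_space M by fact
  interpret D: prob_space "distr M borel f" by (rule M.prob_space_distr) simp
  have F': "F \<in> borel_measurable (PiM {..<k} (\<lambda>_. distr M borel f))"
    using F by (simp cong: measurable_cong_sets sets_PiM_cong)
  have e: "distr (PiM {..<k} (\<lambda>_. M)) (PiM {..<k} (\<lambda>_. distr M borel f)) (compose {..<k} f) = PiM {..<k} (\<lambda>_. distr M borel f)"
  proof -
    have "distr (PiM {..<k} (\<lambda>_. M)) (PiM {..<k} (\<lambda>_. distr M borel f)) (compose {..<k} f)
        = PiM {..<k} (\<lambda>_. distr M (distr M borel f) f)"
      by (rule distr_PiM_finite_prob_space') (auto intro: M.prob_space_axioms D.prob_space_axioms)
    also have "distr M (distr M borel f) f = distr M borel f" by (rule distr_cong) auto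
    finally show ?thesis .
  qed
  have "(\<integral>\<^sup>+d. F d \<partial>PiM {..<k} (\<lambda>_. distr M borel f)) = (\<integral>\<^sup>+w. F (compose {..<k} f w) \<partial>PiM {..<k} (\<lambda>_. M))"
  proof (subst e[symmetric], rule nn_integral_distr)
    show "F \<in> borel_measurable (distr (PiM {..<k} (\<lambda>_. M)) (PiM {..<k} (\<lambda>_. distr M borel f)) (compose {..<k} f))"
      using F' by simp
    show "compose {..<k} f \<in> measurable (PiM {..<k} (\<lambda>_. M)) (PiM {..<k} (\<lambda>_. distr M borel f))"
      unfolding compose_def by measurable
  qed
  then show ?thesis by (simp add: compose_def)
qed

context rademacher
begin

text \<open>The law of each sign is known only through its two point probabilities. The mean of
  \<open>f\<close> therefore follows the recursion \<open>E\<close>, in which the index set appears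
  only through its size.\<close>

lemma psum_distr_eq:
  assumes I: "finite I" "I \<subseteq> {1..}" and J: "finite J" "J \<subseteq> {1..}" and c: "card I = card J"
  shows "distr M borel (psum X I) = distr M borel (psum X J)"
proof -
  define E :: "nat \<Rightarrow> (real \<Rightarrow> ennreal) \<Rightarrow> ennreal" where "E = rec_nat (\<lambda>f. f 0) (\<lambda>_ r f. (r (\<lambda>x. f (1 + x)) + r (\<lambda>x. f (- 1 + x))) / 2) "
  have E: "E 0 f = f 0" "E (Suc n) f = (E n (\<lambda>x. f (1 + x)) + E n (\<lambda>x. f (- 1 + x))) / 2"
    for n and f :: "real \<Rightarrow> ennreal" by (simp_all add: E_def)
  have int: "(\<integral>\<^sup>+\<omega>. f (psum X I \<omega>) \<partial>M) = E (card I) f"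
    if "finite I" "I \<subseteq> {1..}" "f \<in> borel_measurable borel" for I f
    using that
  proof (induction I arbitrary: f rule: finite_induct)
    case empty
    then show ?case by (simp add: psum_def E emeasure_space_1)
  next
    case (insert i I)
    then have i: "i \<ge> 1" and I: "I \<subseteq> {1..}" by auto
    note [measurable] = X_measurable[OF i] psum_measurable[OF I] insert.prems(2)
    have ind: "indep_var borel (X i) borel (psum X I)"
      unfolding psum_def[abs_def]
      by (rule indep_vars_sum[OF insert(1,2) indep_vars_subset[OF X_indep]]) (use insert in auto)
    have part: "(\<integral>\<^sup>+\<omega>. indicator {a} (X i \<omega>) * f (a + psum X I \<omega>) \<partial>M) = E (card I) (\<lambda>x. f (a + x)) * ennreal (1 / 2)"
      if "a = 1 \<or> a = - 1" for a
    proof -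
      have "(\<integral>\<^sup>+\<omega>. indicator {a} (X i \<omega>) * f (a + psum X I \<omega>) \<partial>M)
          = (\<integral>\<^sup>+\<omega>. indicator {a} (X i \<omega>) \<partial>M) * (\<integral>\<^sup>+\<omega>. f (a + psum X I \<omega>) \<partial>M)"
        by (rule nn_integral_indep_mult[OF ind]) measurable
      also have "(\<integral>\<^sup>+\<omega>. f (a + psum X I \<omega>) \<partial>M) = E (card I) (\<lambda>x. f (a + x))"
        by (rule insert.IH[OF I]) measurable
      also have "(\<integral>\<^sup>+\<omega>. indicator {a} (X i \<omega>) \<partial>M) = emeasure M {\<omega> \<in> space M. X i \<omega> = a}"
      proof -
        have "(\<integral>\<^sup>+\<omega>. indicator {a} (X i \<omega>) \<partial>M) = (\<integral>\<^sup>+\<omega>. indicator {\<omega> \<in> space M. X i \<omega> = a} \<omega> \<partial>M)"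
          by (intro nn_integral_cong) (auto simp: indicator_def)
        then show ?thesis by simp
      qed
      also have "\<dots> = ennreal (1 / 2)" using X_prob[OF i] that by (auto simp only: emeasure_eq_measure)
      finally show ?thesis by (simp only: mult.commute)
    qed
    have "(\<integral>\<^sup>+\<omega>. f (psum X (insert i I) \<omega>) \<partial>M)
        = (\<integral>\<^sup>+\<omega>. indicator {1} (X i \<omega>) * f (1 + psum X I \<omega>) + indicator {- 1} (X i \<omega>) * f (- 1 + psum X I \<omega>) \<partial>M)"
      using X_values i insert(1,2) by (intro nn_integral_cong_AE) (auto simp: psum_def elim!: eventually_mono)
    also have "\<dots> = (\<integral>\<^sup>+\<omega>. indicator {1} (X i \<omega>) * f (1 + psum X I \<omega>) \<partial>M) + (\<integral>\<^sup>+\<omega>. indicator {- 1} (X i \<omega>) * f (- 1 + psum X I \<omega>) \<partial>M)"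
      by (rule nn_integral_add) measurable
    also have "\<dots> = E (card I) (\<lambda>x. f (1 + x)) * ennreal (1 / 2) + E (card I) (\<lambda>x. f (- 1 + x)) * ennreal (1 / 2)"
      by (subst part, simp, subst part, simp, rule refl)
    also have "\<dots> = E (card (insert i I)) f"
    proof -
      have "ennreal (1 / 2) = ennreal (inverse 2)" by (simp only: inverse_eq_divide)
      also have "\<dots> = inverse (ennreal 2)" by (rule inverse_ennreal[symmetric]) simp
      also have "ennreal 2 = 2" by (rule ennreal_numeral)
      finally have h: "ennreal (1 / 2) = inverse 2" .
      have c: "card (insert i I) = Suc (card I)" using insert(1,2) by simp
      show ?thesis unfolding h c E(2) divide_ennreal_def distrib_right by (rule refl)
    qed
    finally show ?case .
  qed
  show ?thesis
  proof (rule measure_eqI)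
    fix A assume "A \<in> sets (distr M borel (psum X I))"
    then have A[measurable]: "A \<in> sets borel" by simp
    have "emeasure (distr M borel (psum X I)) A = (\<integral>\<^sup>+\<omega>. indicator A (psum X I \<omega>) \<partial>M)"
      if I: "finite I" "I \<subseteq> {1..}" for I
    proof -
      have "emeasure (distr M borel (psum X I)) A = (\<integral>\<^sup>+x. indicator A x \<partial>distr M borel (psum X I))" by simp
      also have "\<dots> = (\<integral>\<^sup>+\<omega>. indicator A (psum X I \<omega>) \<partial>M)"
        using psum_measurable[OF I(2)] by (intro nn_integral_distr) auto
      finally show ?thesis .
    qed
    then show "emeasure (distr M borel (psum X I)) A = emeasure (distr M borel (psum X J)) A"
      using int[OF I, of "indicator A"] int[OF J, of "indicator A"] c I J by simp
  qed simp
qed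

text \<open>The blocks are disjoint, hence their sums are independent, and they have equal length,
  hence identical laws.\<close>

lemma psum_blocks:
  assumes F: "F \<in> borel_measurable (PiM {..<k} (\<lambda>_. borel :: real measure))" and k: "k > 0"
  shows "(\<integral>\<^sup>+\<omega>. F (\<lambda>i\<in>{..<k}. psum X {i * L + 1..(i + 1) * L} \<omega>) \<partial>M)
    = (\<integral>\<^sup>+d. F d \<partial>PiM {..<k} (\<lambda>_. distr M borel (walk X L)))"
proof -
  let ?B = "\<lambda>i. {i * L + 1..(i + 1) * L}"
  have disj: "disjoint_family_on ?B {..<k}"
    unfolding disjoint_family_on_def
  proof (intro ballI impI)
    fix i j :: nat assume "i \<noteq> j"
    have "?B i \<inter> ?B j = {}" if "i < j" for i j
    proof -
      have "(i + 1) * L \<le> j * L" using that by (intro mult_right_mono) auto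
      then show ?thesis by auto
    qed
    from this[of i j] this[of j i] \<open>i \<noteq> j\<close> show "?B i \<inter> ?B j = {}" by (metis Int_commute nat_neq_iff)
  qed
  have "indep_vars (\<lambda>i. PiM (?B i) (\<lambda>_. borel)) (\<lambda>i \<omega>. \<lambda>l\<in>?B i. X l \<omega>) {..<k}"
    by (rule indep_vars_restrict[OF X_indep _ disj]) auto
  from indep_vars_compose2[OF this, where Y="\<lambda>i u. \<Sum>l\<in>?B i. u l" and N="\<lambda>_. borel"]
  have iv: "indep_vars (\<lambda>_. borel) (\<lambda>i. psum X (?B i)) {..<k}"
    by (simp add: psum_def[abs_def])
  have m: "psum X (?B i) \<in> borel_measurable M" for i by (rule psum_measurable) auto
  have "distr M (PiM {..<k} (\<lambda>_. borel)) (\<lambda>\<omega>. \<lambda>i\<in>{..<k}. psum X (?B i) \<omega>) = PiM {..<k} (\<lambda>i. distr M borel (psum X (?B i)))"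
    using iv m k by (subst indep_vars_iff_distr_eq_PiM'[symmetric]) auto
  also have "\<dots> = PiM {..<k} (\<lambda>_. distr M borel (walk X L))"
  proof (rule PiM_cong)
    fix i
    show "distr M borel (psum X (?B i)) = distr M borel (walk X L)"
      unfolding walk_psum by (rule psum_distr_eq) auto
  qed simp
  finally have e: "distr M (PiM {..<k} (\<lambda>_. borel)) (\<lambda>\<omega>. \<lambda>i\<in>{..<k}. psum X (?B i) \<omega>) = PiM {..<k} (\<lambda>_. distr M borel (walk X L))" .
  show ?thesis
    unfolding e[symmetric] using F by (subst nn_integral_distr) (auto intro!: measurable_restrict psum_measurable)
qed

lemma psum_blocks_sum:
  "(\<Sum>i<j. psum X {i * L + 1..(i + 1) * L} \<omega>) = walk X (j * L) \<omega>"
proof (induction j)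
  case (Suc j)
  have "{1..Suc j * L} = {1..j * L} \<union> {j * L + 1..(j + 1) * L}" by auto
  then have "walk X (Suc j * L) \<omega> = walk X (j * L) \<omega> + psum X {j * L + 1..(j + 1) * L} \<omega>"
    unfolding walk_psum by (simp only: psum_Un finite_atLeastAtMost) (subst psum_Un, auto)
  then show ?case using Suc by simp
qed (simp add: walk_def)

text \<open>Skorohod's representation upgrades the central limit theorem to pointwise convergence on
  one probability space. The local limit theorem can then be applied along each convergent sequence
  of block sums, and dominated convergence gives the limit of the integrals.\<close>

lemma walk_clt_coupling:
  obtains \<Omega> :: "real measure" and Z :: "nat \<Rightarrow> real \<Rightarrow> real" and Z' :: "real \<Rightarrow> real"
  where "prob_space \<Omega>" "\<And>L. Z L \<in> borel_measurable \<Omega>" "Z' \<in> borel_measurable \<Omega>"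
    "\<And>L. distr \<Omega> borel (Z L) = distr M borel (\<lambda>\<omega>. walk X L \<omega> / sqrt (real L))"
    "distr \<Omega> borel Z' = gauss 1"
    "\<And>x. x \<in> space \<Omega> \<Longrightarrow> (\<lambda>L. Z L x) \<longlonglongrightarrow> Z' x"
proof -
  \<comment> \<open>The central limit theorem counts the summands from 0, the walk counts its steps
    from 1.\<close>
  define V where "V i = X (Suc i)" for i
  have Vm[measurable]: "V i \<in> borel_measurable M" for i unfolding V_def by (rule X_measurable) simp
  have vals: "AE \<omega> in M. V i \<omega> = 1 \<or> V i \<omega> = - 1" for i
    using X_values unfolding V_def by eventually_elim auto
  have sq: "AE \<omega> in M. (V i \<omega>)\<^sup>2 = 1" for i
    using vals[of i] by eventually_elim auto
  have indV: "indep_vars (\<lambda>i. borel) V UNIV"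
  proof -
    have "indep_vars (\<lambda>_. borel) (\<lambda>i. psum X {i + 1}) UNIV"
    proof -
      have "indep_vars (\<lambda>i. PiM {i + 1} (\<lambda>_. borel)) (\<lambda>i \<omega>. \<lambda>l\<in>{i + 1}. X l \<omega>) (UNIV :: nat set)"
        by (rule indep_vars_restrict[OF X_indep]) (auto simp: disjoint_family_on_def)
      from indep_vars_compose2[OF this, where Y="\<lambda>i u. u (i + 1)" and N="\<lambda>_. borel"]
      show ?thesis by (simp add: psum_def[abs_def])
    qed
    then show ?thesis by (simp add: psum_def[abs_def] V_def[abs_def])
  qed
  have int2: "integrable M (\<lambda>\<omega>. (V i \<omega>)\<^sup>2)" for i
    by (rule integrable_cong_AE_imp[of M "\<lambda>_. 1"]) (use sq[of i] in auto)
  have intV: "integrable M (V i)" for i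
    by (rule integrable_const_bound[of _ 1]) (use vals[of i] in \<open>auto elim!: eventually_mono\<close>)
  have mean: "expectation (V i) = 0" for i
  proof -
    have "expectation (V i) = (\<integral>\<omega>. indicator {\<omega> \<in> space M. X (Suc i) \<omega> = 1} \<omega> - indicator {\<omega> \<in> space M. X (Suc i) \<omega> = - 1} \<omega> \<partial>M)"
    proof (rule integral_cong_AE)
      show "AE \<omega> in M. V i \<omega> = indicator {\<omega> \<in> space M. X (Suc i) \<omega> = 1} \<omega> - indicator {\<omega> \<in> space M. X (Suc i) \<omega> = - 1} \<omega>"
        using vals[of i] AE_space by eventually_elim (auto simp: V_def)
      show "(\<lambda>\<omega>. indicator {\<omega> \<in> space M. X (Suc i) \<omega> = 1} \<omega> - indicator {\<omega> \<in> space M. X (Suc i) \<omega> = - 1} \<omega> :: real) \<in> borel_measurable M"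
        using Vm[of i] unfolding V_def by measurable
    qed simp
    also have "\<dots> = prob {\<omega> \<in> space M. X (Suc i) \<omega> = 1} - prob {\<omega> \<in> space M. X (Suc i) \<omega> = - 1}"
      using Vm[of i] unfolding V_def by (subst Bochner_Integration.integral_diff) (auto simp: emeasure_eq_measure)
    finally show ?thesis using X_prob[of "Suc i"] by simp
  qed
  have var: "variance (V i) = 1\<^sup>2" for i
  proof -
    have "expectation (\<lambda>\<omega>. (V i \<omega>)\<^sup>2) = expectation (\<lambda>_. 1)"
      by (rule integral_cong_AE) (use sq[of i] in auto)
    then show ?thesis using mean[of i] by (simp add: prob_space)
  qed
  have dist: "distr M borel (V i) = distr M borel (psum X {1})" for i
  proof -
    have "V i = psum X {Suc i}" by (simp add: V_def psum_def[abs_def])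
    then show ?thesis using psum_distr_eq[of "{Suc i}" "{1}"] by simp
  qed
  have clt: "weak_conv_m (\<lambda>n. distr M borel (\<lambda>x. (\<Sum>i<n. V i x) / sqrt (real n * 1\<^sup>2))) std_normal_distribution"
    by (rule central_limit_theorem_zero_mean[OF indV mean _ int2 var dist]) simp
  have W: "(\<Sum>i<n. V i x) = walk X n x" for n x
    unfolding walk_def V_def by (simp add: sum.atLeast1_atMost_eq)
  have rd: "real_distribution (distr M borel (\<lambda>\<omega>. walk X n \<omega> / sqrt (real n)))" for n
    unfolding walk_psum using psum_measurable[of "{1..n}"] by (intro real_distribution_distr) auto
  have clt': "weak_conv_m (\<lambda>n. distr M borel (\<lambda>\<omega>. walk X n \<omega> / sqrt (real n))) std_normal_distribution"
    using clt by (simp add: W)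
  from Skorohod[OF rd real_dist_normal_dist clt'] obtain \<Omega> :: "real measure" and Z :: "nat \<Rightarrow> real \<Rightarrow> real" and Z' :: "real \<Rightarrow> real" where *:
    "prob_space \<Omega>" "\<forall>n. Z n \<in> borel_measurable \<Omega>"
    "\<forall>n. distr \<Omega> borel (Z n) = distr M borel (\<lambda>\<omega>. walk X n \<omega> / sqrt (real n))"
    "Z' \<in> measurable \<Omega> lborel" "distr \<Omega> borel Z' = std_normal_distribution"
    "\<forall>x\<in>space \<Omega>. (\<lambda>n. Z n x) \<longlonglongrightarrow> Z' x" by (elim exE conjE)
  show ?thesis
    by (rule that[of \<Omega> Z Z']) (use * in \<open>auto simp: gauss_def cong: measurable_cong_sets\<close>)
qed

end

lemma distr_gauss_scale:
  assumes s: "s > 0"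
  shows "distr (gauss 1) borel (\<lambda>x. s * x) = gauss s"
proof (rule measure_eqI)
  fix A assume "A \<in> sets (distr (gauss 1) borel (\<lambda>x. s * x))"
  then have A[measurable]: "A \<in> sets borel" by simp
  have "emeasure (distr (gauss 1) borel (\<lambda>x. s * x)) A = (\<integral>\<^sup>+y. indicator A y \<partial>distr (gauss 1) borel (\<lambda>x. s * x))" by simp
  also have "\<dots> = gauss_mean (indicator A) (s\<^sup>2)"
    using s unfolding gauss_mean_def by (subst nn_integral_distr) auto
  also have "\<dots> = (\<integral>\<^sup>+y. indicator A y * ennreal (normal_density 0 s y) \<partial>lborel)"
    using s by (subst gauss_mean_density) auto
  also have "\<dots> = emeasure (gauss s) A"
    by (simp add: gauss_def emeasure_density mult.commute)
  finally show "emeasure (distr (gauss 1) borel (\<lambda>x. s * x)) A = emeasure (gauss s) A" .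
qed simp

section \<open>Even block lengths and their asymptotic proportions\<close>

lemma div_ratio_LIMSEQ:
  assumes m: "m > 0"
  shows "(\<lambda>N. real (N div m) / real N) \<longlonglongrightarrow> 1 / real m"
proof (rule tendsto_sandwich)
  have "(\<lambda>N. 1 / real m - 1 / real N) \<longlonglongrightarrow> 1 / real m - 0"
    by (intro tendsto_intros lim_const_over_n)
  then show "(\<lambda>N. 1 / real m - 1 / real N) \<longlonglongrightarrow> 1 / real m" by simp
  show "\<forall>\<^sub>F N in sequentially. 1 / real m - 1 / real N \<le> real (N div m) / real N"
  proof (rule eventually_sequentiallyI[of 1])
    fix N :: nat assume N: "1 \<le> N"
    have "real N / real m - 1 \<le> real (N div m)"
    proof -
      have "N < m * (N div m) + m" using m by (metis dividend_less_times_div mult.commute add.commute)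
      then have "real N < real m * real (N div m) + real m" by (metis of_nat_add of_nat_less_iff of_nat_mult)
      then show ?thesis using m by (simp add: field_simps)
    qed
    then have "(real N / real m - 1) / real N \<le> real (N div m) / real N" by (rule divide_right_mono) simp
    then show "1 / real m - 1 / real N \<le> real (N div m) / real N" using N m by (simp add: field_simps)
  qed
  show "\<forall>\<^sub>F N in sequentially. real (N div m) / real N \<le> 1 / real m"
  proof (rule eventually_sequentiallyI[of 1])
    fix N :: nat assume N: "1 \<le> N"
    have "m * (N div m) \<le> N" by (rule times_div_less_eq_dividend)
    then have "real m * real (N div m) \<le> real N" by (metis of_nat_le_iff of_nat_mult)
    then have "real (N div m) \<le> real N / real m" using m by (simp add: field_simps)
    then show "real (N div m) / real N \<le> 1 / real m" using N m by (simp add: field_simps)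
  qed
qed (rule tendsto_const)

text \<open>The walk of length \<open>2 * N\<close> is cut into \<open>k\<close> blocks of equal length and a last block that absorbs the remainder.
  All lengths are even because the local limit theorem is sensitive to parity.\<close>

definition block_length :: "nat \<Rightarrow> nat \<Rightarrow> nat" where
  "block_length k N = 2 * (N div Suc k)"

definition last_length :: "nat \<Rightarrow> nat \<Rightarrow> nat" where
  "last_length k N = 2 * N - k * block_length k N"

lemma block_length_le: "Suc k * block_length k N \<le> 2 * N"
proof -
  have "N div Suc k * Suc k \<le> N" by (rule div_times_less_eq_dividend)
  then show ?thesis by (simp add: block_length_def algebra_simps)
qed

lemma block_lengths: "k * block_length k N + last_length k N = 2 * N" "block_length k N \<le> last_length k N"
  using block_length_le[of k N] by (auto simp: last_length_def)

text \<open>None of the \<open>k + 1\<close> blocks is longer than the last one, so the last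
  contains at least the fraction \<open>1 / (k + 1)\<close> of the steps. This yields the uniform
  majorant in \<open>bridge_block_limit\<close>.\<close>

lemma last_length_ge: "real (2 * N) \<le> real (Suc k) * real (last_length k N)"
proof -
  have "2 * N = k * block_length k N + last_length k N" by (rule block_lengths(1)[symmetric])
  also have "\<dots> \<le> k * last_length k N + last_length k N" by (intro add_right_mono mult_left_mono block_lengths) simp
  finally have "2 * N \<le> Suc k * last_length k N" by simp
  then show ?thesis by (metis of_nat_le_iff of_nat_mult)
qed

lemma even_last_length: "even (last_length k N)"
  by (simp add: last_length_def block_length_def)

lemma block_length_ratio: "(\<lambda>N. real (block_length k N) / real (2 * N)) \<longlonglongrightarrow> 1 / real (Suc k)"
  using div_ratio_LIMSEQ[of "Suc k"] by (simp add: block_length_def)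

lemma last_length_ratio: "(\<lambda>N. real (last_length k N) / real (2 * N)) \<longlonglongrightarrow> 1 / real (Suc k)"
proof (rule Lim_transform_eventually)
  have "(\<lambda>N. 1 - real k * (real (block_length k N) / real (2 * N))) \<longlonglongrightarrow> 1 - real k * (1 / real (Suc k))"
    by (intro tendsto_diff tendsto_mult tendsto_const block_length_ratio)
  moreover have "1 - real k * (1 / real (Suc k)) = 1 / real (Suc k)" by (simp add: field_simps)
  ultimately show "(\<lambda>N. 1 - real k * (real (block_length k N) / real (2 * N))) \<longlonglongrightarrow> 1 / real (Suc k)" by simp
  show "\<forall>\<^sub>F N in sequentially. 1 - real k * (real (block_length k N) / real (2 * N)) = real (last_length k N) / real (2 * N)"
  proof (rule eventually_sequentiallyI[of 1])
    fix N :: nat assume N: "1 \<le> N"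
    have "real k * real (block_length k N) + real (last_length k N) = real (2 * N)"
      by (metis block_lengths(1) of_nat_add of_nat_mult)
    then have "real (last_length k N) = real (2 * N) - real k * real (block_length k N)" by simp
    then show "1 - real k * (real (block_length k N) / real (2 * N)) = real (last_length k N) / real (2 * N)"
      using N by (simp add: diff_divide_distrib)
  qed
qed

lemma last_length_at_top: "filterlim (last_length k) at_top sequentially"
  unfolding filterlim_at_top
proof
  fix Z
  show "\<forall>\<^sub>F N in sequentially. Z \<le> last_length k N"
  proof (rule eventually_sequentiallyI)
    fix N assume N: "Suc k * Z \<le> N"
    have "Z \<le> N div Suc k" using N by (metis div_le_mono nonzero_mult_div_cancel_left nat.simps(3))
    also have "\<dots> \<le> block_length k N" by (simp add: block_length_def)
    finally show "Z \<le> last_length k N" using block_lengths(2)[of k N] by linarith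
  qed
qed

lemma block_length_at_top: "filterlim (block_length k) at_top sequentially"
  unfolding filterlim_at_top
proof
  fix Z
  show "\<forall>\<^sub>F N in sequentially. Z \<le> block_length k N"
  proof (rule eventually_sequentiallyI)
    fix N assume N: "Suc k * Z \<le> N"
    have "Z \<le> N div Suc k" using N by (metis div_le_mono nonzero_mult_div_cancel_left nat.simps(3))
    also have "\<dots> \<le> block_length k N" by (simp add: block_length_def)
    finally show "Z \<le> block_length k N" .
  qed
qed

context rademacher
begin

lemma walk_parity: "AE \<omega> in M. \<forall>n. even n \<longrightarrow> (\<exists>j::int. walk X n \<omega> = 2 * of_int j)"
  using X_values
proof eventually_elim
  case (elim \<omega>)
  have "\<exists>j::int. walk X n \<omega> = real n + 2 * of_int j" for n
  proof (induction n)
    case 0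
    then show ?case by (intro exI[of _ 0]) (simp add: walk_def)
  next
    case (Suc n)
    then obtain j :: int where j: "walk X n \<omega> = real n + 2 * of_int j" by blast
    have "walk X (Suc n) \<omega> = walk X n \<omega> + X (Suc n) \<omega>" by (simp add: walk_def)
    have "X (Suc n) \<omega> = 1 \<or> X (Suc n) \<omega> = - 1" using elim by simp
    then show ?case
    proof
      assume "X (Suc n) \<omega> = 1"
      then show ?thesis using j \<open>walk X (Suc n) \<omega> = _\<close> by (intro exI[of _ j]) simp
    next
      assume "X (Suc n) \<omega> = - 1"
      then show ?thesis using j \<open>walk X (Suc n) \<omega> = _\<close> by (intro exI[of _ "j - 1"]) simp
    qed
  qed
  then show ?case
  proof (intro allI impI)
    fix n :: nat assume "even n"
    then obtain l where "n = 2 * l" by (elim evenE)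
    moreover obtain j :: int where "walk X n \<omega> = real n + 2 * of_int j"
      using \<open>\<And>n. \<exists>j::int. walk X n \<omega> = real n + 2 * of_int j\<close> by blast
    ultimately show "\<exists>j::int. walk X n \<omega> = 2 * of_int j" by (intro exI[of _ "int l + j"]) simp
  qed
qed

text \<open>The last block is integrated out and contributes the probability of cancelling the other
  blocks. For the first \<open>k\<close> blocks the coupled variables converge pointwise: the block
  functional follows by continuity, and the cancelling probability times \<open>sqrt (2 * N)\<close>
  by the local limit theorem. The limit is a Gaussian vector weighted by the density of one further
  Gaussian step, as on the left-hand side of \<open>nn_integral_bridge\<close>.\<close>

lemma bridge_block_limit:
  fixes f :: "real \<Rightarrow> real"
  assumes t: "t > 0" and k: "k > 0"
    and f: "continuous_on UNIV f" "\<And>a. 0 \<le> f a" "\<And>a. f a \<le> K"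
  defines "\<epsilon> \<equiv> \<lambda>N. step_size t (2 * N)" and "s \<equiv> sqrt (t / real (Suc k))"
  shows "(\<lambda>N. ennreal (sqrt (real (2 * N))) *
      (\<integral>\<^sup>+\<omega>. ennreal (f (block_var k (t / real (2 * N) * real (block_length k N)) (t / real (2 * N) * real (last_length k N))
          (\<lambda>i. \<epsilon> N * psum X {i * block_length k N + 1..(i + 1) * block_length k N} \<omega>)))
        * indicator {0} (walk X (2 * N) \<omega>) \<partial>M))
    \<longlonglongrightarrow> ennreal (2 * sqrt t) *
      (\<integral>\<^sup>+d. ennreal (f (step_var t (Suc k) d)) * ennreal (normal_density 0 s (0 - (\<Sum>i<k. d i))) \<partial>gauss_vec k s)"
proof -
  let ?m = "Suc k"
  have [measurable]: "f \<in> borel_measurable borel" by (rule borel_measurable_continuous_onI[OF f(1)])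
  have K: "0 \<le> K" using f(2,3) by (meson order_trans)
  have s: "s > 0" using t by (simp add: s_def)
  obtain \<Omega> :: "real measure" and Z Z' where \<Omega>: "prob_space \<Omega>"
    and Z[measurable]: "\<And>L. Z L \<in> borel_measurable \<Omega>" and Z'[measurable]: "Z' \<in> borel_measurable \<Omega>"
    and Zd: "\<And>L. distr \<Omega> borel (Z L) = distr M borel (\<lambda>\<omega>. walk X L \<omega> / sqrt (real L))"
    and Zd': "distr \<Omega> borel Z' = gauss 1"
    and Zlim: "\<And>x. x \<in> space \<Omega> \<Longrightarrow> (\<lambda>L. Z L x) \<longlonglongrightarrow> Z' x"
    by (rule walk_clt_coupling) blast
  interpret \<Omega>: prob_space \<Omega> by fact
  have wm[measurable]: "walk X L \<in> borel_measurable M" for L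
    unfolding walk_psum by (rule psum_measurable) auto
  define PP where "PP = PiM {..<k} (\<lambda>_. \<Omega>)"
  interpret PP: prob_space PP unfolding PP_def by (intro prob_space_PiM \<Omega>)
  define L where "L = block_length k"
  define h where "h = last_length k"
  define a where "a N = t / real (2 * N) * real (L N)" for N
  define b where "b N = t / real (2 * N) * real (h N)" for N
  define G where "G N d = ennreal (f (block_var k (a N) (b N) (\<lambda>i. \<epsilon> N * d i))) * ennreal (srw (h N) (\<Sum>i<k. d i))" for N d
  have bm[measurable]: "(\<lambda>d. block_var k a' b' (\<lambda>i. e * d i)) \<in> borel_measurable (PiM {..<k} (\<lambda>_. borel))" for a' b' e
    unfolding block_var_def
    by (intro borel_measurable_add borel_measurable_sum borel_measurable_times borel_measurable_const
        measurable_compose[OF _ borel_measurable_exp] measurable_component_singleton) auto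
  have G[measurable]: "G N \<in> borel_measurable (PiM {..<k} (\<lambda>_. borel))" for N
    unfolding G_def[abs_def] by measurable
  \<comment> \<open>Length 0 is treated apart: both sides are the point mass at 0, whereas division
    by \<open>sqrt 0\<close> loses the walk.\<close>
  have scale: "distr M borel (walk X L') = distr \<Omega> borel (\<lambda>x. sqrt (real L') * Z L' x)" for L'
  proof (cases "L' = 0")
    case True
    have "distr M borel (walk X 0) = return borel 0"
      using distr_const[of 0 borel] by (simp add: walk_def[abs_def])
    moreover have "distr \<Omega> borel (\<lambda>x. sqrt (real 0) * Z 0 x) = return borel 0"
      using \<Omega>.distr_const[of 0 borel] by simp
    ultimately show ?thesis using True by simp
  next
    case False
    have "distr \<Omega> borel (\<lambda>x. sqrt (real L') * Z L' x) = distr (distr \<Omega> borel (Z L')) borel (\<lambda>z. sqrt (real L') * z)"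
      by (simp add: distr_distr comp_def)
    also have "\<dots> = distr M borel (\<lambda>\<omega>. sqrt (real L') * (walk X L' \<omega> / sqrt (real L')))"
      unfolding Zd by (simp add: distr_distr comp_def)
    finally show ?thesis using False by simp
  qed
  \<comment> \<open>Transfer to \<open>k\<close> independent copies of the coupled space;
    \<open>G\<close> carries the functional and the cancelling probability of the last
    block.\<close>
  have rep: "(\<integral>\<^sup>+\<omega>. ennreal (f (block_var k (a N) (b N) (\<lambda>i. \<epsilon> N * psum X {i * L N + 1..(i + 1) * L N} \<omega>)))
        * indicator {0} (walk X (2 * N) \<omega>) \<partial>M)
      = (\<integral>\<^sup>+w. G N (\<lambda>i\<in>{..<k}. sqrt (real (L N)) * Z (L N) (w i)) \<partial>PP)" for N
  proof -
    let ?I = "{1..k * L N}" and ?J = "{k * L N + 1..2 * N}" and ?B = "\<lambda>i. {i * L N + 1..(i + 1) * L N}"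
    let ?F = "\<lambda>u. ennreal (f (block_var k (a N) (b N) (\<lambda>i. \<epsilon> N * (\<Sum>l\<in>?B i. u l))))"
    have nL: "k * L N + h N = 2 * N" unfolding L_def h_def by (rule block_lengths)
    have BI: "?B i \<subseteq> ?I" if "i < k" for i
    proof -
      have "(i + 1) * L N \<le> k * L N" using that by (intro mult_right_mono) auto
      then show ?thesis by auto
    qed
    have BI': "x \<in> ?I" if "x \<in> ?B i" "i < k" for x i using BI that by blast
    have Fm: "?F \<in> borel_measurable (PiM ?I (\<lambda>_. borel))"
    proof -
      have "(\<lambda>u. block_var k (a N) (b N) (\<lambda>i. \<epsilon> N * (\<Sum>l\<in>?B i. u l))) \<in> borel_measurable (PiM ?I (\<lambda>_. borel))"
        unfolding block_var_def
        by (intro borel_measurable_add borel_measurable_sum borel_measurable_times borel_measurable_const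
            measurable_compose[OF _ borel_measurable_exp] measurable_component_singleton; erule BI'; auto)
      then show ?thesis by measurable
    qed
    have w: "walk X (2 * N) \<omega> = psum X ?I \<omega> + psum X ?J \<omega>" for \<omega>
    proof -
      have "{1..2 * N} = ?I \<union> ?J" using nL by auto
      then show ?thesis unfolding walk_psum by (simp only:) (subst psum_Un, auto)
    qed
    have Fr: "?F (\<lambda>l\<in>?I. X l \<omega>) = ennreal (f (block_var k (a N) (b N) (\<lambda>i. \<epsilon> N * psum X (?B i) \<omega>)))" for \<omega>
    proof -
      have "(\<Sum>l\<in>?B i. (\<lambda>l\<in>?I. X l \<omega>) l) = psum X (?B i) \<omega>" if "i < k" for i
        unfolding psum_def using BI[OF that] by (intro sum.cong) auto
      then show ?thesis by (intro arg_cong[where f="\<lambda>x. ennreal (f x)"] block_var_cong) simp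
    qed
    have "(\<integral>\<^sup>+\<omega>. ennreal (f (block_var k (a N) (b N) (\<lambda>i. \<epsilon> N * psum X (?B i) \<omega>))) * indicator {0} (walk X (2 * N) \<omega>) \<partial>M)
       = (\<integral>\<^sup>+\<omega>. ?F (\<lambda>l\<in>?I. X l \<omega>) * indicator {0} (psum X ?I \<omega> + psum X ?J \<omega>) \<partial>M)"
      unfolding Fr w ..
    also have "\<dots> = (\<integral>\<^sup>+\<omega>. ?F (\<lambda>l\<in>?I. X l \<omega>) * ennreal (srw (card ?J) (psum X ?I \<omega>)) \<partial>M)"
      by (rule nn_integral_psum_zero[OF _ _ _ _ _ Fm]) auto
    also have "\<dots> = (\<integral>\<^sup>+\<omega>. G N (\<lambda>i\<in>{..<k}. psum X (?B i) \<omega>) \<partial>M)"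
    proof (rule nn_integral_cong)
      fix \<omega>
      have "psum X ?I \<omega> = (\<Sum>i<k. (\<lambda>i\<in>{..<k}. psum X (?B i) \<omega>) i)"
        unfolding sum_restrict_lessThan psum_blocks_sum walk_psum ..
      moreover have "card ?J = h N" using nL by simp
      moreover have "block_var k (a N) (b N) (\<lambda>i. \<epsilon> N * psum X (?B i) \<omega>) = block_var k (a N) (b N) (\<lambda>i. \<epsilon> N * (\<lambda>i\<in>{..<k}. psum X (?B i) \<omega>) i)"
        by (rule block_var_cong) simp
      ultimately show "?F (\<lambda>l\<in>?I. X l \<omega>) * ennreal (srw (card ?J) (psum X ?I \<omega>)) = G N (\<lambda>i\<in>{..<k}. psum X (?B i) \<omega>)"
        unfolding Fr G_def by (simp only:)
    qed
    also have "\<dots> = (\<integral>\<^sup>+d. G N d \<partial>PiM {..<k} (\<lambda>_. distr M borel (walk X (L N))))"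
      by (rule psum_blocks[OF G k])
    also have "\<dots> = (\<integral>\<^sup>+w. G N (\<lambda>i\<in>{..<k}. sqrt (real (L N)) * Z (L N) (w i)) \<partial>PP)"
      unfolding scale PP_def by (rule nn_integral_PiM_distr[OF \<Omega> _ G]) measurable
    finally show ?thesis .
  qed
  \<comment> \<open>That the walk takes even values at even times is a property of its law, so it
    holds for the coupled variables almost surely; the local limit theorem needs it.\<close>
  have parity: "AE x in \<Omega>. \<forall>L. even L \<longrightarrow> (\<exists>j::int. sqrt (real L) * Z L x = 2 * of_int j)"
  proof -
    have "AE x in \<Omega>. even L \<longrightarrow> (\<exists>j::int. sqrt (real L) * Z L x = 2 * of_int j)" for L
    proof (cases "even L")
      case True
      let ?A = "range (\<lambda>j::int. 2 * of_int j :: real)"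
      have A: "{y \<in> space borel. y \<in> ?A} \<in> sets borel"
        using sets.countable[of ?A borel] by auto
      have "AE \<omega> in M. walk X L \<omega> \<in> ?A" using walk_parity by eventually_elim (use True in auto)
      then have "AE y in distr M borel (walk X L). y \<in> ?A"
        using AE_distr_iff[OF wm A, of L] by simp
      then have "AE x in \<Omega>. sqrt (real L) * Z L x \<in> ?A"
        unfolding scale using AE_distr_iff[OF _ A, of "\<lambda>x. sqrt (real L) * Z L x" \<Omega>] by simp
      then show ?thesis by eventually_elim auto
    qed simp
    then show ?thesis by (simp add: AE_all_countable)
  qed
  have parity': "AE w in PP. \<forall>i\<in>{..<k}. \<forall>L. even L \<longrightarrow> (\<exists>j::int. sqrt (real L) * Z L (w i) = 2 * of_int j)"
    unfolding PP_def by (intro eventually_ball_finite ballI AE_PiM_component \<Omega> parity) auto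
  have La: "(\<lambda>N. real (L N) / real (2 * N)) \<longlonglongrightarrow> 1 / real ?m" and ha: "(\<lambda>N. real (h N) / real (2 * N)) \<longlonglongrightarrow> 1 / real ?m"
    unfolding L_def h_def by (rule block_length_ratio last_length_ratio)+
  have alim: "a \<longlonglongrightarrow> t / real ?m" and blim: "b \<longlonglongrightarrow> t / real ?m"
    using tendsto_mult_left[OF La, of t] tendsto_mult_left[OF ha, of t] by (simp_all add: a_def[abs_def] b_def[abs_def] del: of_nat_Suc)
  \<comment> \<open>The product is \<open>sqrt (a N)\<close>; its limit \<open>s\<close> is the
    standard deviation of a Brownian increment over one of \<open>k + 1\<close> equal cells.\<close>
  have elim: "(\<lambda>N. \<epsilon> N * sqrt (real (L N))) \<longlonglongrightarrow> s"
  proof -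
    have "(\<lambda>N. sqrt (a N)) \<longlonglongrightarrow> s" unfolding s_def by (intro tendsto_real_sqrt alim)
    then show ?thesis by (simp add: \<epsilon>_def step_size_def a_def real_sqrt_mult[symmetric] del: real_sqrt_mult)
  qed
  have hpos: "\<forall>\<^sub>F N in sequentially. h N > 0"
    using last_length_at_top[of k, unfolded filterlim_at_top, rule_format, of 1] unfolding h_def by (rule eventually_mono) simp
  have Lh: "(\<lambda>N. sqrt (real (L N) / real (h N))) \<longlonglongrightarrow> 1"
  proof -
    have "(\<lambda>N. (real (L N) / real (2 * N)) / (real (h N) / real (2 * N))) \<longlonglongrightarrow> (1 / real ?m) / (1 / real ?m)"
      by (intro tendsto_divide La ha) simp
    then have "(\<lambda>N. real (L N) / real (h N)) \<longlonglongrightarrow> 1"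
    proof (rule Lim_transform_eventually[OF tendsto_eq_rhs])
      show "\<forall>\<^sub>F N in sequentially. real (L N) / real (2 * N) / (real (h N) / real (2 * N)) = real (L N) / real (h N)"
        by (rule eventually_sequentiallyI[of 1]) simp
    qed (simp del: of_nat_Suc)
    from tendsto_real_sqrt[OF this] show ?thesis by simp
  qed
  have nh: "(\<lambda>N. sqrt (real (2 * N) / real (h N))) \<longlonglongrightarrow> sqrt (real ?m)"
  proof -
    have "(\<lambda>N. inverse (real (h N) / real (2 * N))) \<longlonglongrightarrow> inverse (1 / real ?m)"
      by (intro tendsto_inverse ha) simp
    then have "(\<lambda>N. real (2 * N) / real (h N)) \<longlonglongrightarrow> real ?m" by (simp del: of_nat_Suc)
    then show ?thesis by (rule tendsto_real_sqrt)
  qed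
  define R where "R w = f (block_var k (t / real ?m) (t / real ?m) (\<lambda>i. s * Z' (w i))) * (sqrt (real ?m) * (sqrt (2 / pi) * exp (- (\<Sum>i<k. Z' (w i))\<^sup>2 / 2)))" for w
  have lim: "(\<lambda>N. \<integral>\<^sup>+w. ennreal (sqrt (real (2 * N))) * G N (\<lambda>i\<in>{..<k}. sqrt (real (L N)) * Z (L N) (w i)) \<partial>PP) \<longlonglongrightarrow> (\<integral>\<^sup>+w. ennreal (R w) \<partial>PP)"
  \<comment> \<open>With \<open>m = k + 1\<close>, the bounds
    \<open>srw (h N) x \<le> 1 / sqrt (h N)\<close> and \<open>2 * N \<le> m * h N\<close> keep the
    normalised probability below \<open>sqrt m\<close>.\<close>
  proof (rule nn_integral_dominated_convergence[where w="\<lambda>_. ennreal (K * sqrt (real ?m))"])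
    have cm: "(\<lambda>w. w i) \<in> measurable PP \<Omega>" if "i < k" for i
      unfolding PP_def using that by (intro measurable_component_singleton) simp
    have vm: "(\<lambda>w. \<lambda>i\<in>{..<k}. g (w i)) \<in> measurable PP (PiM {..<k} (\<lambda>_. borel))" if "g \<in> borel_measurable \<Omega>" for g :: "real \<Rightarrow> real"
      by (intro measurable_restrict measurable_compose[OF cm that]) simp
    show "(\<lambda>w. ennreal (sqrt (real (2 * N))) * G N (\<lambda>i\<in>{..<k}. sqrt (real (L N)) * Z (L N) (w i))) \<in> borel_measurable PP" for N
    proof -
      have "(\<lambda>x. sqrt (real (L N)) * Z (L N) x) \<in> borel_measurable \<Omega>" by measurable
      from measurable_compose[OF vm[OF this] G[of N]] show ?thesis by measurable
    qed
    show "(\<lambda>w. ennreal (R w)) \<in> borel_measurable PP"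
    proof -
      have "(\<lambda>w. block_var k (t / real ?m) (t / real ?m) (\<lambda>i. s * (\<lambda>i\<in>{..<k}. Z' (w i)) i)) \<in> borel_measurable PP"
        by (rule measurable_compose[OF vm[OF Z'] bm])
      moreover have "block_var k (t / real ?m) (t / real ?m) (\<lambda>i. s * (\<lambda>i\<in>{..<k}. Z' (w i)) i) = block_var k (t / real ?m) (t / real ?m) (\<lambda>i. s * Z' (w i))" for w
        by (rule block_var_cong) simp
      ultimately have [measurable]: "(\<lambda>w. block_var k (t / real ?m) (t / real ?m) (\<lambda>i. s * Z' (w i))) \<in> borel_measurable PP" by simp
      have [measurable]: "(\<lambda>w. \<Sum>i<k. Z' (w i)) \<in> borel_measurable PP"
        by (intro borel_measurable_sum measurable_compose[OF cm Z']) simp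
      show ?thesis unfolding R_def by measurable
    qed
    show "(\<lambda>_. ennreal (K * sqrt (real ?m))) \<in> borel_measurable PP" by simp
    show "(\<integral>\<^sup>+_. ennreal (K * sqrt (real ?m)) \<partial>PP) < \<infinity>" by (simp add: PP.emeasure_space_1)
    show "AE w in PP. ennreal (sqrt (real (2 * N))) * G N (\<lambda>i\<in>{..<k}. sqrt (real (L N)) * Z (L N) (w i)) \<le> ennreal (K * sqrt (real ?m))" for N
    proof (rule AE_I2)
      fix w
      let ?d = "\<lambda>i\<in>{..<k}. sqrt (real (L N)) * Z (L N) (w i)"
      have "sqrt (real (2 * N)) * srw (h N) (\<Sum>i<k. ?d i) \<le> sqrt (real ?m)"
      proof (cases "h N > 0")
        case True
        have "sqrt (real (2 * N)) * srw (h N) (\<Sum>i<k. ?d i) \<le> sqrt (real ?m * real (h N)) * (1 / sqrt (real (h N)))"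
          using last_length_ge[of N k] unfolding h_def[symmetric]
          by (intro mult_mono srw_le[OF True] real_sqrt_le_mono) auto
        also have "\<dots> = sqrt (real ?m)" using True by (simp add: real_sqrt_mult)
        finally show ?thesis .
      next
        case False
        \<comment> \<open>An empty last block forces \<open>N = 0\<close>, and then the prefactor
          vanishes.\<close>
        then have "h N = 0" by simp
        then have "real (2 * N) \<le> 0" using last_length_ge[of N k] unfolding h_def[symmetric] by simp
        then have "real (2 * N) = 0" by simp
        then show ?thesis by (simp del: of_nat_mult of_nat_Suc)
      qed
      then have "f (block_var k (a N) (b N) (\<lambda>i. \<epsilon> N * ?d i)) * (sqrt (real (2 * N)) * srw (h N) (\<Sum>i<k. ?d i)) \<le> K * sqrt (real ?m)"
        using f K by (intro mult_mono) auto
      then show "ennreal (sqrt (real (2 * N))) * G N ?d \<le> ennreal (K * sqrt (real ?m))"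
        unfolding G_def using f(2)
        by (simp add: ennreal_mult[symmetric] mult_ac ennreal_leI del: of_nat_mult of_nat_Suc)
    qed
    show "AE w in PP. (\<lambda>N. ennreal (sqrt (real (2 * N))) * G N (\<lambda>i\<in>{..<k}. sqrt (real (L N)) * Z (L N) (w i))) \<longlonglongrightarrow> ennreal (R w)"
      using parity' AE_space
    proof eventually_elim
      case (elim w)
      have wi: "w i \<in> space \<Omega>" if "i < k" for i using elim(2) that by (auto simp: PP_def space_PiM PiE_def)
      let ?d = "\<lambda>N. \<lambda>i\<in>{..<k}. sqrt (real (L N)) * Z (L N) (w i)"
      have Zi: "(\<lambda>N. Z (L N) (w i)) \<longlonglongrightarrow> Z' (w i)" if "i < k" for i
        unfolding L_def by (rule filterlim_compose[OF Zlim[OF wi[OF that]] block_length_at_top])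
      have bl: "(\<lambda>N. block_var k (a N) (b N) (\<lambda>i. \<epsilon> N * ?d N i)) \<longlonglongrightarrow> block_var k (t / real ?m) (t / real ?m) (\<lambda>i. s * Z' (w i))"
      proof (rule block_var_tendsto[OF alim blim])
        fix i assume i: "i < k"
        have "(\<lambda>N. \<epsilon> N * sqrt (real (L N)) * Z (L N) (w i)) \<longlonglongrightarrow> s * Z' (w i)"
          by (intro tendsto_mult \<open>(\<lambda>N. \<epsilon> N * sqrt (real (L N))) \<longlonglongrightarrow> s\<close> Zi[OF i])
        then show "(\<lambda>N. \<epsilon> N * ?d N i) \<longlonglongrightarrow> s * Z' (w i)" using i by (simp add: mult.assoc)
      qed
      have fl: "(\<lambda>N. f (block_var k (a N) (b N) (\<lambda>i. \<epsilon> N * ?d N i))) \<longlonglongrightarrow> f (block_var k (t / real ?m) (t / real ?m) (\<lambda>i. s * Z' (w i)))"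
        by (rule continuous_on_tendsto_compose[OF f(1) bl]) auto
      have x: "\<exists>j::int. (\<Sum>i<k. ?d N i) = 2 * of_int j" for N
      proof -
        have "\<forall>i\<in>{..<k}. \<exists>j::int. ?d N i = 2 * of_int j"
        proof -
          have "even (L N)" by (simp add: L_def block_length_def)
          then show ?thesis using elim(1) by auto
        qed
        then obtain J :: "nat \<Rightarrow> int" where "\<And>i. i < k \<Longrightarrow> ?d N i = 2 * of_int (J i)" by (metis lessThan_iff)
        then have "(\<Sum>i<k. ?d N i) = 2 * of_int (\<Sum>i<k. J i)" by (simp add: sum_distrib_left)
        then show ?thesis by blast
      qed
      have xl: "(\<lambda>N. (\<Sum>i<k. ?d N i) / sqrt (real (h N))) \<longlonglongrightarrow> (\<Sum>i<k. Z' (w i))"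
      proof -
        have "(\<lambda>N. (\<Sum>i<k. Z (L N) (w i)) * sqrt (real (L N) / real (h N))) \<longlonglongrightarrow> (\<Sum>i<k. Z' (w i)) * 1"
          by (intro tendsto_mult tendsto_sum Lh Zi) simp
        moreover have "(\<Sum>i<k. Z (L N) (w i)) * sqrt (real (L N) / real (h N)) = (\<Sum>i<k. ?d N i) / sqrt (real (h N))" for N
          by (simp add: real_sqrt_divide sum_distrib_left[symmetric])
        ultimately show ?thesis by simp
      qed
      have sl: "(\<lambda>N. sqrt (real (h N)) * srw (h N) (\<Sum>i<k. ?d N i)) \<longlonglongrightarrow> sqrt (2 / pi) * exp (- (\<Sum>i<k. Z' (w i))\<^sup>2 / 2)"
        by (rule srw_local_limit[OF _ _ x xl]) (auto simp: h_def last_length_at_top even_last_length)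
      have "(\<lambda>N. sqrt (real (2 * N) / real (h N)) * (sqrt (real (h N)) * srw (h N) (\<Sum>i<k. ?d N i)))
          \<longlonglongrightarrow> sqrt (real ?m) * (sqrt (2 / pi) * exp (- (\<Sum>i<k. Z' (w i))\<^sup>2 / 2))"
        by (intro tendsto_mult nh sl)
      then have "(\<lambda>N. sqrt (real (2 * N)) * srw (h N) (\<Sum>i<k. ?d N i)) \<longlonglongrightarrow> sqrt (real ?m) * (sqrt (2 / pi) * exp (- (\<Sum>i<k. Z' (w i))\<^sup>2 / 2))"
      proof (rule Lim_transform_eventually)
        show "\<forall>\<^sub>F N in sequentially. sqrt (real (2 * N) / real (h N)) * (sqrt (real (h N)) * srw (h N) (\<Sum>i<k. ?d N i)) = sqrt (real (2 * N)) * srw (h N) (\<Sum>i<k. ?d N i)"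
          using hpos by eventually_elim (simp add: real_sqrt_divide del: of_nat_mult)
      qed
      from tendsto_mult[OF fl this]
      have "(\<lambda>N. ennreal (f (block_var k (a N) (b N) (\<lambda>i. \<epsilon> N * ?d N i)) * (sqrt (real (2 * N)) * srw (h N) (\<Sum>i<k. ?d N i)))) \<longlonglongrightarrow> ennreal (R w)"
        unfolding R_def by (rule tendsto_ennrealI)
      moreover have "ennreal (f (block_var k (a N) (b N) (\<lambda>i. \<epsilon> N * ?d N i)) * (sqrt (real (2 * N)) * srw (h N) (\<Sum>i<k. ?d N i)))
          = ennreal (sqrt (real (2 * N))) * G N (?d N)" for N
        unfolding G_def using f(2) by (simp add: ennreal_mult[symmetric] mult_ac del: of_nat_mult)
      ultimately show ?case by (simp only:)
    qed
  qed
  have out: "ennreal (sqrt (real (2 * N))) *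
      (\<integral>\<^sup>+\<omega>. ennreal (f (block_var k (a N) (b N) (\<lambda>i. \<epsilon> N * psum X {i * L N + 1..(i + 1) * L N} \<omega>)))
        * indicator {0} (walk X (2 * N) \<omega>) \<partial>M)
      = (\<integral>\<^sup>+w. ennreal (sqrt (real (2 * N))) * G N (\<lambda>i\<in>{..<k}. sqrt (real (L N)) * Z (L N) (w i)) \<partial>PP)" for N
    unfolding rep
  proof (rule nn_integral_cmult[symmetric])
    have "(\<lambda>w. \<lambda>i\<in>{..<k}. sqrt (real (L N)) * Z (L N) (w i)) \<in> measurable PP (PiM {..<k} (\<lambda>_. borel))"
    proof (intro measurable_restrict borel_measurable_times borel_measurable_const)
      fix i assume "i \<in> {..<k}"
      then have cm: "(\<lambda>w. w i) \<in> measurable PP \<Omega>" unfolding PP_def by (rule measurable_component_singleton)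
      show "(\<lambda>w. Z (L N) (w i)) \<in> borel_measurable PP" by (rule measurable_compose[OF cm Z])
    qed
    then show "(\<lambda>w. G N (\<lambda>i\<in>{..<k}. sqrt (real (L N)) * Z (L N) (w i))) \<in> borel_measurable PP"
      by (rule measurable_compose[OF _ G])
  qed
  have final: "(\<integral>\<^sup>+w. ennreal (R w) \<partial>PP)
      = ennreal (2 * sqrt t) * (\<integral>\<^sup>+d. ennreal (f (step_var t ?m d)) * ennreal (normal_density 0 s (0 - (\<Sum>i<k. d i))) \<partial>gauss_vec k s)"
  proof -
    let ?H = "\<lambda>d. ennreal (2 * sqrt t) * (ennreal (f (step_var t ?m d)) * ennreal (normal_density 0 s (0 - (\<Sum>i<k. d i))))"
    have sm[measurable]: "step_var t ?m \<in> borel_measurable (PiM {..<k} (\<lambda>_. borel))"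
    proof -
      have "step_var t ?m = block_var k (t / real ?m) (t / real ?m)"
        by (rule ext) (rule block_var_step_var[symmetric])
      then show ?thesis by (simp only: block_var_measurable)
    qed
    have Hm: "?H \<in> borel_measurable (PiM {..<k} (\<lambda>_. borel))" by measurable
    have gv: "gauss_vec k s = PiM {..<k} (\<lambda>_. distr \<Omega> borel (\<lambda>x. s * Z' x))"
    proof -
      have "distr \<Omega> borel (\<lambda>x. s * Z' x) = distr (distr \<Omega> borel Z') borel (\<lambda>x. s * x)"
        by (simp add: distr_distr comp_def)
      then show ?thesis by (simp add: gauss_vec_def Zd' distr_gauss_scale[OF s])
    qed
    have "ennreal (2 * sqrt t) * (\<integral>\<^sup>+d. ennreal (f (step_var t ?m d)) * ennreal (normal_density 0 s (0 - (\<Sum>i<k. d i))) \<partial>gauss_vec k s)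
        = (\<integral>\<^sup>+d. ?H d \<partial>gauss_vec k s)"
      by (rule nn_integral_cmult[symmetric]) measurable
    also have "\<dots> = (\<integral>\<^sup>+w. ?H (\<lambda>i\<in>{..<k}. s * Z' (w i)) \<partial>PP)"
      unfolding gv PP_def by (rule nn_integral_PiM_distr[OF \<Omega> _ Hm]) measurable
    also have "\<dots> = (\<integral>\<^sup>+w. ennreal (R w) \<partial>PP)"
    proof (rule nn_integral_cong)
      fix w
      let ?S = "\<Sum>i<k. Z' (w i)"
      have 1: "step_var t ?m (\<lambda>i\<in>{..<k}. s * Z' (w i)) = block_var k (t / real ?m) (t / real ?m) (\<lambda>i. s * Z' (w i))"
        unfolding block_var_step_var[symmetric] by (rule block_var_cong) simp
      have 2: "(\<Sum>i<k. (\<lambda>i\<in>{..<k}. s * Z' (w i)) i) = s * ?S"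
        unfolding sum_restrict_lessThan by (simp add: sum_distrib_left)
      \<comment> \<open>Uses \<open>sqrt t / s = sqrt m\<close> and
        \<open>2 / sqrt (2 * pi) = sqrt (2 / pi)\<close>. The 2 on the left is the parity factor of
        the local limit theorem.\<close>
      have 3: "2 * sqrt t * normal_density 0 s (0 - s * ?S) = sqrt (real ?m) * (sqrt (2 / pi) * exp (- ?S\<^sup>2 / 2))"
      proof -
        have "normal_density 0 s (0 - s * ?S) = 1 / (sqrt (2 * pi) * s) * exp (- ?S\<^sup>2 / 2)"
          using s by (simp add: normal_density_def real_sqrt_mult power_mult_distrib)
        moreover have "2 * sqrt t * (1 / (sqrt (2 * pi) * s)) = sqrt (real ?m) * sqrt (2 / pi)"
        proof -
          have "s * sqrt (real ?m) = sqrt t" unfolding s_def by (simp add: real_sqrt_mult[symmetric] del: real_sqrt_mult of_nat_Suc)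
          then have "sqrt t / s = sqrt (real ?m)" using s by (simp add: field_simps)
          moreover have "2 / sqrt (2 * pi) = sqrt (2 / pi)"
          proof -
            have "2 / sqrt (2 * pi) = sqrt 4 / sqrt (2 * pi)" by simp
            also have "\<dots> = sqrt (4 / (2 * pi))" by (rule real_sqrt_divide[symmetric])
            finally show ?thesis by simp
          qed
          moreover have "2 * sqrt t * (1 / (sqrt (2 * pi) * s)) = (sqrt t / s) * (2 / sqrt (2 * pi))" by (simp add: mult.commute)
          ultimately show ?thesis by (simp only:)
        qed
        ultimately show ?thesis by (simp only: mult.assoc[symmetric])
      qed
      have "?H (\<lambda>i\<in>{..<k}. s * Z' (w i)) = ennreal (f (block_var k (t / real ?m) (t / real ?m) (\<lambda>i. s * Z' (w i))) * (2 * sqrt t * normal_density 0 s (0 - s * ?S)))"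
        unfolding 1 2 using f(2) t by (simp add: ennreal_mult[symmetric] mult_ac del: of_nat_Suc)
      also have "\<dots> = ennreal (R w)" unfolding 3 R_def ..
      finally show "?H (\<lambda>i\<in>{..<k}. s * Z' (w i)) = ennreal (R w)" .
    qed
    finally show ?thesis ..
  qed
  show ?thesis
    using lim unfolding final out[symmetric] unfolding a_def b_def L_def h_def .
qed

end

section \<open>Comparison of the walk functional with its block version\<close>

text \<open>The conditional variance of \<open>walk_b\<close> given the signs, with
  \<open>\<epsilon>\<^sup>2\<close> written as \<open>t / n\<close>. The index runs from 0 because
  the walk enters \<open>walk_b\<close> at time \<open>j - 1\<close>.\<close>

definition walk_var :: "real \<Rightarrow> (nat \<Rightarrow> 'a \<Rightarrow> real) \<Rightarrow> nat \<Rightarrow> 'a \<Rightarrow> real" where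
  "walk_var t X n \<omega> = (\<Sum>j<n. t / real n * exp (2 * step_size t n * walk X j \<omega>))"

text \<open>The term \<open>j = 0\<close> alone is \<open>t / n\<close>. This bound degenerates as
  \<open>n\<close> grows and serves only positivity, integrability and continuity at fixed
  \<open>n\<close>.\<close>

lemma walk_var_ge:
  assumes "t > 0" "n > 0"
  shows "t / real n \<le> walk_var t X n \<omega>"
proof -
  have "t / real n * exp (2 * step_size t n * walk X 0 \<omega>) \<le> walk_var t X n \<omega>"
    unfolding walk_var_def by (rule member_le_sum) (use assms in auto)
  then show ?thesis by (simp add: walk_def)
qed

lemma walk_var_pos: "t > 0 \<Longrightarrow> n > 0 \<Longrightarrow> walk_var t X n \<omega> > 0"
  using walk_var_ge[of t n X \<omega>] by (smt (verit) divide_pos_pos of_nat_0_less_iff)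

lemma inverse_walk_var_le:
  assumes t: "t > 0" and n: "n > 0"
  shows "1 / walk_var t X n \<omega> \<le> (\<Sum>j<n. 1 / (t * real n) * exp (- 2 * step_size t n * walk X j \<omega>))"
proof -
  let ?a = "\<lambda>j. exp (2 * step_size t n * walk X j \<omega>)"
  have A: "walk_var t X n \<omega> = t / real n * (\<Sum>j<n. ?a j)"
    by (simp add: walk_var_def sum_distrib_left)
  have B: "(\<Sum>j<n. 1 / (t * real n) * exp (- 2 * step_size t n * walk X j \<omega>)) = 1 / (t * real n) * (\<Sum>j<n. 1 / ?a j)"
    by (simp add: sum_distrib_left exp_minus inverse_eq_divide)
  have "(\<Sum>j<n. ?a j) > 0" using n by (intro sum_pos) auto
  moreover have "(real n)\<^sup>2 \<le> (\<Sum>j<n. ?a j) * (\<Sum>j<n. 1 / ?a j)"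
    by (rule sum_times_sum_inverse) simp
  ultimately have "(real n)\<^sup>2 * (1 / (t * real n * (\<Sum>j<n. ?a j)))
      \<le> (\<Sum>j<n. ?a j) * (\<Sum>j<n. 1 / ?a j) * (1 / (t * real n * (\<Sum>j<n. ?a j)))"
    using t n by (intro mult_right_mono) auto
  then show ?thesis using t n \<open>(\<Sum>j<n. ?a j) > 0\<close> unfolding A B by (simp add: power2_eq_square)
qed

text \<open>Adding \<open>\<delta>\<^sup>2\<close> under the root gives the bound
  \<open>1 / \<delta>\<close> and the Lipschitz constant \<open>1 / \<delta> ^ 3\<close> on the
  half-line; the absolute value makes the function continuous on the whole line, as
  \<open>bridge_block_limit\<close> asks.\<close>

definition smooth_inv_sqrt :: "real \<Rightarrow> real \<Rightarrow> real" where
  "smooth_inv_sqrt \<delta> a = 1 / sqrt (\<bar>a\<bar> + \<delta>\<^sup>2)"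

lemma smooth_inv_sqrt_bounds:
  assumes "\<delta> > 0"
  shows "0 \<le> smooth_inv_sqrt \<delta> a" "smooth_inv_sqrt \<delta> a \<le> 1 / \<delta>"
proof -
  show "0 \<le> smooth_inv_sqrt \<delta> a" by (simp add: smooth_inv_sqrt_def)
  have "\<delta> \<le> sqrt (\<bar>a\<bar> + \<delta>\<^sup>2)" by (rule real_le_rsqrt) simp
  then show "smooth_inv_sqrt \<delta> a \<le> 1 / \<delta>"
    using assms by (auto simp: smooth_inv_sqrt_def intro!: divide_left_mono mult_pos_pos add_nonneg_pos)
qed

lemma continuous_smooth_inv_sqrt: "\<delta> > 0 \<Longrightarrow> continuous_on UNIV (smooth_inv_sqrt \<delta>)"
  unfolding smooth_inv_sqrt_def[abs_def]
  by (intro continuous_intros) (auto simp: add_nonneg_eq_0_iff)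

lemma inverse_sqrt_diff:
  fixes u v :: real
  assumes "u > 0" "v > 0"
  shows "1 / sqrt u - 1 / sqrt v = (v - u) / (sqrt u * sqrt v * (sqrt u + sqrt v))"
proof -
  have "v - u = (sqrt v - sqrt u) * (sqrt u + sqrt v)"
    using assms by (simp add: algebra_simps)
  moreover have "sqrt u + sqrt v > 0" using assms by (simp add: add_pos_pos)
  ultimately show ?thesis using assms by (simp add: divide_simps)
qed

lemma smooth_inv_sqrt_lipschitz:
  assumes \<delta>: "\<delta> > 0" and ab: "0 \<le> a" "0 \<le> b"
  shows "\<bar>smooth_inv_sqrt \<delta> a - smooth_inv_sqrt \<delta> b\<bar> \<le> \<bar>a - b\<bar> / \<delta> ^ 3"
proof -
  let ?u = "a + \<delta>\<^sup>2" and ?v = "b + \<delta>\<^sup>2"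
  have uv: "?u > 0" "?v > 0" using \<delta> ab by (simp_all add: add_nonneg_pos)
  have s: "\<delta> \<le> sqrt ?u" "\<delta> \<le> sqrt ?v" using \<delta> ab by (simp_all add: real_le_rsqrt)
  have "\<bar>smooth_inv_sqrt \<delta> a - smooth_inv_sqrt \<delta> b\<bar> = \<bar>a - b\<bar> / (sqrt ?u * sqrt ?v * (sqrt ?u + sqrt ?v))"
    using inverse_sqrt_diff[OF uv] ab uv
    by (simp add: smooth_inv_sqrt_def abs_mult abs_minus_commute abs_of_nonneg)
  also have "\<dots> \<le> \<bar>a - b\<bar> / (\<delta> * \<delta> * \<delta>)"
  proof (intro divide_left_mono mult_mono)
    show "\<delta> \<le> sqrt ?u + sqrt ?v" using s \<delta> by linarith
    show "0 < sqrt ?u * sqrt ?v * (sqrt ?u + sqrt ?v) * (\<delta> * \<delta> * \<delta>)"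
      using uv \<delta> by (intro mult_pos_pos add_pos_pos) auto
  qed (use s \<delta> uv in auto)
  finally show ?thesis by (simp add: power3_eq_cube)
qed

text \<open>The difference is \<open>\<delta>\<^sup>2\<close> divided by a product that is at least
  \<open>a * \<delta>\<close>. The resulting error is linear in \<open>1 / a\<close>, whose mean on
  the return event is under control.\<close>

lemma smooth_inv_sqrt_approx:
  assumes \<delta>: "\<delta> > 0" and a: "a > 0"
  shows "0 \<le> 1 / sqrt a - smooth_inv_sqrt \<delta> a" "1 / sqrt a - smooth_inv_sqrt \<delta> a \<le> \<delta> * (1 / a)"
proof -
  let ?v = "a + \<delta>\<^sup>2"
  have v: "?v > 0" using a by (simp add: add_pos_nonneg)
  have e: "1 / sqrt a - smooth_inv_sqrt \<delta> a = \<delta>\<^sup>2 / (sqrt a * sqrt ?v * (sqrt a + sqrt ?v))"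
    using inverse_sqrt_diff[OF a v] a by (simp add: smooth_inv_sqrt_def)
  show "0 \<le> 1 / sqrt a - smooth_inv_sqrt \<delta> a" unfolding e using a v by simp
  have s: "\<delta> \<le> sqrt ?v" "sqrt a \<le> sqrt ?v" using \<delta> a by (auto simp: real_le_rsqrt)
  have "a * \<delta> \<le> sqrt a * sqrt ?v * (sqrt a + sqrt ?v)"
  proof -
    have "a * \<delta> = sqrt a * sqrt a * \<delta>" using a by simp
    also have "\<dots> \<le> sqrt a * sqrt ?v * (sqrt a + sqrt ?v)"
    proof (intro mult_mono)
      have "0 \<le> sqrt a" using a by simp
      then show "\<delta> \<le> sqrt a + sqrt ?v" using s(1) by linarith
    qed (use s \<delta> a v in auto)
    finally show ?thesis .
  qed
  then have "\<delta>\<^sup>2 / (sqrt a * sqrt ?v * (sqrt a + sqrt ?v)) \<le> \<delta>\<^sup>2 / (a * \<delta>)"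
    using a v \<delta> by (intro divide_left_mono mult_pos_pos add_pos_pos) auto
  also have "\<dots> = \<delta> * (1 / a)" using \<delta> by (simp add: power2_eq_square)
  finally show "1 / sqrt a - smooth_inv_sqrt \<delta> a \<le> \<delta> * (1 / a)" unfolding e .
qed

text \<open>Three nested limits: \<open>N\<close> to infinity for given \<open>j\<close> and
  \<open>k\<close>, then \<open>k\<close>, then \<open>j\<close>. In the application
  \<open>j\<close> governs the regularisation and \<open>k\<close> the number of blocks;
  \<open>j\<close> has to be fixed before \<open>k\<close> because the error of the blocks contains
  \<open>1 / \<delta> ^ 3\<close>.\<close>

lemma iterated_limit:
  fixes q :: "nat \<Rightarrow> real" and D b :: "nat \<Rightarrow> nat \<Rightarrow> nat \<Rightarrow> real"
  assumes bound: "\<And>j k. k \<ge> 2 \<Longrightarrow> eventually (\<lambda>N. \<bar>q N - D j k N\<bar> \<le> a j + b j k N) sequentially"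
    and a: "a \<longlonglongrightarrow> 0"
    and b: "\<And>j k. k \<ge> 2 \<Longrightarrow> b j k \<longlonglongrightarrow> b' j k" "\<And>j. b' j \<longlonglongrightarrow> 0"
    and D: "\<And>j k. k \<ge> 2 \<Longrightarrow> D j k \<longlonglongrightarrow> D' j k" "\<And>j. D' j \<longlonglongrightarrow> D'' j" "D'' \<longlonglongrightarrow> T"
  shows "q \<longlonglongrightarrow> T"
proof (rule tendstoI)
  fix e :: real assume "e > 0"
  \<comment> \<open>Five errors occur, each below \<open>\<eta>\<close>.\<close>
  define \<eta> where "\<eta> = e / 6"
  have \<eta>: "\<eta> > 0" using \<open>e > 0\<close> by (simp add: \<eta>_def)
  have "eventually (\<lambda>j. a j < \<eta> \<and> dist (D'' j) T < \<eta>) sequentially"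
    using order_tendstoD(2)[OF a \<eta>] tendstoD[OF D(3) \<eta>] by eventually_elim auto
  then obtain j where j: "a j < \<eta>" "dist (D'' j) T < \<eta>" by (auto simp: eventually_sequentially)
  have "eventually (\<lambda>k. k \<ge> 2 \<and> b' j k < \<eta> \<and> dist (D' j k) (D'' j) < \<eta>) sequentially"
    using eventually_ge_at_top[of 2] order_tendstoD(2)[OF b(2) \<eta>] tendstoD[OF D(2) \<eta>] by eventually_elim auto
  then obtain k where k: "k \<ge> 2" "b' j k < \<eta>" "dist (D' j k) (D'' j) < \<eta>" by (auto simp: eventually_sequentially)
  show "eventually (\<lambda>N. dist (q N) T < e) sequentially"
    using bound[OF k(1), of j] order_tendstoD(2)[OF b(1)[OF k(1), of j] k(2)] tendstoD[OF D(1)[OF k(1), of j] \<eta>]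
  proof eventually_elim
    case (elim N)
    have "\<bar>q N - T\<bar> < 6 * \<eta>" using elim j k unfolding dist_real_def by linarith
    then show ?case by (simp add: dist_real_def \<eta>_def)
  qed
qed

text \<open>The time at which the walk is frozen for the index \<open>j\<close>: the start of the
  block of length \<open>L\<close> that contains \<open>j\<close>, or \<open>k * L\<close>
  throughout the last block, which has a length of its own.\<close>

definition block_start :: "nat \<Rightarrow> nat \<Rightarrow> nat \<Rightarrow> nat" where
  "block_start k L j = (if j < k * L then (j div L) * L else k * L)"

lemma sum_block_start:
  assumes L: "L > 0"
  shows "(\<Sum>j<k * L + h. g (block_start k L j)) = real L * (\<Sum>i<k. g (i * L)) + real h * (g (k * L) :: real)"
proof -
  have "(\<Sum>j<k * L + h. g (block_start k L j)) = (\<Sum>j<k * L. g (block_start k L j)) + (\<Sum>j=k * L..<k * L + h. g (block_start k L j))"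
    by (simp add: sum.atLeastLessThan_concat lessThan_atLeast0)
  also have "(\<Sum>j=k * L..<k * L + h. g (block_start k L j)) = real h * g (k * L)"
    by (simp add: block_start_def)
  also have "(\<Sum>j<k * L. g (block_start k L j)) = (\<Sum>i<k. \<Sum>j=i * L..<i * L + L. g (block_start k L j))"
    by (rule sum.nat_group[symmetric])
  also have "\<dots> = (\<Sum>i<k. real L * g (i * L))"
  proof (intro sum.cong refl)
    fix i assume "i \<in> {..<k}"
    then have ik: "(i + 1) * L \<le> k * L" by (intro mult_right_mono) auto
    have "block_start k L j = i * L" if "j \<in> {i * L..<i * L + L}" for j
    proof -
      have "j div L = i" using that L by (intro div_nat_eqI) (auto simp: mult.commute)
      then show ?thesis using that ik by (simp add: block_start_def)
    qed
    then show "(\<Sum>j=i * L..<i * L + L. g (block_start k L j)) = real L * g (i * L)" by simp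
  qed
  finally show ?thesis by (simp add: sum_distrib_left)
qed

text \<open>Here \<open>h\<close> is the length of the last block. No other block is longer, so it
  bounds the lag for every index.\<close>

lemma block_start_le:
  assumes "j < k * L + h" "L \<le> h"
  shows "block_start k L j \<le> j" "j - block_start k L j \<le> h" "block_start k L j \<le> k * L"
proof -
  show "block_start k L j \<le> j" by (auto simp: block_start_def)
  show "block_start k L j \<le> k * L"
  proof (cases "j < k * L")
    case True
    then show ?thesis unfolding block_start_def using div_times_less_eq_dividend[of j L] by (simp only: if_True)
  qed (simp add: block_start_def)
  show "j - block_start k L j \<le> h"
  proof (cases "j < k * L")
    case True
    then have "L > 0" by (cases L) auto
    have "j - (j div L) * L = j mod L" by (simp add: minus_div_mult_eq_mod)
    moreover have "j mod L < L" using \<open>L > 0\<close> by simp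
    ultimately show ?thesis using True assms(2) by (simp add: block_start_def)
  qed (use assms in \<open>auto simp: block_start_def\<close>)
qed

section \<open>Moment bounds on the return event\<close>

context rademacher
begin

lemma walk_measurable [measurable]: "walk X n \<in> borel_measurable M"
  unfolding walk_psum by (rule psum_measurable) auto

lemma walk_var_measurable [measurable]: "walk_var t X n \<in> borel_measurable M"
  unfolding walk_var_def[abs_def] by measurable

text \<open>The reciprocal is bounded by an average of exponentials, and
  \<open>walk_bridge_exp_moment\<close> with \<open>c = - 2 * \<epsilon>\<close> applies to each of
  them; \<open>\<epsilon>\<^sup>2 * n = t\<close> turns its exponent into
  \<open>2 * t\<close>.\<close>

lemma inverse_walk_var_moment:
  assumes t: "t > 0" and n: "n > 0"
  shows "(\<integral>\<^sup>+\<omega>. ennreal (1 / walk_var t X n \<omega>) * indicator {0} (walk X n \<omega>) \<partial>M) \<le> ennreal (sqrt (2 / real n) * (exp (2 * t) / t))"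
proof -
  let ?e = "step_size t n"
  have e2: "?e\<^sup>2 * real n = t" using t n by (simp add: step_size_def)
  have "(\<integral>\<^sup>+\<omega>. ennreal (1 / walk_var t X n \<omega>) * indicator {0} (walk X n \<omega>) \<partial>M)
    \<le> (\<integral>\<^sup>+\<omega>. (\<Sum>j<n. ennreal (1 / (t * real n)) * (ennreal (exp (- 2 * ?e * walk X j \<omega>)) * indicator {0} (walk X n \<omega>))) \<partial>M)"
  proof (intro nn_integral_mono)
    fix \<omega>
    have "ennreal (1 / walk_var t X n \<omega>) \<le> ennreal (\<Sum>j<n. 1 / (t * real n) * exp (- 2 * ?e * walk X j \<omega>))"
      by (intro ennreal_leI inverse_walk_var_le t n)
    also have "\<dots> = (\<Sum>j<n. ennreal (1 / (t * real n)) * ennreal (exp (- 2 * ?e * walk X j \<omega>)))"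
      using t by (subst sum_ennreal[symmetric]) (auto intro!: sum.cong simp: ennreal_mult[symmetric] simp del: sum_ennreal)
    finally show "ennreal (1 / walk_var t X n \<omega>) * indicator {0} (walk X n \<omega>)
      \<le> (\<Sum>j<n. ennreal (1 / (t * real n)) * (ennreal (exp (- 2 * ?e * walk X j \<omega>)) * indicator {0} (walk X n \<omega>)))"
      by (auto simp: indicator_def)
  qed
  also have "\<dots> = (\<Sum>j<n. ennreal (1 / (t * real n)) * (\<integral>\<^sup>+\<omega>. ennreal (exp (- 2 * ?e * walk X j \<omega>)) * indicator {0} (walk X n \<omega>) \<partial>M))"
    by (simp add: nn_integral_sum nn_integral_cmult)
  also have "\<dots> \<le> (\<Sum>j<n. ennreal (1 / (t * real n)) * ennreal (sqrt (2 / real n) * exp ((- 2 * ?e)\<^sup>2 * real n / 2)))"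
    by (intro sum_mono mult_left_mono walk_bridge_exp_moment n) auto
  also have "\<dots> = (\<Sum>j<n. ennreal (1 / (t * real n) * (sqrt (2 / real n) * exp ((- 2 * ?e)\<^sup>2 * real n / 2))))"
    using t by (subst ennreal_mult) auto
  also have "(- 2 * ?e)\<^sup>2 * real n / 2 = 2 * t"
    unfolding power_mult_distrib using e2(1) by (simp add: mult.commute)
  also have "(\<Sum>j<n. ennreal (1 / (t * real n) * (sqrt (2 / real n) * exp (2 * t)))) = ennreal (sqrt (2 / real n) * (exp (2 * t) / t))"
    using t n by (subst sum_ennreal) auto
  finally show ?thesis .
qed

text \<open>The difference is \<open>u * v\<close> with \<open>u\<close> the exponential at time
  \<open>i\<close> and \<open>v\<close> the relative change up to time \<open>j\<close>; then
  \<open>u * \<bar>v\<bar> \<le> \<eta> * u\<^sup>2 + v\<^sup>2 / \<eta>\<close> separates the two.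
  The parameter \<open>\<eta>\<close> stays free until the number of blocks is sent to infinity. The
  condition \<open>2 * h \<le> n\<close> is the one of \<open>walk_bridge_increment\<close>.\<close>

lemma walk_bridge_exp_difference:
  assumes t: "t > 0" and n: "n > 0" and ij: "i \<le> j" "j \<le> n" "j - i \<le> h" "2 * h \<le> n" and \<eta>: "\<eta> > 0"
  shows "(\<integral>\<^sup>+\<omega>. ennreal \<bar>exp (2 * step_size t n * walk X j \<omega>) - exp (2 * step_size t n * walk X i \<omega>)\<bar> * indicator {0} (walk X n \<omega>) \<partial>M)
    \<le> ennreal (sqrt (2 / real n) * (\<eta> * exp (8 * t) + (exp (8 * t * (real h / real n)) - 1) / \<eta>))"
proof -
  let ?e = "step_size t n"
  have e2: "?e\<^sup>2 * real n = t" "?e\<^sup>2 = t / real n" using t n by (simp_all add: step_size_def)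
  have "(\<integral>\<^sup>+\<omega>. ennreal \<bar>exp (2 * ?e * walk X j \<omega>) - exp (2 * ?e * walk X i \<omega>)\<bar> * indicator {0} (walk X n \<omega>) \<partial>M)
    \<le> (\<integral>\<^sup>+\<omega>. ennreal \<eta> * (ennreal (exp (4 * ?e * walk X i \<omega>)) * indicator {0} (walk X n \<omega>))
         + ennreal (1 / \<eta>) * (ennreal ((exp (2 * ?e * (walk X j \<omega> - walk X i \<omega>)) - 1)\<^sup>2) * indicator {0} (walk X n \<omega>)) \<partial>M)"
  proof (intro nn_integral_mono)
    fix \<omega>
    let ?u = "exp (2 * ?e * walk X i \<omega>)" and ?v = "exp (2 * ?e * (walk X j \<omega> - walk X i \<omega>)) - 1"
    have "exp (2 * ?e * walk X j \<omega>) - exp (2 * ?e * walk X i \<omega>) = ?u * ?v"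
      by (simp add: algebra_simps mult_exp_exp)
    then have "\<bar>exp (2 * ?e * walk X j \<omega>) - exp (2 * ?e * walk X i \<omega>)\<bar> = ?u * \<bar>?v\<bar>" by (simp add: abs_mult)
    also have "\<dots> \<le> \<eta> * ?u\<^sup>2 + 1 / \<eta> * ?v\<^sup>2"
    proof -
      have "2 * (\<eta> * ?u) * \<bar>?v\<bar> \<le> (\<eta> * ?u)\<^sup>2 + \<bar>?v\<bar>\<^sup>2" by (rule sum_squares_bound)
      moreover have "0 \<le> (\<eta> * ?u) * \<bar>?v\<bar>" using \<eta> by simp
      ultimately have "\<eta> * (?u * \<bar>?v\<bar>) \<le> (\<eta> * ?u)\<^sup>2 + ?v\<^sup>2" by (simp add: mult.assoc)
      then have "?u * \<bar>?v\<bar> \<le> ((\<eta> * ?u)\<^sup>2 + ?v\<^sup>2) / \<eta>" using \<eta> by (simp add: pos_le_divide_eq mult.commute)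
      also have "\<dots> = \<eta> * ?u\<^sup>2 + 1 / \<eta> * ?v\<^sup>2" using \<eta> by (simp add: power_mult_distrib add_divide_distrib power2_eq_square)
      finally show ?thesis .
    qed
    also have "?u\<^sup>2 = exp (4 * ?e * walk X i \<omega>)" by (simp add: exp_double[symmetric] mult.assoc)
    finally have "ennreal \<bar>exp (2 * ?e * walk X j \<omega>) - exp (2 * ?e * walk X i \<omega>)\<bar> \<le> ennreal (\<eta> * exp (4 * ?e * walk X i \<omega>) + 1 / \<eta> * ?v\<^sup>2)"
      by (rule ennreal_leI)
    also have "\<dots> = ennreal \<eta> * ennreal (exp (4 * ?e * walk X i \<omega>)) + ennreal (1 / \<eta>) * ennreal (?v\<^sup>2)"
      using \<eta> by (subst ennreal_plus) (auto simp: ennreal_mult[symmetric])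
    finally show "ennreal \<bar>exp (2 * ?e * walk X j \<omega>) - exp (2 * ?e * walk X i \<omega>)\<bar> * indicator {0} (walk X n \<omega>)
      \<le> ennreal \<eta> * (ennreal (exp (4 * ?e * walk X i \<omega>)) * indicator {0} (walk X n \<omega>))
         + ennreal (1 / \<eta>) * (ennreal (?v\<^sup>2) * indicator {0} (walk X n \<omega>))"
      by (auto simp: indicator_def)
  qed
  also have "\<dots> = ennreal \<eta> * (\<integral>\<^sup>+\<omega>. ennreal (exp (4 * ?e * walk X i \<omega>)) * indicator {0} (walk X n \<omega>) \<partial>M)
      + ennreal (1 / \<eta>) * (\<integral>\<^sup>+\<omega>. ennreal ((exp (2 * ?e * (walk X j \<omega> - walk X i \<omega>)) - 1)\<^sup>2) * indicator {0} (walk X n \<omega>) \<partial>M)"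
    by (simp add: nn_integral_add nn_integral_cmult)
  also have "\<dots> \<le> ennreal \<eta> * ennreal (sqrt (2 / real n) * exp ((4 * ?e)\<^sup>2 * real n / 2))
      + ennreal (1 / \<eta>) * ennreal (sqrt (2 / real n) * (exp (2 * (2 * ?e)\<^sup>2 * real (j - i)) - 1))"
    using ij n by (intro add_mono mult_left_mono walk_bridge_exp_moment walk_bridge_increment) auto
  also have "\<dots> \<le> ennreal \<eta> * ennreal (sqrt (2 / real n) * exp (8 * t))
      + ennreal (1 / \<eta>) * ennreal (sqrt (2 / real n) * (exp (8 * t * (real h / real n)) - 1))"
  proof (intro add_mono mult_left_mono ennreal_leI)
    have "(4 * ?e)\<^sup>2 * real n / 2 = 8 * t" unfolding power_mult_distrib using e2(1) by (simp add: mult.commute)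
    then show "exp ((4 * ?e)\<^sup>2 * real n / 2) \<le> exp (8 * t)" by simp
    have "2 * (2 * ?e)\<^sup>2 * real (j - i) = 8 * t * (real (j - i) / real n)" unfolding power_mult_distrib e2(2) by simp
    also have "\<dots> \<le> 8 * t * (real h / real n)" using ij t by (intro mult_left_mono divide_right_mono) auto
    finally show "exp (2 * (2 * ?e)\<^sup>2 * real (j - i)) - 1 \<le> exp (8 * t * (real h / real n)) - 1" by simp
  qed auto
  also have "\<dots> = ennreal (\<eta> * (sqrt (2 / real n) * exp (8 * t)) + 1 / \<eta> * (sqrt (2 / real n) * (exp (8 * t * (real h / real n)) - 1)))"
    using \<eta> t by (subst ennreal_plus) (auto simp: ennreal_mult[symmetric])
  also have "\<eta> * (sqrt (2 / real n) * exp (8 * t)) + 1 / \<eta> * (sqrt (2 / real n) * (exp (8 * t * (real h / real n)) - 1))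
     = sqrt (2 / real n) * (\<eta> * exp (8 * t) + (exp (8 * t * (real h / real n)) - 1) / \<eta>)"
    by (simp add: algebra_simps diff_divide_distrib)
  finally show ?thesis .
qed

text \<open>\<open>walk_var\<close> with the walk frozen at its value at the start of each block (\<open>coarse_var_eq\<close>).\<close>

definition coarse_var :: "real \<Rightarrow> nat \<Rightarrow> nat \<Rightarrow> 'a \<Rightarrow> real" where
  "coarse_var t k N \<omega> = block_var k (t / real (2 * N) * real (block_length k N)) (t / real (2 * N) * real (last_length k N))
     (\<lambda>i. step_size t (2 * N) * psum X {i * block_length k N + 1..(i + 1) * block_length k N} \<omega>)"

lemma coarse_var_eq:
  assumes L: "block_length k N > 0"
  shows "coarse_var t k N \<omega> = (\<Sum>j<2 * N. t / real (2 * N) * exp (2 * step_size t (2 * N) * walk X (block_start k (block_length k N) j) \<omega>))"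
proof -
  let ?L = "block_length k N" and ?h = "last_length k N" and ?e = "step_size t (2 * N)"
  have S: "(\<Sum>l<i. ?e * psum X {l * ?L + 1..(l + 1) * ?L} \<omega>) = ?e * walk X (i * ?L) \<omega>" for i
    unfolding sum_distrib_left[symmetric] psum_blocks_sum ..
  have "(\<Sum>j<2 * N. exp (2 * ?e * walk X (block_start k ?L j) \<omega>))
      = real ?L * (\<Sum>i<k. exp (2 * ?e * walk X (i * ?L) \<omega>)) + real ?h * exp (2 * ?e * walk X (k * ?L) \<omega>)"
    unfolding block_lengths(1)[of k N, symmetric] by (rule sum_block_start[OF L])
  then show ?thesis
    unfolding coarse_var_def block_var_def S
    unfolding sum_distrib_left[symmetric]
    by (simp add: algebra_simps del: of_nat_mult)
qed

lemma coarse_var_nonneg: "t > 0 \<Longrightarrow> 0 \<le> coarse_var t k N \<omega>"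
  unfolding coarse_var_def block_var_def by (intro add_nonneg_nonneg mult_nonneg_nonneg sum_nonneg) auto

lemma coarse_var_measurable [measurable]: "coarse_var t k N \<in> borel_measurable M"
proof -
  have [measurable]: "psum X {i * L + 1..(i + 1) * L} \<in> borel_measurable M" for i L
    by (rule psum_measurable) auto
  show ?thesis unfolding coarse_var_def[abs_def] block_var_def by measurable
qed

text \<open>Each time \<open>j\<close> is compared with the start of its block. There are
  \<open>2 * N\<close> terms of weight \<open>t / (2 * N)\<close>, so the bound for one term is
  multiplied by \<open>t\<close>.\<close>

lemma coarse_var_difference:
  assumes t: "t > 0" and L: "block_length k N > 0" and h: "2 * last_length k N \<le> 2 * N" and \<eta>: "\<eta> > 0"
  shows "(\<integral>\<^sup>+\<omega>. ennreal \<bar>walk_var t X (2 * N) \<omega> - coarse_var t k N \<omega>\<bar> * indicator {0} (walk X (2 * N) \<omega>) \<partial>M)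
    \<le> ennreal (sqrt (2 / real (2 * N)) * (t * (\<eta> * exp (8 * t) + (exp (8 * t * (real (last_length k N) / real (2 * N))) - 1) / \<eta>)))"
proof -
  let ?n = "2 * N" and ?L = "block_length k N" and ?h = "last_length k N" and ?e = "step_size t (2 * N)"
  let ?B = "\<eta> * exp (8 * t) + (exp (8 * t * (real ?h / real ?n)) - 1) / \<eta>"
  let ?g = "\<lambda>j \<omega>. exp (2 * ?e * walk X j \<omega>)" and ?s = "block_start k ?L"
  have n: "?n > 0" using L by (cases N) (auto simp: block_length_def)
  have B: "0 \<le> ?B" using t \<eta> by (intro add_nonneg_nonneg divide_nonneg_pos) auto
  have "(\<integral>\<^sup>+\<omega>. ennreal \<bar>walk_var t X ?n \<omega> - coarse_var t k N \<omega>\<bar> * indicator {0} (walk X ?n \<omega>) \<partial>M)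
    \<le> (\<integral>\<^sup>+\<omega>. (\<Sum>j<?n. ennreal (t / real ?n) * (ennreal \<bar>?g j \<omega> - ?g (?s j) \<omega>\<bar> * indicator {0} (walk X ?n \<omega>))) \<partial>M)"
  proof (intro nn_integral_mono)
    fix \<omega>
    have "walk_var t X ?n \<omega> - coarse_var t k N \<omega> = (\<Sum>j<?n. t / real ?n * (?g j \<omega> - ?g (?s j) \<omega>))"
      unfolding coarse_var_eq[OF L] walk_var_def by (simp add: sum_subtractf[symmetric] right_diff_distrib del: of_nat_mult)
    then have "\<bar>walk_var t X ?n \<omega> - coarse_var t k N \<omega>\<bar> \<le> (\<Sum>j<?n. \<bar>t / real ?n * (?g j \<omega> - ?g (?s j) \<omega>)\<bar>)"
      by (simp only: sum_abs)
    also have "\<dots> = (\<Sum>j<?n. t / real ?n * \<bar>?g j \<omega> - ?g (?s j) \<omega>\<bar>)"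
      using t by (simp add: abs_mult)
    finally have "ennreal \<bar>walk_var t X ?n \<omega> - coarse_var t k N \<omega>\<bar> \<le> ennreal (\<Sum>j<?n. t / real ?n * \<bar>?g j \<omega> - ?g (?s j) \<omega>\<bar>)"
      by (rule ennreal_leI)
    also have "\<dots> = (\<Sum>j<?n. ennreal (t / real ?n) * ennreal \<bar>?g j \<omega> - ?g (?s j) \<omega>\<bar>)"
      using t by (subst sum_ennreal[symmetric]) (auto intro!: sum.cong simp: ennreal_mult[symmetric] simp del: sum_ennreal)
    finally show "ennreal \<bar>walk_var t X ?n \<omega> - coarse_var t k N \<omega>\<bar> * indicator {0} (walk X ?n \<omega>)
      \<le> (\<Sum>j<?n. ennreal (t / real ?n) * (ennreal \<bar>?g j \<omega> - ?g (?s j) \<omega>\<bar> * indicator {0} (walk X ?n \<omega>)))"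
      by (auto simp: indicator_def)
  qed
  also have "\<dots> = (\<Sum>j<?n. ennreal (t / real ?n) * (\<integral>\<^sup>+\<omega>. ennreal \<bar>?g j \<omega> - ?g (?s j) \<omega>\<bar> * indicator {0} (walk X ?n \<omega>) \<partial>M))"
    by (simp add: nn_integral_sum nn_integral_cmult)
  also have "\<dots> \<le> (\<Sum>j<?n. ennreal (t / real ?n) * ennreal (sqrt (2 / real ?n) * ?B))"
  proof (intro sum_mono mult_left_mono)
    fix j assume "j \<in> {..<?n}"
    then have j: "j < k * ?L + ?h" unfolding block_lengths(1) by simp
    note bs = block_start_le[OF j block_lengths(2)]
    show "(\<integral>\<^sup>+\<omega>. ennreal \<bar>?g j \<omega> - ?g (?s j) \<omega>\<bar> * indicator {0} (walk X ?n \<omega>) \<partial>M) \<le> ennreal (sqrt (2 / real ?n) * ?B)"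
      by (rule walk_bridge_exp_difference[OF t n bs(1) _ bs(2) h \<eta>]) (use \<open>j \<in> {..<?n}\<close> in simp)
  qed simp
  also have "\<dots> = (\<Sum>j<?n. ennreal (t / real ?n * (sqrt (2 / real ?n) * ?B)))"
    using t B by (subst ennreal_mult) auto
  also have "\<dots> = ennreal (sqrt (2 / real ?n) * (t * ?B))"
  proof -
    have "(\<Sum>j<?n. ennreal (t / real ?n * (sqrt (2 / real ?n) * ?B))) = ennreal (\<Sum>j<?n. t / real ?n * (sqrt (2 / real ?n) * ?B))"
      using t B by (intro sum_ennreal mult_nonneg_nonneg) auto
    also have "(\<Sum>j<?n. t / real ?n * (sqrt (2 / real ?n) * ?B)) = real ?n * (t / real ?n * (sqrt (2 / real ?n) * ?B))"
      by (simp only: sum_constant card_lessThan)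
    also have "\<dots> = sqrt (2 / real ?n) * (t * ?B)" using n by (simp del: of_nat_mult)
    finally show ?thesis .
  qed
  finally show ?thesis .
qed

end

section \<open>The density of the walk on the affine group\<close>

context rademacher
begin

lemma normal_density_walk_var_le:
  assumes "t > 0" "n > 0"
  shows "normal_density 0 (sqrt (walk_var t X n \<omega>)) y \<le> 1 + real n / t"
proof -
  have "1 / walk_var t X n \<omega> \<le> 1 / (t / real n)"
    using walk_var_ge[OF assms, of X \<omega>] walk_var_pos[OF assms, of X \<omega>] assms by (intro divide_left_mono) auto
  then show ?thesis using normal_density_0_le[OF walk_var_pos[OF assms, of X \<omega>], of y] by simp
qed

definition walk_density :: "real \<Rightarrow> nat \<Rightarrow> real \<Rightarrow> real" where
  "walk_density t n y = (\<integral>\<omega>. normal_density 0 (sqrt (walk_var t X n \<omega>)) y * indicator {0} (walk X n \<omega>) \<partial>M)"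

lemma integrable_walk_density:
  assumes "t > 0" "n > 0"
  shows "integrable M (\<lambda>\<omega>. normal_density 0 (sqrt (walk_var t X n \<omega>)) y * indicator {0} (walk X n \<omega>))"
proof (rule integrable_const_bound[where B = "1 + real n / t"])
  show "AE \<omega> in M. norm (normal_density 0 (sqrt (walk_var t X n \<omega>)) y * indicator {0} (walk X n \<omega>)) \<le> 1 + real n / t"
    using normal_density_walk_var_le[OF assms, of _ y] assms by (intro AE_I2) (auto simp: indicator_def)
qed measurable

lemma walk_density_nonneg: "0 \<le> walk_density t n y"
  unfolding walk_density_def by (intro integral_nonneg_AE) auto

lemma continuous_walk_density:
  assumes t: "t > 0" and n: "n > 0"
  shows "continuous_on UNIV (walk_density t n)"
  unfolding continuous_on_sequentially
proof (intro ballI allI impI, elim conjE)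
  fix y :: real and u :: "nat \<Rightarrow> real" assume u: "u \<longlonglongrightarrow> y"
  show "(walk_density t n \<circ> u) \<longlonglongrightarrow> walk_density t n y"
    unfolding comp_def walk_density_def
  proof (rule integral_dominated_convergence)
    show "integrable M (\<lambda>\<omega>. 1 + real n / t)" by simp
    show "AE \<omega> in M. norm (normal_density 0 (sqrt (walk_var t X n \<omega>)) (u k) * indicator {0} (walk X n \<omega>)) \<le> 1 + real n / t" for k
      using normal_density_walk_var_le[OF t n, of _ "u k"] t by (intro AE_I2) (auto simp: indicator_def)
    show "AE \<omega> in M. (\<lambda>k. normal_density 0 (sqrt (walk_var t X n \<omega>)) (u k) * indicator {0} (walk X n \<omega>))
        \<longlonglongrightarrow> normal_density 0 (sqrt (walk_var t X n \<omega>)) y * indicator {0} (walk X n \<omega>)"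
    proof (rule AE_I2)
      fix \<omega>
      have "sqrt (walk_var t X n \<omega>) \<noteq> 0" using walk_var_pos[OF t n, of X \<omega>] by simp
      then show "(\<lambda>k. normal_density 0 (sqrt (walk_var t X n \<omega>)) (u k) * indicator {0} (walk X n \<omega>))
        \<longlonglongrightarrow> normal_density 0 (sqrt (walk_var t X n \<omega>)) y * indicator {0} (walk X n \<omega>)"
        unfolding normal_density_def by (intro tendsto_intros u) auto
    qed
  qed measurable
qed

lemma walk_density_at_0:
  assumes "t > 0" "n > 0"
  shows "walk_density t n 0 = 1 / sqrt (2 * pi) * (\<integral>\<omega>. 1 / sqrt (walk_var t X n \<omega>) * indicator {0} (walk X n \<omega>) \<partial>M)"
proof -
  have "walk_density t n 0 = (\<integral>\<omega>. 1 / sqrt (2 * pi) * (1 / sqrt (walk_var t X n \<omega>) * indicator {0} (walk X n \<omega>)) \<partial>M)"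
    unfolding walk_density_def using walk_var_pos[OF assms, of X]
    by (intro Bochner_Integration.integral_cong refl) (simp add: normal_density_def real_sqrt_mult less_imp_le)
  then show ?thesis by (simp only: integral_mult_right_zero)
qed

text \<open>An instance of the Gaussian mixture with the signs as \<open>U\<close>: the coefficient
  of \<open>Y j\<close> depends on the signs before \<open>j\<close>, and the test function
  \<open>G\<close> contains the return event together with \<open>\<Gamma>\<close>.\<close>

lemma continuous_density_walk_b:
  assumes Y: "std_gaussian_sequence M Y" and XY: "indep_processes M {1..} X Y" and t: "t > 0" and n: "n > 0"
  shows "continuous_density_on_event M (\<lambda>\<omega>. walk X n \<omega> = 0) (walk_b (step_size t n) X Y n) (walk_density t n)"
  unfolding continuous_density_on_event_def
proof (intro conjI ballI allI continuous_walk_density t n walk_density_nonneg)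
  fix \<Gamma> :: "real set" assume \<Gamma>[measurable]: "\<Gamma> \<in> sets borel"
  let ?J = "{1..n}" and ?e = "step_size t n"
  let ?S = "PiM ?J (\<lambda>_. borel :: real measure)" and ?U = "\<lambda>\<omega>. \<lambda>i\<in>?J. X i \<omega>"
  define c where "c j u = ?e * exp (?e * (\<Sum>i=1..j - 1. u i))" for j and u :: "nat \<Rightarrow> real"
  define G :: "(nat \<Rightarrow> real) \<times> real \<Rightarrow> ennreal"
    where "G = (\<lambda>(u, y). indicator {0} (\<Sum>i=1..n. u i) * indicator \<Gamma> y)"
  have e: "?e > 0" "?e\<^sup>2 = t / real n" using t n by (simp_all add: step_size_def)
  have res: "(\<lambda>f. restrict f ?J) \<in> measurable (PiM {1..} (\<lambda>_. borel)) ?S"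
    by (rule measurable_restrict_subset) auto
  have "indep2 ?S (\<lambda>\<omega>. restrict (\<lambda>i\<in>{1..}. X i \<omega>) ?J) ?S (\<lambda>\<omega>. restrict (\<lambda>i\<in>{1..}. Y i \<omega>) ?J)"
    by (rule indep2_compose[OF XY[unfolded indep_processes_def, folded indep2_iff_indep_var] res res])
  moreover have "restrict (\<lambda>i\<in>{1..}. Z i \<omega>) ?J = (\<lambda>i\<in>?J. Z i \<omega>)" for Z :: "nat \<Rightarrow> 'a \<Rightarrow> real" and \<omega>
    by (auto simp: fun_eq_iff)
  ultimately have iv: "indep_var ?S ?U ?S (\<lambda>\<omega>. \<lambda>i\<in>?J. Y i \<omega>)"
    by (simp only: indep2_iff_indep_var)
  have cm: "c j \<in> borel_measurable ?S" if "j \<in> ?J" for j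
  proof -
    have "(\<lambda>u. u i) \<in> borel_measurable ?S" if "i \<in> {1..j - 1}" for i
      using that \<open>j \<in> ?J\<close> by (intro measurable_component_singleton) auto
    then show ?thesis unfolding c_def[abs_def] by measurable
  qed
  have Gm: "G \<in> borel_measurable (?S \<Otimes>\<^sub>M borel)"
  proof -
    have [measurable]: "(\<lambda>u. \<Sum>i=1..n. u i) \<in> borel_measurable ?S"
      by (intro borel_measurable_sum measurable_component_singleton)
    show ?thesis unfolding G_def case_prod_beta by measurable
  qed
  have "indep_vars (\<lambda>_. borel) Y {1..}" using Y unfolding std_gaussian_sequence_def by blast
  then have ind: "indep_vars (\<lambda>_. borel) Y ?J" by (rule indep_vars_subset) auto
  have dY: "distributed M lborel (Y j) (normal_density 0 1)" if "j \<in> ?J" for j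
    using Y that by (auto simp: std_gaussian_sequence_def)
  have w: "(\<Sum>i=1..j - 1. (?U \<omega>) i) = walk X (j - 1) \<omega>" if "j \<in> ?J" for j \<omega>
    unfolding walk_def using that by (intro sum.cong) auto
  have cU: "c j (?U \<omega>) = ?e * exp (?e * walk X (j - 1) \<omega>)" if "j \<in> ?J" for j \<omega>
    by (simp only: c_def w[OF that])
  have wn: "(\<Sum>i=1..n. (?U \<omega>) i) = walk X n \<omega>" for \<omega>
    unfolding walk_def by (intro sum.cong) auto
  have S1: "(\<Sum>j\<in>?J. c j (?U \<omega>) * Y j \<omega>) = walk_b ?e X Y n \<omega>" for \<omega>
    unfolding walk_b_def sum_distrib_left by (intro sum.cong refl) (simp only: cU mult_ac)
  have S2: "(\<Sum>j\<in>?J. (c j (?U \<omega>))\<^sup>2) = walk_var t X n \<omega>" for \<omega>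
  proof -
    have "(\<Sum>j\<in>?J. (c j (?U \<omega>))\<^sup>2) = (\<Sum>j=1..n. t / real n * exp (2 * ?e * walk X (j - 1) \<omega>))"
      by (intro sum.cong refl) (simp only: cU power_mult_distrib e(2) exp_double[symmetric] mult.assoc)
    also have "\<dots> = walk_var t X n \<omega>"
      unfolding walk_var_def by (rule sum.reindex_bij_witness[of _ Suc "\<lambda>j. j - 1"]) auto
    finally show ?thesis .
  qed
  have Ym: "Y j \<in> borel_measurable M" if "j \<ge> 1" for j
    using Y that by (auto simp: std_gaussian_sequence_def distributed_def)
  have bm[measurable]: "walk_b ?e X Y n \<in> borel_measurable M"
    unfolding walk_b_def[abs_def] by (intro borel_measurable_times borel_measurable_sum borel_measurable_const
      measurable_compose[OF _ borel_measurable_exp] walk_measurable Ym) auto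
  have "emeasure M {\<omega> \<in> space M. walk X n \<omega> = 0 \<and> walk_b ?e X Y n \<omega> \<in> \<Gamma>}
      = (\<integral>\<^sup>+\<omega>. indicator {\<omega> \<in> space M. walk X n \<omega> = 0 \<and> walk_b ?e X Y n \<omega> \<in> \<Gamma>} \<omega> \<partial>M)"
    by (rule nn_integral_indicator[symmetric]) measurable
  also have "\<dots> = (\<integral>\<^sup>+\<omega>. G (?U \<omega>, \<Sum>j\<in>?J. c j (?U \<omega>) * Y j \<omega>) \<partial>M)"
    unfolding S1 G_def prod.case wn by (intro nn_integral_cong) (auto simp: indicator_def)
  also have "\<dots> = (\<integral>\<^sup>+\<omega>. (\<integral>\<^sup>+y. G (?U \<omega>, y) * ennreal (normal_density 0 (1 * sqrt (\<Sum>j\<in>?J. (c j (?U \<omega>))\<^sup>2)) y) \<partial>lborel) \<partial>M)"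
    by (rule nn_integral_gaussian_mixture[OF prob_space_axioms iv ind _ _ _ dY cm _ Gm])
       (use n e in \<open>auto simp: c_def\<close>)
  also have "\<dots> = (\<integral>\<^sup>+\<omega>. (\<integral>\<^sup>+y. indicator {0} (walk X n \<omega>) * indicator \<Gamma> y * ennreal (normal_density 0 (sqrt (walk_var t X n \<omega>)) y) \<partial>lborel) \<partial>M)"
    unfolding S2 G_def prod.case wn mult_1 ..
  also have "\<dots> = (\<integral>\<^sup>+y. (\<integral>\<^sup>+\<omega>. indicator {0} (walk X n \<omega>) * indicator \<Gamma> y * ennreal (normal_density 0 (sqrt (walk_var t X n \<omega>)) y) \<partial>M) \<partial>lborel)"
  proof -
    interpret pair_sigma_finite M lborel ..
    show ?thesis by (rule Fubini'[symmetric]) measurable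
  qed
  also have "\<dots> = (\<integral>\<^sup>+y. ennreal (walk_density t n y) * indicator \<Gamma> y \<partial>lborel)"
  proof (intro nn_integral_cong)
    fix y
    have "(\<integral>\<^sup>+\<omega>. indicator {0} (walk X n \<omega>) * indicator \<Gamma> y * ennreal (normal_density 0 (sqrt (walk_var t X n \<omega>)) y) \<partial>M)
        = (\<integral>\<^sup>+\<omega>. ennreal (normal_density 0 (sqrt (walk_var t X n \<omega>)) y * indicator {0} (walk X n \<omega>)) * indicator \<Gamma> y \<partial>M)"
      by (intro nn_integral_cong) (auto simp: indicator_def)
    also have "\<dots> = (\<integral>\<^sup>+\<omega>. ennreal (normal_density 0 (sqrt (walk_var t X n \<omega>)) y * indicator {0} (walk X n \<omega>)) \<partial>M) * indicator \<Gamma> y"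
      by (rule nn_integral_multc) measurable
    also have "(\<integral>\<^sup>+\<omega>. ennreal (normal_density 0 (sqrt (walk_var t X n \<omega>)) y * indicator {0} (walk X n \<omega>)) \<partial>M) = ennreal (walk_density t n y)"
      unfolding walk_density_def by (rule nn_integral_eq_integral[OF integrable_walk_density[OF t n]]) simp
    finally show "(\<integral>\<^sup>+\<omega>. indicator {0} (walk X n \<omega>) * indicator \<Gamma> y * ennreal (normal_density 0 (sqrt (walk_var t X n \<omega>)) y) \<partial>M)
      = ennreal (walk_density t n y) * indicator \<Gamma> y" .
  qed
  finally show "emeasure M {\<omega> \<in> space M. walk X n \<omega> = 0 \<and> walk_b ?e X Y n \<omega> \<in> \<Gamma>}
    = (\<integral>\<^sup>+y. ennreal (walk_density t n y) * indicator \<Gamma> y \<partial>lborel)" .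
qed

section \<open>Errors of the regularisation and of the blocks as real expectations\<close>

lemma integrable_inverse_walk_var:
  assumes "t > 0" "n > 0"
  shows "integrable M (\<lambda>\<omega>. 1 / walk_var t X n \<omega> * indicator {0} (walk X n \<omega>))" (is "integrable M ?f")
    and "(\<integral>\<omega>. 1 / walk_var t X n \<omega> * indicator {0} (walk X n \<omega>) \<partial>M) \<le> sqrt (2 / real n) * (exp (2 * t) / t)"
proof -
  have f: "AE \<omega> in M. 0 \<le> ?f \<omega>" using walk_var_pos[OF assms, of X] by (intro AE_I2) (simp add: less_imp_le)
  have "(\<integral>\<^sup>+\<omega>. ennreal (?f \<omega>) \<partial>M) = (\<integral>\<^sup>+\<omega>. ennreal (1 / walk_var t X n \<omega>) * indicator {0} (walk X n \<omega>) \<partial>M)"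
    by (intro nn_integral_cong) (auto simp: indicator_def)
  with inverse_walk_var_moment[OF assms]
  have le: "(\<integral>\<^sup>+\<omega>. ennreal (?f \<omega>) \<partial>M) \<le> ennreal (sqrt (2 / real n) * (exp (2 * t) / t))" by simp
  show i: "integrable M ?f"
    by (rule integrableI_nonneg[OF _ f]) (use le in \<open>auto intro: order.strict_trans1\<close>)
  show "integral\<^sup>L M ?f \<le> sqrt (2 / real n) * (exp (2 * t) / t)"
    using le unfolding nn_integral_eq_integral[OF i f] using assms by (simp add: ennreal_le_iff)
qed

lemma integrable_coarse_var_difference:
  assumes t: "t > 0" and L: "block_length k N > 0" and h: "2 * last_length k N \<le> 2 * N" and \<eta>: "\<eta> > 0"
  shows "integrable M (\<lambda>\<omega>. \<bar>walk_var t X (2 * N) \<omega> - coarse_var t k N \<omega>\<bar> * indicator {0} (walk X (2 * N) \<omega>))" (is "integrable M ?f")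
    and "(\<integral>\<omega>. \<bar>walk_var t X (2 * N) \<omega> - coarse_var t k N \<omega>\<bar> * indicator {0} (walk X (2 * N) \<omega>) \<partial>M)
      \<le> sqrt (2 / real (2 * N)) * (t * (\<eta> * exp (8 * t) + (exp (8 * t * (real (last_length k N) / real (2 * N))) - 1) / \<eta>))" (is "_ \<le> ?c")
proof -
  have f: "AE \<omega> in M. 0 \<le> ?f \<omega>" by simp
  have c: "0 \<le> ?c" using t \<eta> by (intro mult_nonneg_nonneg add_nonneg_nonneg divide_nonneg_pos) auto
  have "(\<integral>\<^sup>+\<omega>. ennreal (?f \<omega>) \<partial>M) = (\<integral>\<^sup>+\<omega>. ennreal \<bar>walk_var t X (2 * N) \<omega> - coarse_var t k N \<omega>\<bar> * indicator {0} (walk X (2 * N) \<omega>) \<partial>M)"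
    by (intro nn_integral_cong) (auto simp: indicator_def)
  with coarse_var_difference[OF assms]
  have le: "(\<integral>\<^sup>+\<omega>. ennreal (?f \<omega>) \<partial>M) \<le> ennreal ?c" by simp
  show i: "integrable M ?f"
    by (rule integrableI_nonneg[OF _ f]) (use le in \<open>auto intro: order.strict_trans1\<close>)
  show "integral\<^sup>L M ?f \<le> ?c"
    using le unfolding nn_integral_eq_integral[OF i f] using c by (simp add: ennreal_le_iff)
qed

lemma smooth_inv_sqrt_measurable: "\<delta> > 0 \<Longrightarrow> smooth_inv_sqrt \<delta> \<in> borel_measurable borel"
  by (rule borel_measurable_continuous_onI[OF continuous_smooth_inv_sqrt])

lemma integrable_smooth_inv_sqrt:
  assumes \<delta>: "\<delta> > 0" and f[measurable]: "f \<in> borel_measurable M" and g[measurable]: "g \<in> borel_measurable M"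
  shows "integrable M (\<lambda>\<omega>. smooth_inv_sqrt \<delta> (f \<omega>) * indicator {0 :: real} (g \<omega>))"
proof (rule integrable_const_bound[where B = "1 / \<delta>"])
  note smooth_inv_sqrt_measurable[OF \<delta>, measurable]
  show "AE \<omega> in M. norm (smooth_inv_sqrt \<delta> (f \<omega>) * indicator {0} (g \<omega>)) \<le> 1 / \<delta>"
    using smooth_inv_sqrt_bounds[OF \<delta>] \<delta> by (intro AE_I2) (auto simp: indicator_def)
  show "(\<lambda>\<omega>. smooth_inv_sqrt \<delta> (f \<omega>) * indicator {0} (g \<omega>)) \<in> borel_measurable M" by measurable
qed

text \<open>The regularisation error is controlled by the mean of \<open>1 / walk_var\<close>, the
  error of freezing the walk in blocks by the Lipschitz bound. Both carry the factor
  \<open>sqrt (2 / (2 * N))\<close>, which the normalisation by \<open>sqrt (2 * N)\<close> reduces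
  to \<open>sqrt 2\<close>.\<close>

lemma smooth_coarse_comparison:
  assumes t: "t > 0" and L: "block_length k N > 0" and h: "2 * last_length k N \<le> 2 * N" and \<eta>: "\<eta> > 0" and \<delta>: "\<delta> > 0"
  shows "\<bar>(\<integral>\<omega>. 1 / sqrt (walk_var t X (2 * N) \<omega>) * indicator {0} (walk X (2 * N) \<omega>) \<partial>M)
       - (\<integral>\<omega>. smooth_inv_sqrt \<delta> (coarse_var t k N \<omega>) * indicator {0} (walk X (2 * N) \<omega>) \<partial>M)\<bar>
    \<le> sqrt (2 / real (2 * N)) * (\<delta> * (exp (2 * t) / t)
       + t * (\<eta> * exp (8 * t) + (exp (8 * t * (real (last_length k N) / real (2 * N))) - 1) / \<eta>) / \<delta> ^ 3)"
proof -
  let ?n = "2 * N"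
  let ?A = "walk_var t X ?n" and ?A' = "coarse_var t k N" and ?I = "\<lambda>\<omega>. indicator {0} (walk X ?n \<omega>) :: real"
  have n: "?n > 0" using L by (cases N) (auto simp: block_length_def)
  note pos = walk_var_pos[OF t n, of X]
  note i1 = integrable_inverse_walk_var[OF t n] and i2 = integrable_coarse_var_difference[OF t L h \<eta>]
  have "\<bar>1 / sqrt (?A \<omega>) * ?I \<omega> - smooth_inv_sqrt \<delta> (?A' \<omega>) * ?I \<omega>\<bar>
      \<le> \<delta> * (1 / ?A \<omega> * ?I \<omega>) + \<bar>?A \<omega> - ?A' \<omega>\<bar> * ?I \<omega> / \<delta> ^ 3" for \<omega>
  proof -
    have "\<bar>1 / sqrt (?A \<omega>) - smooth_inv_sqrt \<delta> (?A' \<omega>)\<bar> \<le> \<delta> * (1 / ?A \<omega>) + \<bar>?A \<omega> - ?A' \<omega>\<bar> / \<delta> ^ 3"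
      using smooth_inv_sqrt_approx[OF \<delta> pos[of \<omega>]]
        smooth_inv_sqrt_lipschitz[OF \<delta> less_imp_le[OF pos[of \<omega>]] coarse_var_nonneg[OF t, of k N \<omega>]] by linarith
    then show ?thesis by (auto simp: indicator_def)
  qed
  note pw = this
  have ir: "integrable M (\<lambda>\<omega>. \<delta> * (1 / ?A \<omega> * ?I \<omega>) + \<bar>?A \<omega> - ?A' \<omega>\<bar> * ?I \<omega> / \<delta> ^ 3)"
    by (intro Bochner_Integration.integrable_add integrable_mult_right integrable_divide i1 i2)
  have i3: "integrable M (\<lambda>\<omega>. smooth_inv_sqrt \<delta> (?A' \<omega>) * ?I \<omega>)"
    by (rule integrable_smooth_inv_sqrt[OF \<delta>]) measurable
  note smooth_inv_sqrt_measurable[OF \<delta>, measurable]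
  have id: "integrable M (\<lambda>\<omega>. 1 / sqrt (?A \<omega>) * ?I \<omega> - smooth_inv_sqrt \<delta> (?A' \<omega>) * ?I \<omega>)"
  proof (rule Bochner_Integration.integrable_bound[OF ir])
    show "AE \<omega> in M. norm (1 / sqrt (?A \<omega>) * ?I \<omega> - smooth_inv_sqrt \<delta> (?A' \<omega>) * ?I \<omega>)
        \<le> norm (\<delta> * (1 / ?A \<omega> * ?I \<omega>) + \<bar>?A \<omega> - ?A' \<omega>\<bar> * ?I \<omega> / \<delta> ^ 3)"
      unfolding real_norm_def by (intro AE_I2 order_trans[OF pw abs_ge_self])
  qed measurable
  \<comment> \<open>The inverse square root is integrable as the sum of the dominated difference and
    a bounded function.\<close>
  have iq: "integrable M (\<lambda>\<omega>. 1 / sqrt (?A \<omega>) * ?I \<omega>)"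
    using Bochner_Integration.integrable_add[OF id i3] by simp
  have "\<bar>(\<integral>\<omega>. 1 / sqrt (?A \<omega>) * ?I \<omega> \<partial>M) - (\<integral>\<omega>. smooth_inv_sqrt \<delta> (?A' \<omega>) * ?I \<omega> \<partial>M)\<bar>
      = \<bar>\<integral>\<omega>. 1 / sqrt (?A \<omega>) * ?I \<omega> - smooth_inv_sqrt \<delta> (?A' \<omega>) * ?I \<omega> \<partial>M\<bar>"
    by (simp only: Bochner_Integration.integral_diff[OF iq i3])
  also have "\<dots> \<le> (\<integral>\<omega>. \<bar>1 / sqrt (?A \<omega>) * ?I \<omega> - smooth_inv_sqrt \<delta> (?A' \<omega>) * ?I \<omega>\<bar> \<partial>M)"
    by (rule integral_abs_bound)
  also have "\<dots> \<le> (\<integral>\<omega>. \<delta> * (1 / ?A \<omega> * ?I \<omega>) + \<bar>?A \<omega> - ?A' \<omega>\<bar> * ?I \<omega> / \<delta> ^ 3 \<partial>M)"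
    by (rule integral_mono[OF integrable_abs[OF id] ir pw])
  also have "\<dots> = \<delta> * (\<integral>\<omega>. 1 / ?A \<omega> * ?I \<omega> \<partial>M) + (\<integral>\<omega>. \<bar>?A \<omega> - ?A' \<omega>\<bar> * ?I \<omega> \<partial>M) / \<delta> ^ 3"
    by (subst Bochner_Integration.integral_add)
       (auto intro!: integrable_mult_right integrable_divide i1 i2 simp only: integral_mult_right_zero integral_divide_zero)
  also have "\<dots> \<le> \<delta> * (sqrt (2 / real ?n) * (exp (2 * t) / t))
      + (sqrt (2 / real ?n) * (t * (\<eta> * exp (8 * t) + (exp (8 * t * (real (last_length k N) / real ?n)) - 1) / \<eta>))) / \<delta> ^ 3"
    using \<delta> by (intro add_mono mult_left_mono divide_right_mono i1 i2) auto
  also have "\<dots> = sqrt (2 / real ?n) * (\<delta> * (exp (2 * t) / t)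
       + t * (\<eta> * exp (8 * t) + (exp (8 * t * (real (last_length k N) / real ?n)) - 1) / \<eta>) / \<delta> ^ 3)"
    by (simp add: distrib_left mult_ac del: of_nat_mult)
  finally show ?thesis .
qed

end

section \<open>Convergence to the heat kernel\<close>

context two_brownian
begin

lemma bridge_sum_measurable_section: "t > 0 \<Longrightarrow> (\<lambda>\<omega>. bridge_sum t m x (\<lambda>s. B s \<omega>)) \<in> borel_measurable N"
  using measurable_Pair2[OF bridge_sum_measurable, of t x m] by simp

lemma smooth_bridge_sum_LIMSEQ:
  assumes t: "t > 0" and \<delta>: "\<delta> > 0"
  shows "(\<lambda>k. \<integral>\<omega>. smooth_inv_sqrt \<delta> (bridge_sum t (Suc k) 0 (\<lambda>s. B s \<omega>)) \<partial>N)
    \<longlonglongrightarrow> (\<integral>\<omega>. smooth_inv_sqrt \<delta> (bridge_var t 0 (\<lambda>s. B s \<omega>)) \<partial>N)"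
proof (rule integral_dominated_convergence)
  note [measurable] = borel_measurable_continuous_onI[OF continuous_smooth_inv_sqrt[OF \<delta>]]
    bridge_sum_measurable_section[OF t] bridge_var_measurable_section[OF t]
  show "integrable N (\<lambda>\<omega>. 1 / \<delta>)" by simp
  show "AE \<omega> in N. norm (smooth_inv_sqrt \<delta> (bridge_sum t (Suc k) 0 (\<lambda>s. B s \<omega>))) \<le> 1 / \<delta>" for k
    using smooth_inv_sqrt_bounds[OF \<delta>] by (intro AE_I2) (simp add: abs_of_nonneg)
  show "AE \<omega> in N. (\<lambda>k. smooth_inv_sqrt \<delta> (bridge_sum t (Suc k) 0 (\<lambda>s. B s \<omega>)))
      \<longlonglongrightarrow> smooth_inv_sqrt \<delta> (bridge_var t 0 (\<lambda>s. B s \<omega>))"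
    by (intro AE_I2 continuous_on_tendsto_compose[OF continuous_smooth_inv_sqrt[OF \<delta>]]
        LIMSEQ_Suc[OF bridge_sum_LIMSEQ[OF t B_continuous]]) auto
  show "(\<lambda>\<omega>. smooth_inv_sqrt \<delta> (bridge_sum t (Suc k) 0 (\<lambda>s. B s \<omega>))) \<in> borel_measurable N" for k by measurable
  show "(\<lambda>\<omega>. smooth_inv_sqrt \<delta> (bridge_var t 0 (\<lambda>s. B s \<omega>))) \<in> borel_measurable N" by measurable
qed

text \<open>Dominated convergence with the inverse square root itself as majorant, since the
  regularised function lies below it.\<close>

lemma smooth_inv_sqrt_bridge_var_LIMSEQ:
  assumes t: "t > 0"
  shows "(\<lambda>j. \<integral>\<omega>. smooth_inv_sqrt (inverse (real (Suc j))) (bridge_var t 0 (\<lambda>s. B s \<omega>)) \<partial>N)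
    \<longlonglongrightarrow> (\<integral>\<omega>. 1 / sqrt (bridge_var t 0 (\<lambda>s. B s \<omega>)) \<partial>N)"
proof (rule integral_dominated_convergence)
  let ?A = "\<lambda>\<omega>. bridge_var t 0 (\<lambda>s. B s \<omega>)"
  note [measurable] = bridge_var_measurable_section[OF t]
  show "integrable N (\<lambda>\<omega>. 1 / sqrt (?A \<omega>))" by (rule integrable_inverse_sqrt_bridge_var[OF t])
  have pos: "?A \<omega> > 0" if "\<omega> \<in> space N" for \<omega> by (rule bridge_var_0_pos[OF t B_continuous[OF that]])
  show "AE \<omega> in N. norm (smooth_inv_sqrt (inverse (real (Suc j))) (?A \<omega>)) \<le> 1 / sqrt (?A \<omega>)" for j
  proof (rule AE_I2)
    fix \<omega> assume "\<omega> \<in> space N"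
    then show "norm (smooth_inv_sqrt (inverse (real (Suc j))) (?A \<omega>)) \<le> 1 / sqrt (?A \<omega>)"
      using smooth_inv_sqrt_approx(1)[OF _ pos, of "inverse (real (Suc j))" \<omega>]
        smooth_inv_sqrt_bounds(1)[of "inverse (real (Suc j))" "?A \<omega>"] by simp
  qed
  show "AE \<omega> in N. (\<lambda>j. smooth_inv_sqrt (inverse (real (Suc j))) (?A \<omega>)) \<longlonglongrightarrow> 1 / sqrt (?A \<omega>)"
  proof (rule AE_I2)
    fix \<omega> assume "\<omega> \<in> space N"
    then have "(\<lambda>j. 1 / sqrt (\<bar>?A \<omega>\<bar> + (inverse (real (Suc j)))\<^sup>2)) \<longlonglongrightarrow> 1 / sqrt (\<bar>?A \<omega>\<bar> + 0\<^sup>2)"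
      using pos[of \<omega>] by (intro tendsto_intros LIMSEQ_inverse_real_of_nat) auto
    then show "(\<lambda>j. smooth_inv_sqrt (inverse (real (Suc j))) (?A \<omega>)) \<longlonglongrightarrow> 1 / sqrt (?A \<omega>)"
      using pos[OF \<open>\<omega> \<in> space N\<close>] by (simp add: smooth_inv_sqrt_def)
  qed
  show "(\<lambda>\<omega>. smooth_inv_sqrt (inverse (real (Suc j))) (?A \<omega>)) \<in> borel_measurable N" for j
    unfolding smooth_inv_sqrt_def by measurable
  show "(\<lambda>\<omega>. 1 / sqrt (?A \<omega>)) \<in> borel_measurable N" by measurable
qed

text \<open>The limit from \<open>bridge_block_limit\<close> is a weighted Gaussian vector;
  \<open>brownian_bridge_kernel\<close> with \<open>x = 0\<close> turns it into the density of
  \<open>B t\<close> at 0 times a mean over the bridge from 0 to 0.\<close>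

lemma smooth_coarse_var_LIMSEQ:
  fixes M :: "'a measure"
  assumes X: "rademacher_sequence M X" and t: "t > 0" and k: "k > 0" and \<delta>: "\<delta> > 0"
  shows "(\<lambda>n. sqrt (real (2 * n)) * (\<integral>\<omega>. smooth_inv_sqrt \<delta> (rademacher.coarse_var X t k n \<omega>) * indicator {0} (walk X (2 * n) \<omega>) \<partial>M))
    \<longlonglongrightarrow> 2 * sqrt t * normal_density 0 (sqrt t) 0 * (\<integral>\<omega>. smooth_inv_sqrt \<delta> (bridge_sum t (Suc k) 0 (\<lambda>s. B s \<omega>)) \<partial>N)"
proof -
  interpret R: rademacher M X by unfold_locales fact
  let ?h = "smooth_inv_sqrt \<delta>" and ?s = "sqrt (t / real (Suc k))"
  note h0 = smooth_inv_sqrt_bounds(1)[OF \<delta>]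
  note [measurable] = borel_measurable_continuous_onI[OF continuous_smooth_inv_sqrt[OF \<delta>]]
    bridge_sum_measurable_section[OF t]
  have sm[measurable]: "step_var t (Suc k) \<in> borel_measurable (PiM {..<k} (\<lambda>_. borel))"
  proof -
    have "step_var t (Suc k) = block_var k (t / real (Suc k)) (t / real (Suc k))"
      by (rule ext) (rule block_var_step_var[symmetric])
    then show ?thesis by (simp only: block_var_measurable)
  qed
  have ib: "integrable N (\<lambda>\<omega>. ?h (bridge_sum t (Suc k) 0 (\<lambda>s. B s \<omega>)))"
  proof (rule integrable_const_bound[where B = "1 / \<delta>"])
    show "AE \<omega> in N. norm (?h (bridge_sum t (Suc k) 0 (\<lambda>s. B s \<omega>))) \<le> 1 / \<delta>"
      using smooth_inv_sqrt_bounds[OF \<delta>] by (intro AE_I2) (simp add: abs_of_nonneg)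
  qed measurable
  have L: "ennreal (sqrt (real (2 * n))) * (\<integral>\<^sup>+\<omega>. ennreal (?h (R.coarse_var t k n \<omega>)) * indicator {0} (walk X (2 * n) \<omega>) \<partial>M)
      = ennreal (sqrt (real (2 * n)) * (\<integral>\<omega>. ?h (R.coarse_var t k n \<omega>) * indicator {0} (walk X (2 * n) \<omega>) \<partial>M))" for n
  proof -
    have "(\<integral>\<^sup>+\<omega>. ennreal (?h (R.coarse_var t k n \<omega>)) * indicator {0} (walk X (2 * n) \<omega>) \<partial>M)
        = (\<integral>\<^sup>+\<omega>. ennreal (?h (R.coarse_var t k n \<omega>) * indicator {0} (walk X (2 * n) \<omega>)) \<partial>M)"
      by (intro nn_integral_cong) (auto simp: indicator_def)
    also have "\<dots> = ennreal (\<integral>\<omega>. ?h (R.coarse_var t k n \<omega>) * indicator {0} (walk X (2 * n) \<omega>) \<partial>M)"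
      using h0 by (intro nn_integral_eq_integral R.integrable_smooth_inv_sqrt[OF \<delta>]
        R.coarse_var_measurable R.walk_measurable) auto
    finally show ?thesis by (simp add: ennreal_mult'[symmetric] del: of_nat_mult)
  qed
  have "ennreal (2 * sqrt t) * (\<integral>\<^sup>+d. ennreal (?h (step_var t (Suc k) d)) * ennreal (normal_density 0 ?s (0 - (\<Sum>i<k. d i))) \<partial>gauss_vec k ?s)
      = ennreal (2 * sqrt t) * (ennreal (normal_density 0 (sqrt t) 0) *
          (\<integral>\<^sup>+\<omega>. ennreal (?h (step_var t (Suc k) (\<lambda>i\<in>{..<k}. increment t (Suc k) B i \<omega> + (0 - B t \<omega>) / real (Suc k)))) \<partial>N))"
    by (subst brownian_bridge_kernel[OF B t]) measurable
  also have "(\<integral>\<^sup>+\<omega>. ennreal (?h (step_var t (Suc k) (\<lambda>i\<in>{..<k}. increment t (Suc k) B i \<omega> + (0 - B t \<omega>) / real (Suc k)))) \<partial>N)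
      = (\<integral>\<^sup>+\<omega>. ennreal (?h (bridge_sum t (Suc k) 0 (\<lambda>s. B s \<omega>))) \<partial>N)"
    by (intro nn_integral_cong) (simp only: bridge_sum_eq_step_var[OF B _ t])
  also have "\<dots> = ennreal (\<integral>\<omega>. ?h (bridge_sum t (Suc k) 0 (\<lambda>s. B s \<omega>)) \<partial>N)"
    using h0 by (intro nn_integral_eq_integral ib) auto
  also have "ennreal (2 * sqrt t) * (ennreal (normal_density 0 (sqrt t) 0) * ennreal (\<integral>\<omega>. ?h (bridge_sum t (Suc k) 0 (\<lambda>s. B s \<omega>)) \<partial>N))
      = ennreal (2 * sqrt t * normal_density 0 (sqrt t) 0 * (\<integral>\<omega>. ?h (bridge_sum t (Suc k) 0 (\<lambda>s. B s \<omega>)) \<partial>N))"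
    using t by (simp add: ennreal_mult'[symmetric] mult.assoc)
  finally have R: "ennreal (2 * sqrt t) * (\<integral>\<^sup>+d. ennreal (?h (step_var t (Suc k) d)) * ennreal (normal_density 0 ?s (0 - (\<Sum>i<k. d i))) \<partial>gauss_vec k ?s)
     = ennreal (2 * sqrt t * normal_density 0 (sqrt t) 0 * (\<integral>\<omega>. ?h (bridge_sum t (Suc k) 0 (\<lambda>s. B s \<omega>)) \<partial>N))" .
  have "(\<lambda>n. ennreal (sqrt (real (2 * n)) * (\<integral>\<omega>. ?h (R.coarse_var t k n \<omega>) * indicator {0} (walk X (2 * n) \<omega>) \<partial>M)))
    \<longlonglongrightarrow> ennreal (2 * sqrt t * normal_density 0 (sqrt t) 0 * (\<integral>\<omega>. ?h (bridge_sum t (Suc k) 0 (\<lambda>s. B s \<omega>)) \<partial>N))"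
    using R.bridge_block_limit[OF t k continuous_smooth_inv_sqrt[OF \<delta>] smooth_inv_sqrt_bounds[OF \<delta>], folded R.coarse_var_def]
    unfolding L R .
  moreover have "0 \<le> sqrt (real (2 * n)) * (\<integral>\<omega>. ?h (R.coarse_var t k n \<omega>) * indicator {0} (walk X (2 * n) \<omega>) \<partial>M)" for n
    using h0 by (intro mult_nonneg_nonneg integral_nonneg_AE AE_I2) auto
  moreover have "0 \<le> 2 * sqrt t * normal_density 0 (sqrt t) 0 * (\<integral>\<omega>. ?h (bridge_sum t (Suc k) 0 (\<lambda>s. B s \<omega>)) \<partial>N)"
    using h0 t by (intro mult_nonneg_nonneg integral_nonneg_AE AE_I2) auto
  ultimately show ?thesis by (subst (asm) tendsto_ennreal_iff) auto
qed

text \<open>The regularisation parameter is \<open>\<delta> j = 1 / (j + 1)\<close>, the splitting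
  parameter \<open>\<eta> k = 1 / sqrt (k + 1)\<close>. The last block has asymptotic relative
  length \<open>1 / (k + 1)\<close>, the square of \<open>\<eta> k\<close>, so both parts of the
  error of the blocks are of order \<open>\<eta> k\<close>.\<close>

lemma inverse_sqrt_walk_var_LIMSEQ:
  fixes M :: "'a measure"
  assumes X: "rademacher_sequence M X" and t: "t > 0"
  shows "(\<lambda>n. sqrt (real (2 * n)) * (\<integral>\<omega>. 1 / sqrt (walk_var t X (2 * n) \<omega>) * indicator {0} (walk X (2 * n) \<omega>) \<partial>M))
    \<longlonglongrightarrow> 2 * sqrt t * normal_density 0 (sqrt t) 0 * (\<integral>\<omega>. 1 / sqrt (bridge_var t 0 (\<lambda>s. B s \<omega>)) \<partial>N)"
proof -
  interpret R: rademacher M X by unfold_locales fact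
  define \<delta> where "\<delta> j = inverse (real (Suc j))" for j
  define \<eta> where "\<eta> k = sqrt (1 / real (Suc k))" for k
  have \<delta>: "\<delta> j > 0" for j by (simp add: \<delta>_def)
  have \<eta>: "\<eta> k > 0" for k by (simp add: \<eta>_def)
  let ?r = "\<lambda>k n. real (last_length k n) / real (2 * n)"
  let ?b = "\<lambda>j k r. sqrt 2 * (t * (\<eta> k * exp (8 * t) + (exp (8 * t * r) - 1) / \<eta> k) / \<delta> j ^ 3)"
  show ?thesis
  proof (rule iterated_limit)
    fix j k :: nat assume k: "k \<ge> 2"
    have k0: "k > 0" using k by simp
    \<comment> \<open>For \<open>k \<ge> 2\<close> the last block is eventually shorter than half of
      the walk, as the increment bound on the return event demands.\<close>
    have "1 / real (Suc k) < 1 / 2" using k by (simp add: field_simps)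
    from order_tendstoD(2)[OF last_length_ratio this] have "\<forall>\<^sub>F n in sequentially. ?r k n < 1 / 2" .
    moreover have "\<forall>\<^sub>F n in sequentially. block_length k n > 0"
      by (rule eventually_compose_filterlim[OF eventually_gt_at_top block_length_at_top])
    ultimately show "\<forall>\<^sub>F n in sequentially.
        \<bar>sqrt (real (2 * n)) * (\<integral>\<omega>. 1 / sqrt (walk_var t X (2 * n) \<omega>) * indicator {0} (walk X (2 * n) \<omega>) \<partial>M)
         - sqrt (real (2 * n)) * (\<integral>\<omega>. smooth_inv_sqrt (\<delta> j) (R.coarse_var t k n \<omega>) * indicator {0} (walk X (2 * n) \<omega>) \<partial>M)\<bar>
        \<le> \<delta> j * (sqrt 2 * (exp (2 * t) / t)) + ?b j k (?r k n)"
      using eventually_gt_at_top[of 0]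
    proof eventually_elim
      case (elim n)
      have h: "2 * last_length k n \<le> 2 * n"
      proof -
        have "real (last_length k n) < real n" using elim by (simp add: field_simps)
        then show ?thesis by simp
      qed
      let ?q = "\<integral>\<omega>. 1 / sqrt (walk_var t X (2 * n) \<omega>) * indicator {0} (walk X (2 * n) \<omega>) \<partial>M"
        and ?D = "\<integral>\<omega>. smooth_inv_sqrt (\<delta> j) (R.coarse_var t k n \<omega>) * indicator {0} (walk X (2 * n) \<omega>) \<partial>M"
        and ?c = "\<delta> j * (exp (2 * t) / t) + t * (\<eta> k * exp (8 * t) + (exp (8 * t * ?r k n) - 1) / \<eta> k) / \<delta> j ^ 3"
      have "\<bar>sqrt (real (2 * n)) * ?q - sqrt (real (2 * n)) * ?D\<bar> = sqrt (real (2 * n)) * \<bar>?q - ?D\<bar>"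
        by (simp add: right_diff_distrib[symmetric] abs_mult del: of_nat_mult)
      also have "\<dots> \<le> sqrt (real (2 * n)) * (sqrt (2 / real (2 * n)) * ?c)"
        by (intro mult_left_mono R.smooth_coarse_comparison[OF t _ h \<eta> \<delta>]) (use elim in auto)
      also have "\<dots> = sqrt 2 * ?c"
        using elim by (simp add: real_sqrt_divide del: of_nat_mult)
      also have "\<dots> = \<delta> j * (sqrt 2 * (exp (2 * t) / t)) + ?b j k (?r k n)"
        by (simp only: distrib_left mult_ac)
      finally show ?case .
    qed
    show "(\<lambda>n. ?b j k (?r k n)) \<longlonglongrightarrow> ?b j k (1 / real (Suc k))"
      using \<eta>[of k] \<delta>[of j] by (intro tendsto_intros last_length_ratio) auto
    show "(\<lambda>n. sqrt (real (2 * n)) * (\<integral>\<omega>. smooth_inv_sqrt (\<delta> j) (R.coarse_var t k n \<omega>) * indicator {0} (walk X (2 * n) \<omega>) \<partial>M))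
      \<longlonglongrightarrow> 2 * sqrt t * normal_density 0 (sqrt t) 0 * (\<integral>\<omega>. smooth_inv_sqrt (\<delta> j) (bridge_sum t (Suc k) 0 (\<lambda>s. B s \<omega>)) \<partial>N)"
      by (rule smooth_coarse_var_LIMSEQ[OF X t k0 \<delta>])
  next
    have "(\<lambda>j. \<delta> j * (sqrt 2 * (exp (2 * t) / t))) \<longlonglongrightarrow> 0 * (sqrt 2 * (exp (2 * t) / t))"
      unfolding \<delta>_def by (intro tendsto_mult LIMSEQ_inverse_real_of_nat tendsto_const)
    then show "(\<lambda>j. \<delta> j * (sqrt 2 * (exp (2 * t) / t))) \<longlonglongrightarrow> 0" by simp
  next
    fix j
    have \<eta>0: "\<eta> \<longlonglongrightarrow> 0"
      unfolding \<eta>_def using tendsto_real_sqrt[OF LIMSEQ_inverse_real_of_nat] by (simp add: inverse_eq_divide)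
    have "(\<lambda>k. (exp (8 * t * (1 / real (Suc k))) - 1) / \<eta> k) \<longlonglongrightarrow> 0"
    proof (rule tendsto_sandwich)
      show "\<forall>\<^sub>F k in sequentially. 0 \<le> (exp (8 * t * (1 / real (Suc k))) - 1) / \<eta> k"
        using t \<eta> by (intro always_eventually allI divide_nonneg_pos) auto
      show "\<forall>\<^sub>F k in sequentially. (exp (8 * t * (1 / real (Suc k))) - 1) / \<eta> k \<le> exp (8 * t) * (8 * t) * \<eta> k"
      proof (intro always_eventually allI)
        fix k
        have r: "1 / real (Suc k) = \<eta> k * \<eta> k" by (simp add: \<eta>_def)
        let ?z = "8 * t * (1 / real (Suc k))"
        \<comment> \<open>Multiplying by \<open>exp z\<close> gives
          \<open>exp z - 1 \<le> z * exp z\<close>, a bound linear in \<open>z\<close> because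
          \<open>z \<le> 8 * t\<close>.\<close>
        have "1 - ?z \<le> exp (- ?z)" using exp_ge_add_one_self[of "- ?z"] by simp
        then have "exp ?z * (1 - ?z) \<le> exp ?z * exp (- ?z)" by (intro mult_left_mono) auto
        then have "exp ?z - 1 \<le> exp ?z * ?z" by (simp add: exp_minus_inverse algebra_simps)
        also have "\<dots> \<le> exp (8 * t) * ?z"
        proof (intro mult_right_mono)
          have "8 * t * (1 / real (Suc k)) \<le> 8 * t * 1" using t by (intro mult_left_mono) auto
          then show "exp ?z \<le> exp (8 * t)" by simp
        qed (use t in simp)
        also have "\<dots> = (exp (8 * t) * (8 * t) * \<eta> k) * \<eta> k" unfolding r by (simp only: mult_ac)
        finally show "(exp ?z - 1) / \<eta> k \<le> exp (8 * t) * (8 * t) * \<eta> k"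
          using \<eta>[of k] by (simp only: pos_divide_le_eq)
      qed
      show "(\<lambda>k. exp (8 * t) * (8 * t) * \<eta> k) \<longlonglongrightarrow> 0"
        using tendsto_mult_left[OF \<eta>0, of "exp (8 * t) * (8 * t)"] by simp
    qed simp
    then have "(\<lambda>k. ?b j k (1 / real (Suc k))) \<longlonglongrightarrow> sqrt 2 * (t * (0 * exp (8 * t) + 0) / \<delta> j ^ 3)"
      using \<delta>[of j] by (intro tendsto_intros \<eta>0) auto
    then show "(\<lambda>k. ?b j k (1 / real (Suc k))) \<longlonglongrightarrow> 0" by simp
    show "(\<lambda>k. 2 * sqrt t * normal_density 0 (sqrt t) 0 * (\<integral>\<omega>. smooth_inv_sqrt (\<delta> j) (bridge_sum t (Suc k) 0 (\<lambda>s. B s \<omega>)) \<partial>N))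
      \<longlonglongrightarrow> 2 * sqrt t * normal_density 0 (sqrt t) 0 * (\<integral>\<omega>. smooth_inv_sqrt (\<delta> j) (bridge_var t 0 (\<lambda>s. B s \<omega>)) \<partial>N)"
      by (intro tendsto_mult tendsto_const smooth_bridge_sum_LIMSEQ t \<delta>)
  next
    show "(\<lambda>j. 2 * sqrt t * normal_density 0 (sqrt t) 0 * (\<integral>\<omega>. smooth_inv_sqrt (\<delta> j) (bridge_var t 0 (\<lambda>s. B s \<omega>)) \<partial>N))
      \<longlonglongrightarrow> 2 * sqrt t * normal_density 0 (sqrt t) 0 * (\<integral>\<omega>. 1 / sqrt (bridge_var t 0 (\<lambda>s. B s \<omega>)) \<partial>N)"
      unfolding \<delta>_def by (intro tendsto_mult tendsto_const smooth_inv_sqrt_bridge_var_LIMSEQ t)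
  qed
qed

end

text \<open>The kernel and the densities are shown to exist, so that the limit statement about all
  \<open>p\<close> and \<open>q\<close> is not vacuous; continuity makes the values that enter it
  unique.\<close>

theorem theorem4p8:
  fixes M :: "'a measure" and X Y :: "nat \<Rightarrow> 'a \<Rightarrow> real"
    and N :: "'b measure" and B1 B2 :: "real \<Rightarrow> 'b \<Rightarrow> real" and b :: "'b \<Rightarrow> real"
    and t :: real
  assumes X: "rademacher_sequence M X"
    and Y: "std_gaussian_sequence M Y"
    and XY: "indep_processes M {1..} X Y"
    and t: "t > 0"
    and B1: "brownian_motion N B1"
    and B2: "brownian_motion N B2"
    and B12: "indep_processes N {0..} B1 B2"
    and b: "has_ito_integral N (natural_filtration N B1 B2) B2 (\<lambda>s \<omega>. exp (B1 s \<omega>)) t b"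
  shows
    "(\<exists>p. aff_heat_kernel N B1 b t p) \<and>
     (\<forall>n. even n \<and> n \<ge> 2 \<longrightarrow>
        (\<forall>\<Gamma>\<in>sets borel.
           measure M {\<omega> \<in> space M. walk_a (step_size t n) X n \<omega> = 1 \<and> walk_b (step_size t n) X Y n \<omega> \<in> \<Gamma>}
         = measure M {\<omega> \<in> space M. walk X n \<omega> = 0 \<and> walk_b (step_size t n) X Y n \<omega> \<in> \<Gamma>}) \<and>
        (\<exists>q. continuous_density_on_event M (\<lambda>\<omega>. walk X n \<omega> = 0) (walk_b (step_size t n) X Y n) q)) \<and>
     (\<forall>p q.
        aff_heat_kernel N B1 b t p \<and>
        (\<forall>n. even n \<and> n \<ge> 2 \<longrightarrow>
           continuous_density_on_event M (\<lambda>\<omega>. walk X n \<omega> = 0) (walk_b (step_size t n) X Y n) (q n)) \<longrightarrow>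
        (\<lambda>k. q (2 * k) 0 / (2 * step_size t (2 * k) * p aff_unit)) \<longlonglongrightarrow> 1)"
proof (intro conjI allI impI ballI)
  interpret R: rademacher M X by unfold_locales fact
  interpret T: two_brownian N B1 B2 by unfold_locales fact+
  show "\<exists>p. aff_heat_kernel N B1 b t p"
    using T.aff_heat_kernel_joint_density[OF t b] by blast
  {
    fix n :: nat and \<Gamma> :: "real set" assume n: "even n \<and> n \<ge> 2"
    then have "step_size t n > 0" using t by (simp add: step_size_def)
    then have "walk_a (step_size t n) X n \<omega> = 1 \<longleftrightarrow> walk X n \<omega> = 0" for \<omega>
      by (simp add: walk_a_def)
    then show "measure M {\<omega> \<in> space M. walk_a (step_size t n) X n \<omega> = 1 \<and> walk_b (step_size t n) X Y n \<omega> \<in> \<Gamma>}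
         = measure M {\<omega> \<in> space M. walk X n \<omega> = 0 \<and> walk_b (step_size t n) X Y n \<omega> \<in> \<Gamma>}"
      by simp
  }
  {
    fix n :: nat assume "even n \<and> n \<ge> 2"
    then have "n > 0" by simp
    then show "\<exists>q. continuous_density_on_event M (\<lambda>\<omega>. walk X n \<omega> = 0) (walk_b (step_size t n) X Y n) q"
      using R.continuous_density_walk_b[OF Y XY t] by blast
  }
  fix p :: "real \<times> real \<Rightarrow> real" and q :: "nat \<Rightarrow> real \<Rightarrow> real"
  assume "aff_heat_kernel N B1 b t p \<and>
        (\<forall>n. even n \<and> n \<ge> 2 \<longrightarrow>
           continuous_density_on_event M (\<lambda>\<omega>. walk X n \<omega> = 0) (walk_b (step_size t n) X Y n) (q n))"
  then have p: "aff_heat_kernel N B1 b t p"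
    and q: "\<And>n. even n \<Longrightarrow> n \<ge> 2 \<Longrightarrow> continuous_density_on_event M (\<lambda>\<omega>. walk X n \<omega> = 0) (walk_b (step_size t n) X Y n) (q n)"
    by auto
  let ?I = "\<integral>\<omega>. 1 / sqrt (bridge_var t 0 (\<lambda>s. B1 s \<omega>)) \<partial>N"
  let ?Q = "\<lambda>k. \<integral>\<omega>. 1 / sqrt (walk_var t X (2 * k) \<omega>) * indicator {0} (walk X (2 * k) \<omega>) \<partial>M"
  have pe: "p aff_unit = 1 / (2 * pi * sqrt t) * ?I"
    unfolding T.aff_heat_kernel_unit[OF t b p] T.joint_density_0[OF t] ..
  have I: "?I \<noteq> 0" using T.joint_density_0_pos[OF t] unfolding T.joint_density_0[OF t] by auto
  have s: "sqrt (2 * pi) * sqrt (2 * pi) = 2 * pi" by simp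
  \<comment> \<open>The prefactor makes the left-hand side equal to the quotient of the claim,
    because \<open>2 * step_size t (2 * k) * p aff_unit\<close> is
    \<open>?I / (pi * sqrt (2 * k))\<close>.\<close>
  have "(\<lambda>k. pi / (sqrt (2 * pi) * ?I) * (sqrt (real (2 * k)) * ?Q k))
      \<longlonglongrightarrow> pi / (sqrt (2 * pi) * ?I) * (2 * sqrt t * normal_density 0 (sqrt t) 0 * ?I)"
    by (intro tendsto_mult tendsto_const T.inverse_sqrt_walk_var_LIMSEQ X t)
  also have "pi / (sqrt (2 * pi) * ?I) * (2 * sqrt t * normal_density 0 (sqrt t) 0 * ?I) = 1"
  proof -
    have "normal_density 0 (sqrt t) 0 = 1 / (sqrt (2 * pi) * sqrt t)"
      using t by (simp add: normal_density_def real_sqrt_mult)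
    then have "pi / (sqrt (2 * pi) * ?I) * (2 * sqrt t * normal_density 0 (sqrt t) 0 * ?I) = 2 * pi / (sqrt (2 * pi) * sqrt (2 * pi))"
      using t I by (simp add: field_simps del: real_sqrt_mult_self)
    then show ?thesis unfolding s by simp
  qed
  finally show "(\<lambda>k. q (2 * k) 0 / (2 * step_size t (2 * k) * p aff_unit)) \<longlonglongrightarrow> 1"
  proof (rule Lim_transform_eventually)
    show "\<forall>\<^sub>F k in sequentially. pi / (sqrt (2 * pi) * ?I) * (sqrt (real (2 * k)) * ?Q k)
        = q (2 * k) 0 / (2 * step_size t (2 * k) * p aff_unit)"
    proof (rule eventually_sequentiallyI[of 1])
      fix k :: nat assume "1 \<le> k"
      then have n: "2 * k > 0" and k: "real (2 * k) > 0" by simp_all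
      \<comment> \<open>Continuity determines the density at every point, so any admissible
        \<open>q\<close> has the value of the mixture density at 0.\<close>
      have "q (2 * k) 0 = R.walk_density t (2 * k) 0"
        by (rule continuous_density_on_event_unique[OF q R.continuous_density_walk_b[OF Y XY t n]]) (use \<open>1 \<le> k\<close> in auto)
      also have "\<dots> = 1 / sqrt (2 * pi) * ?Q k" by (rule R.walk_density_at_0[OF t n])
      finally have q0: "q (2 * k) 0 = 1 / sqrt (2 * pi) * ?Q k" .
      have e: "2 * step_size t (2 * k) * p aff_unit = ?I / (pi * sqrt (real (2 * k)))"
        using t by (simp add: pe step_size_def real_sqrt_divide del: of_nat_mult)
      show "pi / (sqrt (2 * pi) * ?I) * (sqrt (real (2 * k)) * ?Q k) = q (2 * k) 0 / (2 * step_size t (2 * k) * p aff_unit)"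
        unfolding q0 e by (simp add: mult_ac del: of_nat_mult)
    qed
  qed
qed

end
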